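(* Let $b:[0,\infty)\times\mathbb{R}^d\to\mathbb{R}^d$ be a measurable function with $b\in L^\infty([0,\infty)\times\mathbb{R}^d)$, let $\mu_0\in\mathcal{P}(\mathbb{R}^d)$, and let $X$ be the solution of the McKean-Vlasov SDE $$dX_t=\langle b(t,X_t-\cdot),\mu_t\rangle\,dt+dW_t,\qquad \mu_t=\operatorname{Law}(X_t),$$ with initial distribution $\operatorname{Law}(X_0)=\mu_0$. Then for each $t>0$, $X_t$ has a density $p_t$ with respect to the Lebesgue measure, and $p_t\in B_{1,\infty}^{2+\gamma}(\mathbb{R}^d)$ and $p_t\in\mathcal{C}_b^{1+\gamma}(\mathbb{R}^d)$ for every $\gamma\in(0,1)$.
   Context: $W$ is a standard $d$-dimensional Brownian motion (independent of $X_0$), $\mathcal{P}(\mathbb{R}^d)$ is the set of Borel probability measures on $\mathbb{R}^d$, and $\langle b(t,x-\cdot),\mu\rangle:=\int_{\mathbb{R}^d}b(t,x-y)\,\mu(dy)$. The equation is known to be well-posed (unique in law) for $b\in L^\infty$. Besov spaces: fix $\psi,\varphi\in C_c^\infty(\mathbb{R}^d)$ with $\operatorname{supp}\varphi\subset B(4)\setminus B(1)$, $\operatorname{supp}\psi\subset B(4)$ (balls centred at $0$), such that with $\varphi_0:=\psi$ and $\varphi_j:=\varphi(2^{-j}\cdot)$ for $j\ge1$ one has $\sum_{j\ge0}\varphi_j=1$. For a tempered distribution $f$ put $f_n=\mathcal{F}^{-1}(\varphi_n\hat f)$ and $\|f\|_{B^s_{p,q}}:=\|(2^{ns}\|f_n\|_{L^p})_{n\ge0}\|_{\ell^q}$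 for $s\in\mathbb{R}$, $p,q\in[1,\infty]$. $B^s_{p,q}(\mathbb{R}^d)$ is the closure of the Schwartz space with respect to this norm. For $s\in(0,\infty)\setminus\mathbb{Z}$, $\mathcal{C}_b^s(\mathbb{R}^d)$ is the Hölder space of bounded functions that are $\lfloor s\rfloor$ times differentiable with bounded derivatives and whose $\lfloor s\rfloor$-th derivatives are $(s-\lfloor s\rfloor)$-Hölder continuous on $\mathbb{R}^d$. *)

theory Defs
  imports "HOL-Probability.Probability"
begin

section \<open>Iterated derivatives, test functions and Hoelder spaces\<close>

text \<open>\<open>iter_deriv [v1, \<dots>, vk] f\<close> is the iterated directional derivative of \<open>f\<close>; with all
  \<open>vi\<close> in \<open>Basis\<close> these are the partial derivatives of order \<open>k\<close>. Outside the range where the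
  derivatives exist the value is junk, so it is always used under \<open>differentiable_upto\<close>.\<close>

primrec iter_deriv ::
  "'a::euclidean_space list \<Rightarrow> ('a \<Rightarrow> 'b::real_normed_vector) \<Rightarrow> 'a \<Rightarrow> 'b" where
  "iter_deriv [] f = f"
| "iter_deriv (v # vs) f = (\<lambda>x. frechet_derivative (iter_deriv vs f) (at x) v)"

definition differentiable_upto ::
  "nat \<Rightarrow> ('a::euclidean_space \<Rightarrow> 'b::real_normed_vector) \<Rightarrow> bool" where
  "differentiable_upto k f \<longleftrightarrow>
     (\<forall>vs. set vs \<subseteq> Basis \<and> length vs < k \<longrightarrow> (\<forall>x. iter_deriv vs f differentiable (at x)))"

definition smooth :: "('a::euclidean_space \<Rightarrow> 'b::real_normed_vector) \<Rightarrow> bool" where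
  "smooth f \<longleftrightarrow> (\<forall>k. differentiable_upto k f)"

definition supp :: "('a::euclidean_space \<Rightarrow> 'b::real_normed_vector) \<Rightarrow> 'a set" where
  "supp f = closure {x. f x \<noteq> 0}"

definition test_functions :: "('a::euclidean_space \<Rightarrow> 'b::real_normed_vector) set" where
  "test_functions = {f. smooth f \<and> compact (supp f)}"

text \<open>The space \<open>C_b^s\<close>, meant for \<open>s > 0\<close> not an integer.\<close>

definition holder_space ::
  "real \<Rightarrow> ('a::euclidean_space \<Rightarrow> 'b::real_normed_vector) set" where
  "holder_space s = {f.
     differentiable_upto (nat \<lfloor>s\<rfloor>) f \<and>
     (\<forall>vs. set vs \<subseteq> Basis \<and> length vs \<le> nat \<lfloor>s\<rfloor> \<longrightarrow> bounded (range (iter_deriv vs f))) \<and>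
     (\<forall>vs. set vs \<subseteq> Basis \<and> length vs = nat \<lfloor>s\<rfloor> \<longrightarrow>
        (\<exists>C. \<forall>x y. norm (iter_deriv vs f x - iter_deriv vs f y)
                     \<le> C * norm (x - y) powr (s - of_int \<lfloor>s\<rfloor>)))}"


section \<open>Schwartz functions and tempered distributions\<close>

definition schwartz :: "('a::euclidean_space \<Rightarrow> complex) set" where
  "schwartz = {f. smooth f \<and>
     (\<forall>n vs. set vs \<subseteq> Basis \<longrightarrow>
        bounded (range (\<lambda>x. (1 + norm x) ^ n *\<^sub>R iter_deriv vs f x)))}"

definition schwartz_seminorm :: "nat \<Rightarrow> ('a::euclidean_space \<Rightarrow> complex) \<Rightarrow> real" where
  "schwartz_seminorm N f =
     (\<Sum>vs \<in> {vs. set vs \<subseteq> Basis \<and> length vs \<le> N}.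
        SUP x. (1 + norm x) ^ N * norm (iter_deriv vs f x))"

text \<open>Distributions are functionals on all functions; only their values on \<open>schwartz\<close> matter.\<close>

type_synonym 'a distribution = "('a \<Rightarrow> complex) \<Rightarrow> complex"

definition tempered :: "'a::euclidean_space distribution \<Rightarrow> bool" where
  "tempered T \<longleftrightarrow>
     (\<forall>f\<in>schwartz. \<forall>g\<in>schwartz. T (\<lambda>x. f x + g x) = T f + T g) \<and>
     (\<forall>c. \<forall>f\<in>schwartz. T (\<lambda>x. c * f x) = c * T f) \<and>
     (\<exists>N C. \<forall>f\<in>schwartz. norm (T f) \<le> C * schwartz_seminorm N f)"

definition dist_of :: "('a::euclidean_space \<Rightarrow> complex) \<Rightarrow> 'a distribution" where
  "dist_of h = (\<lambda>g. \<integral>x. h x * g x \<partial>lborel)"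

definition represents :: "('a::euclidean_space \<Rightarrow> complex) \<Rightarrow> 'a distribution \<Rightarrow> bool" where
  "represents h T \<longleftrightarrow> h \<in> borel_measurable lborel \<and>
     (\<forall>g\<in>schwartz. integrable lborel (\<lambda>x. h x * g x) \<and> T g = dist_of h g)"

definition fourier :: "('a::euclidean_space \<Rightarrow> complex) \<Rightarrow> 'a \<Rightarrow> complex" where
  "fourier f \<xi> = (\<integral>x. cis (- (x \<bullet> \<xi>)) * f x \<partial>lborel)"

definition inv_fourier :: "('a::euclidean_space \<Rightarrow> complex) \<Rightarrow> 'a \<Rightarrow> complex" where
  "inv_fourier f x =
     (\<integral>\<xi>. cis (x \<bullet> \<xi>) * f \<xi> \<partial>lborel) / of_real ((2 * pi) ^ DIM('a))"

text \<open>On distributions, the Fourier transform and multiplication by a function act by duality.\<close>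

definition dist_fourier :: "'a::euclidean_space distribution \<Rightarrow> 'a distribution" where
  "dist_fourier T = (\<lambda>g. T (fourier g))"

definition dist_inv_fourier :: "'a::euclidean_space distribution \<Rightarrow> 'a distribution" where
  "dist_inv_fourier T = (\<lambda>g. T (inv_fourier g))"

definition dist_mult ::
  "('a::euclidean_space \<Rightarrow> complex) \<Rightarrow> 'a distribution \<Rightarrow> 'a distribution" where
  "dist_mult m T = (\<lambda>g. T (\<lambda>x. m x * g x))"


section \<open>Besov spaces\<close>

definition ennreal_powr :: "ennreal \<Rightarrow> real \<Rightarrow> ennreal" where
  "ennreal_powr x r = (if x = \<infinity> then \<infinity> else ennreal (enn2real x powr r))"

definition Lp_norm :: "ennreal \<Rightarrow> ('a::euclidean_space \<Rightarrow> complex) \<Rightarrow> ennreal" where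
  "Lp_norm p h =
     (if p = \<infinity> then esssup lborel (\<lambda>x. ennreal (norm (h x)))
      else ennreal_powr (\<integral>\<^sup>+x. ennreal_powr (ennreal (norm (h x))) (enn2real p) \<partial>lborel)
             (1 / enn2real p))"

text \<open>The \<open>L^p\<close> norm of a distribution: the norm of a representing function (unique up to null
  sets), and \<open>\<infinity>\<close> (the infimum of the empty set) if there is none.\<close>

definition dist_Lp_norm :: "ennreal \<Rightarrow> 'a::euclidean_space distribution \<Rightarrow> ennreal" where
  "dist_Lp_norm p T = (INF h \<in> {h. represents h T}. Lp_norm p h)"

definition ell_norm :: "ennreal \<Rightarrow> (nat \<Rightarrow> ennreal) \<Rightarrow> ennreal" where
  "ell_norm q a =
     (if q = \<infinity> then (SUP n. a n)
      else ennreal_powr (\<Sum>n. ennreal_powr (a n) (enn2real q)) (1 / enn2real q))"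

definition lp_cutoff ::
  "('a::euclidean_space \<Rightarrow> complex) \<Rightarrow> ('a \<Rightarrow> complex) \<Rightarrow> nat \<Rightarrow> 'a \<Rightarrow> complex" where
  "lp_cutoff \<psi> \<phi> j x = (if j = 0 then \<psi> x else \<phi> (x /\<^sub>R 2 ^ j))"

definition lp_partition ::
  "('a::euclidean_space \<Rightarrow> complex) \<Rightarrow> ('a \<Rightarrow> complex) \<Rightarrow> bool" where
  "lp_partition \<psi> \<phi> \<longleftrightarrow>
     \<psi> \<in> test_functions \<and> \<phi> \<in> test_functions \<and>
     supp \<psi> \<subseteq> ball 0 4 \<and> supp \<phi> \<subseteq> ball 0 4 - ball 0 1 \<and>
     (\<forall>x. (\<lambda>j. lp_cutoff \<psi> \<phi> j x) sums 1)"

definition lp_block ::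
  "('a::euclidean_space \<Rightarrow> complex) \<Rightarrow> ('a \<Rightarrow> complex) \<Rightarrow> nat \<Rightarrow> 'a distribution \<Rightarrow> 'a distribution"
  where
  "lp_block \<psi> \<phi> n T = dist_inv_fourier (dist_mult (lp_cutoff \<psi> \<phi> n) (dist_fourier T))"

definition besov_norm ::
  "('a::euclidean_space \<Rightarrow> complex) \<Rightarrow> ('a \<Rightarrow> complex) \<Rightarrow> real \<Rightarrow> ennreal \<Rightarrow> ennreal
    \<Rightarrow> 'a distribution \<Rightarrow> ennreal" where
  "besov_norm \<psi> \<phi> s p q T =
     ell_norm q (\<lambda>n. ennreal (2 powr (real n * s)) * dist_Lp_norm p (lp_block \<psi> \<phi> n T))"

text \<open>The closure of the Schwartz functions in the norm, also for \<open>p = \<infinity>\<close> or \<open>q = \<infinity>\<close>, where it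
  is smaller than the set of all tempered distributions of finite norm.\<close>

definition besov_space ::
  "('a::euclidean_space \<Rightarrow> complex) \<Rightarrow> ('a \<Rightarrow> complex) \<Rightarrow> real \<Rightarrow> ennreal \<Rightarrow> ennreal
    \<Rightarrow> 'a distribution set" where
  "besov_space \<psi> \<phi> s p q = {T. tempered T \<and>
     (\<forall>\<epsilon>>0. \<exists>g\<in>schwartz. besov_norm \<psi> \<phi> s p q (\<lambda>h. T h - dist_of g h) < \<epsilon>)}"


section \<open>The McKean-Vlasov equation\<close>

text \<open>Time is \<open>real\<close>; only indices \<open>t \<ge> 0\<close> are ever constrained.\<close>

definition filtered_prob_space :: "'w measure \<Rightarrow> (real \<Rightarrow> 'w measure) \<Rightarrow> bool" where
  "filtered_prob_space M F \<longleftrightarrow> prob_space M \<and>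
     (\<forall>t\<ge>0. subalgebra M (F t)) \<and>
     (\<forall>s t. 0 \<le> s \<and> s \<le> t \<longrightarrow> sets (F s) \<subseteq> sets (F t))"

definition adapted ::
  "(real \<Rightarrow> 'w measure) \<Rightarrow> (real \<Rightarrow> 'w \<Rightarrow> 'a::euclidean_space) \<Rightarrow> bool" where
  "adapted F X \<longleftrightarrow> (\<forall>t\<ge>0. X t \<in> borel_measurable (F t))"

definition brownian_motion ::
  "'w measure \<Rightarrow> (real \<Rightarrow> 'w measure) \<Rightarrow> (real \<Rightarrow> 'w \<Rightarrow> 'a::euclidean_space) \<Rightarrow> bool" where
  "brownian_motion M F W \<longleftrightarrow> adapted F W \<and>
     (AE \<omega> in M. W 0 \<omega> = 0) \<and>
     (AE \<omega> in M. continuous_on {0..} (\<lambda>t. W t \<omega>)) \<and>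
     (\<forall>s t. 0 \<le> s \<and> s < t \<longrightarrow>
        distributed M lborel (\<lambda>\<omega>. W t \<omega> - W s \<omega>)
          (\<lambda>x. ennreal (\<Prod>e\<in>Basis. normal_density 0 (sqrt (t - s)) (x \<bullet> e))) \<and>
        prob_space.indep_set M (sets (F s))
          (sets (vimage_algebra (space M) (\<lambda>\<omega>. W t \<omega> - W s \<omega>) borel)))"

definition law :: "'w measure \<Rightarrow> ('w \<Rightarrow> 'a::euclidean_space) \<Rightarrow> 'a measure" where
  "law M Y = distr M borel Y"

definition pairing ::
  "(real \<Rightarrow> 'a::euclidean_space \<Rightarrow> 'a) \<Rightarrow> real \<Rightarrow> 'a \<Rightarrow> 'a measure \<Rightarrow> 'a" where
  "pairing b t x \<mu> = (\<integral>y. b t (x - y) \<partial>\<mu>)"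

text \<open>Weak solutions: \<open>X 0\<close> is measurable with respect to \<open>F 0\<close>, hence independent of \<open>W\<close>.
  The integrability clauses make the (totalised) Bochner integrals meaningful.\<close>

definition mckean_vlasov_solution ::
  "'w measure \<Rightarrow> (real \<Rightarrow> 'w measure) \<Rightarrow> (real \<Rightarrow> 'w \<Rightarrow> 'a::euclidean_space)
    \<Rightarrow> (real \<Rightarrow> 'a \<Rightarrow> 'a) \<Rightarrow> (real \<Rightarrow> 'w \<Rightarrow> 'a) \<Rightarrow> bool" where
  "mckean_vlasov_solution M F W b X \<longleftrightarrow>
     filtered_prob_space M F \<and> brownian_motion M F W \<and> adapted F X \<and>
     (AE \<omega> in M. \<forall>t\<ge>0.
        (AE s in lborel. s \<in> {0..t} \<longrightarrow> integrable (law M (X s)) (\<lambda>y. b s (X s \<omega> - y))) \<and>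
        set_integrable lborel {0..t} (\<lambda>s. pairing b s (X s \<omega>) (law M (X s))) \<and>
        X t \<omega> = X 0 \<omega> + (LINT s:{0..t}|lborel. pairing b s (X s \<omega>) (law M (X s))) + W t \<omega>)"

end

theory Submission
  imports Defs
begin

text \<open>Since \<open>b\<close> is bounded only almost everywhere, the law \<open>\<mu>\<^sub>t\<close> must first be shown to be
  absolutely continuous for almost every \<open>t\<close>.\<close>

section \<open>Gaussian measures and the heat semigroup\<close>

text \<open>The drift of the equation is a convolution of \<open>b\<close> with the law \<mu>_t, so
  it inherits every bit of smoothness that \<mu>_t has, although \<open>b\<close> itself is only
  bounded. The Gaussian noise adds half an order of smoothness at each turn, and the two facts feed
  each other without end: at every positive time the law has translation differences of all orders n
  bounded by a constant times |h|^(n/2).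

  Smoothness of the law is expressed by duality: for bounded Borel \<phi>, the expectation of the
  n-th difference of \<phi> along X_t is at most K sup|\<phi>| |h|^(n/2). Duhamel's formula
  (\<open>duhamel\<close>) writes the expectation of \<open>heat \<delta> \<phi>\<close> at time t
  as a heat flow started from an earlier time plus a time integral of drift times gradient of the
  heat flow. It is obtained without stochastic calculus: second order expansion of the heat
  semigroup over short intervals leaves an error of order 3/2 in the length, and a function with
  such increments is constant. Taking one more difference costs the kernel r^(-3/4), which is
  integrable, while the remaining differences fall on the law and on the drift, whose differences
  are controlled by those of the law (\<open>drift_smooth\<close>). This is the induction step
  \<open>mollified_law_step\<close>, and \<open>smooth_law_all\<close> is its result.

  That argument wants a drift bounded at every point, whereas \<open>b\<close> is bounded almost
  everywhere only and the law might charge the exceptional set. So for almost every time the law is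
  first shown to vanish on Lebesgue null sets (\<open>null_compact\<close>,
  \<open>Xmod_law_null\<close>). Before this is known the drift need not be bounded, only integrable
  along almost every path; an exponential weight in its total variation makes the errors telescope,
  and comparing Gaussian mollifications at the scales 8^(-i) over time steps 4^(-i) gives a limit
  that is uniform in the test function. Afterwards \<open>b\<close> can be replaced by a bounded
  version without changing the drift (\<open>mean_field_instance\<close>).

  From the difference bounds the rest is analysis. Testing with waves gives a characteristic
  function that decays faster than any power (\<open>chf_decay\<close>), Fourier inversion gives a
  smooth density (\<open>law_dens\<close>), and duality with a sign function gives integral bounds
  for its differences (\<open>dens_L1_differences\<close>). Hoelder regularity follows from the
  decay of the Fourier transform (\<open>Re_fourier_holder_space\<close>). For the Besov space, a
  Littlewood-Paley block of index n is dominated by sixth differences with step 2^(-n)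
  (\<open>lp_block_differences\<close>), hence by 2^(-3n), and 3 exceeds 2 + \<gamma>. Since the
  Besov space is a closure, Schwartz approximants are required: the density times a wide Gaussian is
  Schwartz (\<open>gauss_fourier_schwartz\<close>), keeps the difference bounds uniformly and
  converges in L^1, and \<open>besov_space_fourier\<close> splits the blocks into finitely many low
  ones and a uniformly small tail.\<close>

definition gauss_density :: "real \<Rightarrow> 'a::euclidean_space \<Rightarrow> real" where
  "gauss_density t x = (\<Prod>e\<in>Basis. normal_density 0 (sqrt t) (x \<bullet> e))"

definition gauss :: "real \<Rightarrow> 'a::euclidean_space measure" where
  "gauss t = density lborel (\<lambda>x. ennreal (gauss_density t x))"

text \<open>The bound holds at every point and not just almost everywhere, because such functions
  are integrated against laws that are not yet known to have a density.\<close>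

definition bounded_borel :: "real \<Rightarrow> ('a::euclidean_space \<Rightarrow> real) \<Rightarrow> bool" where
  "bounded_borel B f \<longleftrightarrow> f \<in> borel_measurable borel \<and> (\<forall>x. \<bar>f x\<bar> \<le> B)"

definition heat :: "real \<Rightarrow> ('a::euclidean_space \<Rightarrow> real) \<Rightarrow> 'a \<Rightarrow> real" where
  "heat t f x = (\<integral>z. f (x + z) \<partial>gauss t)"

text \<open>The derivative of \<open>heat t f\<close> at \<open>x\<close> in direction
  \<open>v\<close>, with the derivative moved to the Gaussian density. In this form it makes sense
  for every bounded Borel \<open>f\<close>.\<close>

definition dheat :: "real \<Rightarrow> 'a::euclidean_space \<Rightarrow> ('a \<Rightarrow> real) \<Rightarrow> 'a \<Rightarrow> real" where
  "dheat t v f x = (\<integral>z. f (x + z) * (z \<bullet> v / t) \<partial>gauss t)"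

section \<open>Gaussian measures; translations and dilations of Lebesgue measure\<close>

lemma bounded_borelD:
  assumes "bounded_borel B f"
  shows "f \<in> borel_measurable borel" "\<bar>f x\<bar> \<le> B" "0 \<le> B"
  using assms order_trans[of 0 "\<bar>f undefined\<bar>" B] by (auto simp: bounded_borel_def)

lemma gauss_density_measurable[measurable]: "gauss_density t \<in> borel_measurable borel"
  unfolding gauss_density_def[abs_def] by measurable

lemma sets_gauss[simp, measurable_cong]: "sets (gauss t) = sets borel"
  and space_gauss[simp]: "space (gauss t) = UNIV"
  by (simp_all add: gauss_def)

lemma gauss_density_nonneg[simp]: "0 \<le> gauss_density t x"
  by (auto simp: gauss_density_def intro!: prod_nonneg)

lemma gauss_density_eq:
  fixes x :: "'a::euclidean_space"
  assumes t: "0 < t"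
  shows "gauss_density t x = (1 / sqrt (2 * pi * t)) ^ DIM('a) * exp (- (norm x)\<^sup>2 / (2 * t))"
proof -
  have "gauss_density t x = (\<Prod>e\<in>Basis. (1 / sqrt (2 * pi * t)) * exp (- (x \<bullet> e)\<^sup>2 / (2 * t)))"
    unfolding gauss_density_def normal_density_def using t by simp
  also have "\<dots> = (1 / sqrt (2 * pi * t)) ^ DIM('a) * exp (\<Sum>e\<in>Basis. - (x \<bullet> e)\<^sup>2 / (2 * t))"
    by (simp only: prod.distrib prod_constant exp_sum[OF finite_Basis])
  also have "(\<Sum>e\<in>Basis. - (x \<bullet> e)\<^sup>2 / (2 * t)) = - (norm x)\<^sup>2 / (2 * t)"
    unfolding power2_norm_eq_inner
    by (subst euclidean_inner) (simp add: sum_negf sum_divide_distrib[symmetric] power2_eq_square)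
  finally show ?thesis .
qed

lemma prob_space_gauss:
  assumes "0 < t"
  shows "prob_space (gauss t :: 'a::euclidean_space measure)"
proof
  have "emeasure (gauss t :: 'a measure) (space (gauss t)) = (\<integral>\<^sup>+(x::'a). ennreal (gauss_density t x) \<partial>lborel)"
    by (simp add: gauss_def emeasure_density)
  also have "\<dots> = (\<integral>\<^sup>+(x::'a). (\<Prod>e\<in>Basis. ennreal (normal_density 0 (sqrt t) (x \<bullet> e))) \<partial>lborel)"
    by (simp add: gauss_density_def prod_ennreal)
  also have "\<dots> = (\<Prod>e\<in>(Basis::'a set). (\<integral>\<^sup>+x. ennreal (normal_density 0 (sqrt t) x) \<partial>lborel))"
    by (rule nn_integral_lborel_prod) auto
  also have "\<dots> = 1"
  proof -
    have "(\<integral>\<^sup>+x. ennreal (normal_density 0 (sqrt t) x) \<partial>lborel) = 1"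
      using assms by (subst nn_integral_eq_integral) auto
    then show ?thesis by simp
  qed
  finally show "emeasure (gauss t :: 'a measure) (space (gauss t)) = 1" .
qed

lemma nn_integral_lborel_shift:
  fixes c :: "'a::euclidean_space"
  assumes [measurable]: "f \<in> borel_measurable borel"
  shows "(\<integral>\<^sup>+x. f (c + x) \<partial>lborel) = (\<integral>\<^sup>+x. f x \<partial>lborel)"
  by (subst (2) lborel_distr_plus[symmetric, of c]) (simp add: nn_integral_distr)

lemma lborel_integrable_shift:
  fixes c :: "'a::euclidean_space" and f :: "'a \<Rightarrow> 'b::{banach, second_countable_topology}"
  assumes "integrable lborel f"
  shows "integrable lborel (\<lambda>x. f (c + x))"
proof -
  have [measurable]: "f \<in> borel_measurable borel" using assms by auto
  show ?thesis
    using assms by (subst (asm) lborel_distr_plus[symmetric, of c]) (simp add: integrable_distr_eq)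
qed

lemma lborel_integral_shift:
  fixes c :: "'a::euclidean_space" and f :: "'a \<Rightarrow> 'b::{banach, second_countable_topology}"
  shows "(\<integral>x. f (c + x) \<partial>lborel) = (\<integral>x. f x \<partial>lborel)"
proof (cases "integrable lborel f")
  case True
  then have [measurable]: "f \<in> borel_measurable borel" by auto
  show ?thesis
    by (subst (2) lborel_distr_plus[symmetric, of c]) (simp add: integral_distr)
next
  case False
  then have "\<not> integrable lborel (\<lambda>x. f (c + x))"
    using lborel_integrable_shift[of "\<lambda>x. f (c + x)" "- c"] by auto
  with False show ?thesis by (simp add: not_integrable_integral_eq)
qed

lemma nn_integral_lborel_scale:
  fixes f :: "'a::euclidean_space \<Rightarrow> ennreal"
  assumes [measurable]: "f \<in> borel_measurable borel" and c: "c \<noteq> 0"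
  shows "(\<integral>\<^sup>+x. f x \<partial>lborel) = ennreal (\<bar>c\<bar> ^ DIM('a)) * (\<integral>\<^sup>+x. f (c *\<^sub>R x) \<partial>lborel)"
  by (subst lborel_affine[OF c, of 0]) (simp add: nn_integral_density nn_integral_distr nn_integral_cmult)

lemma lborel_integral_scale:
  fixes f :: "'a::euclidean_space \<Rightarrow> 'b::{banach, second_countable_topology}"
  assumes [measurable]: "f \<in> borel_measurable borel" and c: "c \<noteq> 0"
  shows "(\<integral>x. f x \<partial>lborel) = (\<bar>c\<bar> ^ DIM('a)) *\<^sub>R (\<integral>x. f (c *\<^sub>R x) \<partial>lborel)"
  by (subst lborel_affine[OF c, of 0]) (simp add: integral_density integral_distr)

lemma lborel_integrable_scale:
  fixes f :: "'a::euclidean_space \<Rightarrow> 'b::{banach, second_countable_topology}"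
  assumes f: "integrable lborel f" and c: "c \<noteq> 0"
  shows "integrable lborel (\<lambda>x. f (c *\<^sub>R x))"
proof -
  have [measurable]: "f \<in> borel_measurable borel" using f by auto
  have "(\<integral>\<^sup>+x. norm (f (c *\<^sub>R x)) \<partial>lborel) < \<infinity>"
    using f nn_integral_lborel_scale[of "\<lambda>x. ennreal (norm (f x))" c] c
    by (auto simp: integrable_iff_bounded ennreal_mult_less_top ennreal_mult_eq_top_iff less_top)
  then show ?thesis by (auto simp: integrable_iff_bounded)
qed

lemma lborel_distr_uminus_euclidean: "distr lborel borel uminus = (lborel :: 'a::euclidean_space measure)"
  by (subst (2) lborel_affine[of "-1" 0]) (auto simp: density_1)

lemma lborel_integral_reflect:
  fixes f :: "'a::euclidean_space \<Rightarrow> 'b::{banach, second_countable_topology}"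
  assumes [measurable]: "f \<in> borel_measurable borel"
  shows "(\<integral>x. f (- x) \<partial>lborel) = (\<integral>x. f x \<partial>lborel)"
  by (subst (2) lborel_distr_uminus_euclidean[symmetric]) (simp add: integral_distr)

lemma integral_gauss:
  fixes f :: "'a::euclidean_space \<Rightarrow> real"
  assumes [measurable]: "f \<in> borel_measurable borel"
  shows "(\<integral>x. f x \<partial>gauss t) = (\<integral>x. gauss_density t x * f x \<partial>lborel)"
  unfolding gauss_def by (subst integral_density) auto

lemma gauss_density_scale:
  assumes "0 < t"
  shows "gauss_density t (sqrt t *\<^sub>R x) * sqrt t ^ DIM('a) = gauss_density 1 (x :: 'a::euclidean_space)"
  using assms by (simp add: gauss_density_eq power_mult_distrib real_sqrt_mult power_divide)

text \<open>Brownian scaling. It reduces estimates for all \<open>t\<close> to \<open>t = 1\<close>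
  and produces the powers of \<open>sqrt t\<close> in them.\<close>

lemma gauss_scale:
  assumes t: "0 < t"
  shows "gauss t = distr (gauss 1) borel (\<lambda>z :: 'a::euclidean_space. sqrt t *\<^sub>R z)"
proof (rule measure_eqI)
  fix A :: "'a set" assume "A \<in> sets (gauss t)"
  then have [measurable]: "A \<in> sets borel" by simp
  have [measurable]: "(\<lambda>z::'a. sqrt t *\<^sub>R z) -` A \<in> sets borel"
    by (rule measurable_sets_borel[of _ borel]) simp_all
  have "emeasure (gauss t) A = (\<integral>\<^sup>+x. ennreal (gauss_density t x) * indicator A x \<partial>lborel)"
    by (simp add: gauss_def emeasure_density)
  also have "\<dots> = ennreal (\<bar>sqrt t\<bar> ^ DIM('a)) *
      (\<integral>\<^sup>+x. ennreal (gauss_density t (sqrt t *\<^sub>R x)) * indicator A (sqrt t *\<^sub>R x) \<partial>lborel)"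
    using t by (intro nn_integral_lborel_scale) auto
  also have "\<dots> = (\<integral>\<^sup>+x. ennreal (\<bar>sqrt t\<bar> ^ DIM('a)) * (ennreal (gauss_density t (sqrt t *\<^sub>R x)) * indicator A (sqrt t *\<^sub>R x)) \<partial>lborel)"
    by (rule nn_integral_cmult[symmetric]) simp
  also have "\<dots> = (\<integral>\<^sup>+x. ennreal (gauss_density 1 x) * indicator A (sqrt t *\<^sub>R x) \<partial>lborel)"
    using t by (intro nn_integral_cong)
      (simp add: gauss_density_scale[symmetric] ennreal_mult'[symmetric] mult.assoc[symmetric] mult.commute)
  also have "\<dots> = (\<integral>\<^sup>+x. ennreal (gauss_density 1 x) * indicator ((\<lambda>z. sqrt t *\<^sub>R z) -` A) x \<partial>lborel)"
    by (simp add: indicator_def vimage_def)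
  also have "\<dots> = emeasure (gauss 1) ((\<lambda>z::'a. sqrt t *\<^sub>R z) -` A)"
    unfolding gauss_def by (subst emeasure_density) simp_all
  finally show "emeasure (gauss t) A = emeasure (distr (gauss 1) borel (\<lambda>z. sqrt t *\<^sub>R z)) A"
    by (simp add: emeasure_distr)
qed simp

text \<open>Half of the Gaussian exponent absorbs the exponential weight, by completing the square
  in \<open>norm z - 4\<close>; what is left is a multiple of the density with variance 2.\<close>

lemma integrable_exp_norm_gauss: "integrable (gauss 1) (\<lambda>z::'a::euclidean_space. exp (2 * norm z))"
proof -
  have "integrable (gauss 2) (\<lambda>z::'a. 1::real)"
    using prob_space_gauss[of 2] by (intro finite_measure.integrable_const prob_space.finite_measure) simp
  then have i2: "integrable lborel (\<lambda>z::'a. gauss_density 2 z)"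
    unfolding gauss_def by (subst (asm) integrable_density) auto
  have "integrable lborel (\<lambda>z::'a. gauss_density 1 z * exp (2 * norm z))"
  proof (rule Bochner_Integration.integrable_bound)
    show "integrable lborel (\<lambda>z::'a. exp 4 * sqrt 2 ^ DIM('a) * gauss_density 2 z)"
      using i2 by simp
    show "AE z::'a in lborel. norm (gauss_density 1 z * exp (2 * norm z)) \<le> norm (exp 4 * sqrt 2 ^ DIM('a) * gauss_density 2 z)"
    proof (rule AE_I2)
      fix z :: 'a
      have "2 * norm z - (norm z)\<^sup>2 / 2 \<le> 4 - (norm z)\<^sup>2 / 4"
        using zero_le_power2[of "norm z - 4"] by (simp add: power2_eq_square algebra_simps)
      then have "exp (2 * norm z) * exp (- (norm z)\<^sup>2 / 2) \<le> exp 4 * exp (- (norm z)\<^sup>2 / 4)"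
        by (simp add: mult_exp_exp)
      moreover have "1 / sqrt (2 * pi) = sqrt 2 * (1 / sqrt (2 * pi * 2))"
        by (simp add: real_sqrt_mult field_simps)
      then have "(1 / sqrt (2 * pi * 1)) ^ DIM('a) = sqrt 2 ^ DIM('a) * (1 / sqrt (2 * pi * 2)) ^ DIM('a)"
        unfolding power_mult_distrib[symmetric] by simp
      ultimately show "norm (gauss_density 1 z * exp (2 * norm z)) \<le> norm (exp 4 * sqrt 2 ^ DIM('a) * gauss_density 2 z)"
        by (simp add: gauss_density_eq abs_mult mult_left_mono mult.commute mult.left_commute)
    qed
  qed simp
  then show ?thesis
    unfolding gauss_def by (subst integrable_density) auto
qed

lemma gauss_density_minus[simp]: "gauss_density t (- x) = gauss_density t x"
  by (simp add: gauss_density_def normal_density_def)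

lemma gauss_prob[simp]: "0 < t \<Longrightarrow> measure (gauss t :: 'a::euclidean_space measure) UNIV = 1"
  using prob_space.prob_space[OF prob_space_gauss, of t] by simp

lemma integrable_gauss_bounded:
  fixes f :: "'a::euclidean_space \<Rightarrow> real"
  assumes "0 < t" "f \<in> borel_measurable borel" "\<And>x. \<bar>f x\<bar> \<le> B"
  shows "integrable (gauss t) f"
proof -
  interpret prob_space "gauss t :: 'a measure" by (rule prob_space_gauss) fact
  show ?thesis using assms by (intro integrable_const_bound[of _ B]) auto
qed

lemma integrable_norm_gauss_1: "integrable (gauss 1) (\<lambda>z::'a::euclidean_space. norm z ^ k)"
proof (rule Bochner_Integration.integrable_bound)
  show "integrable (gauss 1) (\<lambda>z::'a. fact k * exp (2 * norm z))"
    using integrable_exp_norm_gauss by simp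
  have "norm z ^ k \<le> fact k * exp (2 * norm z)" for z :: 'a
  proof -
    have "norm z ^ k / fact k \<le> exp (norm z)"
      using sum_le_suminf[OF summable_exp_generic[of "norm z"], of "{k}"]
      by (simp add: exp_def divide_inverse_commute)
    also have "\<dots> \<le> exp (2 * norm z)" by simp
    finally show ?thesis by (simp add: field_simps)
  qed
  then show "AE z::'a in gauss 1. norm (norm z ^ k) \<le> norm (fact k * exp (2 * norm z))"
    by (auto intro!: AE_I2)
qed simp

lemma integrable_norm_gauss:
  assumes "0 < t"
  shows "integrable (gauss t) (\<lambda>z::'a::euclidean_space. norm z ^ k)"
  unfolding gauss_scale[OF assms]
  using integrable_norm_gauss_1[of k, where 'a='a]
  by (subst integrable_distr_eq) (auto simp: power_mult_distrib)

definition gauss_norm_moment :: "'a::euclidean_space itself \<Rightarrow> real" where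
  "gauss_norm_moment _ = (\<integral>(z::'a). norm z \<partial>gauss 1)"

lemma gauss_norm_moment_nonneg: "0 \<le> gauss_norm_moment TYPE('a::euclidean_space)"
  unfolding gauss_norm_moment_def by simp

lemma integral_norm_gauss:
  assumes "0 < t"
  shows "(\<integral>(z::'a::euclidean_space). norm z \<partial>gauss t) = sqrt t * gauss_norm_moment TYPE('a)"
  unfolding gauss_scale[OF assms] gauss_norm_moment_def
  using assms by (subst integral_distr) auto

lemma gauss_density_convolution:
  fixes x :: "'a::euclidean_space"
  assumes "0 < s" "0 < t"
  shows "(\<integral>\<^sup>+y. ennreal (gauss_density s (x - y) * gauss_density t y) \<partial>lborel) = ennreal (gauss_density (s + t) x)"
proof -
  have "(\<integral>\<^sup>+y. ennreal (gauss_density s (x - y) * gauss_density t y) \<partial>lborel) =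
    (\<integral>\<^sup>+y. (\<Prod>e\<in>Basis. ennreal (normal_density 0 (sqrt s) (x \<bullet> e - y \<bullet> e) * normal_density 0 (sqrt t) (y \<bullet> e))) \<partial>lborel)"
    by (simp add: gauss_density_def prod_ennreal prod.distrib inner_diff_left)
  also have "\<dots> = (\<Prod>e\<in>Basis. \<integral>\<^sup>+y. ennreal (normal_density 0 (sqrt s) (x \<bullet> e - y) * normal_density 0 (sqrt t) y) \<partial>lborel)"
    by (rule nn_integral_lborel_prod[of "\<lambda>e y. ennreal (normal_density 0 (sqrt s) (x \<bullet> e - y) * normal_density 0 (sqrt t) y)"]) auto
  also have "\<dots> = (\<Prod>e\<in>Basis. ennreal (normal_density 0 (sqrt (s + t)) (x \<bullet> e)))"
    using fun_cong[OF conv_normal_density_zero_mean[of "sqrt s" "sqrt t"]] assms by simp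
  also have "\<dots> = ennreal (gauss_density (s + t) x)"
    by (simp add: gauss_density_def prod_ennreal)
  finally show ?thesis .
qed

lemma gauss_convolution:
  assumes s: "0 < s" and t: "0 < t"
  shows "gauss (s + t) = distr (gauss s \<Otimes>\<^sub>M gauss t) borel (\<lambda>(x, y). x + y :: 'a::euclidean_space)"
proof (rule measure_eqI)
  interpret S: prob_space "gauss s :: 'a measure" by (rule prob_space_gauss) fact
  interpret T: prob_space "gauss t :: 'a measure" by (rule prob_space_gauss) fact
  interpret ST: pair_prob_space "gauss s :: 'a measure" "gauss t :: 'a measure" ..
  fix A :: "'a set" assume "A \<in> sets (gauss (s + t))"
  then have [measurable]: "A \<in> sets borel" by simp
  have "emeasure (distr (gauss s \<Otimes>\<^sub>M gauss t) borel (\<lambda>(x, y). x + y)) A = (\<integral>\<^sup>+p. indicator A (fst p + snd p) \<partial>(gauss s \<Otimes>\<^sub>M gauss t))"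
    by (subst nn_integral_indicator[symmetric], simp, subst nn_integral_distr) (auto simp: case_prod_beta')
  also have "\<dots> = (\<integral>\<^sup>+y. \<integral>\<^sup>+x. indicator A (x + y) \<partial>gauss s \<partial>gauss t)"
    by (subst ST.nn_integral_snd[symmetric]) auto
  also have "\<dots> = (\<integral>\<^sup>+y. ennreal (gauss_density t y) * (\<integral>\<^sup>+x. ennreal (gauss_density s x) * indicator A (x + y) \<partial>lborel) \<partial>lborel)"
    unfolding gauss_def by (simp add: nn_integral_density)
  also have "\<dots> = (\<integral>\<^sup>+y. ennreal (gauss_density t y) * (\<integral>\<^sup>+x. ennreal (gauss_density s (x - y)) * indicator A x \<partial>lborel) \<partial>lborel)"
  proof (rule nn_integral_cong)
    fix y :: 'a
    have "(\<integral>\<^sup>+x. ennreal (gauss_density s x) * indicator A (x + y) \<partial>lborel) = (\<integral>\<^sup>+x. ennreal (gauss_density s (x - y)) * indicator A x \<partial>lborel)"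
      using nn_integral_lborel_shift[of "\<lambda>x. ennreal (gauss_density s (x - y)) * indicator A x" y] by (simp add: add.commute)
    then show "ennreal (gauss_density t y) * (\<integral>\<^sup>+x. ennreal (gauss_density s x) * indicator A (x + y) \<partial>lborel)
        = ennreal (gauss_density t y) * (\<integral>\<^sup>+x. ennreal (gauss_density s (x - y)) * indicator A x \<partial>lborel)" by simp
  qed
  also have "\<dots> = (\<integral>\<^sup>+y. (\<integral>\<^sup>+x. ennreal (gauss_density s (x - y) * gauss_density t y) * indicator A x \<partial>lborel) \<partial>lborel)"
    by (subst nn_integral_cmult[symmetric]) (auto simp: ennreal_mult' ac_simps)
  also have "\<dots> = (\<integral>\<^sup>+x. (\<integral>\<^sup>+y. ennreal (gauss_density s (x - y) * gauss_density t y) * indicator A x \<partial>lborel) \<partial>lborel)"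
    by (rule lborel_pair.Fubini') simp
  also have "\<dots> = (\<integral>\<^sup>+x. ennreal (gauss_density (s + t) x) * indicator A x \<partial>lborel)"
    using s t by (subst nn_integral_multc) (auto simp: gauss_density_convolution)
  also have "\<dots> = emeasure (gauss (s + t)) A"
    by (simp add: gauss_def emeasure_density)
  finally show "emeasure (gauss (s + t)) A = emeasure (distr (gauss s \<Otimes>\<^sub>M gauss t) borel (\<lambda>(x, y). x + y)) A" ..
qed simp

section \<open>The heat semigroup and its second order expansion\<close>

lemma heat_measurable[measurable]:
  fixes f :: "'a::euclidean_space \<Rightarrow> real"
  assumes "0 < t" and [measurable]: "f \<in> borel_measurable borel"
  shows "heat t f \<in> borel_measurable borel"
proof -
  interpret prob_space "gauss t :: 'a measure" by (rule prob_space_gauss) fact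
  show ?thesis unfolding heat_def[abs_def] by measurable
qed

lemma heat_bounded:
  fixes f :: "'a::euclidean_space \<Rightarrow> real"
  assumes "0 < t" "bounded_borel B f"
  shows "bounded_borel B (heat t f)"
proof -
  interpret prob_space "gauss t :: 'a measure" by (rule prob_space_gauss) fact
  note f = bounded_borelD[OF assms(2)]
  note [measurable] = f(1)
  have "\<bar>heat t f x\<bar> \<le> B" for x
  proof -
    have "\<bar>heat t f x\<bar> \<le> (\<integral>z. \<bar>f (x + z)\<bar> \<partial>gauss t)"
      unfolding heat_def by (rule integral_abs_bound)
    also have "\<dots> \<le> (\<integral>(z::'a). B \<partial>gauss t)"
      using f assms(1) by (intro integral_mono integrable_gauss_bounded[of _ _ B]) auto
    finally show ?thesis using assms by simp
  qed
  then show ?thesis using f assms by (auto simp: bounded_borel_def)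
qed

lemma heat_heat:
  fixes f :: "'a::euclidean_space \<Rightarrow> real"
  assumes s: "0 < s" and t: "0 < t" and f: "bounded_borel B f"
  shows "heat s (heat t f) = heat (s + t) f"
proof
  fix x
  interpret S: prob_space "gauss s :: 'a measure" by (rule prob_space_gauss) fact
  interpret T: prob_space "gauss t :: 'a measure" by (rule prob_space_gauss) fact
  interpret ST: pair_prob_space "gauss s :: 'a measure" "gauss t :: 'a measure" ..
  note [measurable] = bounded_borelD(1)[OF f]
  have "heat (s + t) f x = (\<integral>p. f (x + (fst p + snd p)) \<partial>(gauss s \<Otimes>\<^sub>M gauss t))"
    unfolding heat_def gauss_convolution[OF s t] by (subst integral_distr) (auto simp: case_prod_beta')
  also have "\<dots> = (\<integral>y. \<integral>z. f (x + (y + z)) \<partial>gauss t \<partial>gauss s)"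
    using bounded_borelD[OF f] by (subst ST.integral_fst'[symmetric]) (auto intro!: ST.integrable_const_bound[of _ B])
  finally show "heat s (heat t f) x = heat (s + t) f x"
    unfolding heat_def by (simp add: add.assoc)
qed

text \<open>From \<open>exp u * (1 - u) \<le> 1\<close> one gets
  \<open>0 \<le> exp u - 1 - u \<le> u * (exp u - 1)\<close>, and the last factor is at most
  \<open>\<bar>u\<bar> * exp \<bar>u\<bar>\<close> in absolute value.\<close>

lemma exp_minus_linear_bounds:
  fixes u :: real
  shows "\<bar>exp u - 1 - u\<bar> \<le> u\<^sup>2 * exp \<bar>u\<bar>"
proof -
  have 1: "exp u - 1 - u \<ge> 0" using exp_ge_add_one_self[of u] by linarith
  have ge: "exp a * (1 - a) \<le> 1" for a :: real
  proof -
    have "exp a * (1 - a) \<le> exp a * exp (- a)"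
      using exp_ge_add_one_self[of "- a"] by (intro mult_left_mono) auto
    then show ?thesis by (simp add: exp_minus)
  qed
  have 2: "exp u - 1 - u \<le> u * (exp u - 1)" using ge[of u] by (simp add: algebra_simps)
  have 3: "\<bar>exp u - 1\<bar> \<le> \<bar>u\<bar> * exp \<bar>u\<bar>"
  proof (cases "0 \<le> u")
    case True then show ?thesis using ge[of u] by (simp add: algebra_simps)
  next
    case False
    then have "\<bar>exp u - 1\<bar> \<le> \<bar>u\<bar>" by (simp add: abs_if) (use exp_ge_add_one_self[of u] in linarith)
    also have "\<dots> \<le> \<bar>u\<bar> * exp \<bar>u\<bar>" using mult_left_mono[of 1 "exp \<bar>u\<bar>" "\<bar>u\<bar>"] by simp
    finally show ?thesis .
  qed
  have "\<bar>exp u - 1 - u\<bar> \<le> \<bar>u\<bar> * \<bar>exp u - 1\<bar>" using 1 2 by (simp add: abs_mult[symmetric])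
  also have "\<dots> \<le> \<bar>u\<bar> * (\<bar>u\<bar> * exp \<bar>u\<bar>)" using 3 by (intro mult_left_mono) auto
  finally show ?thesis by (simp add: power2_eq_square abs_mult_self_eq mult.assoc[symmetric])
qed

text \<open>The Cameron-Martin factor, read off by expanding the square of
  \<open>norm (z - v)\<close>.\<close>

lemma gauss_density_shift:
  fixes z v :: "'a::euclidean_space"
  assumes "0 < t"
  shows "gauss_density t (z - v) = gauss_density t z * exp (z \<bullet> v / t - (norm v)\<^sup>2 / (2 * t))"
proof -
  have "- (norm (z - v))\<^sup>2 / (2 * t) = - (norm z)\<^sup>2 / (2 * t) + (z \<bullet> v / t - (norm v)\<^sup>2 / (2 * t))"
    using assms by (simp add: power2_norm_eq_inner inner_diff_left inner_diff_right inner_commute field_simps)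
  then show ?thesis
    unfolding gauss_density_eq[OF assms] by (simp only: exp_add mult.assoc mult.left_commute)
qed

lemma integrable_gauss_density:
  assumes "0 < t"
  shows "integrable lborel (gauss_density t :: 'a::euclidean_space \<Rightarrow> real)"
proof -
  have "integrable (gauss t) (\<lambda>z::'a. 1::real)"
    using assms by (intro integrable_gauss_bounded[of _ _ 1]) auto
  then show ?thesis
    unfolding gauss_def by (subst (asm) integrable_density) auto
qed

lemma integrable_gauss_iff:
  fixes f :: "'a::euclidean_space \<Rightarrow> real"
  assumes [measurable]: "f \<in> borel_measurable borel"
  shows "integrable (gauss t) f \<longleftrightarrow> integrable lborel (\<lambda>x. gauss_density t x * f x)"
  unfolding gauss_def by (subst integrable_density) auto

lemma gauss_exp_weight:
  fixes v :: "'a::euclidean_space"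
  assumes t: "0 < t"
  shows integrable_gauss_exp: "integrable (gauss t) (\<lambda>z. exp (z \<bullet> v / t - (norm v)\<^sup>2 / (2 * t)))"
    and integral_gauss_exp: "(\<integral>z. exp (z \<bullet> v / t - (norm v)\<^sup>2 / (2 * t)) \<partial>gauss t) = 1"
proof -
  show "integrable (gauss t) (\<lambda>z. exp (z \<bullet> v / t - (norm v)\<^sup>2 / (2 * t)))"
    using lborel_integrable_shift[OF integrable_gauss_density[OF t], of "- v"]
    by (subst integrable_gauss_iff) (auto simp: gauss_density_shift[OF t, symmetric])
  have "(\<integral>z. exp (z \<bullet> v / t - (norm v)\<^sup>2 / (2 * t)) \<partial>gauss t) = (\<integral>z. gauss_density t (- v + z) \<partial>lborel)"
    by (subst integral_gauss) (auto simp: gauss_density_shift[OF t, symmetric])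
  also have "\<dots> = (\<integral>(z::'a). 1 \<partial>gauss t)"
    using integral_gauss[of "\<lambda>_::'a. 1::real" t] by (subst lborel_integral_shift) simp
  finally show "(\<integral>z. exp (z \<bullet> v / t - (norm v)\<^sup>2 / (2 * t)) \<partial>gauss t) = 1" using t by simp
qed

text \<open>A shift of the argument becomes a change of measure. All dependence on \<open>v\<close>
  now sits in an explicit weight, so that expanding in \<open>v\<close> asks no regularity of
  \<open>f\<close>.\<close>

lemma heat_shift_eq:
  fixes f :: "'a::euclidean_space \<Rightarrow> real"
  assumes t: "0 < t" and [measurable]: "f \<in> borel_measurable borel"
  shows "heat t f (x + v) = (\<integral>z. f (x + z) * exp (z \<bullet> v / t - (norm v)\<^sup>2 / (2 * t)) \<partial>gauss t)"
proof -
  have "heat t f (x + v) = (\<integral>z. gauss_density t ((v + z) - v) * f (x + (v + z)) \<partial>lborel)"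
    unfolding heat_def by (subst integral_gauss) (auto simp: add.assoc)
  also have "\<dots> = (\<integral>z. gauss_density t (z - v) * f (x + z) \<partial>lborel)"
    by (rule lborel_integral_shift)
  finally show ?thesis
    by (subst integral_gauss) (auto simp: gauss_density_shift[OF t] ac_simps)
qed

lemma integrable_inner_gauss:
  assumes "0 < t"
  shows "integrable (gauss t) (\<lambda>z::'a::euclidean_space. z \<bullet> v)"
proof (rule Bochner_Integration.integrable_bound)
  show "integrable (gauss t) (\<lambda>z::'a. norm z ^ 1 * norm v)"
    using integrable_norm_gauss[OF assms, of 1, where 'a='a] by simp
qed (auto simp: Cauchy_Schwarz_ineq2)

text \<open>For \<open>norm w \<le> 1\<close> this is Taylor's formula under the integral, with an
  exponential moment as constant. For larger \<open>w\<close> the three terms are integrated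
  separately, and the total \<open>2 + m * norm w\<close> is at most
  \<open>(2 + m) * (norm w)\<^sup>2\<close>.\<close>

lemma gauss_exp_second_order:
  "\<exists>C\<ge>0. \<forall>w::'a::euclidean_space.
     (\<integral>z. \<bar>exp (z \<bullet> w - (norm w)\<^sup>2 / 2) - 1 - z \<bullet> w\<bar> \<partial>gauss 1) \<le> C * (norm w)\<^sup>2"
proof -
  define I where "I = (\<integral>(z::'a). exp (2 * norm z) \<partial>gauss 1)"
  define m where "m = gauss_norm_moment TYPE('a)"
  have m: "0 \<le> m" by (simp add: m_def gauss_norm_moment_nonneg)
  have I: "0 \<le> I" by (simp add: I_def)
  have ii: "integrable (gauss 1) (\<lambda>z. z \<bullet> w)" for w :: 'a by (rule integrable_inner_gauss) simp
  have ie: "integrable (gauss 1) (\<lambda>z. exp (z \<bullet> w - (norm w)\<^sup>2 / 2))" for w :: 'a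
    using integrable_gauss_exp[of 1 w] by simp
  have i1: "integrable (gauss 1) (\<lambda>z::'a. 1::real)" by (rule integrable_gauss_bounded[of _ _ 1]) auto
  show ?thesis
  proof (intro exI[of _ "(1 + 2 * exp 2 * I) + (2 + m)"] conjI allI)
    show "0 \<le> (1 + 2 * exp 2 * I) + (2 + m)" using I m by (intro add_nonneg_nonneg) auto
    fix w :: 'a
    show "(\<integral>z. \<bar>exp (z \<bullet> w - (norm w)\<^sup>2 / 2) - 1 - z \<bullet> w\<bar> \<partial>gauss 1) \<le> ((1 + 2 * exp 2 * I) + (2 + m)) * (norm w)\<^sup>2"
    proof (cases "norm w \<le> 1")
      case True
      have iL: "integrable (gauss 1) (\<lambda>z. \<bar>exp (z \<bullet> w - (norm w)\<^sup>2 / 2) - 1 - z \<bullet> w\<bar>)"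
        by (intro integrable_abs Bochner_Integration.integrable_diff i1 ie ii)
      have bd: "\<bar>exp (z \<bullet> w - (norm w)\<^sup>2 / 2) - 1 - z \<bullet> w\<bar> \<le> (norm w)\<^sup>2 * (1 + 2 * exp 2 * exp (2 * norm z))" for z :: 'a
      proof -
        define u where "u = z \<bullet> w - (norm w)\<^sup>2 / 2"
        \<comment> \<open>The exponent \<open>u\<close> satisfies both
          \<open>\<bar>u\<bar> \<le> norm w * a\<close> and \<open>\<bar>u\<bar> \<le> a\<close>.
          The first bound supplies the factor \<open>(norm w)\<^sup>2\<close>, the second controls
          \<open>exp \<bar>u\<bar>\<close>; together with \<open>a\<^sup>2 \<le> 2 * exp a\<close>
          there remains a multiple of \<open>exp (2 * norm z)\<close>.\<close>
        define a where "a = norm z + 1"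
        have a: "0 \<le> a" by (simp add: a_def)
        have w2: "(norm w)\<^sup>2 / 2 \<le> norm w * 1"
        proof -
          have "(norm w)\<^sup>2 \<le> norm w" using True by (simp add: power2_eq_square mult_left_le)
          then show ?thesis using norm_ge_zero[of w] by linarith
        qed
        have "\<bar>u\<bar> \<le> \<bar>z \<bullet> w\<bar> + (norm w)\<^sup>2 / 2"
          unfolding u_def using abs_triangle_ineq4[of "z \<bullet> w" "(norm w)\<^sup>2 / 2"] by simp
        also have "\<dots> \<le> norm z * norm w + norm w * 1" using w2 Cauchy_Schwarz_ineq2[of z w] by linarith
        finally have u1: "\<bar>u\<bar> \<le> norm w * a" by (simp add: a_def algebra_simps)
        have u2: "\<bar>u\<bar> \<le> a" using u1 True a mult_right_mono[of "norm w" 1 a] by simp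
        have "u\<^sup>2 \<le> (norm w * a)\<^sup>2" using u1 by (simp add: abs_le_square_iff[symmetric] a)
        moreover have "a\<^sup>2 \<le> 2 * exp a" using exp_lower_Taylor_quadratic[OF a] a by simp
        ultimately have "u\<^sup>2 \<le> (norm w)\<^sup>2 * (2 * exp a)"
          using mult_left_mono[of "a\<^sup>2" "2 * exp a" "(norm w)\<^sup>2"] by (simp add: power_mult_distrib)
        then have "u\<^sup>2 * exp \<bar>u\<bar> \<le> ((norm w)\<^sup>2 * (2 * exp a)) * exp a"
          using u2 by (intro mult_mono) auto
        also have "\<dots> = (norm w)\<^sup>2 * (2 * exp 2 * exp (2 * norm z))"
          by (simp add: a_def mult_exp_exp algebra_simps)
        finally have "\<bar>exp u - 1 - u\<bar> \<le> (norm w)\<^sup>2 * (2 * exp 2 * exp (2 * norm z))"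
          using exp_minus_linear_bounds[of u] by linarith
        moreover have "\<bar>exp u - 1 - z \<bullet> w\<bar> \<le> \<bar>exp u - 1 - u\<bar> + (norm w)\<^sup>2 / 2"
        proof -
          have "exp u - 1 - z \<bullet> w = (exp u - 1 - u) - (norm w)\<^sup>2 / 2" by (simp add: u_def)
          then show ?thesis using abs_triangle_ineq4[of "exp u - 1 - u" "(norm w)\<^sup>2 / 2"] by simp
        qed
        moreover have "(norm w)\<^sup>2 * (1 + 2 * exp 2 * exp (2 * norm z)) = (norm w)\<^sup>2 + (norm w)\<^sup>2 * (2 * exp 2 * exp (2 * norm z))"
          by (simp add: algebra_simps)
        ultimately show ?thesis unfolding u_def[symmetric] using zero_le_power2[of "norm w"] by linarith
      qed
      have "(\<integral>z. \<bar>exp (z \<bullet> w - (norm w)\<^sup>2 / 2) - 1 - z \<bullet> w\<bar> \<partial>gauss 1) \<le> (\<integral>(z::'a). (norm w)\<^sup>2 * (1 + 2 * exp 2 * exp (2 * norm z)) \<partial>gauss 1)"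
      proof (rule integral_mono[OF iL])
        show "integrable (gauss 1) (\<lambda>z::'a. (norm w)\<^sup>2 * (1 + 2 * exp 2 * exp (2 * norm z)))"
          by (intro integrable_mult_right Bochner_Integration.integrable_add i1 integrable_exp_norm_gauss)
      qed (rule bd)
      also have "\<dots> = (norm w)\<^sup>2 * (1 + 2 * exp 2 * I)"
        using integrable_exp_norm_gauss[where 'a='a] i1 by (simp add: I_def)
      also have "\<dots> \<le> (norm w)\<^sup>2 * ((1 + 2 * exp 2 * I) + (2 + m))"
        using m by (intro mult_left_mono) auto
      finally show ?thesis by (simp add: mult.commute)
    next
      case False
      have "(\<integral>z. \<bar>exp (z \<bullet> w - (norm w)\<^sup>2 / 2) - 1 - z \<bullet> w\<bar> \<partial>gauss 1) \<le>
         (\<integral>z. exp (z \<bullet> w - (norm w)\<^sup>2 / 2) + 1 + norm z ^ 1 * norm w \<partial>gauss 1)"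
      proof (rule integral_mono)
        show "\<bar>exp (z \<bullet> w - (norm w)\<^sup>2 / 2) - 1 - z \<bullet> w\<bar> \<le> exp (z \<bullet> w - (norm w)\<^sup>2 / 2) + 1 + norm z ^ 1 * norm w" for z
          using Cauchy_Schwarz_ineq2[of z w] exp_gt_zero[of "z \<bullet> w - (norm w)\<^sup>2 / 2"]
          unfolding power_one_right by linarith
      qed (use ii ie i1 integrable_norm_gauss[of 1 1, where 'a='a] in auto)
      also have "\<dots> = 1 + 1 + m * norm w"
        using ie[of w] i1 integrable_norm_gauss[of 1 1, where 'a='a] integral_gauss_exp[of 1 w]
        by (simp add: m_def gauss_norm_moment_def)
      also have "\<dots> \<le> (2 + m) * (norm w)\<^sup>2"
      proof -
        have "norm w \<le> (norm w)\<^sup>2" "1 \<le> (norm w)\<^sup>2"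
          using False mult_right_mono[of 1 "norm w" "norm w"] by (simp_all add: power2_eq_square)
        then show ?thesis using mult_left_mono[of "norm w" "(norm w)\<^sup>2" m] m by (simp add: algebra_simps)
      qed
      also have "\<dots> \<le> ((1 + 2 * exp 2 * I) + (2 + m)) * (norm w)\<^sup>2"
        using I by (intro mult_right_mono) auto
      finally show ?thesis .
    qed
  qed
qed

text \<open>After scaling to unit variance the remainder is that of
  \<open>gauss_exp_second_order\<close> at \<open>v /\<^sub>R sqrt t\<close>, whence the factor
  \<open>1 / t\<close>. The constant is chosen before \<open>t\<close>, \<open>B\<close> and
  \<open>f\<close>, so it depends on the dimension alone.\<close>

lemma heat_second_order:
  "\<exists>C\<ge>0. \<forall>t>0. \<forall>B f. \<forall>x v :: 'a::euclidean_space. bounded_borel B f \<longrightarrow>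
     \<bar>heat t f (x + v) - heat t f x - dheat t v f x\<bar> \<le> C * B * (norm v)\<^sup>2 / t"
proof -
  obtain C where C: "0 \<le> C" "\<And>w::'a. (\<integral>z. \<bar>exp (z \<bullet> w - (norm w)\<^sup>2 / 2) - 1 - z \<bullet> w\<bar> \<partial>gauss 1) \<le> C * (norm w)\<^sup>2"
    using gauss_exp_second_order by blast
  have "\<bar>heat t f (x + v) - heat t f x - dheat t v f x\<bar> \<le> C * B * (norm v)\<^sup>2 / t"
    if t: "0 < t" and f: "bounded_borel B f" for t B f and x v :: 'a
  proof -
    note [measurable] = bounded_borelD(1)[OF f]
    define k where "k = (\<lambda>z. exp (z \<bullet> v / t - (norm v)\<^sup>2 / (2 * t)) - 1 - z \<bullet> v / t)"
    have i1: "integrable (gauss t) (\<lambda>z. f (x + z))"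
      using t bounded_borelD[OF f] by (intro integrable_gauss_bounded[of _ _ B]) auto
    have i2: "integrable (gauss t) (\<lambda>z. f (x + z) * exp (z \<bullet> v / t - (norm v)\<^sup>2 / (2 * t)))"
      by (rule Bochner_Integration.integrable_bound[OF integrable_mult_right[OF integrable_gauss_exp[OF t, of v], of B]])
         (use bounded_borelD[OF f] in \<open>auto simp: abs_mult intro!: mult_right_mono\<close>)
    have i3: "integrable (gauss t) (\<lambda>z. f (x + z) * (z \<bullet> v / t))"
      by (rule Bochner_Integration.integrable_bound[OF integrable_mult_right[OF integrable_inner_gauss[OF t, of v], of "B / t"]])
         (use bounded_borelD[OF f] t in \<open>auto simp: abs_mult intro!: mult_right_mono divide_right_mono\<close>)
    have ik: "integrable (gauss t) k"
    proof -
      have "integrable (gauss t) (\<lambda>z::'a. 1::real)" by (rule integrable_gauss_bounded[OF t, of _ 1]) auto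
      moreover have "integrable (gauss t) (\<lambda>z. z \<bullet> v / t)" using integrable_inner_gauss[OF t, of v] by simp
      ultimately show ?thesis
        unfolding k_def using integrable_gauss_exp[OF t, of v] by (intro Bochner_Integration.integrable_diff)
    qed
    have "heat t f (x + v) - heat t f x - dheat t v f x = (\<integral>z. f (x + z) * k z \<partial>gauss t)"
    proof -
      have "(\<lambda>z. f (x + z) * k z) = (\<lambda>z. (f (x + z) * exp (z \<bullet> v / t - (norm v)\<^sup>2 / (2 * t)) - f (x + z)) - f (x + z) * (z \<bullet> v / t))"
        unfolding k_def right_diff_distrib by simp
      then show ?thesis
        unfolding heat_shift_eq[OF t bounded_borelD(1)[OF f]] unfolding heat_def dheat_def
        using Bochner_Integration.integral_diff[OF Bochner_Integration.integrable_diff[OF i2 i1] i3] Bochner_Integration.integral_diff[OF i2 i1]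
        by (simp only:)
    qed
    also have "\<bar>\<dots>\<bar> \<le> (\<integral>z. \<bar>f (x + z) * k z\<bar> \<partial>gauss t)" by (rule integral_abs_bound)
    also have "\<dots> \<le> (\<integral>z. B * \<bar>k z\<bar> \<partial>gauss t)"
    proof (rule integral_mono)
      show "integrable (gauss t) (\<lambda>z. \<bar>f (x + z) * k z\<bar>)"
        by (rule Bochner_Integration.integrable_bound[OF integrable_mult_right[OF ik, of B]])
           (use bounded_borelD[OF f] ik in \<open>auto simp: abs_mult k_def intro!: mult_right_mono\<close>)
    qed (use bounded_borelD[OF f] ik in \<open>auto simp: abs_mult intro!: mult_right_mono\<close>)
    also have "\<dots> = B * (\<integral>z. \<bar>k z\<bar> \<partial>gauss t)" by simp
    also have "(\<integral>z. \<bar>k z\<bar> \<partial>gauss t) = (\<integral>z. \<bar>exp (z \<bullet> (v /\<^sub>R sqrt t) - (norm (v /\<^sub>R sqrt t))\<^sup>2 / 2) - 1 - z \<bullet> (v /\<^sub>R sqrt t)\<bar> \<partial>gauss 1)"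
    proof -
      have "k (sqrt t *\<^sub>R z) = exp (z \<bullet> (v /\<^sub>R sqrt t) - (norm (v /\<^sub>R sqrt t))\<^sup>2 / 2) - 1 - z \<bullet> (v /\<^sub>R sqrt t)" for z
      proof -
        have "sqrt t * (z \<bullet> v) / t = (z \<bullet> v) / sqrt t" using t by (simp add: field_simps)
        moreover have "(norm (v /\<^sub>R sqrt t))\<^sup>2 = (norm v)\<^sup>2 / t" using t by (simp add: power_mult_distrib power_inverse divide_inverse)
        moreover have "z \<bullet> (v /\<^sub>R sqrt t) = (z \<bullet> v) / sqrt t"
          by (simp add: divide_inverse mult.commute)
        moreover have "(norm v)\<^sup>2 / (2 * t) = (norm v)\<^sup>2 / t / 2" by simp
        ultimately show ?thesis unfolding k_def inner_scaleR_left by (simp only:)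
      qed
      moreover have "k \<in> borel_measurable borel" unfolding k_def by measurable
      ultimately show ?thesis
        unfolding gauss_scale[OF t] by (subst integral_distr) auto
    qed
    also have "B * \<dots> \<le> B * (C * (norm (v /\<^sub>R sqrt t))\<^sup>2)"
      by (intro mult_left_mono C(2) bounded_borelD(3)[OF f])
    also have "\<dots> = C * B * (norm v)\<^sup>2 / t"
      using t by (simp add: power_mult_distrib power_inverse divide_inverse ac_simps)
    finally show ?thesis .
  qed
  with C(1) show ?thesis by blast
qed

section \<open>Identities and uniform estimates for the derivative of the heat semigroup\<close>

lemma heat_shift: "heat t (\<lambda>x. f (x + h)) x = heat t f (x + h)"
  by (simp add: heat_def algebra_simps)

lemma dheat_shift: "dheat t v (\<lambda>x. f (x + h)) x = dheat t v f (x + h)"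
  by (simp add: dheat_def algebra_simps)

lemma integrable_heat:
  assumes "0 < t" "bounded_borel B f"
  shows "integrable (gauss t) (\<lambda>z. f (x + z))"
proof -
  note [measurable] = bounded_borelD(1)[OF assms(2)]
  show ?thesis using assms bounded_borelD[OF assms(2)] by (intro integrable_gauss_bounded[of _ _ B]) auto
qed

lemma integrable_dheat:
  assumes t: "0 < t" and f: "bounded_borel B f"
  shows "integrable (gauss t) (\<lambda>z. f (x + z) * (z \<bullet> v / t))"
proof -
  note [measurable] = bounded_borelD(1)[OF f]
  show ?thesis
    by (rule Bochner_Integration.integrable_bound[OF integrable_mult_right[OF integrable_inner_gauss[OF t, of v], of "B / t"]])
       (use bounded_borelD[OF f] t in \<open>auto simp: abs_mult intro!: mult_right_mono divide_right_mono\<close>)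
qed

lemma heat_diff:
  assumes "0 < t" "bounded_borel B f" "bounded_borel B' g"
  shows "heat t (\<lambda>x. f x - g x) x = heat t f x - heat t g x"
  unfolding heat_def using integrable_heat[OF assms(1,2)] integrable_heat[OF assms(1,3)]
  by (intro Bochner_Integration.integral_diff)

lemma dheat_diff:
  assumes "0 < t" "bounded_borel B f" "bounded_borel B' g"
  shows "dheat t v (\<lambda>x. f x - g x) x = dheat t v f x - dheat t v g x"
  unfolding dheat_def left_diff_distrib
  using integrable_dheat[OF assms(1,2)] integrable_dheat[OF assms(1,3)]
  by (intro Bochner_Integration.integral_diff)

lemma dheat_measurable_joint:
  fixes f :: "'a::euclidean_space \<Rightarrow> real"
  assumes [measurable]: "f \<in> borel_measurable borel"
  shows "(\<lambda>p. dheat (fst p) v f (snd p)) \<in> borel_measurable (borel \<Otimes>\<^sub>M borel)"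
proof -
  have [measurable]: "(\<lambda>p. gauss_density (fst (fst p)) (snd p) :: real) \<in> borel_measurable ((borel \<Otimes>\<^sub>M borel) \<Otimes>\<^sub>M (lborel :: 'a measure))"
    unfolding gauss_density_def normal_density_def by measurable
  have "(\<lambda>p. dheat (fst p) v f (snd p)) = (\<lambda>p. \<integral>z. gauss_density (fst p) z * (f (snd p + z) * (z \<bullet> v / fst p)) \<partial>lborel)"
    unfolding dheat_def by (subst integral_gauss) auto
  also have "\<dots> \<in> borel_measurable (borel \<Otimes>\<^sub>M borel)"
    by measurable
  finally show ?thesis .
qed

lemma dheat_measurable[measurable]:
  fixes f :: "'a::euclidean_space \<Rightarrow> real"
  assumes [measurable]: "f \<in> borel_measurable borel"
  shows "dheat t v f \<in> borel_measurable borel"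
  using measurable_compose[OF _ dheat_measurable_joint[OF assms], of "\<lambda>x. (t, x)" borel v] by simp

lemma dheat_bounded:
  fixes f :: "'a::euclidean_space \<Rightarrow> real"
  assumes t: "0 < t" and f: "bounded_borel B f"
  shows "bounded_borel (gauss_norm_moment TYPE('a) * B * norm v / sqrt t) (dheat t v f)"
  unfolding bounded_borel_def
proof (intro conjI allI)
  show "dheat t v f \<in> borel_measurable borel"
    using bounded_borelD(1)[OF f] by simp
  fix x :: 'a
  have "\<bar>dheat t v f x\<bar> \<le> (\<integral>z. \<bar>f (x + z) * (z \<bullet> v / t)\<bar> \<partial>gauss t)"
    unfolding dheat_def by (rule integral_abs_bound)
  also have "\<dots> \<le> (\<integral>(z::'a). norm z ^ 1 * (B * norm v / t) \<partial>gauss t)"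
  proof (rule integral_mono)
    show "\<bar>f (x + z) * (z \<bullet> v / t)\<bar> \<le> norm z ^ 1 * (B * norm v / t)" for z
    proof -
      have "\<bar>f (x + z) * (z \<bullet> v / t)\<bar> = \<bar>f (x + z)\<bar> * (\<bar>z \<bullet> v\<bar> / t)" using t by (simp add: abs_mult)
      also have "\<dots> \<le> B * ((norm z * norm v) / t)"
        using t bounded_borelD[OF f] by (intro mult_mono divide_right_mono Cauchy_Schwarz_ineq2) auto
      finally show ?thesis by (simp add: ac_simps)
    qed
    show "integrable (gauss t) (\<lambda>z::'a. norm z ^ 1 * (B * norm v / t))"
      by (intro integrable_mult_left integrable_norm_gauss t)
  qed (intro integrable_abs integrable_dheat[OF t f])
  also have "\<dots> = (\<integral>(z::'a). norm z \<partial>gauss t) * (B * norm v / t)" by simp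
  also have "\<dots> = gauss_norm_moment TYPE('a) * B * norm v / sqrt t"
    using t by (simp add: integral_norm_gauss field_simps)
  finally show "\<bar>dheat t v f x\<bar> \<le> gauss_norm_moment TYPE('a) * B * norm v / sqrt t" .
qed

lemma dheat_sum_Basis:
  fixes f :: "'a::euclidean_space \<Rightarrow> real"
  assumes t: "0 < t" and f: "bounded_borel B f"
  shows "dheat t v f x = (\<Sum>e\<in>Basis. (v \<bullet> e) * dheat t e f x)"
proof -
  have "dheat t v f x = (\<integral>z. (\<Sum>e\<in>Basis. (v \<bullet> e) * (f (x + z) * (z \<bullet> e / t))) \<partial>gauss t)"
    unfolding dheat_def
    by (subst (1) euclidean_inner) (simp add: sum_divide_distrib sum_distrib_left ac_simps)
  also have "\<dots> = (\<Sum>e\<in>Basis. (v \<bullet> e) * dheat t e f x)"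
    unfolding dheat_def by (subst Bochner_Integration.integral_sum, rule integrable_mult_right[OF integrable_dheat[OF t f]]) simp
  finally show ?thesis .
qed

lemma dheat_scaleR: "dheat t (c *\<^sub>R v) f x = c * dheat t v f x"
  unfolding dheat_def by (subst integral_mult_right_zero[symmetric]) (simp add: ac_simps)

text \<open>\<open>dheat\<close> is determined by the first order expansion of \<open>heat\<close>.\<close>

lemma quadratic_unique:
  fixes a C :: real
  assumes "\<And>\<tau>. 0 < \<tau> \<Longrightarrow> \<bar>\<tau> * a\<bar> \<le> C * \<tau>\<^sup>2"
  shows "a = 0"
proof (rule ccontr)
  assume "a \<noteq> 0"
  have C: "0 \<le> C" using assms[of 1] by simp
  have "\<bar>a\<bar> \<le> C * \<tau>" if "0 < \<tau>" for \<tau>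
    using assms[OF that] that by (simp add: abs_mult power2_eq_square)
  from this[of "\<bar>a\<bar> / (2 * (C + 1))"] C \<open>a \<noteq> 0\<close> have "\<bar>a\<bar> * (C + 2) \<le> 0"
    by (simp add: field_simps)
  moreover have "0 < \<bar>a\<bar> * (C + 2)" using C \<open>a \<noteq> 0\<close> by simp
  ultimately show False by simp
qed

text \<open>Both sides are the first order coefficient of \<open>heat (s + t) f\<close> at
  \<open>x\<close> in direction \<open>v\<close>, each with a quadratic remainder, so
  \<open>quadratic_unique\<close> identifies them. Nothing is differentiated under an integral
  sign.\<close>

lemma dheat_heat:
  fixes f :: "'a::euclidean_space \<Rightarrow> real"
  assumes s: "0 < s" and t: "0 < t" and f: "bounded_borel B f"
  shows "dheat s v (heat t f) x = dheat (s + t) v f x"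
proof -
  obtain C where C: "0 \<le> C" "\<And>t B f x v. 0 < t \<Longrightarrow> bounded_borel B f \<Longrightarrow>
     \<bar>heat t f (x + v) - heat t f x - dheat t v f (x::'a)\<bar> \<le> C * B * (norm v)\<^sup>2 / t"
    using heat_second_order[where 'a='a] by metis
  have "dheat s v (heat t f) x - dheat (s + t) v f x = 0"
  proof (rule quadratic_unique)
    fix \<tau> :: real assume \<tau>: "0 < \<tau>"
    have 1: "\<bar>heat (s + t) f (x + \<tau> *\<^sub>R v) - heat (s + t) f x - \<tau> * dheat s v (heat t f) x\<bar> \<le> C * B * (norm (\<tau> *\<^sub>R v))\<^sup>2 / s"
      using C(2)[OF s heat_bounded[OF t f], of x "\<tau> *\<^sub>R v"] by (simp add: heat_heat[OF s t f] dheat_scaleR)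
    have 2: "\<bar>heat (s + t) f (x + \<tau> *\<^sub>R v) - heat (s + t) f x - \<tau> * dheat (s + t) v f x\<bar> \<le> C * B * (norm (\<tau> *\<^sub>R v))\<^sup>2 / (s + t)"
      using C(2)[OF _ f, of "s + t" x "\<tau> *\<^sub>R v"] s t by (simp add: dheat_scaleR)
    have 3: "\<tau> * (dheat s v (heat t f) x - dheat (s + t) v f x) =
       (heat (s + t) f (x + \<tau> *\<^sub>R v) - heat (s + t) f x - \<tau> * dheat (s + t) v f x)
       - (heat (s + t) f (x + \<tau> *\<^sub>R v) - heat (s + t) f x - \<tau> * dheat s v (heat t f) x)"
      by (simp add: algebra_simps)
    have "\<bar>\<tau> * (dheat s v (heat t f) x - dheat (s + t) v f x)\<bar> \<le> C * B * (norm (\<tau> *\<^sub>R v))\<^sup>2 / (s + t) + C * B * (norm (\<tau> *\<^sub>R v))\<^sup>2 / s"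
      unfolding 3 by (rule order_trans[OF abs_triangle_ineq4 add_mono[OF 2 1]])
    also have "\<dots> = (C * B * (norm v)\<^sup>2 / (s + t) + C * B * (norm v)\<^sup>2 / s) * \<tau>\<^sup>2"
      by (simp add: power_mult_distrib algebra_simps)
    finally show "\<bar>\<tau> * (dheat s v (heat t f) x - dheat (s + t) v f x)\<bar> \<le> (C * B * (norm v)\<^sup>2 / (s + t) + C * B * (norm v)\<^sup>2 / s) * \<tau>\<^sup>2" .
  qed
  then show ?thesis by simp
qed

text \<open>A Lipschitz bound in space becomes a bound in time, because the Gaussian displacement
  over time \<open>t\<close> has mean length proportional to \<open>sqrt t\<close>.\<close>

lemma heat_bounded_diff:
  fixes f :: "'a::euclidean_space \<Rightarrow> real"
  assumes t: "0 < t" and f: "bounded_borel B f" and bd: "\<And>z. \<bar>f (x + z) - f x\<bar> \<le> L * norm z"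
  shows "\<bar>heat t f x - f x\<bar> \<le> L * (sqrt t * gauss_norm_moment TYPE('a))"
proof -
  note [measurable] = bounded_borelD(1)[OF f]
  have "heat t f x - f x = (\<integral>z. f (x + z) - f x \<partial>gauss t)"
    unfolding heat_def using t integrable_heat[OF t f, of x] integrable_gauss_bounded[of t "\<lambda>_::'a. f x" "\<bar>f x\<bar>"]
    by (subst Bochner_Integration.integral_diff) auto
  also have "\<bar>\<dots>\<bar> \<le> (\<integral>z. \<bar>f (x + z) - f x\<bar> \<partial>gauss t)" by (rule integral_abs_bound)
  also have "\<dots> \<le> (\<integral>(z::'a). L * norm z ^ 1 \<partial>gauss t)"
  proof (rule integral_mono)
    show "integrable (gauss t) (\<lambda>z. \<bar>f (x + z) - f x\<bar>)"
      using t integrable_heat[OF t f, of x] integrable_gauss_bounded[of t "\<lambda>_::'a. f x" "\<bar>f x\<bar>"]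
      by (intro integrable_abs Bochner_Integration.integrable_diff) auto
    show "integrable (gauss t) (\<lambda>z::'a. L * norm z ^ 1)"
      by (intro integrable_mult_right integrable_norm_gauss t)
  qed (use bd in auto)
  also have "\<dots> = L * (sqrt t * gauss_norm_moment TYPE('a))"
    by (simp add: integral_norm_gauss[OF t])
  finally show ?thesis .
qed

text \<open>Apply \<open>heat s\<close> to the remainder of the first order expansion of
  \<open>heat t f\<close>. Averaging preserves its uniform quadratic bound, so
  \<open>heat s (dheat t v f) x\<close> is again the first order coefficient of
  \<open>heat (s + t) f\<close>.\<close>

lemma heat_dheat:
  fixes f :: "'a::euclidean_space \<Rightarrow> real"
  assumes s: "0 < s" and t: "0 < t" and f: "bounded_borel B f"
  shows "heat s (dheat t v f) x = dheat (s + t) v f x"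
proof -
  obtain C where C: "0 \<le> C" "\<And>t B f x v. 0 < t \<Longrightarrow> bounded_borel B f \<Longrightarrow>
     \<bar>heat t f (x + v) - heat t f x - dheat t v f (x::'a)\<bar> \<le> C * B * (norm v)\<^sup>2 / t"
    using heat_second_order[where 'a='a] by metis
  have "heat s (dheat t v f) x - dheat (s + t) v f x = 0"
  proof (rule quadratic_unique)
    fix \<tau> :: real assume \<tau>: "0 < \<tau>"
    define g where "g = (\<lambda>y. heat t f (y + \<tau> *\<^sub>R v) - heat t f y - \<tau> * dheat t v f y)"
    have gb: "bounded_borel (C * B * (norm (\<tau> *\<^sub>R v))\<^sup>2 / t) g"
    proof -
      have [measurable]: "heat t f \<in> borel_measurable borel" "dheat t v f \<in> borel_measurable borel"
        by (rule bounded_borelD(1)[OF heat_bounded[OF t f]], rule bounded_borelD(1)[OF dheat_bounded[OF t f]])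
      have "g \<in> borel_measurable borel" unfolding g_def by measurable
      moreover have "\<bar>g y\<bar> \<le> C * B * (norm (\<tau> *\<^sub>R v))\<^sup>2 / t" for y
        using C(2)[OF t f, of y "\<tau> *\<^sub>R v"] unfolding g_def dheat_scaleR .
      ultimately show ?thesis unfolding bounded_borel_def by blast
    qed
    have "heat s g x = heat (s + t) f (x + \<tau> *\<^sub>R v) - heat (s + t) f x - \<tau> * heat s (dheat t v f) x"
    proof -
      have i1: "integrable (gauss s) (\<lambda>z. heat t f (x + z + \<tau> *\<^sub>R v))"
        using integrable_heat[OF s heat_bounded[OF t f], of "x + \<tau> *\<^sub>R v"] by (simp add: ac_simps)
      have i2: "integrable (gauss s) (\<lambda>z. heat t f (x + z))" by (rule integrable_heat[OF s heat_bounded[OF t f]])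
      have i3: "integrable (gauss s) (\<lambda>z. \<tau> * dheat t v f (x + z))"
        by (intro integrable_mult_right integrable_heat[OF s dheat_bounded[OF t f]])
      have "heat s g x = (\<integral>z. heat t f (x + z + \<tau> *\<^sub>R v) \<partial>gauss s) - heat s (heat t f) x - \<tau> * heat s (dheat t v f) x"
        unfolding heat_def[of s] g_def
        by (simp only: Bochner_Integration.integral_diff[OF Bochner_Integration.integrable_diff[OF i1 i2] i3]
            Bochner_Integration.integral_diff[OF i1 i2] integral_mult_right_zero)
      also have "(\<integral>z. heat t f (x + z + \<tau> *\<^sub>R v) \<partial>gauss s) = heat s (heat t f) (x + \<tau> *\<^sub>R v)"
        unfolding heat_def[of s] by (simp add: ac_simps)
      finally show ?thesis by (simp add: heat_heat[OF s t f])
    qed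
    then have 1: "\<bar>heat (s + t) f (x + \<tau> *\<^sub>R v) - heat (s + t) f x - \<tau> * heat s (dheat t v f) x\<bar> \<le> C * B * (norm (\<tau> *\<^sub>R v))\<^sup>2 / t"
      using bounded_borelD(2)[OF heat_bounded[OF s gb], of x] by simp
    have 2: "\<bar>heat (s + t) f (x + \<tau> *\<^sub>R v) - heat (s + t) f x - \<tau> * dheat (s + t) v f x\<bar> \<le> C * B * (norm (\<tau> *\<^sub>R v))\<^sup>2 / (s + t)"
      using C(2)[OF _ f, of "s + t" x "\<tau> *\<^sub>R v"] s t by (simp add: dheat_scaleR)
    have 3: "\<tau> * (heat s (dheat t v f) x - dheat (s + t) v f x) =
       (heat (s + t) f (x + \<tau> *\<^sub>R v) - heat (s + t) f x - \<tau> * dheat (s + t) v f x)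
       - (heat (s + t) f (x + \<tau> *\<^sub>R v) - heat (s + t) f x - \<tau> * heat s (dheat t v f) x)"
      by (simp add: algebra_simps)
    have "\<bar>\<tau> * (heat s (dheat t v f) x - dheat (s + t) v f x)\<bar> \<le> C * B * (norm (\<tau> *\<^sub>R v))\<^sup>2 / (s + t) + C * B * (norm (\<tau> *\<^sub>R v))\<^sup>2 / t"
      unfolding 3 by (rule order_trans[OF abs_triangle_ineq4 add_mono[OF 2 1]])
    also have "\<dots> = (C * B * (norm v)\<^sup>2 / (s + t) + C * B * (norm v)\<^sup>2 / t) * \<tau>\<^sup>2"
      by (simp add: power_mult_distrib algebra_simps)
    finally show "\<bar>\<tau> * (heat s (dheat t v f) x - dheat (s + t) v f x)\<bar> \<le> (C * B * (norm v)\<^sup>2 / (s + t) + C * B * (norm v)\<^sup>2 / t) * \<tau>\<^sup>2" .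
  qed
  then show ?thesis by simp
qed

text \<open>All estimates under one constant, so that later computations carry a single number
  \<open>heat_const\<close> depending on the dimension only. Each spatial derivative costs
  \<open>1 / sqrt t\<close>; a time step \<open>s\<close> is bounded by \<open>sqrt s\<close> times
  one further spatial derivative, which is crude but sufficient.\<close>

definition heat_estimates :: "'a::euclidean_space itself \<Rightarrow> real \<Rightarrow> bool" where
  "heat_estimates _ C \<longleftrightarrow> 0 \<le> C \<and> (\<forall>t>0. \<forall>B f. \<forall>x v :: 'a. bounded_borel B f \<longrightarrow>
     \<bar>heat t f (x + v) - heat t f x - dheat t v f x\<bar> \<le> C * B * (norm v)\<^sup>2 / t \<and>
     \<bar>heat t f (x + v) - heat t f x\<bar> \<le> C * B * norm v / sqrt t \<and>
     \<bar>dheat t v f x\<bar> \<le> C * B * norm v / sqrt t \<and>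
     (\<forall>y. \<bar>dheat t v f (x + y) - dheat t v f x\<bar> \<le> C * B * norm v * norm y / t) \<and>
     (\<forall>s>0. \<bar>heat (t + s) f x - heat t f x\<bar> \<le> C * B * sqrt s / sqrt t \<and>
        \<bar>dheat (t + s) v f x - dheat t v f x\<bar> \<le> C * B * norm v * sqrt s / t))"

lemma heat_estimates_exist: "\<exists>C. heat_estimates TYPE('a::euclidean_space) C"
proof -
  obtain C where C: "0 \<le> C" "\<And>t B f x v. 0 < t \<Longrightarrow> bounded_borel B f \<Longrightarrow>
     \<bar>heat t f (x + v) - heat t f x - dheat t v f (x::'a)\<bar> \<le> C * B * (norm v)\<^sup>2 / t"
    using heat_second_order[where 'a='a] by metis
  define m where "m = gauss_norm_moment TYPE('a)"
  have m: "0 \<le> m" by (simp add: m_def gauss_norm_moment_nonneg)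
  define L where "L = C + m + 2"
  have L: "0 \<le> L" "C \<le> L" "m \<le> L" using C m by (auto simp: L_def)
  have q: "\<bar>dheat t v f x\<bar> \<le> m * B * norm v / sqrt t" if "0 < t" "bounded_borel B f" for t B f and x v :: 'a
    using bounded_borelD(2)[OF dheat_bounded[OF that]] by (simp add: m_def)
  have lip: "\<bar>heat t f (x + v) - heat t f x\<bar> \<le> L * B * norm v / sqrt t" if t: "0 < t" and f: "bounded_borel B f" for t B f and x v :: 'a
  \<comment> \<open>Up to the parabolic length \<open>sqrt t\<close> the second order expansion
    gives the better bound, beyond it the trivial bound \<open>2 * B\<close> does.\<close>
  proof (cases "norm v \<le> sqrt t")
    case True
    have B: "0 \<le> B" by (rule bounded_borelD(3)[OF f])
    have "(norm v)\<^sup>2 / t = (norm v / sqrt t) * (norm v / sqrt t)" using t by (simp add: power2_eq_square)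
    also have "\<dots> \<le> 1 * (norm v / sqrt t)" using True t by (intro mult_right_mono) auto
    finally have "C * B * ((norm v)\<^sup>2 / t) \<le> C * B * (norm v / sqrt t)" using C B by (intro mult_left_mono) auto
    then have "\<bar>heat t f (x + v) - heat t f x\<bar> \<le> C * B * (norm v / sqrt t) + m * B * (norm v / sqrt t)"
      using C(2)[OF t f, of x v] q[OF t f, of v x] by simp
    also have "\<dots> = (C + m) * (B * norm v / sqrt t)" by (simp add: algebra_simps add_divide_distrib)
    also have "\<dots> \<le> L * (B * norm v / sqrt t)" using B t by (intro mult_right_mono) (auto simp: L_def)
    finally show ?thesis by simp
  next
    case False
    have B: "0 \<le> B" by (rule bounded_borelD(3)[OF f])
    have "\<bar>heat t f (x + v) - heat t f x\<bar> \<le> 2 * B * 1"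
      using bounded_borelD(2)[OF heat_bounded[OF t f], of x] bounded_borelD(2)[OF heat_bounded[OF t f], of "x + v"] by simp
    also have "\<dots> \<le> 2 * B * (norm v / sqrt t)" using False B t by (intro mult_left_mono) auto
    also have "\<dots> = 2 * (B * norm v / sqrt t)" by simp
    also have "\<dots> \<le> L * (B * norm v / sqrt t)" using B t C m by (intro mult_right_mono) (auto simp: L_def)
    finally show ?thesis by simp
  qed
  have dlip: "\<bar>dheat t v f (x + y) - dheat t v f x\<bar> \<le> (2 * m * L) * B * norm v * norm y / t"
    if t: "0 < t" and f: "bounded_borel B f" for t B f and x v y :: 'a
  proof -
    \<comment> \<open>Time is split in two halves: the first makes the difference of translates
      small in the uniform norm, the second pays for the derivative in direction
      \<open>v\<close>.\<close>
    define g where "g = (\<lambda>x. heat (t/2) f (x + y) - heat (t/2) f x)"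
    have t2: "0 < t / 2" using t by simp
    have hb: "bounded_borel B (heat (t/2) f)" by (rule heat_bounded[OF t2 f])
    have hby: "bounded_borel B (\<lambda>x. heat (t/2) f (x + y))"
    proof -
      note [measurable] = bounded_borelD(1)[OF hb]
      have "(\<lambda>x. heat (t/2) f (x + y)) \<in> borel_measurable borel" by measurable
      then show ?thesis using bounded_borelD(2)[OF hb] unfolding bounded_borel_def by blast
    qed
    have gb: "bounded_borel (L * B * norm y / sqrt (t/2)) g"
    proof -
      note [measurable] = bounded_borelD(1)[OF hb] bounded_borelD(1)[OF hby]
      have "g \<in> borel_measurable borel" unfolding g_def by measurable
      then show ?thesis using lip[OF t2 f, of _ y] unfolding bounded_borel_def g_def by blast
    qed
    have "dheat t v f (x + y) - dheat t v f x = dheat (t/2) v g x"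
      using dheat_heat[OF t2 t2 f, of v "x + y"] dheat_heat[OF t2 t2 f, of v x] unfolding g_def dheat_diff[OF t2 hby hb] dheat_shift by simp
    also have "\<bar>\<dots>\<bar> \<le> m * (L * B * norm y / sqrt (t/2)) * norm v / sqrt (t/2)" by (rule q[OF t2 gb])
    also have "\<dots> = (2 * m * L) * B * norm v * norm y / t" using t by (simp add: field_simps)
    finally show ?thesis .
  qed
  have ht: "\<bar>heat (t + s) f x - heat t f x\<bar> \<le> (m * L) * B * sqrt s / sqrt t"
    if t: "0 < t" and s: "0 < s" and f: "bounded_borel B f" for s t B f and x :: 'a
    using heat_bounded_diff[OF s heat_bounded[OF t f], of x "L * B / sqrt t"] lip[OF t f, of x]
    by (simp add: heat_heat[OF s t f] m_def ac_simps)
  have dt: "\<bar>dheat (t + s) v f x - dheat t v f x\<bar> \<le> (m * (2 * m * L)) * B * norm v * sqrt s / t"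
    if t: "0 < t" and s: "0 < s" and f: "bounded_borel B f" for s t B f and x v :: 'a
    using heat_bounded_diff[OF s dheat_bounded[OF t f], of v x "(2 * m * L) * B * norm v / t"] dlip[OF t f, of v x]
    by (simp add: heat_dheat[OF s t f] m_def ac_simps)
  define D where "D = L + 2 * m * L + m * L + m * (2 * m * L)"
  have D: "C \<le> D" "m \<le> D" "L \<le> D" "2 * m * L \<le> D" "m * L \<le> D" "m * (2 * m * L) \<le> D" "0 \<le> D"
  proof -
    have "0 \<le> 2 * m * L" "0 \<le> m * L" "0 \<le> m * (2 * m * L)"
      using L m by (simp_all only: mult_nonneg_nonneg zero_le_numeral)
    then show "C \<le> D" "m \<le> D" "L \<le> D" "2 * m * L \<le> D" "m * L \<le> D" "m * (2 * m * L) \<le> D" "0 \<le> D"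
      using L unfolding D_def by linarith+
  qed
  have mono: "c * B * a / b \<le> D * B * a / b" if "c \<le> D" "0 \<le> B" "0 \<le> a" "0 \<le> b" for c B a b
    using that by (intro divide_right_mono mult_right_mono) auto
  have mono2: "c * B * a * a' / b \<le> D * B * a * a' / b" if "c \<le> D" "0 \<le> B" "0 \<le> a" "0 \<le> a'" "0 \<le> b" for c B a a' b
    using that by (intro divide_right_mono mult_right_mono) auto
  show ?thesis
    unfolding heat_estimates_def
  proof (intro exI[of _ D] conjI allI impI)
    fix t B :: real and f :: "'a \<Rightarrow> real" and x v :: 'a assume t: "0 < t" and f: "bounded_borel B f"
    note B = bounded_borelD(3)[OF f]
    show "\<bar>heat t f (x + v) - heat t f x - dheat t v f x\<bar> \<le> D * B * (norm v)\<^sup>2 / t"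
      by (rule order_trans[OF C(2)[OF t f] mono]) (use D B t in auto)
    show "\<bar>heat t f (x + v) - heat t f x\<bar> \<le> D * B * norm v / sqrt t"
      by (rule order_trans[OF lip[OF t f] mono]) (use D B t in auto)
    show "\<bar>dheat t v f x\<bar> \<le> D * B * norm v / sqrt t"
      by (rule order_trans[OF q[OF t f] mono]) (use D B t in auto)
    show "\<bar>dheat t v f (x + y) - dheat t v f x\<bar> \<le> D * B * norm v * norm y / t" for y
      by (rule order_trans[OF dlip[OF t f] mono2]) (use D B t in auto)
    fix s :: real assume s: "0 < s"
    show "\<bar>heat (t + s) f x - heat t f x\<bar> \<le> D * B * sqrt s / sqrt t"
      by (rule order_trans[OF ht[OF t s f] mono]) (use D B t s in auto)
    show "\<bar>dheat (t + s) v f x - dheat t v f x\<bar> \<le> D * B * norm v * sqrt s / t"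
      by (rule order_trans[OF dt[OF t s f] mono2]) (use D B t s in auto)
  qed (rule D)
qed

definition heat_const :: "'a::euclidean_space itself \<Rightarrow> real" where
  "heat_const A = (SOME C. heat_estimates A C)"

lemma heat_const: "heat_estimates TYPE('a::euclidean_space) (heat_const TYPE('a))"
  unfolding heat_const_def by (rule someI_ex[OF heat_estimates_exist])

lemma heat_const_nonneg: "0 \<le> heat_const TYPE('a::euclidean_space)"
  using heat_const[where 'a='a] by (simp add: heat_estimates_def)

lemma heat_const_estimates:
  fixes x v :: "'a::euclidean_space"
  assumes "0 < t" "bounded_borel B f"
  shows "\<bar>heat t f (x + v) - heat t f x - dheat t v f x\<bar> \<le> heat_const TYPE('a) * B * (norm v)\<^sup>2 / t"
    and "\<bar>heat t f (x + v) - heat t f x\<bar> \<le> heat_const TYPE('a) * B * norm v / sqrt t"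
    and "\<bar>dheat t v f x\<bar> \<le> heat_const TYPE('a) * B * norm v / sqrt t"
    and "\<bar>dheat t v f (x + y) - dheat t v f x\<bar> \<le> heat_const TYPE('a) * B * norm v * norm y / t"
    and "0 < s \<Longrightarrow> \<bar>heat (t + s) f x - heat t f x\<bar> \<le> heat_const TYPE('a) * B * sqrt s / sqrt t"
    and "0 < s \<Longrightarrow> \<bar>dheat (t + s) v f x - dheat t v f x\<bar> \<le> heat_const TYPE('a) * B * norm v * sqrt s / t"
  using heat_const[where 'a='a] assms by (auto simp: heat_estimates_def)

section \<open>Finite differences and translations\<close>

text \<open>Smoothness is measured by iterated differences instead of derivatives: they act on
  arbitrary bounded Borel functions, commute with the heat semigroup, and pass by duality to laws
  without a density.\<close>

definition fdiff :: "'a::real_vector \<Rightarrow> ('a \<Rightarrow> 'b::ab_group_add) \<Rightarrow> 'a \<Rightarrow> 'b" where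
  "fdiff h f = (\<lambda>x. f (x + h) - f x)"

lemma fdiff_funpow_Suc: "(fdiff h ^^ Suc m) f = fdiff h ((fdiff h ^^ m) f)"
  "(fdiff h ^^ Suc m) f = (fdiff h ^^ m) (fdiff h f)"
  by (simp_all add: funpow_swap1)

lemma fdiff_funpow_shift: "(fdiff h ^^ m) (\<lambda>x. f (x + c)) x = (fdiff h ^^ m) f (x + c)"
  by (induction m arbitrary: x) (simp_all add: fdiff_def algebra_simps)

lemma fdiff_funpow_diff: "(fdiff h ^^ m) (\<lambda>x. f x - g x) x = (fdiff h ^^ m) f x - (fdiff h ^^ m) g x"
  by (induction m arbitrary: x) (simp_all add: fdiff_def)

lemma fdiff_funpow_sum: "(fdiff h ^^ m) (\<lambda>x. \<Sum>i\<in>I. f i x) x = (\<Sum>i\<in>I. (fdiff h ^^ m) (f i) x)"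
  by (induction m arbitrary: x) (simp_all add: fdiff_def sum_subtractf)

lemma bounded_borel_shift:
  assumes "bounded_borel B f" shows "bounded_borel B (\<lambda>x. f (x + h))"
proof -
  note [measurable] = bounded_borelD(1)[OF assms]
  have "(\<lambda>x. f (x + h)) \<in> borel_measurable borel" by measurable
  then show ?thesis using bounded_borelD(2)[OF assms] unfolding bounded_borel_def by blast
qed

lemma bounded_borel_reflect:
  assumes "bounded_borel B f" shows "bounded_borel B (\<lambda>y. f (x - y))"
proof -
  note [measurable] = bounded_borelD(1)[OF assms]
  have "(\<lambda>y. f (x - y)) \<in> borel_measurable borel" by measurable
  then show ?thesis using bounded_borelD(2)[OF assms] unfolding bounded_borel_def by blast
qed

lemma bounded_borel_mult:
  assumes "bounded_borel A f" "bounded_borel B g" shows "bounded_borel (A * B) (\<lambda>x. f x * g x)"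
proof -
  note [measurable] = bounded_borelD(1)[OF assms(1)] bounded_borelD(1)[OF assms(2)]
  have "(\<lambda>x. f x * g x) \<in> borel_measurable borel" by measurable
  moreover have "\<bar>f x * g x\<bar> \<le> A * B" for x
    using bounded_borelD(2,3)[OF assms(1)] bounded_borelD(2,3)[OF assms(2)] unfolding abs_mult
    by (intro mult_mono) auto
  ultimately show ?thesis unfolding bounded_borel_def by blast
qed

lemma bounded_borel_diff:
  assumes "bounded_borel A f" "bounded_borel B g" shows "bounded_borel (A + B) (\<lambda>x. f x - g x)"
proof -
  note [measurable] = bounded_borelD(1)[OF assms(1)] bounded_borelD(1)[OF assms(2)]
  have "(\<lambda>x. f x - g x) \<in> borel_measurable borel" by measurable
  moreover have "\<bar>f x - g x\<bar> \<le> A + B" for x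
    using bounded_borelD(2)[OF assms(1), of x] bounded_borelD(2)[OF assms(2), of x] by linarith
  ultimately show ?thesis unfolding bounded_borel_def by blast
qed

lemma bounded_borel_mono: "bounded_borel A f \<Longrightarrow> A \<le> B \<Longrightarrow> bounded_borel B f"
  unfolding bounded_borel_def by (meson order_trans)

lemma bounded_borel_fdiff:
  assumes "bounded_borel B f" shows "bounded_borel (2 * B) (fdiff h f)"
  using bounded_borel_diff[OF bounded_borel_shift[OF assms, of h] assms] by (simp add: fdiff_def)

lemma bounded_borel_fdiff_funpow:
  assumes "bounded_borel B f" shows "bounded_borel (2 ^ m * B) ((fdiff h ^^ m) f)"
proof (induction m)
  case 0 then show ?case using assms by simp
next
  case (Suc m)
  show ?case using bounded_borel_fdiff[OF Suc, of h] by (simp add: mult.assoc)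
qed

lemma heat_fdiff_funpow:
  assumes "0 < t" "bounded_borel B f"
  shows "heat t ((fdiff h ^^ m) f) = (fdiff h ^^ m) (heat t f)"
proof (induction m)
  case (Suc m)
  note b = bounded_borel_fdiff_funpow[OF assms(2), where m = m and h = h]
  have "heat t (fdiff h ((fdiff h ^^ m) f)) x = fdiff h (heat t ((fdiff h ^^ m) f)) x" for x
    unfolding fdiff_def[of h "(fdiff h ^^ m) f"]
    by (subst heat_diff[OF assms(1) bounded_borel_shift[OF b] b]) (simp add: heat_shift fdiff_def)
  then show ?case by (simp add: Suc fun_eq_iff)
qed simp

lemma dheat_fdiff_funpow:
  assumes "0 < t" "bounded_borel B f"
  shows "dheat t v ((fdiff h ^^ m) f) = (fdiff h ^^ m) (dheat t v f)"
proof (induction m)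
  case (Suc m)
  note b = bounded_borel_fdiff_funpow[OF assms(2), where m = m and h = h]
  have "dheat t v (fdiff h ((fdiff h ^^ m) f)) x = fdiff h (dheat t v ((fdiff h ^^ m) f)) x" for x
    unfolding fdiff_def[of h "(fdiff h ^^ m) f"]
    by (subst dheat_diff[OF assms(1) bounded_borel_shift[OF b] b]) (simp add: dheat_shift fdiff_def)
  then show ?case by (simp add: Suc fun_eq_iff)
qed simp

text \<open>Used as an interpolation: a bound free of the step length and one linear in it combine
  to one with its square root, and the singularities in time are averaged in the same way.\<close>

lemma geometric_mean_bound:
  fixes x a b :: real
  assumes "0 \<le> x" "x \<le> a" "x \<le> b"
  shows "x \<le> sqrt (a * b)"
  using assms by (intro real_le_rsqrt) (auto simp: power2_eq_square intro!: mult_mono)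

text \<open>On the standard Gaussian the small variance becomes a factor
  \<open>sqrt (\<delta> n)\<close> in the argument, and dominated convergence applies.\<close>

lemma heat_tendsto_id:
  fixes f :: "'a::euclidean_space \<Rightarrow> real"
  assumes f: "bounded_borel B f" and cont: "continuous_on UNIV f"
    and \<delta>: "\<And>n. 0 < \<delta> n" "\<delta> \<longlonglongrightarrow> 0"
  shows "(\<lambda>n. heat (\<delta> n) f x) \<longlonglongrightarrow> f x"
proof -
  note [measurable] = bounded_borelD(1)[OF f]
  have eq: "heat (\<delta> n) f x = (\<integral>z. f (x + sqrt (\<delta> n) *\<^sub>R z) \<partial>gauss 1)" for n
  proof -
    note p = \<delta>(1)[of n]
    show ?thesis
      unfolding heat_def gauss_scale[OF p] by (subst integral_distr) simp_all
  qed
  have "(\<lambda>n. \<integral>z. f (x + sqrt (\<delta> n) *\<^sub>R z) \<partial>gauss 1) \<longlonglongrightarrow> (\<integral>(z::'a). f x \<partial>gauss 1)"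
  proof (rule integral_dominated_convergence[where w="\<lambda>_. B"])
    show "AE z in gauss 1. (\<lambda>n. f (x + sqrt (\<delta> n) *\<^sub>R z)) \<longlonglongrightarrow> f x"
    proof (rule AE_I2)
      fix z :: 'a
      have "(\<lambda>n. sqrt (\<delta> n)) \<longlonglongrightarrow> sqrt 0"
        by (intro tendsto_real_sqrt \<delta>(2))
      then have "(\<lambda>n. x + sqrt (\<delta> n) *\<^sub>R z) \<longlonglongrightarrow> x + sqrt 0 *\<^sub>R z"
        by (intro tendsto_add tendsto_scaleR tendsto_const)
      then have "(\<lambda>n. x + sqrt (\<delta> n) *\<^sub>R z) \<longlonglongrightarrow> x" by (simp only: real_sqrt_zero scaleR_zero_left add_0_right)
      moreover have "isCont f x" using cont by (simp only: continuous_on_eq_continuous_at[OF open_UNIV] UNIV_I)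
      ultimately show "(\<lambda>n. f (x + sqrt (\<delta> n) *\<^sub>R z)) \<longlonglongrightarrow> f x"
        by (rule isCont_tendsto_compose[rotated])
    qed
    show "integrable (gauss 1) (\<lambda>z::'a. B)"
      using bounded_borelD(3)[OF f] by (intro integrable_gauss_bounded[of _ _ B]) auto
    show "AE z in gauss 1. norm (f (x + sqrt (\<delta> n) *\<^sub>R z)) \<le> B" for n
      using bounded_borelD(2)[OF f] by auto
  qed auto
  also have "(\<integral>(z::'a). f x \<partial>gauss 1) = f x" by simp
  finally show ?thesis unfolding eq .
qed

section \<open>Approximation by continuous functions\<close>

text \<open>The tents \<open>1 - (n + 1) * infdist x K\<close>, cut off at zero. The last two
  clauses confine the supports to the unit neighbourhood of \<open>K\<close>; the empty set is
  treated apart because \<open>infdist\<close> to it is zero by convention.\<close>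

lemma closed_indicator_approx:
  fixes K :: "'a::euclidean_space set"
  assumes "closed K"
  obtains f :: "nat \<Rightarrow> 'a \<Rightarrow> real"
  where "\<And>n. continuous_on UNIV (f n)" "\<And>n x. 0 \<le> f n x" "\<And>n x. f n x \<le> 1"
    "\<And>x. (\<lambda>n. f n x) \<longlonglongrightarrow> indicator K x" "\<And>n x. x \<in> K \<Longrightarrow> f n x = 1"
    "\<And>n x. K \<noteq> {} \<Longrightarrow> f n x \<noteq> 0 \<Longrightarrow> infdist x K \<le> 1" "\<And>n. K = {} \<Longrightarrow> f n x = 0"
proof (cases "K = {}")
  case True
  show ?thesis by (rule that[of "\<lambda>_ _. 0"]) (auto simp: True)
next
  case False
  define f where "f = (\<lambda>(n::nat) x. max 0 (1 - real (Suc n) * infdist x K))"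
  show ?thesis
  proof (rule that[of f])
    show "continuous_on UNIV (f n)" for n
      unfolding f_def by (intro continuous_intros continuous_on_infdist)
    show "0 \<le> f n x" "f n x \<le> 1" for n x
      using infdist_nonneg[of x K] by (auto simp: f_def)
    show "(\<lambda>n. f n x) \<longlonglongrightarrow> indicator K x" for x
    proof (cases "x \<in> K")
      case True then show ?thesis by (simp add: f_def)
    next
      case x: False
      then have pos: "0 < infdist x K"
        using assms False infdist_nonneg[of x K] in_closed_iff_infdist_zero[of K x] by (auto simp: less_le)
      obtain N :: nat where N: "1 / infdist x K < N" using reals_Archimedean2 by blast
      have "f n x = 0" if "N \<le> n" for n
      proof -
        have "1 < real N * infdist x K" using N pos by (simp add: field_simps)
        also have "\<dots> \<le> real (Suc n) * infdist x K" using that pos by (intro mult_right_mono) auto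
        finally show ?thesis by (simp add: f_def)
      qed
      then have "eventually (\<lambda>n. f n x = indicator K x) sequentially"
        using x by (auto simp: eventually_sequentially)
      then show ?thesis by (rule tendsto_eventually)
    qed
    show "f n x = 1" if "x \<in> K" for n x using that by (simp add: f_def)
    show "infdist x K \<le> 1" if "f n x \<noteq> 0" for n x
    proof -
      have "real (Suc n) * infdist x K < 1" using that by (auto simp: f_def max_def split: if_splits)
      moreover have "1 * infdist x K \<le> real (Suc n) * infdist x K"
        using infdist_nonneg[of x K] by (intro mult_right_mono) auto
      ultimately show ?thesis by linarith
    qed
  qed (use False in auto)
qed

text \<open>For an indicator, inner regularity of the finite Borel measure gives a compact subset of
  almost full measure, and tents approximate its indicator. Sums and dominated limits are handled by
  \<open>integrable_induct\<close>.\<close>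

lemma integrable_continuous_approx:
  fixes f :: "'a::euclidean_space \<Rightarrow> real"
  assumes "finite_measure N" and sets_N: "sets N = sets borel" and f: "integrable N f" and e: "0 < e"
  shows "\<exists>g. continuous_on UNIV g \<and> integrable N g \<and> (\<integral>x. \<bar>f x - g x\<bar> \<partial>N) < e"
proof -
  interpret finite_measure N by fact
  have [simp]: "space N = UNIV" using sets_N by (metis sets_eq_imp_space_eq space_borel)
  have contm: "g \<in> borel_measurable N" if "continuous_on UNIV g" for g :: "'a \<Rightarrow> real"
    using borel_measurable_continuous_onI[OF that] by (simp add: measurable_cong_sets[OF sets_N refl])
  show ?thesis using f e
  proof (induction f arbitrary: e rule: integrable_induct)
    case (base A c)
    have "\<exists>g. continuous_on UNIV g \<and> (\<forall>x. \<bar>g x\<bar> \<le> 1) \<and> (\<integral>x. \<bar>indicator A x - g x\<bar> \<partial>N) < d" if "0 < d" for d :: real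
    proof -
      have A: "A \<in> sets borel" using base sets_N by auto
      have "emeasure N A = (SUP K \<in> {K. K \<subseteq> A \<and> compact K}. emeasure N K)"
        by (rule inner_regular[OF sets_N _ A]) simp
      then have "\<exists>K. K \<subseteq> A \<and> compact K \<and> measure N A - measure N K < d / 2" 
      proof -
        assume sup: "emeasure N A = (SUP K \<in> {K. K \<subseteq> A \<and> compact K}. emeasure N K)"
        show ?thesis
        proof (cases "measure N A < d/2")
          case True then show ?thesis by (intro exI[of _ "{}"]) auto
        next
          case False
          have "ennreal (measure N A - d/2) < emeasure N A"
            unfolding emeasure_eq_measure using False \<open>0 < d\<close> by (intro ennreal_lessI) auto
          then obtain K where "K \<subseteq> A" "compact K" "ennreal (measure N A - d/2) < emeasure N K"
            unfolding sup less_SUP_iff by auto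
          then show ?thesis
            unfolding emeasure_eq_measure using False by (intro exI[of _ K]) (auto simp: ennreal_less_iff)
        qed
      qed
      then obtain K where K: "K \<subseteq> A" "compact K" "measure N A - measure N K < d / 2" by auto
      have KN[measurable]: "K \<in> sets N" "A \<in> sets N" using K sets_N A by (auto simp: compact_imp_closed)
      obtain f :: "nat \<Rightarrow> 'a \<Rightarrow> real" where g: "\<And>n. continuous_on UNIV (f n)" "\<And>n x. 0 \<le> f n x" "\<And>n x. f n x \<le> 1"
          "\<And>x. (\<lambda>n. f n x) \<longlonglongrightarrow> indicator K x"
        using closed_indicator_approx[OF compact_imp_closed[OF K(2)]] by metis
      note [measurable] = contm[OF g(1)]
      have "(\<lambda>n. \<integral>x. \<bar>indicator A x - f n x\<bar> \<partial>N) \<longlonglongrightarrow> (\<integral>x. \<bar>indicator A x - indicator K x\<bar> \<partial>N)"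
      proof (rule integral_dominated_convergence[where w="\<lambda>_. 2"])
        show "AE x in N. (\<lambda>n. \<bar>indicator A x - f n x\<bar>) \<longlonglongrightarrow> \<bar>indicator A x - indicator K x\<bar>"
          by (intro AE_I2 tendsto_intros g)
        show "AE x in N. norm \<bar>indicator A x - f n x\<bar> \<le> 2" for n
        proof (rule AE_I2)
          fix x show "norm \<bar>indicator A x - f n x\<bar> \<le> 2"
            using g(2)[of n x] g(3)[of n x] by (cases "x \<in> A") (simp_all add: abs_le_iff)
        qed
      qed auto
      moreover have "(\<integral>x. \<bar>indicator A x - indicator K x\<bar> \<partial>N) = (\<integral>x. (indicator (A - K) x::real) \<partial>N)"
        using K(1) by (intro Bochner_Integration.integral_cong) (auto simp: indicator_def)
      moreover have "\<dots> < d"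
        using K base \<open>0 < d\<close> by (simp add: finite_measure_Diff)
      ultimately have "eventually (\<lambda>n. (\<integral>x. \<bar>indicator A x - f n x\<bar> \<partial>N) < d) sequentially"
        by (intro order_tendstoD(2)) auto
      then obtain n where "(\<integral>x. \<bar>indicator A x - f n x\<bar> \<partial>N) < d"
        by (auto simp: eventually_sequentially)
      then show ?thesis using g(1-3)[of n] by (intro exI[of _ "f n"]) (auto simp: abs_le_iff intro: order_trans)
    qed
    from this[of "e / (\<bar>c\<bar> + 1)"] base obtain g where g: "continuous_on UNIV g" "\<And>x. \<bar>g x\<bar> \<le> 1"
        "(\<integral>x. \<bar>indicator A x - g x\<bar> \<partial>N) < e / (\<bar>c\<bar> + 1)" by (auto simp: field_simps)
    have gi: "integrable N g"
      using g(2) by (intro integrable_const_bound[of _ 1] contm g(1)) auto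
    have "(\<integral>x. \<bar>indicator A x *\<^sub>R c - g x * c\<bar> \<partial>N) = \<bar>c\<bar> * (\<integral>x. \<bar>indicator A x - g x\<bar> \<partial>N)"
      by (subst integral_mult_right_zero[symmetric]) (simp add: abs_mult[symmetric] algebra_simps)
    also have "\<dots> \<le> \<bar>c\<bar> * (e / (\<bar>c\<bar> + 1))" using g(3) by (intro mult_left_mono) auto
    also have "\<dots> < e" using base by (simp add: field_simps)
    finally show ?case using g(1) gi by (intro exI[of _ "\<lambda>x. g x * c"]) (auto intro!: continuous_intros)
  next
    case (add f g)
    obtain f' where f': "continuous_on UNIV f'" "integrable N f'" "(\<integral>x. \<bar>f x - f' x\<bar> \<partial>N) < e / 2"
      using add.IH(1)[of "e/2"] add.prems by auto
    obtain g' where g': "continuous_on UNIV g'" "integrable N g'" "(\<integral>x. \<bar>g x - g' x\<bar> \<partial>N) < e / 2"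
      using add.IH(2)[of "e/2"] add.prems by auto
    have "(\<integral>x. \<bar>f x + g x - (f' x + g' x)\<bar> \<partial>N) \<le> (\<integral>x. \<bar>f x - f' x\<bar> + \<bar>g x - g' x\<bar> \<partial>N)"
      using add.hyps f' g' by (intro integral_mono) auto
    also have "\<dots> < e" using add.hyps f' g' by (subst Bochner_Integration.integral_add) auto
    finally show ?case using f' g' by (intro exI[of _ "\<lambda>x. f' x + g' x"]) (auto intro!: continuous_intros)
  next
    case (lim f s)
    have "(\<lambda>i. \<integral>x. \<bar>f x - s i x\<bar> \<partial>N) \<longlonglongrightarrow> (\<integral>x. \<bar>f x - f x\<bar> \<partial>N)"
    proof (rule integral_dominated_convergence[where w="\<lambda>x. 3 * \<bar>f x\<bar>"])
      show "AE x in N. (\<lambda>i. \<bar>f x - s i x\<bar>) \<longlonglongrightarrow> \<bar>f x - f x\<bar>"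
        using lim by (intro AE_I2 tendsto_intros) auto
      show "AE x in N. norm \<bar>f x - s i x\<bar> \<le> 3 * \<bar>f x\<bar>" for i
      proof (rule AE_I2)
        fix x
        have "norm (s i x) \<le> 2 * norm (f x)" by (rule lim.hyps(3)) simp
        then show "norm \<bar>f x - s i x\<bar> \<le> 3 * \<bar>f x\<bar>" using abs_triangle_ineq4[of "f x" "s i x"] by simp
      qed
    qed (use lim.hyps in auto)
    then have "eventually (\<lambda>i. (\<integral>x. \<bar>f x - s i x\<bar> \<partial>N) < e / 2) sequentially"
      using lim.prems by (intro order_tendstoD(2)) auto
    then obtain i where i: "(\<integral>x. \<bar>f x - s i x\<bar> \<partial>N) < e / 2" by (auto simp: eventually_sequentially)
    obtain g where g: "continuous_on UNIV g" "integrable N g" "(\<integral>x. \<bar>s i x - g x\<bar> \<partial>N) < e / 2"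
      using lim.IH[of "e/2" i] lim.prems by auto
    have "(\<integral>x. \<bar>f x - g x\<bar> \<partial>N) \<le> (\<integral>x. \<bar>f x - s i x\<bar> + \<bar>s i x - g x\<bar> \<partial>N)"
      using lim.hyps g by (intro integral_mono) auto
    also have "\<dots> < e" using lim.hyps g i by (subst Bochner_Integration.integral_add) auto
    finally show ?case using g by auto
  qed
qed

text \<open>Cutting the approximant off at \<open>- B\<close> and \<open>B\<close> keeps it
  continuous and can only bring it closer to \<open>f\<close>, whose values lie in that
  interval.\<close>

lemma bounded_borel_continuous_approx:
  fixes f :: "'a::euclidean_space \<Rightarrow> real"
  assumes "finite_measure N" and sets_N: "sets N = sets borel" and f: "bounded_borel B f" and e: "0 < e"
  shows "\<exists>g. continuous_on UNIV g \<and> bounded_borel B g \<and> (\<integral>x. \<bar>f x - g x\<bar> \<partial>N) < e"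
proof -
  interpret finite_measure N by fact
  have fm[measurable]: "f \<in> borel_measurable N"
    using bounded_borelD(1)[OF f] by (simp add: measurable_cong_sets[OF sets_N refl])
  have fi: "integrable N f"
    using bounded_borelD(2)[OF f] by (intro integrable_const_bound[of _ B]) auto
  obtain g where g: "continuous_on UNIV g" "integrable N g" "(\<integral>x. \<bar>f x - g x\<bar> \<partial>N) < e"
    using integrable_continuous_approx[OF assms(1) sets_N fi e] by auto
  note B = bounded_borelD(3)[OF f]
  define g' where "g' = (\<lambda>x. max (- B) (min B (g x)))"
  have c: "continuous_on UNIV g'" unfolding g'_def by (intro continuous_intros g)
  have b: "bounded_borel B g'"
    using borel_measurable_continuous_onI[OF c] B by (auto simp: bounded_borel_def g'_def abs_le_iff)
  have gm: "g' \<in> borel_measurable N"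
    using bounded_borelD(1)[OF b] by (simp add: measurable_cong_sets[OF sets_N refl])
  have "(\<integral>x. \<bar>f x - g' x\<bar> \<partial>N) \<le> (\<integral>x. \<bar>f x - g x\<bar> \<partial>N)"
  proof (rule integral_mono)
    show "integrable N (\<lambda>x. \<bar>f x - g' x\<bar>)"
      using fi gm bounded_borelD(2)[OF b] by (intro integrable_abs Bochner_Integration.integrable_diff integrable_const_bound[of g' B]) auto
    show "\<bar>f x - g' x\<bar> \<le> \<bar>f x - g x\<bar>" for x
      using bounded_borelD(2)[OF f, of x] unfolding g'_def by (auto simp: max_def min_def abs_if split: if_splits)
  qed (use fi g in auto)
  with c b g(3) show ?thesis by (intro exI[of _ g']) auto
qed

section \<open>Absolute continuity of mean-field laws\<close>

lemma dheat_measurable_joint3: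
  fixes f :: "'a::euclidean_space \<Rightarrow> real"
  assumes [measurable]: "f \<in> borel_measurable borel"
    and [measurable]: "a \<in> borel_measurable N" "v \<in> borel_measurable N" "x \<in> borel_measurable N"
  shows "(\<lambda>p. dheat (a p) (v p) f (x p)) \<in> borel_measurable N"
proof -
  have [measurable]: "(\<lambda>p. gauss_density (a (fst p)) (snd p) :: real) \<in> borel_measurable (N \<Otimes>\<^sub>M (lborel :: 'a measure))"
    unfolding gauss_density_def normal_density_def by measurable
  have "(\<lambda>p. dheat (a p) (v p) f (x p)) = (\<lambda>p. \<integral>z. gauss_density (a p) z * (f (x p + z) * (z \<bullet> v p / a p)) \<partial>lborel)"
    unfolding dheat_def by (subst integral_gauss) auto
  also have "\<dots> \<in> borel_measurable N"
    by measurable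
  finally show ?thesis .
qed

lemma (in prob_space) integrable_bounded_borel:
  fixes f :: "'b::euclidean_space \<Rightarrow> real"
  assumes "bounded_borel B f" "x \<in> borel_measurable M"
  shows "integrable M (\<lambda>\<omega>. f (x \<omega>))"
  using bounded_borelD[OF assms(1)] assms(2) by (intro integrable_const_bound[of _ B]) auto

lemma (in prob_space) expectation_abs_le:
  fixes f :: "'a \<Rightarrow> real"
  assumes "f \<in> borel_measurable M" "\<And>\<omega>. \<omega> \<in> space M \<Longrightarrow> \<bar>f \<omega>\<bar> \<le> B"
  shows "\<bar>\<integral>\<omega>. f \<omega> \<partial>M\<bar> \<le> B"
proof -
  have "integrable M f" using assms by (intro integrable_const_bound[of _ B]) auto
  then have "\<bar>\<integral>\<omega>. f \<omega> \<partial>M\<bar> \<le> (\<integral>\<omega>. \<bar>f \<omega>\<bar> \<partial>M)" "(\<integral>\<omega>. \<bar>f \<omega>\<bar> \<partial>M) \<le> B"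
    using assms(2) by (auto intro!: integral_abs_bound integral_le_const)
  then show ?thesis by linarith
qed

text \<open>The situation once the coefficient has been replaced by a field \<open>c\<close> bounded
  at every point. The function \<open>drift t\<close> below is the convolution of \<open>c t\<close>
  with the law of \<open>Y t\<close>, and \<open>acc\<close> is the part of \<open>Y\<close> of
  bounded variation.\<close>

locale mean_field_paths = prob_space M for M :: "'w measure" +
  fixes Y :: "real \<Rightarrow> 'w \<Rightarrow> 'a::euclidean_space" and c :: "real \<Rightarrow> 'a \<Rightarrow> 'a" and \<beta> :: real
  assumes Y_joint[measurable]: "(\<lambda>p. Y (fst p) (snd p)) \<in> borel_measurable (borel \<Otimes>\<^sub>M M)"
    and c_joint[measurable]: "(\<lambda>p. c (fst p) (snd p)) \<in> borel_measurable (borel \<Otimes>\<^sub>M borel)"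
    and c_bound: "\<And>t x. norm (c t x) \<le> \<beta>"
begin

definition drift :: "real \<Rightarrow> 'a \<Rightarrow> 'a" where
  "drift t x = (\<integral>\<omega>. c t (x - Y t \<omega>) \<partial>M)"

definition acc :: "real \<Rightarrow> 'w \<Rightarrow> 'a" where
  "acc t \<omega> = (LINT s:{0..t}|lborel. drift s (Y s \<omega>))"

lemma \<beta>_nonneg: "0 \<le> \<beta>"
  using order_trans[OF norm_ge_zero c_bound] .

lemma Y_measurable[measurable]: "Y t \<in> borel_measurable M"
  using measurable_compose[OF _ Y_joint, of "\<lambda>\<omega>. (t, \<omega>)" M] by simp

lemma drift_joint[measurable]: "(\<lambda>p. drift (fst p) (snd p)) \<in> borel_measurable (borel \<Otimes>\<^sub>M borel)"
proof -
  have 1: "(\<lambda>q. Y (fst (fst q)) (snd q)) \<in> borel_measurable ((borel \<Otimes>\<^sub>M (borel :: 'a measure)) \<Otimes>\<^sub>M M)"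
    using measurable_compose[OF _ Y_joint, of "\<lambda>q. (fst (fst q), snd q)" "(borel \<Otimes>\<^sub>M (borel :: 'a measure)) \<Otimes>\<^sub>M M"] by simp
  have "(\<lambda>q. c (fst (fst q)) (snd (fst q) - Y (fst (fst q)) (snd q))) \<in> borel_measurable ((borel \<Otimes>\<^sub>M borel) \<Otimes>\<^sub>M M)"
    using measurable_compose[OF _ c_joint, of "\<lambda>q. (fst (fst q), snd (fst q) - Y (fst (fst q)) (snd q))" "(borel \<Otimes>\<^sub>M borel) \<Otimes>\<^sub>M M"] 1
    by simp
  then show ?thesis
    unfolding drift_def by (intro borel_measurable_lebesgue_integral) (simp add: case_prod_beta')
qed

lemma drift_bound: "norm (drift t x) \<le> \<beta>"
proof -
  have [measurable]: "(\<lambda>\<omega>. c t (x - Y t \<omega>)) \<in> borel_measurable M"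
    using measurable_compose[OF _ c_joint, of "\<lambda>\<omega>. (t, x - Y t \<omega>)" M] by simp
  have int: "integrable M (\<lambda>\<omega>. norm (c t (x - Y t \<omega>)))"
    using c_bound by (intro integrable_const_bound[of _ \<beta>]) auto
  have "norm (drift t x) \<le> (\<integral>\<omega>. norm (c t (x - Y t \<omega>)) \<partial>M)"
    unfolding drift_def by (rule integral_norm_bound)
  also have "\<dots> \<le> \<beta>"
    using c_bound by (intro integral_le_const int) auto
  finally show ?thesis .
qed

lemma drift_path_joint[measurable]: "(\<lambda>p. drift (fst p) (Y (fst p) (snd p))) \<in> borel_measurable (borel \<Otimes>\<^sub>M M)"
  using measurable_compose[OF _ drift_joint, of "\<lambda>p. (fst p, Y (fst p) (snd p))" "borel \<Otimes>\<^sub>M M"] by simp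

lemma drift_path_measurable[measurable]:
  "\<omega> \<in> space M \<Longrightarrow> (\<lambda>s. drift s (Y s \<omega>)) \<in> borel_measurable borel"
  using measurable_compose[OF _ drift_path_joint, of "\<lambda>s. (s, \<omega>)" borel] by simp

lemma drift_path_set_integrable:
  assumes "\<omega> \<in> space M"
  shows "set_integrable lborel {s<..u} (\<lambda>r. drift r (Y r \<omega>))" "set_integrable lborel {s..u} (\<lambda>r. drift r (Y r \<omega>))"
proof -
  show "set_integrable lborel {s..u} (\<lambda>r. drift r (Y r \<omega>))"
    unfolding set_integrable_def
  proof (rule integrableI_bounded_set[where A="{s..u}" and B=\<beta>])
    show "emeasure lborel {s..u} < \<infinity>" by (cases "s \<le> u") auto
  qed (use drift_bound assms in auto)
  then show "set_integrable lborel {s<..u} (\<lambda>r. drift r (Y r \<omega>))"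
    by (rule set_integrable_subset) auto
qed

lemma acc_diff:
  assumes "\<omega> \<in> space M" "0 \<le> s" "s \<le> u"
  shows "acc u \<omega> - acc s \<omega> = (LINT r:{s<..u}|lborel. drift r (Y r \<omega>))"
proof -
  have "{0..u} = {0..s} \<union> {s<..u}" "{0..s} \<inter> {s<..u} = {}" using assms by auto
  then have "acc u \<omega> = acc s \<omega> + (LINT r:{s<..u}|lborel. drift r (Y r \<omega>))"
    unfolding acc_def using drift_path_set_integrable[OF assms(1)] by (simp add: set_integral_Un)
  then show ?thesis by simp
qed

lemma acc_diff_bound:
  assumes "\<omega> \<in> space M" "0 \<le> s" "s \<le> u"
  shows "norm (acc u \<omega> - acc s \<omega>) \<le> \<beta> * (u - s)"
proof -
  have "norm (acc u \<omega> - acc s \<omega>) \<le> (LINT r:{s<..u}|lborel. norm (drift r (Y r \<omega>)))"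
    unfolding acc_diff[OF assms] by (rule set_integral_norm_bound) (rule drift_path_set_integrable[OF assms(1)])
  also have "\<dots> \<le> (LINT r:{s<..u}|lborel. \<beta>)"
    using drift_bound drift_path_set_integrable(1)[OF assms(1), of s u]
    by (intro set_integral_mono set_integrable_norm) (use assms in \<open>auto simp: set_integrable_def\<close>)
  also have "\<dots> = \<beta> * (u - s)" using assms by (simp add: set_lebesgue_integral_def)
  finally show ?thesis .
qed

lemma acc_measurable[measurable]: "acc t \<in> borel_measurable M"
proof -
  have "(\<lambda>q. drift (snd q) (Y (snd q) (fst q))) \<in> borel_measurable (M \<Otimes>\<^sub>M (lborel :: real measure))"
    using measurable_compose[OF _ drift_path_joint, of "\<lambda>q. (snd q, fst q)" "M \<Otimes>\<^sub>M (lborel :: real measure)"] by simp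
  then have "(\<lambda>\<omega>. \<integral>s. indicator {0..t} s *\<^sub>R drift s (Y s \<omega>) \<partial>lborel) \<in> borel_measurable M"
    by (intro lborel.borel_measurable_lebesgue_integral) (simp add: case_prod_beta')
  then show ?thesis
    unfolding acc_def[abs_def] set_lebesgue_integral_def .
qed

lemma expectation_set_integral_swap:
  fixes g :: "real \<Rightarrow> 'w \<Rightarrow> real"
  assumes g[measurable]: "(\<lambda>p. g (fst p) (snd p)) \<in> borel_measurable (borel \<Otimes>\<^sub>M M)"
    and bd: "\<And>\<tau> \<omega>. \<tau> \<in> {s<..u} \<Longrightarrow> \<omega> \<in> space M \<Longrightarrow> \<bar>g \<tau> \<omega>\<bar> \<le> K"
  shows "(\<integral>\<omega>. (LINT \<tau>:{s<..u}|lborel. g \<tau> \<omega>) \<partial>M) = (LINT \<tau>:{s<..u}|lborel. (\<integral>\<omega>. g \<tau> \<omega> \<partial>M))"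
    and "set_integrable lborel {s<..u} (\<lambda>\<tau>. \<integral>\<omega>. g \<tau> \<omega> \<partial>M)"
    and "integrable M (\<lambda>\<omega>. LINT \<tau>:{s<..u}|lborel. g \<tau> \<omega>)"
proof -
  interpret P: pair_sigma_finite "lborel :: real measure" M ..
  have int: "integrable (lborel \<Otimes>\<^sub>M M) (\<lambda>(\<tau>, \<omega>). indicator {s<..u} \<tau> *\<^sub>R g \<tau> \<omega>)"
  proof (rule integrableI_bounded_set[where A="{s<..u} \<times> space M" and B=K])
    show "(\<lambda>(\<tau>, \<omega>). indicator {s<..u} \<tau> *\<^sub>R g \<tau> \<omega>) \<in> borel_measurable (lborel \<Otimes>\<^sub>M M)"
      using g by (simp add: case_prod_beta' measurable_cong_sets[OF sets_pair_measure_cong[OF sets_lborel refl] refl])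
    have "emeasure (lborel \<Otimes>\<^sub>M M) ({s<..u} \<times> space M) = emeasure lborel {s<..u} * emeasure M (space M)"
      by (rule emeasure_pair_measure_Times) auto
    also have "\<dots> < \<infinity>" by (cases "s \<le> u") (auto simp: emeasure_space_1)
    finally show "emeasure (lborel \<Otimes>\<^sub>M M) ({s<..u} \<times> space M) < \<infinity>" .
    show "AE p in lborel \<Otimes>\<^sub>M M. p \<in> {s<..u} \<times> space M \<longrightarrow> norm (case p of (\<tau>, \<omega>) \<Rightarrow> indicator {s<..u} \<tau> *\<^sub>R g \<tau> \<omega>) \<le> K"
      using bd by (intro AE_I2) auto
    show "AE p in lborel \<Otimes>\<^sub>M M. p \<notin> {s<..u} \<times> space M \<longrightarrow> (case p of (\<tau>, \<omega>) \<Rightarrow> indicator {s<..u} \<tau> *\<^sub>R g \<tau> \<omega>) = 0"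
      by (intro AE_I2) (auto simp: space_pair_measure indicator_def)
  qed auto
  show "(\<integral>\<omega>. (LINT \<tau>:{s<..u}|lborel. g \<tau> \<omega>) \<partial>M) = (LINT \<tau>:{s<..u}|lborel. (\<integral>\<omega>. g \<tau> \<omega> \<partial>M))"
    unfolding set_lebesgue_integral_def using P.Fubini_integral[OF int] by simp
  show "set_integrable lborel {s<..u} (\<lambda>\<tau>. \<integral>\<omega>. g \<tau> \<omega> \<partial>M)"
    unfolding set_integrable_def using P.integrable_fst'[OF int] by simp
  show "integrable M (\<lambda>\<omega>. LINT \<tau>:{s<..u}|lborel. g \<tau> \<omega>)"
    unfolding set_lebesgue_integral_def using P.integrable_snd[OF int] by simp
qed

end

text \<open>What is retained of the Brownian motion: the increment of \<open>Y - acc\<close> after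
  time \<open>s\<close> is Gaussian and independent of \<open>Y s\<close>.\<close>

locale mean_field = mean_field_paths M Y c \<beta>
  for M :: "'w measure" and Y :: "real \<Rightarrow> 'w \<Rightarrow> 'a::euclidean_space" and c :: "real \<Rightarrow> 'a \<Rightarrow> 'a" and \<beta> :: real +
  assumes increments: "\<And>s t. 0 \<le> s \<Longrightarrow> s < t \<Longrightarrow>
     distr M (borel \<Otimes>\<^sub>M borel) (\<lambda>\<omega>. (Y s \<omega>, Y t \<omega> - Y s \<omega> - (acc t \<omega> - acc s \<omega>)))
       = distr M borel (Y s) \<Otimes>\<^sub>M gauss (t - s)"
begin

text \<open>Without the displacement by the drift, \<open>Y t\<close> is \<open>Y s\<close> plus an
  independent Gaussian; integrating that Gaussian out yields the heat semigroup.\<close>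

lemma expectation_step:
  assumes st: "0 \<le> s" "s < t" and f: "bounded_borel B f"
  shows "(\<integral>\<omega>. f (Y t \<omega> - (acc t \<omega> - acc s \<omega>)) \<partial>M) = (\<integral>\<omega>. heat (t - s) f (Y s \<omega>) \<partial>M)"
proof -
  note [measurable] = bounded_borelD(1)[OF f]
  interpret D: prob_space "distr M borel (Y s)" by (rule prob_space_distr) simp
  interpret G: prob_space "gauss (t - s) :: 'a measure" using st by (intro prob_space_gauss) simp
  interpret DG: pair_prob_space "distr M borel (Y s)" "gauss (t - s) :: 'a measure" ..
  have "(\<integral>\<omega>. f (Y t \<omega> - (acc t \<omega> - acc s \<omega>)) \<partial>M)
      = (\<integral>p. f (fst p + snd p) \<partial>distr M (borel \<Otimes>\<^sub>M borel) (\<lambda>\<omega>. (Y s \<omega>, Y t \<omega> - Y s \<omega> - (acc t \<omega> - acc s \<omega>))))"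
    by (subst integral_distr) (auto simp: algebra_simps)
  also have "\<dots> = (\<integral>p. f (fst p + snd p) \<partial>(distr M borel (Y s) \<Otimes>\<^sub>M gauss (t - s)))"
    unfolding increments[OF st] ..
  also have "\<dots> = (\<integral>x. \<integral>z. f (x + z) \<partial>gauss (t - s) \<partial>distr M borel (Y s))"
    using bounded_borelD[OF f] by (subst DG.integral_fst'[symmetric]) (auto intro!: DG.integrable_const_bound[of _ B])
  also have "\<dots> = (\<integral>\<omega>. heat (t - s) f (Y s \<omega>) \<partial>M)"
    unfolding heat_def by (subst integral_distr) auto
  finally show ?thesis .
qed

lemma increment_law:
  assumes st: "0 \<le> s" "s < t"
  shows "distr M borel (\<lambda>\<omega>. Y t \<omega> - Y s \<omega> - (acc t \<omega> - acc s \<omega>)) = gauss (t - s)"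
proof -
  interpret D: prob_space "distr M borel (Y s)" by (rule prob_space_distr) simp
  interpret G: prob_space "gauss (t - s) :: 'a measure" using st by (intro prob_space_gauss) simp
  have "distr M borel (\<lambda>\<omega>. Y t \<omega> - Y s \<omega> - (acc t \<omega> - acc s \<omega>))
     = distr (distr M (borel \<Otimes>\<^sub>M borel) (\<lambda>\<omega>. (Y s \<omega>, Y t \<omega> - Y s \<omega> - (acc t \<omega> - acc s \<omega>)))) borel snd"
    by (subst distr_distr) (auto simp: o_def)
  also have "\<dots> = distr (distr M borel (Y s) \<Otimes>\<^sub>M gauss (t - s)) (gauss (t - s)) snd"
    unfolding increments[OF st] by (rule distr_cong) auto
  also have "\<dots> = gauss (t - s)"
  proof (rule measure_eqI)
    fix A :: "'a set" assume "A \<in> sets (distr (distr M borel (Y s) \<Otimes>\<^sub>M gauss (t - s)) (gauss (t - s)) snd)"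
    then have A: "A \<in> sets (gauss (t - s))" by simp
    have "emeasure (distr (distr M borel (Y s) \<Otimes>\<^sub>M gauss (t - s)) (gauss (t - s)) snd) A
      = emeasure (distr M borel (Y s) \<Otimes>\<^sub>M gauss (t - s)) (space (distr M borel (Y s)) \<times> A)"
      using A by (subst emeasure_distr) (auto intro!: arg_cong2[where f=emeasure] simp: space_pair_measure)
    also have "\<dots> = emeasure (distr M borel (Y s)) (space (distr M borel (Y s))) * emeasure (gauss (t - s)) A"
      by (rule G.emeasure_pair_measure_Times) (use A in auto)
    also have "\<dots> = emeasure (gauss (t - s)) A"
      unfolding D.emeasure_space_1 by simp
    finally show "emeasure (distr (distr M borel (Y s) \<Otimes>\<^sub>M gauss (t - s)) (gauss (t - s)) snd) A = emeasure (gauss (t - s)) A" .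
  qed simp
  finally show ?thesis .
qed

lemma increment_norm:
  assumes st: "0 \<le> s" "s \<le> t"
  shows "integrable M (\<lambda>\<omega>. norm (Y t \<omega> - Y s \<omega> - (acc t \<omega> - acc s \<omega>)))"
    "(\<integral>\<omega>. norm (Y t \<omega> - Y s \<omega> - (acc t \<omega> - acc s \<omega>)) \<partial>M) = sqrt (t - s) * gauss_norm_moment TYPE('a)"
proof -
  have "integrable M (\<lambda>\<omega>. norm (Y t \<omega> - Y s \<omega> - (acc t \<omega> - acc s \<omega>))) \<and>
    (\<integral>\<omega>. norm (Y t \<omega> - Y s \<omega> - (acc t \<omega> - acc s \<omega>)) \<partial>M) = sqrt (t - s) * gauss_norm_moment TYPE('a)"
  proof (cases "s = t")
    case False
    then have lt: "s < t" using st by simp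
    have "integrable (gauss (t - s)) (\<lambda>z::'a. norm z)"
      using integrable_norm_gauss[of "t - s" 1, where 'a='a] lt by simp
    then show ?thesis
      using lt integral_norm_gauss[of "t - s", where 'a='a] unfolding increment_law[OF st(1) lt, symmetric]
      by (simp add: integrable_distr_eq integral_distr)
  qed simp
  then show "integrable M (\<lambda>\<omega>. norm (Y t \<omega> - Y s \<omega> - (acc t \<omega> - acc s \<omega>)))"
    "(\<integral>\<omega>. norm (Y t \<omega> - Y s \<omega> - (acc t \<omega> - acc s \<omega>)) \<partial>M) = sqrt (t - s) * gauss_norm_moment TYPE('a)"
    by auto
qed

end

section \<open>Duhamel bootstrapping\<close>

lemma bounded_linear_dheat:
  fixes f :: "'a::euclidean_space \<Rightarrow> real"
  assumes "0 < t" "bounded_borel B f"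
  shows "bounded_linear (\<lambda>v. dheat t v f x)"
  unfolding linear_conv_bounded_linear[symmetric]
proof (rule linearI)
  show "dheat t (v + w) f x = dheat t v f x + dheat t w f x" for v w
    unfolding dheat_sum_Basis[OF assms, of "v + w"] dheat_sum_Basis[OF assms, of v] dheat_sum_Basis[OF assms, of w]
    by (simp add: inner_add_left distrib_right sum.distrib)
  show "dheat t (r *\<^sub>R v) f x = r *\<^sub>R dheat t v f x" for r v
    by (simp add: dheat_scaleR)
qed

context mean_field begin

text \<open>Put \<open>r = \<delta> + t - u\<close>, let \<open>D\<close> be the displacement by the
  drift on the interval and \<open>x = Y u - D\<close>. By \<open>expectation_step\<close> the value
  at \<open>s\<close> is the expectation of \<open>heat r \<phi>\<close> at \<open>x\<close>, while
  the value at \<open>u\<close> is the one at \<open>x + D\<close>. The second order expansion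
  leaves \<open>dheat r (D \<omega>) \<phi> (x \<omega>)\<close> with an error quadratic in
  \<open>u - s\<close>; this term is linear in \<open>D\<close>, hence a time integral of drifts.
  Replacing its frozen position and time by the running ones costs \<open>sqrt (u - s)\<close> per
  unit of time in the mean. Altogether the error has order 3/2 in \<open>u - s\<close>, and
  \<open>\<delta> > 0\<close> keeps the kernels regular.\<close>

lemma duhamel_increment:
  assumes \<phi>: "bounded_borel B \<phi>" and \<delta>: "0 < \<delta>" and s: "0 \<le> s" and su: "s < u" and ut: "u \<le> t"
  defines "C \<equiv> heat_const TYPE('a)" and "m \<equiv> gauss_norm_moment TYPE('a)"
    and "q \<equiv> \<lambda>\<tau>. \<integral>\<omega>. dheat (\<delta> + t - \<tau>) (drift \<tau> (Y \<tau> \<omega>)) \<phi> (Y \<tau> \<omega>) \<partial>M"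
  shows "\<bar>(\<integral>\<omega>. heat (\<delta> + t - u) \<phi> (Y u \<omega>) \<partial>M) - (\<integral>\<omega>. heat (\<delta> + t - s) \<phi> (Y s \<omega>) \<partial>M)
      - (LINT \<tau>:{s<..u}|lborel. q \<tau>)\<bar>
    \<le> C * B * (\<beta> * (u - s))\<^sup>2 / \<delta>
      + (C * B * \<beta> / \<delta> * (sqrt (u - s) * m + \<beta> * (u - s)) + C * B * \<beta> * sqrt (u - s) / \<delta>) * (u - s)" (is "?lhs \<le> _")
    and "set_integrable lborel {s<..u} q"
proof -
  define r where "r = \<delta> + t - u"
  have r: "0 < r" "\<delta> \<le> r" using \<delta> ut by (auto simp: r_def)
  note B = bounded_borelD(3)[OF \<phi>]
  have C: "0 \<le> C" unfolding C_def by (rule heat_const_nonneg)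
  have m: "0 \<le> m" unfolding m_def by (rule gauss_norm_moment_nonneg)
  note [measurable] = bounded_borelD(1)[OF \<phi>]
  define \<Phi> where "\<Phi> = heat r \<phi>"
  have hb: "bounded_borel B \<Phi>" unfolding \<Phi>_def by (rule heat_bounded[OF r(1) \<phi>])
  define D where "D = (\<lambda>\<omega>. acc u \<omega> - acc s \<omega>)"
  define x where "x = (\<lambda>\<omega>. Y u \<omega> - D \<omega>)"
  have [measurable]: "D \<in> borel_measurable M" "x \<in> borel_measurable M" unfolding D_def x_def by measurable
  have x2[measurable]: "(\<lambda>p. x (snd p)) \<in> borel_measurable ((borel :: real measure) \<Otimes>\<^sub>M M)" by measurable
  have a_s: "(\<integral>\<omega>. heat (\<delta> + t - s) \<phi> (Y s \<omega>) \<partial>M) = (\<integral>\<omega>. \<Phi> (x \<omega>) \<partial>M)"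
  proof -
    have "heat (u - s) \<Phi> = heat (\<delta> + t - s) \<phi>"
      unfolding \<Phi>_def using heat_heat[OF _ r(1) \<phi>, of "u - s"] su by (simp add: r_def)
    then show ?thesis using expectation_step[OF s su hb] by (simp add: x_def D_def)
  qed
  \<comment> \<open>\<open>g1\<close> is the integrand that the expansion produces, with kernel and
    position frozen; \<open>g2\<close> is the one wanted in Duhamel's formula, at the running time
    and position.\<close>
  define g1 where "g1 = (\<lambda>\<tau> \<omega>. dheat r (drift \<tau> (Y \<tau> \<omega>)) \<phi> (x \<omega>))"
  define g2 where "g2 = (\<lambda>\<tau> \<omega>. dheat (\<delta> + t - \<tau>) (drift \<tau> (Y \<tau> \<omega>)) \<phi> (Y \<tau> \<omega>))"
  have g1m: "(\<lambda>p. g1 (fst p) (snd p)) \<in> borel_measurable (borel \<Otimes>\<^sub>M M)"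
    unfolding g1_def by (rule dheat_measurable_joint3) measurable
  have g2m: "(\<lambda>p. g2 (fst p) (snd p)) \<in> borel_measurable (borel \<Otimes>\<^sub>M M)"
    unfolding g2_def by (rule dheat_measurable_joint3) measurable
  have g1mM[measurable]: "g1 \<tau> \<in> borel_measurable M" for \<tau>
    using measurable_compose[OF _ g1m, of "\<lambda>\<omega>. (\<tau>, \<omega>)" M] by simp
  have g2mM[measurable]: "g2 \<tau> \<in> borel_measurable M" for \<tau>
    using measurable_compose[OF _ g2m, of "\<lambda>\<omega>. (\<tau>, \<omega>)" M] by simp
  have dbd: "\<bar>dheat r' v \<phi> y\<bar> \<le> C * B * \<beta> / sqrt \<delta>" if "\<delta> \<le> r'" "norm v \<le> \<beta>" for r' v y
  proof -
    have "\<bar>dheat r' v \<phi> y\<bar> \<le> C * B * norm v / sqrt r'"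
      unfolding C_def using heat_const_estimates(3)[OF _ \<phi>, of r'] that \<delta> by simp
    also have "\<dots> \<le> C * B * \<beta> / sqrt \<delta>"
      using that \<delta> B C \<beta>_nonneg by (intro frac_le mult_left_mono) auto
    finally show ?thesis .
  qed
  have g1b: "\<bar>g1 \<tau> \<omega>\<bar> \<le> C * B * \<beta> / sqrt \<delta>" for \<tau> \<omega>
    unfolding g1_def using drift_bound r by (intro dbd)
  have g2b: "\<bar>g2 \<tau> \<omega>\<bar> \<le> C * B * \<beta> / sqrt \<delta>" if "\<tau> \<in> {s<..u}" for \<tau> \<omega>
    unfolding g2_def using drift_bound that ut by (intro dbd) auto
  note sw1 = expectation_set_integral_swap[OF g1m, of s u, OF g1b]
  note sw2 = expectation_set_integral_swap[OF g2m, of s u, OF g2b]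
  have q: "q = (\<lambda>\<tau>. \<integral>\<omega>. g2 \<tau> \<omega> \<partial>M)" unfolding q_def g2_def ..
  show "set_integrable lborel {s<..u} q" unfolding q using sw2(2) by simp
  have lin: "dheat r (D \<omega>) \<phi> (x \<omega>) = (LINT \<tau>:{s<..u}|lborel. g1 \<tau> \<omega>)" if \<omega>: "\<omega> \<in> space M" for \<omega>
  proof -
    have "D \<omega> = (\<integral>\<tau>. indicator {s<..u} \<tau> *\<^sub>R drift \<tau> (Y \<tau> \<omega>) \<partial>lborel)"
      unfolding D_def using acc_diff[OF \<omega> s, of u] su by (simp add: set_lebesgue_integral_def)
    then show ?thesis
      using integral_bounded_linear[OF bounded_linear_dheat[OF r(1) \<phi>, of "x \<omega>"] drift_path_set_integrable(1)[OF \<omega>, of s u, unfolded set_integrable_def]]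
      unfolding set_lebesgue_integral_def g1_def by (simp add: dheat_scaleR)
  qed
  have taylor: "\<bar>\<Phi> (x \<omega> + D \<omega>) - \<Phi> (x \<omega>) - (LINT \<tau>:{s<..u}|lborel. g1 \<tau> \<omega>)\<bar> \<le> C * B * (\<beta> * (u - s))\<^sup>2 / \<delta>"
    if \<omega>: "\<omega> \<in> space M" for \<omega>
  proof -
    have "\<bar>\<Phi> (x \<omega> + D \<omega>) - \<Phi> (x \<omega>) - dheat r (D \<omega>) \<phi> (x \<omega>)\<bar> \<le> C * B * (norm (D \<omega>))\<^sup>2 / r"
      unfolding \<Phi>_def C_def by (rule heat_const_estimates(1)[OF r(1) \<phi>])
    also have "\<dots> \<le> C * B * (\<beta> * (u - s))\<^sup>2 / \<delta>"
      using acc_diff_bound[OF \<omega> s, of u] su r \<delta> B C unfolding D_def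
      by (intro frac_le mult_left_mono power_mono) auto
    finally show ?thesis unfolding lin[OF \<omega>] .
  qed
  have int\<Phi>: "integrable M (\<lambda>\<omega>. \<Phi> (x \<omega> + D \<omega>))" "integrable M (\<lambda>\<omega>. \<Phi> (x \<omega>))"
    by (rule integrable_bounded_borel[OF hb]; measurable)+
  have intL: "integrable M (\<lambda>\<omega>. LINT \<tau>:{s<..u}|lborel. g1 \<tau> \<omega>)" using sw1(3) by simp
  have E1: "\<bar>(\<integral>\<omega>. \<Phi> (x \<omega> + D \<omega>) \<partial>M) - (\<integral>\<omega>. \<Phi> (x \<omega>) \<partial>M) - (LINT \<tau>:{s<..u}|lborel. \<integral>\<omega>. g1 \<tau> \<omega> \<partial>M)\<bar> \<le> C * B * (\<beta> * (u - s))\<^sup>2 / \<delta>"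
  proof -
    have "(\<integral>\<omega>. \<Phi> (x \<omega> + D \<omega>) \<partial>M) - (\<integral>\<omega>. \<Phi> (x \<omega>) \<partial>M) - (LINT \<tau>:{s<..u}|lborel. \<integral>\<omega>. g1 \<tau> \<omega> \<partial>M)
      = (\<integral>\<omega>. \<Phi> (x \<omega> + D \<omega>) - \<Phi> (x \<omega>) - (LINT \<tau>:{s<..u}|lborel. g1 \<tau> \<omega>) \<partial>M)"
      using sw1(1) int\<Phi> intL by (simp add: Bochner_Integration.integral_diff)
    also have "\<bar>\<dots>\<bar> \<le> C * B * (\<beta> * (u - s))\<^sup>2 / \<delta>"
      by (rule expectation_abs_le[OF _ taylor])
         (use int\<Phi> intL in \<open>auto intro!: borel_measurable_integrable Bochner_Integration.integrable_diff\<close>)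
    finally show ?thesis .
  qed
  define K where "K = C * B * \<beta> / \<delta> * (sqrt (u - s) * m + \<beta> * (u - s)) + C * B * \<beta> * sqrt (u - s) / \<delta>"
  have CB: "0 \<le> C * B * \<beta> / \<delta>" using C B \<beta>_nonneg \<delta> by simp
  have E2: "\<bar>(\<integral>\<omega>. g1 \<tau> \<omega> \<partial>M) - q \<tau>\<bar> \<le> K" if \<tau>: "\<tau> \<in> {s<..u}" for \<tau>
  proof -
    define Z where "Z = (\<lambda>\<omega>. norm (Y u \<omega> - Y \<tau> \<omega> - (acc u \<omega> - acc \<tau> \<omega>)))"
    have \<tau>': "0 \<le> \<tau>" "\<tau> \<le> u" "s \<le> \<tau>" using \<tau> s by auto
    have Z: "integrable M Z" "(\<integral>\<omega>. Z \<omega> \<partial>M) = sqrt (u - \<tau>) * m"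
      using increment_norm[OF \<tau>'(1,2)] by (simp_all add: Z_def m_def)
    have pt: "\<bar>g1 \<tau> \<omega> - g2 \<tau> \<omega>\<bar> \<le> C * B * \<beta> / \<delta> * (Z \<omega> + \<beta> * (u - s)) + C * B * \<beta> * sqrt (u - s) / \<delta>" if \<omega>: "\<omega> \<in> space M" for \<omega>
    proof -
      define v where "v = drift \<tau> (Y \<tau> \<omega>)"
      have v: "norm v \<le> \<beta>" unfolding v_def by (rule drift_bound)
      \<comment> \<open>The displacement from \<open>Y \<tau>\<close> to \<open>x\<close> consists
        of the noise after \<open>\<tau>\<close> and, with a minus sign, of the drift before
        \<open>\<tau>\<close>. The former has mean length of order \<open>sqrt (u - \<tau>)\<close>,
        the latter is at most \<open>\<beta> * (u - s)\<close>.\<close>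
      have "x \<omega> - Y \<tau> \<omega> = (Y u \<omega> - Y \<tau> \<omega> - (acc u \<omega> - acc \<tau> \<omega>)) - (acc \<tau> \<omega> - acc s \<omega>)"
        by (simp add: x_def D_def)
      then have "norm (x \<omega> - Y \<tau> \<omega>) \<le> Z \<omega> + norm (acc \<tau> \<omega> - acc s \<omega>)"
        unfolding Z_def using norm_triangle_ineq4 by metis
      also have "norm (acc \<tau> \<omega> - acc s \<omega>) \<le> \<beta> * (\<tau> - s)" by (rule acc_diff_bound[OF \<omega> s \<tau>'(3)])
      also have "\<dots> \<le> \<beta> * (u - s)" using \<tau>' \<beta>_nonneg by (intro mult_left_mono) auto
      finally have xY: "norm (x \<omega> - Y \<tau> \<omega>) \<le> Z \<omega> + \<beta> * (u - s)" by simp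
      have "\<bar>dheat r v \<phi> (Y \<tau> \<omega> + (x \<omega> - Y \<tau> \<omega>)) - dheat r v \<phi> (Y \<tau> \<omega>)\<bar> \<le> C * B * norm v * norm (x \<omega> - Y \<tau> \<omega>) / r"
        unfolding C_def by (rule heat_const_estimates(4)[OF r(1) \<phi>])
      also have "\<dots> \<le> C * B * \<beta> * (Z \<omega> + \<beta> * (u - s)) / \<delta>"
        using v xY r \<delta> B C \<beta>_nonneg by (intro frac_le mult_mono mult_left_mono mult_nonneg_nonneg) (auto intro: order_trans[OF norm_ge_zero xY])
      finally have 1: "\<bar>g1 \<tau> \<omega> - dheat r v \<phi> (Y \<tau> \<omega>)\<bar> \<le> C * B * \<beta> / \<delta> * (Z \<omega> + \<beta> * (u - s))"
        by (simp add: g1_def v_def)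
      have 2: "\<bar>g2 \<tau> \<omega> - dheat r v \<phi> (Y \<tau> \<omega>)\<bar> \<le> C * B * \<beta> * sqrt (u - s) / \<delta>"
      proof (cases "\<tau> = u")
        case True
        have "g2 \<tau> \<omega> = dheat r v \<phi> (Y \<tau> \<omega>)" unfolding g2_def v_def r_def True ..
        then show ?thesis using B C \<beta>_nonneg \<delta> su by simp
      next
        case False
        then have "\<bar>dheat (r + (u - \<tau>)) v \<phi> (Y \<tau> \<omega>) - dheat r v \<phi> (Y \<tau> \<omega>)\<bar> \<le> C * B * norm v * sqrt (u - \<tau>) / r"
          unfolding C_def using \<tau>' by (intro heat_const_estimates(6)[OF r(1) \<phi>]) auto
        also have "C * B * norm v * sqrt (u - \<tau>) / r \<le> C * B * \<beta> * sqrt (u - s) / \<delta>"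
          using v r \<delta> B C \<beta>_nonneg \<tau>' by (intro frac_le mult_mono mult_left_mono mult_nonneg_nonneg) auto
        finally have "\<bar>dheat (r + (u - \<tau>)) v \<phi> (Y \<tau> \<omega>) - dheat r v \<phi> (Y \<tau> \<omega>)\<bar> \<le> C * B * \<beta> * sqrt (u - s) / \<delta>" .
        moreover have "r + (u - \<tau>) = \<delta> + t - \<tau>" by (simp add: r_def)
        ultimately show ?thesis unfolding g2_def v_def[symmetric] by (simp only:)
      qed
      show ?thesis using 1 2 by linarith
    qed
    have "\<bar>(\<integral>\<omega>. g1 \<tau> \<omega> \<partial>M) - q \<tau>\<bar> = \<bar>\<integral>\<omega>. g1 \<tau> \<omega> - g2 \<tau> \<omega> \<partial>M\<bar>"
      unfolding q using g1b g2b[OF \<tau>]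
      by (subst Bochner_Integration.integral_diff) (auto intro!: integrable_const_bound[of _ "C * B * \<beta> / sqrt \<delta>"])
    also have "\<dots> \<le> (\<integral>\<omega>. \<bar>g1 \<tau> \<omega> - g2 \<tau> \<omega>\<bar> \<partial>M)" by (rule integral_abs_bound)
    also have "\<dots> \<le> (\<integral>\<omega>. C * B * \<beta> / \<delta> * (Z \<omega> + \<beta> * (u - s)) + C * B * \<beta> * sqrt (u - s) / \<delta> \<partial>M)"
    proof (rule integral_mono)
      show "integrable M (\<lambda>\<omega>. \<bar>g1 \<tau> \<omega> - g2 \<tau> \<omega>\<bar>)"
        using g1b g2b[OF \<tau>]
        by (intro integrable_abs Bochner_Integration.integrable_diff) (auto intro!: integrable_const_bound[of _ "C * B * \<beta> / sqrt \<delta>"])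
      show "integrable M (\<lambda>\<omega>. C * B * \<beta> / \<delta> * (Z \<omega> + \<beta> * (u - s)) + C * B * \<beta> * sqrt (u - s) / \<delta>)"
        using Z(1) by (intro Bochner_Integration.integrable_add integrable_mult_right integrable_const)
    qed (rule pt)
    also have "\<dots> = C * B * \<beta> / \<delta> * (sqrt (u - \<tau>) * m + \<beta> * (u - s)) + C * B * \<beta> * sqrt (u - s) / \<delta>"
      using Z by (simp add: prob_space del: times_divide_eq_left times_divide_eq_right)
    also have "\<dots> \<le> K"
      unfolding K_def using \<tau>' m CB by (intro add_right_mono mult_left_mono mult_right_mono) auto
    finally show ?thesis .
  qed
  have int1: "set_integrable lborel {s<..u} (\<lambda>\<tau>. \<integral>\<omega>. g1 \<tau> \<omega> \<partial>M)" using sw1(2) by simp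
  have int2: "set_integrable lborel {s<..u} q" by fact
  have E3: "\<bar>(LINT \<tau>:{s<..u}|lborel. \<integral>\<omega>. g1 \<tau> \<omega> \<partial>M) - (LINT \<tau>:{s<..u}|lborel. q \<tau>)\<bar> \<le> K * (u - s)"
  proof -
    have "(LINT \<tau>:{s<..u}|lborel. \<integral>\<omega>. g1 \<tau> \<omega> \<partial>M) - (LINT \<tau>:{s<..u}|lborel. q \<tau>) = (LINT \<tau>:{s<..u}|lborel. (\<integral>\<omega>. g1 \<tau> \<omega> \<partial>M) - q \<tau>)"
      by (rule set_integral_diff(2)[OF int1 int2, symmetric])
    also have "\<bar>\<dots>\<bar> \<le> (LINT \<tau>:{s<..u}|lborel. norm ((\<integral>\<omega>. g1 \<tau> \<omega> \<partial>M) - q \<tau>))"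
      using set_integral_norm_bound[OF set_integral_diff(1)[OF int1 int2]] by simp
    also have "\<dots> \<le> (LINT \<tau>:{s<..u}|lborel. K)"
      using E2 su by (intro set_integral_mono set_integrable_norm set_integral_diff(1)[OF int1 int2]) (auto simp: set_integrable_def)
    also have "\<dots> = K * (u - s)" using su by (simp add: set_lebesgue_integral_def)
    finally show ?thesis .
  qed
  have "?lhs = \<bar>((\<integral>\<omega>. \<Phi> (x \<omega> + D \<omega>) \<partial>M) - (\<integral>\<omega>. \<Phi> (x \<omega>) \<partial>M) - (LINT \<tau>:{s<..u}|lborel. \<integral>\<omega>. g1 \<tau> \<omega> \<partial>M))
    + ((LINT \<tau>:{s<..u}|lborel. \<integral>\<omega>. g1 \<tau> \<omega> \<partial>M) - (LINT \<tau>:{s<..u}|lborel. q \<tau>))\<bar>"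
    unfolding a_s by (simp add: x_def \<Phi>_def r_def)
  also have "\<dots> \<le> C * B * (\<beta> * (u - s))\<^sup>2 / \<delta> + K * (u - s)"
    by (rule order_trans[OF abs_triangle_ineq add_mono[OF E1 E3]])
  finally show "?lhs \<le> C * B * (\<beta> * (u - s))\<^sup>2 / \<delta>
      + (C * B * \<beta> / \<delta> * (sqrt (u - s) * m + \<beta> * (u - s)) + C * B * \<beta> * sqrt (u - s) / \<delta>) * (u - s)"
    unfolding K_def .
qed

end

text \<open>Difference quotients are at most \<open>K * sqrt \<bar>y - x\<bar>\<close>, so the
  derivative vanishes on the whole interval. This turns error bounds over short intervals into an
  exact identity.\<close>

lemma holder_exponent_gt_1_constant:
  fixes f :: "real \<Rightarrow> real"
  assumes ab: "a \<le> b" and bd: "\<And>s u. a \<le> s \<Longrightarrow> s < u \<Longrightarrow> u \<le> b \<Longrightarrow> \<bar>f u - f s\<bar> \<le> K * (u - s) * sqrt (u - s)"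
  shows "f a = f b"
proof -
  have "(f has_field_derivative 0) (at x within {a..b})" if x: "x \<in> {a..b}" for x
    unfolding has_field_derivative_iff
  proof (rule Lim_null_comparison)
    show "((\<lambda>y. K * sqrt \<bar>y - x\<bar>) \<longlongrightarrow> 0) (at x within {a..b})"
      by (auto intro!: tendsto_eq_intros)
    have "norm ((f y - f x) / (y - x)) \<le> K * sqrt \<bar>y - x\<bar>" if y: "y \<in> {a..b}" "y \<noteq> x" for y
    proof -
      have "\<bar>f y - f x\<bar> \<le> K * sqrt \<bar>y - x\<bar> * \<bar>y - x\<bar>"
      proof (cases "x < y")
        case True
        then show ?thesis using bd[of x y] x y by (simp add: mult_ac)
      next
        case False
        then show ?thesis using bd[of y x] x y by (simp add: mult_ac abs_minus_commute)
      qed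
      then show ?thesis using y by (simp add: pos_divide_le_eq)
    qed
    then show "\<forall>\<^sub>F y in at x within {a..b}. norm ((f y - f x) / (y - x)) \<le> K * sqrt \<bar>y - x\<bar>"
      unfolding eventually_at_filter by (intro always_eventually) auto
  qed
  then obtain c where "\<And>x. x \<in> {a..b} \<Longrightarrow> f x = c"
    using has_field_derivative_zero_constant[of "{a..b}" f] by auto
  then show ?thesis using ab by auto
qed

context mean_field begin

text \<open>The quantity \<open>H u\<close>, which is the expectation of
  \<open>heat (\<delta> + t - u) \<phi>\<close> along \<open>Y u\<close> minus the integral of
  \<open>q\<close> up to \<open>u\<close>, has increments of order 3/2 by
  \<open>duhamel_increment\<close> and is therefore constant. Comparing \<open>u = t0\<close> and
  \<open>u = t\<close> gives the formula.\<close>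

lemma duhamel:
  assumes \<phi>: "bounded_borel B \<phi>" and \<delta>: "0 < \<delta>" and t0: "0 \<le> t0" "t0 \<le> t"
  defines "q \<equiv> \<lambda>\<tau>. \<integral>\<omega>. dheat (\<delta> + t - \<tau>) (drift \<tau> (Y \<tau> \<omega>)) \<phi> (Y \<tau> \<omega>) \<partial>M"
  shows "(\<integral>\<omega>. heat \<delta> \<phi> (Y t \<omega>) \<partial>M) = (\<integral>\<omega>. heat (\<delta> + t - t0) \<phi> (Y t0 \<omega>) \<partial>M) + (LINT \<tau>:{t0<..t}|lborel. q \<tau>)"
proof -
  define C where "C = heat_const TYPE('a)"
  define m where "m = gauss_norm_moment TYPE('a)"
  define T where "T = t - t0"
  define H where "H = (\<lambda>u. (\<integral>\<omega>. heat (\<delta> + t - u) \<phi> (Y u \<omega>) \<partial>M) - (LINT \<tau>:{t0<..u}|lborel. q \<tau>))"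
  \<comment> \<open>The error of \<open>duhamel_increment\<close> with the factor
    \<open>\<eta> * sqrt \<eta>\<close> taken out, where \<open>\<eta>\<close> is the interval
    length; in what remains \<open>sqrt \<eta>\<close> is replaced by \<open>sqrt T\<close>.\<close>
  define K where "K = C * B * \<beta>\<^sup>2 * sqrt T / \<delta> + (C * B * \<beta> / \<delta> * (m + \<beta> * sqrt T) + C * B * \<beta> / \<delta>)"
  note B = bounded_borelD(3)[OF \<phi>]
  have C: "0 \<le> C" unfolding C_def by (rule heat_const_nonneg)
  have m: "0 \<le> m" unfolding m_def by (rule gauss_norm_moment_nonneg)
  have int_q: "set_integrable lborel {s<..u} q" if "t0 \<le> s" "s \<le> u" "u \<le> t" for s u
  proof (cases "s = u")
    case False
    then show ?thesis
      unfolding q_def using that t0 by (intro duhamel_increment(2)[OF \<phi> \<delta>]) auto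
  qed (simp add: set_integrable_def)
  have "H t0 = H t"
  proof (rule holder_exponent_gt_1_constant[OF t0(2)])
    fix s u assume su: "t0 \<le> s" "s < u" "u \<le> t"
    define \<eta> where "\<eta> = u - s"
    have \<eta>: "0 < \<eta>" "\<eta> \<le> T" using su by (auto simp: \<eta>_def T_def)
    have sq: "\<eta> = sqrt \<eta> * sqrt \<eta>" using \<eta> by simp
    have split: "{t0<..u} = {t0<..s} \<union> {s<..u}" "{t0<..s} \<inter> {s<..u} = {}" using su by auto
    have "(LINT \<tau>:{t0<..u}|lborel. q \<tau>) = (LINT \<tau>:{t0<..s}|lborel. q \<tau>) + (LINT \<tau>:{s<..u}|lborel. q \<tau>)"
      unfolding split(1) by (rule set_integral_Un[OF split(2)]) (use su int_q in auto)
    then have "\<bar>H u - H s\<bar> = \<bar>(\<integral>\<omega>. heat (\<delta> + t - u) \<phi> (Y u \<omega>) \<partial>M) - (\<integral>\<omega>. heat (\<delta> + t - s) \<phi> (Y s \<omega>) \<partial>M) - (LINT \<tau>:{s<..u}|lborel. q \<tau>)\<bar>"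
      by (simp add: H_def)
    also have "\<dots> \<le> C * B * (\<beta> * \<eta>)\<^sup>2 / \<delta> + (C * B * \<beta> / \<delta> * (sqrt \<eta> * m + \<beta> * \<eta>) + C * B * \<beta> * sqrt \<eta> / \<delta>) * \<eta>"
      unfolding \<eta>_def q_def C_def m_def using su t0 by (intro duhamel_increment(1)[OF \<phi> \<delta>]) auto
    also have "\<dots> = (C * B * \<beta>\<^sup>2 * sqrt \<eta> / \<delta> + (C * B * \<beta> / \<delta> * (m + \<beta> * sqrt \<eta>) + C * B * \<beta> / \<delta>)) * \<eta> * sqrt \<eta>"
    proof -
      define w where "w = sqrt \<eta>"
      have w: "\<eta> = w * w" "sqrt \<eta> = w" "sqrt (w * w) = w" using \<eta> by (auto simp: w_def)
      show ?thesis unfolding w(2) unfolding w(1) by (simp add: w(3) power2_eq_square algebra_simps add_divide_distrib)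
    qed
    also have "\<dots> \<le> K * \<eta> * sqrt \<eta>"
    proof -
      have "sqrt \<eta> \<le> sqrt T" using \<eta> by simp
      moreover have "0 \<le> C * B * \<beta>\<^sup>2" "0 \<le> C * B * \<beta> / \<delta>" using C B \<beta>_nonneg \<delta> by auto
      ultimately show ?thesis
        unfolding K_def using \<delta> \<eta> \<beta>_nonneg B C
        by (intro mult_right_mono add_mono mult_left_mono divide_right_mono) auto
    qed
    finally show "\<bar>H u - H s\<bar> \<le> K * (u - s) * sqrt (u - s)" unfolding \<eta>_def .
  qed
  then show ?thesis by (simp add: H_def set_lebesgue_integral_def)
qed

text \<open>A translation-difference bound of order \<open>n / 2\<close> for the law of \<open>Y t\<close>, by duality with
  bounded Borel functions.\<close>

definition smooth_law :: "nat \<Rightarrow> real \<Rightarrow> real \<Rightarrow> bool" where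
  "smooth_law n K a \<longleftrightarrow> 0 \<le> K \<and> (\<forall>t\<ge>a. \<forall>h B \<phi>. bounded_borel B \<phi> \<longrightarrow>
     \<bar>\<integral>\<omega>. (fdiff h ^^ n) \<phi> (Y t \<omega>) \<partial>M\<bar> \<le> K * B * sqrt (norm h) ^ n)"

section \<open>Regularity of the law by induction on the order of the differences\<close>

lemma smooth_lawD:
  assumes "smooth_law n K a"
  shows "0 \<le> K"
    and "a \<le> t \<Longrightarrow> bounded_borel B \<phi> \<Longrightarrow> \<bar>\<integral>\<omega>. (fdiff h ^^ n) \<phi> (Y t \<omega>) \<partial>M\<bar> \<le> K * B * sqrt (norm h) ^ n"
  using assms unfolding smooth_law_def by blast+

lemma smooth_law_0: "smooth_law 0 1 a"
  unfolding smooth_law_def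
proof (intro conjI allI impI)
  fix t h B and \<phi> :: "'a \<Rightarrow> real" assume \<phi>: "bounded_borel B \<phi>"
  note [measurable] = bounded_borelD(1)[OF \<phi>]
  show "\<bar>\<integral>\<omega>. (fdiff h ^^ 0) \<phi> (Y t \<omega>) \<partial>M\<bar> \<le> 1 * B * sqrt (norm h) ^ 0"
    using bounded_borelD(2)[OF \<phi>] by (simp add: expectation_abs_le)
qed simp

text \<open>Since the drift is a convolution with the law of \<open>Y s\<close>, a difference in
  \<open>x\<close> can be taken in the other variable of \<open>c s (x - y)\<close>, with the step
  reversed.\<close>

lemma fdiff_drift:
  "(fdiff h ^^ j) (\<lambda>x. drift s x \<bullet> e) x = (\<integral>\<omega>. (fdiff (- h) ^^ j) (\<lambda>y. c s (x - y) \<bullet> e) (Y s \<omega>) \<partial>M)"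
proof (induction j arbitrary: x)
  case 0
  have [measurable]: "(\<lambda>\<omega>. c s (x - Y s \<omega>)) \<in> borel_measurable M" for x
    using measurable_compose[OF _ c_joint, of "\<lambda>\<omega>. (s, x - Y s \<omega>)" M] by simp
  have "integrable M (\<lambda>\<omega>. c s (x - Y s \<omega>))"
    using c_bound by (intro integrable_const_bound[of _ \<beta>]) auto
  then show ?case by (simp add: drift_def integral_inner_left)
next
  case (Suc j)
  define \<phi> where "\<phi> = (\<lambda>y. c s (x - y) \<bullet> e)"
  have cm[measurable]: "(\<lambda>y. c s y) \<in> borel_measurable borel"
    using measurable_compose[OF _ c_joint, of "\<lambda>y. (s, y)" borel] by simp
  have b: "bounded_borel (\<beta> * norm e) (\<lambda>y. c s (z - y) \<bullet> e)" for z
  proof -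
    have "(\<lambda>y. c s (z - y) \<bullet> e) \<in> borel_measurable borel" by measurable
    moreover have "\<bar>c s (z - y) \<bullet> e\<bar> \<le> \<beta> * norm e" for y
      by (rule order_trans[OF Cauchy_Schwarz_ineq2]) (intro mult_right_mono c_bound norm_ge_zero)
    ultimately show ?thesis unfolding bounded_borel_def by blast
  qed
  have sh: "(fdiff (- h) ^^ j) (\<lambda>y. c s ((x + h) - y) \<bullet> e) z = (fdiff (- h) ^^ j) \<phi> (z + (- h))" for z
    using fdiff_funpow_shift[of j "- h" \<phi> "- h" z] by (simp add: \<phi>_def algebra_simps)
  have b': "bounded_borel (2 ^ j * (\<beta> * norm e)) ((fdiff (- h) ^^ j) \<phi>)"
    unfolding \<phi>_def by (rule bounded_borel_fdiff_funpow[OF b])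
  have i1: "integrable M (\<lambda>\<omega>. (fdiff (- h) ^^ j) \<phi> (Y s \<omega>))"
    by (rule integrable_bounded_borel[OF b']) measurable
  have i2: "integrable M (\<lambda>\<omega>. (fdiff (- h) ^^ j) \<phi> (Y s \<omega> + (- h)))"
    by (rule integrable_bounded_borel[OF b']) measurable
  have "(fdiff h ^^ Suc j) (\<lambda>x. drift s x \<bullet> e) x = (fdiff h ^^ j) (\<lambda>x. drift s x \<bullet> e) (x + h) - (fdiff h ^^ j) (\<lambda>x. drift s x \<bullet> e) x"
    by (simp add: fdiff_def)
  also have "\<dots> = (\<integral>\<omega>. (fdiff (- h) ^^ j) \<phi> (Y s \<omega> + (- h)) \<partial>M) - (\<integral>\<omega>. (fdiff (- h) ^^ j) \<phi> (Y s \<omega>) \<partial>M)"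
    unfolding Suc.IH sh unfolding \<phi>_def ..
  also have "\<dots> = (\<integral>\<omega>. (fdiff (- h) ^^ j) \<phi> (Y s \<omega> + (- h)) - (fdiff (- h) ^^ j) \<phi> (Y s \<omega>) \<partial>M)"
    by (rule Bochner_Integration.integral_diff[OF i2 i1, symmetric])
  also have "\<dots> = (\<integral>\<omega>. (fdiff (- h) ^^ Suc j) \<phi> (Y s \<omega>) \<partial>M)"
    by (simp add: fdiff_def)
  finally show ?case unfolding \<phi>_def .
qed

lemma drift_component_measurable: "(\<lambda>x. drift s x \<bullet> e) \<in> borel_measurable borel"
proof -
  have [measurable]: "(\<lambda>x. drift s x) \<in> borel_measurable borel"
    using measurable_compose[OF _ drift_joint, of "\<lambda>x. (s, x)" borel] by simp
  show ?thesis by measurable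
qed

text \<open>For fixed \<open>x\<close>, the function \<open>c s (x - y) \<bullet> e\<close> of
  \<open>y\<close> is bounded by \<beta> and so is an admissible test function for
  \<open>smooth_law\<close>. Thus the drift is as smooth as the law however rough \<open>c\<close>
  is; this feedback drives the whole induction.\<close>

lemma drift_smooth:
  assumes "smooth_law j K a" "a \<le> s" "norm e = 1"
  shows "bounded_borel (K * \<beta> * sqrt (norm h) ^ j) ((fdiff h ^^ j) (\<lambda>x. drift s x \<bullet> e))"
proof -
  have cm[measurable]: "(\<lambda>y. c s y) \<in> borel_measurable borel"
    using measurable_compose[OF _ c_joint, of "\<lambda>y. (s, y)" borel] by simp
  have b: "bounded_borel \<beta> (\<lambda>y. c s (z - y) \<bullet> e)" for z
  proof -
    have "(\<lambda>y. c s (z - y) \<bullet> e) \<in> borel_measurable borel" by measurable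
    moreover have "\<bar>c s (z - y) \<bullet> e\<bar> \<le> \<beta>" for y
      using order_trans[OF Cauchy_Schwarz_ineq2 c_bound[THEN mult_right_mono]] assms(3) by (metis mult.right_neutral norm_ge_zero)
    ultimately show ?thesis unfolding bounded_borel_def by blast
  qed
  have "bounded_borel (\<beta> * 1) (\<lambda>x. drift s x \<bullet> e)"
    unfolding bounded_borel_def
  proof (intro conjI allI drift_component_measurable)
    show "\<bar>drift s x \<bullet> e\<bar> \<le> \<beta> * 1" for x
      unfolding assms(3)[symmetric] by (rule order_trans[OF Cauchy_Schwarz_ineq2]) (intro mult_right_mono drift_bound norm_ge_zero)
  qed
  then have "(fdiff h ^^ j) (\<lambda>x. drift s x \<bullet> e) \<in> borel_measurable borel"
    by (intro bounded_borelD(1)[OF bounded_borel_fdiff_funpow])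
  moreover have "\<bar>(fdiff h ^^ j) (\<lambda>x. drift s x \<bullet> e) x\<bar> \<le> K * \<beta> * sqrt (norm h) ^ j" for x
    using smooth_lawD(2)[OF assms(1,2) b[of x], of "- h"] unfolding fdiff_drift norm_minus_cancel .
  ultimately show ?thesis unfolding bounded_borel_def by blast
qed

end

text \<open>The Leibniz rule moved to the other factor: \<open>V \<Delta>\<theta> = \<Delta>(V' \<theta>) - (\<Delta>V') \<theta>\<close> with \<open>V' = V(\<cdot> - h)\<close>.\<close>

lemma (in prob_space) fdiff_product_bound:
  fixes Z :: "'a \<Rightarrow> 'b::euclidean_space" and \<rho> :: real
  assumes [measurable]: "Z \<in> borel_measurable M"
    and A: "\<And>i B \<phi>. i \<le> m \<Longrightarrow> bounded_borel B \<phi> \<Longrightarrow> \<bar>\<integral>\<omega>. (fdiff h ^^ i) \<phi> (Z \<omega>) \<partial>M\<bar> \<le> A * B * \<rho> ^ i"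
    and V: "\<And>j. j \<le> k \<Longrightarrow> bounded_borel (L * \<rho> ^ j) ((fdiff h ^^ j) V)"
    and \<theta>: "bounded_borel B \<theta>" and ik: "i + k \<le> m"
  shows "\<bar>\<integral>\<omega>. (fdiff h ^^ i) (\<lambda>x. V x * (fdiff h ^^ k) \<theta> x) (Z \<omega>) \<partial>M\<bar> \<le> 2 ^ k * A * L * B * \<rho> ^ (i + k)"
  using V ik
proof (induction k arbitrary: i V L)
  case 0
  have "bounded_borel (L * B) (\<lambda>x. V x * \<theta> x)"
    using bounded_borel_mult[OF _ \<theta>, of L V] 0(1)[of 0] by simp
  from A[OF _ this, of i] 0 show ?case by (simp add: mult.assoc)
next
  case (Suc k)
  define V' where "V' = (\<lambda>x. V (x + (- h)))"
  define \<eta> where "\<eta> = (fdiff h ^^ k) \<theta>"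
  have eb: "bounded_borel (2 ^ k * B) \<eta>" unfolding \<eta>_def by (rule bounded_borel_fdiff_funpow[OF \<theta>])
  have V'j: "bounded_borel (L * \<rho> ^ j) ((fdiff h ^^ j) V')" if "j \<le> Suc k" for j
  proof -
    have "(fdiff h ^^ j) V' = (\<lambda>x. (fdiff h ^^ j) V (x + (- h)))"
      unfolding V'_def using fdiff_funpow_shift by blast
    then show ?thesis using bounded_borel_shift[OF Suc.prems(1)[OF that], of "- h"] by simp
  qed
  have dV'j: "bounded_borel ((L * \<rho>) * \<rho> ^ j) ((fdiff h ^^ j) (fdiff h V'))" if "j \<le> k" for j
    using V'j[of "Suc j"] that by (simp add: fdiff_funpow_Suc(2)[symmetric] mult.assoc del: funpow.simps)
  have eq: "(\<lambda>x. V x * (fdiff h ^^ Suc k) \<theta> x) = (\<lambda>x. fdiff h (\<lambda>x. V' x * \<eta> x) x - fdiff h V' x * \<eta> x)"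
    by (rule ext) (simp add: \<eta>_def V'_def fdiff_def algebra_simps)
  have p1: "bounded_borel (L * \<rho> ^ 0 * (2 ^ k * B)) (\<lambda>x. V' x * \<eta> x)"
    using bounded_borel_mult[OF V'j[of 0] eb] by simp
  have p2: "bounded_borel (L * \<rho> * \<rho> ^ 0 * (2 ^ k * B)) (\<lambda>x. fdiff h V' x * \<eta> x)"
    using bounded_borel_mult[OF dV'j[of 0] eb] by simp
  have int: "integrable M (\<lambda>\<omega>. f (Z \<omega>))" if "bounded_borel K f" for K and f :: "'b \<Rightarrow> real"
    using bounded_borelD[OF that] by (intro integrable_const_bound[of _ K]) auto
  have "(\<integral>\<omega>. (fdiff h ^^ i) (\<lambda>x. V x * (fdiff h ^^ Suc k) \<theta> x) (Z \<omega>) \<partial>M)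
    = (\<integral>\<omega>. (fdiff h ^^ Suc i) (\<lambda>x. V' x * \<eta> x) (Z \<omega>) \<partial>M) - (\<integral>\<omega>. (fdiff h ^^ i) (\<lambda>x. fdiff h V' x * \<eta> x) (Z \<omega>) \<partial>M)"
    unfolding eq fdiff_funpow_diff fdiff_funpow_Suc(2)[of i]
    by (rule Bochner_Integration.integral_diff)
       (rule int[OF bounded_borel_fdiff_funpow[OF bounded_borel_fdiff[OF p1]]] int[OF bounded_borel_fdiff_funpow[OF p2]])+
  also have "\<bar>\<dots>\<bar> \<le> 2 ^ k * A * L * B * \<rho> ^ (Suc i + k) + 2 ^ k * A * (L * \<rho>) * B * \<rho> ^ (i + k)"
    unfolding \<eta>_def using V'j dV'j Suc.prems(2)
    by (intro order_trans[OF abs_triangle_ineq4 add_mono] Suc.IH) auto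
  also have "\<dots> = 2 ^ Suc k * A * L * B * \<rho> ^ (i + Suc k)" by (simp add: algebra_simps)
  finally show ?case .
qed

lemma continuous_on_fdiff_funpow:
  fixes f :: "'a::real_normed_vector \<Rightarrow> real"
  assumes "continuous_on UNIV f"
  shows "continuous_on UNIV ((fdiff h ^^ m) f)"
proof (induction m)
  case (Suc m)
  have "continuous_on UNIV (\<lambda>x. (fdiff h ^^ m) f (x + h) - (fdiff h ^^ m) f x)"
    by (intro continuous_intros continuous_on_compose2[OF Suc]) auto
  then show ?case unfolding fdiff_funpow_Suc(1) fdiff_def[of h "(fdiff h ^^ m) f"] .
qed (use assms in simp)

lemma abs_fdiff_funpow_le:
  fixes d :: "'a::real_vector \<Rightarrow> real"
  shows "\<bar>(fdiff h ^^ n) d x\<bar> \<le> 2 ^ n * (\<Sum>j\<le>n. \<bar>d (x + real j *\<^sub>R h)\<bar>)"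
proof (induction n arbitrary: x)
  case (Suc n)
  have s1: "(\<Sum>j\<le>n. \<bar>d (x + h + real j *\<^sub>R h)\<bar>) \<le> (\<Sum>j\<le>Suc n. \<bar>d (x + real j *\<^sub>R h)\<bar>)"
    by (subst sum.atMost_Suc_shift) (simp add: scaleR_add_left add.assoc add.commute add.left_commute)
  have s2: "(\<Sum>j\<le>n. \<bar>d (x + real j *\<^sub>R h)\<bar>) \<le> (\<Sum>j\<le>Suc n. \<bar>d (x + real j *\<^sub>R h)\<bar>)"
    by simp
  have "\<bar>(fdiff h ^^ Suc n) d x\<bar> \<le> \<bar>(fdiff h ^^ n) d (x + h)\<bar> + \<bar>(fdiff h ^^ n) d x\<bar>"
    unfolding fdiff_funpow_Suc(1) unfolding fdiff_def[of h "(fdiff h ^^ n) d"] by (rule abs_triangle_ineq4)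
  also have "\<dots> \<le> 2 ^ n * (\<Sum>j\<le>Suc n. \<bar>d (x + real j *\<^sub>R h)\<bar>) + 2 ^ n * (\<Sum>j\<le>Suc n. \<bar>d (x + real j *\<^sub>R h)\<bar>)"
    by (intro add_mono order_trans[OF Suc.IH] mult_left_mono s1 s2) auto
  finally show ?case by simp
qed simp

text \<open>An \<open>n\<close>-th difference at \<open>Z\<close> sees \<phi> only at the points
  \<open>Z + j h\<close> with \<open>j \<le> n\<close>. The measure \<open>N\<close> is the sum of
  the laws of these points, and approximating \<phi> by a continuous function in L^1 of
  \<open>N\<close> changes the expectation by an arbitrarily small amount.\<close>

lemma (in prob_space) fdiff_continuous_approx:
  fixes Z :: "'a \<Rightarrow> 'b::euclidean_space"
  assumes Z[measurable]: "Z \<in> borel_measurable M" and \<phi>: "bounded_borel B \<phi>"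
    and cont: "\<And>g. continuous_on UNIV g \<Longrightarrow> bounded_borel B g \<Longrightarrow> \<bar>\<integral>\<omega>. (fdiff h ^^ n) g (Z \<omega>) \<partial>M\<bar> \<le> K"
  shows "\<bar>\<integral>\<omega>. (fdiff h ^^ n) \<phi> (Z \<omega>) \<partial>M\<bar> \<le> K"
proof (rule field_le_epsilon)
  fix e :: real assume e: "0 < e"
  define N where "N = distr (count_space {..n} \<Otimes>\<^sub>M M) borel (\<lambda>p. Z (snd p) + real (fst p) *\<^sub>R h)"
  interpret C: finite_measure "count_space {..n}" by (rule finite_measure_count_space) simp
  interpret P: pair_sigma_finite "count_space {..n}" M ..
  have fin: "finite_measure (count_space {..n} \<Otimes>\<^sub>M M)"
    by (rule finite_measure_pair_measure) unfold_locales
  interpret CM: finite_measure "count_space {..n} \<Otimes>\<^sub>M M" by fact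
  have [measurable]: "(\<lambda>p. Z (snd p) + real (fst p) *\<^sub>R h) \<in> borel_measurable (count_space {..n} \<Otimes>\<^sub>M M)"
  proof -
    have [measurable]: "(\<lambda>p. real (fst p)) \<in> borel_measurable (count_space {..n} \<Otimes>\<^sub>M M)"
      by (rule measurable_compose[OF measurable_fst]) simp
    have [measurable]: "(\<lambda>p. Z (snd p)) \<in> borel_measurable (count_space {..n} \<Otimes>\<^sub>M M)"
      by (rule measurable_compose[OF measurable_snd Z])
    show ?thesis by measurable
  qed
  have finN: "finite_measure N" unfolding N_def by (rule CM.finite_measure_distr) measurable
  have N: "(\<integral>x. f x \<partial>N) = (\<Sum>j\<le>n. \<integral>\<omega>. f (Z \<omega> + real j *\<^sub>R h) \<partial>M)" if f: "bounded_borel B' f" for f :: "'b \<Rightarrow> real" and B'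
  proof -
    note [measurable] = bounded_borelD(1)[OF f]
    have "(\<integral>x. f x \<partial>N) = (\<integral>p. f (Z (snd p) + real (fst p) *\<^sub>R h) \<partial>(count_space {..n} \<Otimes>\<^sub>M M))"
      unfolding N_def by (rule integral_distr) measurable
    also have "\<dots> = (\<integral>j. (\<integral>\<omega>. f (Z \<omega> + real j *\<^sub>R h) \<partial>M) \<partial>count_space {..n})"
      using bounded_borelD(2)[OF f]
      by (subst P.integral_fst'[symmetric]) (auto intro!: CM.integrable_const_bound[of _ B'])
    also have "\<dots> = (\<Sum>j\<le>n. \<integral>\<omega>. f (Z \<omega> + real j *\<^sub>R h) \<partial>M)"
      by (simp add: lebesgue_integral_count_space_finite)
    finally show ?thesis .
  qed
  have "0 < e / 2 ^ n" using e by simp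
  from bounded_borel_continuous_approx[OF finN _ \<phi> this] obtain g where
    g: "continuous_on UNIV g" "bounded_borel B g" "(\<integral>x. \<bar>\<phi> x - g x\<bar> \<partial>N) < e / 2 ^ n"
    by (auto simp: N_def)
  note [measurable] = bounded_borelD(1)[OF \<phi>] bounded_borelD(1)[OF g(2)]
  have db: "bounded_borel (B + B) (\<lambda>x. \<phi> x - g x)" by (rule bounded_borel_diff[OF \<phi> g(2)])
  have adb: "bounded_borel (B + B) (\<lambda>x. \<bar>\<phi> x - g x\<bar>)" using db unfolding bounded_borel_def by auto
  have int: "integrable M (\<lambda>\<omega>. f (Z \<omega>))" if "bounded_borel K f" for K and f :: "'b \<Rightarrow> real"
    using bounded_borelD[OF that] by (intro integrable_const_bound[of _ K]) auto
  note i\<phi> = int[OF bounded_borel_fdiff_funpow[OF \<phi>]] and ig = int[OF bounded_borel_fdiff_funpow[OF g(2)]]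
  have idj: "integrable M (\<lambda>\<omega>. \<bar>\<phi> (Z \<omega> + real j *\<^sub>R h) - g (Z \<omega> + real j *\<^sub>R h)\<bar>)" for j
    by (rule int[OF bounded_borel_shift[OF adb]])
  have "(\<integral>\<omega>. (fdiff h ^^ n) \<phi> (Z \<omega>) \<partial>M) = (\<integral>\<omega>. (fdiff h ^^ n) g (Z \<omega>) \<partial>M) + (\<integral>\<omega>. (fdiff h ^^ n) (\<lambda>x. \<phi> x - g x) (Z \<omega>) \<partial>M)"
    unfolding fdiff_funpow_diff using Bochner_Integration.integral_diff[OF i\<phi> ig, of n h n h] by simp
  moreover have "\<bar>\<integral>\<omega>. (fdiff h ^^ n) (\<lambda>x. \<phi> x - g x) (Z \<omega>) \<partial>M\<bar> \<le> e"
  proof -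
    have "\<bar>\<integral>\<omega>. (fdiff h ^^ n) (\<lambda>x. \<phi> x - g x) (Z \<omega>) \<partial>M\<bar> \<le> (\<integral>\<omega>. \<bar>(fdiff h ^^ n) (\<lambda>x. \<phi> x - g x) (Z \<omega>)\<bar> \<partial>M)"
      by (rule integral_abs_bound)
    also have "\<dots> \<le> (\<integral>\<omega>. 2 ^ n * (\<Sum>j\<le>n. \<bar>\<phi> (Z \<omega> + real j *\<^sub>R h) - g (Z \<omega> + real j *\<^sub>R h)\<bar>) \<partial>M)"
    proof (rule integral_mono)
      show "integrable M (\<lambda>\<omega>. \<bar>(fdiff h ^^ n) (\<lambda>x. \<phi> x - g x) (Z \<omega>)\<bar>)"
        by (intro integrable_abs int[OF bounded_borel_fdiff_funpow[OF db]])
      show "integrable M (\<lambda>\<omega>. 2 ^ n * (\<Sum>j\<le>n. \<bar>\<phi> (Z \<omega> + real j *\<^sub>R h) - g (Z \<omega> + real j *\<^sub>R h)\<bar>))"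
        by (intro integrable_mult_right Bochner_Integration.integrable_sum idj)
    qed (rule abs_fdiff_funpow_le)
    also have "\<dots> = 2 ^ n * (\<integral>x. \<bar>\<phi> x - g x\<bar> \<partial>N)"
      unfolding N[OF adb] by (simp add: Bochner_Integration.integral_sum[OF idj])
    also have "\<dots> \<le> 2 ^ n * (e / 2 ^ n)" using g(3) by (intro mult_left_mono) auto
    finally show ?thesis by simp
  qed
  ultimately show "\<bar>\<integral>\<omega>. (fdiff h ^^ n) \<phi> (Z \<omega>) \<partial>M\<bar> \<le> K + e"
    using cont[OF g(1,2)] by linarith
qed

text \<open>The antiderivative is a multiple of the power 1/4 and stays bounded at the singularity.
  The bound does not involve the gap \<open>c - u\<close>, so it survives the removal of the
  mollification.\<close>

lemma powr_singular_integral: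
  fixes c s u :: real
  assumes su: "s \<le> u" "u < c"
  shows "set_integrable lborel {s<..u} (\<lambda>\<tau>. (c - \<tau>) powr (- 3 / 4))"
    and "(LINT \<tau>:{s<..u}|lborel. (c - \<tau>) powr (- 3 / 4)) \<le> 4 * (c - s) powr (1 / 4)"
proof -
  define f where "f = (\<lambda>\<tau>. (c - \<tau>) powr (- 3 / 4))"
  define F where "F = (\<lambda>\<tau>. - 4 * (c - \<tau>) powr (1 / 4))"
  have d: "(F has_real_derivative f \<tau>) (at \<tau>)" if "\<tau> \<le> u" for \<tau>
    unfolding F_def f_def using that su by (auto intro!: derivative_eq_intros)
  have c: "isCont f \<tau>" if "\<tau> \<le> u" for \<tau>
    unfolding f_def using that su by (auto intro!: continuous_intros)
  have "(\<integral>\<tau>. f \<tau> * indicator {s..u} \<tau> \<partial>lborel) = F u - F s" and i: "integrable lborel (\<lambda>\<tau>. f \<tau> * indicator {s..u} \<tau>)"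
    using integral_FTC_Icc_real[OF su(1), of F f] d c borel_integrable_atLeastAtMost[of s u f]
    by (auto simp: has_bochner_integral_iff indicator_def if_distrib cong: if_cong)
  then have eq: "(LINT \<tau>:{s..u}|lborel. f \<tau>) = F u - F s" and i': "set_integrable lborel {s..u} f"
    by (auto simp: set_lebesgue_integral_def set_integrable_def mult.commute)
  show i2: "set_integrable lborel {s<..u} (\<lambda>\<tau>. (c - \<tau>) powr (- 3 / 4))"
    unfolding f_def[symmetric] by (rule set_integrable_subset[OF i']) auto
  have "(LINT \<tau>:{s<..u}|lborel. f \<tau>) \<le> (LINT \<tau>:{s..u}|lborel. f \<tau>)"
    unfolding set_lebesgue_integral_def using i' i2
    by (intro integral_mono) (auto simp: set_integrable_def f_def indicator_def)
  also have "\<dots> \<le> 4 * (c - s) powr (1 / 4)" unfolding eq by (simp add: F_def)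
  finally show "(LINT \<tau>:{s<..u}|lborel. (c - \<tau>) powr (- 3 / 4)) \<le> 4 * (c - s) powr (1 / 4)"
    unfolding f_def .
qed

text \<open>The exponent 3/4 is the average of the exponents 1/2 and 1 of the bounds for a
  derivative of the heat flow and for the difference of that derivative.\<close>

lemma sqrt_mult_self_sqrt:
  fixes r :: real
  assumes "0 < r" shows "sqrt (1 / (sqrt r * r)) = r powr (- 3 / 4)"
proof -
  have "sqrt r * r = r powr (3 / 2)"
    using assms powr_add[of r "1/2" 1] by (simp add: powr_half_sqrt)
  then have "1 / (sqrt r * r) = r powr (- 3 / 2)" by (simp add: powr_minus_divide)
  then show ?thesis using assms by (simp add: powr_half_sqrt[symmetric] powr_powr)
qed

context mean_field begin

section \<open>The induction step: one more difference, half an order of smoothness\<close>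

text \<open>Duhamel's formula is applied to the difference of order \<open>Suc m\<close> of \<phi>.
  One of the differences is spent on the heat kernel, where interpolation gives
  \<open>sqrt (norm h)\<close>; the other \<open>m\<close> are given to the law and, through the
  product bound, to the drift. The constant is the same for all
  \<open>\<delta> \<le> 1\<close>.\<close>

lemma mollified_law_step:
  assumes a: "0 < a" and sm: "\<And>j. j \<le> m \<Longrightarrow> smooth_law j K (a / 2)"
    and t: "a \<le> t" and \<phi>: "bounded_borel B \<phi>" and \<delta>: "0 < \<delta>" "\<delta> \<le> 1"
  defines "C \<equiv> heat_const TYPE('a)"
  shows "\<bar>\<integral>\<omega>. (fdiff h ^^ Suc m) (heat \<delta> \<phi>) (Y t \<omega>) \<partial>M\<bar>
    \<le> (K * sqrt (2 * C / sqrt (a / 2)) + real DIM('a) * (2 ^ m * K * (K * \<beta>) * (C * sqrt 2)) * (4 * (1 + a / 2) powr (1 / 4))) * B * sqrt (norm h) ^ Suc m"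
proof -
  define \<rho> where "\<rho> = sqrt (norm h)"
  \<comment> \<open>Starting at distance \<open>a / 2\<close> before \<open>t\<close> leaves the
    heat kernel a fixed positive time and keeps all times involved above \<open>a / 2\<close>, where
    the induction hypothesis holds.\<close>
  define t0 where "t0 = t - a / 2"
  have \<rho>: "0 \<le> \<rho>" by (simp add: \<rho>_def)
  have t0: "0 \<le> t0" "t0 \<le> t" "a / 2 \<le> t0" using a t by (auto simp: t0_def)
  note B = bounded_borelD(3)[OF \<phi>]
  have C: "0 \<le> C" unfolding C_def by (rule heat_const_nonneg)
  have K: "0 \<le> K" using smooth_lawD(1)[OF sm[of 0]] by simp
  define \<phi>' where "\<phi>' = (fdiff h ^^ Suc m) \<phi>"
  have \<phi>': "bounded_borel (2 ^ Suc m * B) \<phi>'" unfolding \<phi>'_def by (rule bounded_borel_fdiff_funpow[OF \<phi>])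
  define q where "q = (\<lambda>\<tau>. \<integral>\<omega>. dheat (\<delta> + t - \<tau>) (drift \<tau> (Y \<tau> \<omega>)) \<phi>' (Y \<tau> \<omega>) \<partial>M)"
  have duh: "(\<integral>\<omega>. (fdiff h ^^ Suc m) (heat \<delta> \<phi>) (Y t \<omega>) \<partial>M)
     = (\<integral>\<omega>. heat (\<delta> + t - t0) \<phi>' (Y t0 \<omega>) \<partial>M) + (LINT \<tau>:{t0<..t}|lborel. q \<tau>)"
    using duhamel[OF \<phi>' \<delta>(1) t0(1,2)] unfolding q_def \<phi>'_def heat_fdiff_funpow[OF \<delta>(1) \<phi>] .
  have first: "\<bar>\<integral>\<omega>. heat (\<delta> + t - t0) \<phi>' (Y t0 \<omega>) \<partial>M\<bar> \<le> K * sqrt (2 * C / sqrt (a / 2)) * B * \<rho> ^ Suc m"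
  proof -
    define r where "r = \<delta> + t - t0"
    have r: "0 < r" "a / 2 \<le> r" using \<delta> a by (auto simp: r_def t0_def)
    \<comment> \<open>Interpolates between the trivial bound \<open>2 * B\<close> and the Lipschitz
      bound of the heat flow; since \<open>r\<close> is at least \<open>a / 2\<close> there is no
      singularity in this term.\<close>
    define \<theta> where "\<theta> = fdiff h (heat r \<phi>)"
    have hb: "bounded_borel B (heat r \<phi>)" by (rule heat_bounded[OF r(1) \<phi>])
    have "bounded_borel (sqrt (2 * C / sqrt (a / 2)) * B * \<rho>) \<theta>"
      unfolding bounded_borel_def
    proof (intro conjI allI)
      show "\<theta> \<in> borel_measurable borel" unfolding \<theta>_def by (rule bounded_borelD(1)[OF bounded_borel_fdiff[OF hb]])
      fix x
      have 1: "\<bar>\<theta> x\<bar> \<le> 2 * B" unfolding \<theta>_def by (rule bounded_borelD(2)[OF bounded_borel_fdiff[OF hb]])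
      have "\<bar>\<theta> x\<bar> \<le> C * B * norm h / sqrt r"
        unfolding \<theta>_def fdiff_def C_def by (rule heat_const_estimates(2)[OF r(1) \<phi>])
      also have "\<dots> \<le> C * B * norm h / sqrt (a / 2)" using C B r a by (intro frac_le) auto
      finally have 2: "\<bar>\<theta> x\<bar> \<le> C * B * norm h / sqrt (a / 2)" .
      have "\<bar>\<theta> x\<bar> \<le> sqrt (2 * B * (C * B * norm h / sqrt (a / 2)))"
        by (rule geometric_mean_bound[OF _ 1 2]) simp
      also have "2 * B * (C * B * norm h / sqrt (a / 2)) = (2 * C / sqrt (a / 2)) * (B * B) * norm h" by simp
      also have "sqrt \<dots> = sqrt (2 * C / sqrt (a / 2)) * B * \<rho>"
        unfolding real_sqrt_mult \<rho>_def using B by simp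
      finally show "\<bar>\<theta> x\<bar> \<le> sqrt (2 * C / sqrt (a / 2)) * B * \<rho>" .
    qed
    from smooth_lawD(2)[OF sm[of m] t0(3) this, of h]
    have "\<bar>\<integral>\<omega>. (fdiff h ^^ m) \<theta> (Y t0 \<omega>) \<partial>M\<bar> \<le> K * (sqrt (2 * C / sqrt (a / 2)) * B * \<rho>) * \<rho> ^ m"
      by (simp add: \<rho>_def)
    moreover have "heat r \<phi>' = (fdiff h ^^ m) \<theta>"
      unfolding \<phi>'_def \<theta>_def heat_fdiff_funpow[OF r(1) \<phi>] by (rule fdiff_funpow_Suc(2))
    ultimately show ?thesis unfolding r_def by (simp add: mult_ac)
  qed
  define Q where "Q = real DIM('a) * (2 ^ m * K * (K * \<beta>) * (C * sqrt 2)) * B * \<rho> ^ Suc m"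
  have Q: "0 \<le> Q" unfolding Q_def using K C B \<beta>_nonneg \<rho> by (intro mult_nonneg_nonneg) auto
  have qb: "\<bar>q \<tau>\<bar> \<le> Q * (\<delta> + t - \<tau>) powr (- 3 / 4)" if \<tau>: "\<tau> \<in> {t0<..t}" for \<tau>
  proof -
    define r where "r = \<delta> + t - \<tau>"
    have r: "0 < r" using \<tau> \<delta> by (simp add: r_def)
    have a2: "a / 2 \<le> \<tau>" using \<tau> t0 by simp
    \<comment> \<open>Interpolates between twice the bound for the derivative, of order
      \<open>1 / sqrt r\<close>, and the bound \<open>norm h / r\<close> for its difference. The
      result is \<open>sqrt (norm h)\<close> times \<open>r\<close> to the power -3/4, which is
      integrable up to the endpoint.\<close>
    define \<theta> where "\<theta> = (\<lambda>e. fdiff h (dheat r e \<phi>))"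
    define L where "L = C * sqrt 2 * B * \<rho> * r powr (- 3 / 4)"
    have \<theta>b: "bounded_borel L (\<theta> e)" if e: "e \<in> Basis" for e
      unfolding bounded_borel_def
    proof (intro conjI allI)
      note db = dheat_bounded[OF r \<phi>, of e]
      show "\<theta> e \<in> borel_measurable borel" unfolding \<theta>_def by (rule bounded_borelD(1)[OF bounded_borel_fdiff[OF db]])
      fix x
      have "\<bar>\<theta> e x\<bar> \<le> \<bar>dheat r e \<phi> (x + h)\<bar> + \<bar>dheat r e \<phi> x\<bar>" unfolding \<theta>_def fdiff_def by (rule abs_triangle_ineq4)
      also have "\<dots> \<le> C * B * norm e / sqrt r + C * B * norm e / sqrt r"
        unfolding C_def by (intro add_mono heat_const_estimates(3)[OF r \<phi>])
      finally have 1: "\<bar>\<theta> e x\<bar> \<le> 2 * C * B / sqrt r" using e by (simp add: mult_ac)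
      have 2: "\<bar>\<theta> e x\<bar> \<le> C * B * norm h / r"
        using heat_const_estimates(4)[OF r \<phi>, of e x h] e unfolding \<theta>_def fdiff_def C_def by simp
      have "\<bar>\<theta> e x\<bar> \<le> sqrt ((2 * C * B / sqrt r) * (C * B * norm h / r))"
        by (rule geometric_mean_bound[OF _ 1 2]) simp
      also have "(2 * C * B / sqrt r) * (C * B * norm h / r) = (C * C) * 2 * (B * B) * norm h * (1 / (sqrt r * r))" by simp
      also have "sqrt \<dots> = L"
        unfolding real_sqrt_mult sqrt_mult_self_sqrt[OF r, unfolded real_sqrt_mult] L_def \<rho>_def using B C
        using sqrt_mult_self_sqrt[OF r] by (simp add: real_sqrt_mult real_sqrt_divide)
      finally show "\<bar>\<theta> e x\<bar> \<le> L" .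
    qed
    have eq: "dheat r (drift \<tau> y) \<phi>' y = (\<Sum>e\<in>Basis. (drift \<tau> y \<bullet> e) * (fdiff h ^^ m) (\<theta> e) y)" for y
    proof -
      have "dheat r e \<phi>' = (fdiff h ^^ m) (\<theta> e)" for e
        unfolding \<phi>'_def \<theta>_def dheat_fdiff_funpow[OF r \<phi>] by (rule fdiff_funpow_Suc(2))
      then show ?thesis using dheat_sum_Basis[OF r \<phi>', of "drift \<tau> y" y] by simp
    qed
    have each: "\<bar>\<integral>\<omega>. (drift \<tau> (Y \<tau> \<omega>) \<bullet> e) * (fdiff h ^^ m) (\<theta> e) (Y \<tau> \<omega>) \<partial>M\<bar> \<le> 2 ^ m * K * (K * \<beta>) * L * \<rho> ^ m"
      if e: "e \<in> Basis" for e
    proof -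
      \<comment> \<open>The product bound with no outer difference: all \<open>m\<close> differences
        are moved from \<theta> to the law and to the component of the drift.\<close>
      have "\<bar>\<integral>\<omega>. (fdiff h ^^ 0) (\<lambda>x. (drift \<tau> x \<bullet> e) * (fdiff h ^^ m) (\<theta> e) x) (Y \<tau> \<omega>) \<partial>M\<bar> \<le> 2 ^ m * K * (K * \<beta>) * L * \<rho> ^ (0 + m)"
      proof (rule fdiff_product_bound[where m=m])
        show "\<bar>\<integral>\<omega>. (fdiff h ^^ i) \<psi> (Y \<tau> \<omega>) \<partial>M\<bar> \<le> K * B' * \<rho> ^ i" if "i \<le> m" "bounded_borel B' \<psi>" for i B' \<psi>
          unfolding \<rho>_def by (rule smooth_lawD(2)[OF sm[OF that(1)] a2 that(2)])
        show "bounded_borel (K * \<beta> * \<rho> ^ j) ((fdiff h ^^ j) (\<lambda>x. drift \<tau> x \<bullet> e))" if "j \<le> m" for j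
          unfolding \<rho>_def using e by (intro drift_smooth[OF sm[OF that] a2]) simp
      qed (use \<theta>b[OF e] in auto)
      then show ?thesis by simp
    qed
    have int: "integrable M (\<lambda>\<omega>. (drift \<tau> (Y \<tau> \<omega>) \<bullet> e) * (fdiff h ^^ m) (\<theta> e) (Y \<tau> \<omega>))" if e: "e \<in> Basis" for e
    proof -
      have "bounded_borel (K * \<beta>) (\<lambda>x. drift \<tau> x \<bullet> e)"
        using drift_smooth[OF sm[of 0] a2, of e h] e by simp
      from bounded_borel_mult[OF this bounded_borel_fdiff_funpow[OF \<theta>b[OF e], of m h]]
      show ?thesis by (rule integrable_bounded_borel) measurable
    qed
    have "q \<tau> = (\<Sum>e\<in>Basis. \<integral>\<omega>. (drift \<tau> (Y \<tau> \<omega>) \<bullet> e) * (fdiff h ^^ m) (\<theta> e) (Y \<tau> \<omega>) \<partial>M)"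
      unfolding q_def r_def[symmetric] eq by (rule Bochner_Integration.integral_sum[OF int])
    also have "\<bar>\<dots>\<bar> \<le> (\<Sum>e\<in>(Basis::'a set). 2 ^ m * K * (K * \<beta>) * L * \<rho> ^ m)"
      by (rule order_trans[OF sum_abs]) (intro sum_mono each)
    also have "\<dots> = Q * r powr (- 3 / 4)" by (simp add: Q_def L_def mult_ac)
    finally show ?thesis unfolding r_def .
  qed
  have \<phi>'q: "set_integrable lborel {t0<..t} q"
  proof -
    have "t0 < t" using a by (simp add: t0_def)
    then show ?thesis unfolding q_def using t0 by (intro duhamel_increment(2)[OF \<phi>' \<delta>(1)]) auto
  qed
  have pw: "set_integrable lborel {t0<..t} (\<lambda>\<tau>. (\<delta> + t - \<tau>) powr (- 3 / 4))"
    "(LINT \<tau>:{t0<..t}|lborel. (\<delta> + t - \<tau>) powr (- 3 / 4)) \<le> 4 * (\<delta> + t - t0) powr (1 / 4)"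
    using powr_singular_integral[OF t0(2), of "\<delta> + t"] \<delta> by auto
  have second: "\<bar>LINT \<tau>:{t0<..t}|lborel. q \<tau>\<bar> \<le> Q * (4 * (1 + a / 2) powr (1 / 4))"
  proof -
    have "\<bar>LINT \<tau>:{t0<..t}|lborel. q \<tau>\<bar> \<le> (LINT \<tau>:{t0<..t}|lborel. norm (q \<tau>))"
      using set_integral_norm_bound[OF \<phi>'q] by simp
    also have "\<dots> \<le> (LINT \<tau>:{t0<..t}|lborel. Q * (\<delta> + t - \<tau>) powr (- 3 / 4))"
      using qb by (intro set_integral_mono set_integrable_norm \<phi>'q set_integrable_mult_right pw) auto
    also have "\<dots> = Q * (LINT \<tau>:{t0<..t}|lborel. (\<delta> + t - \<tau>) powr (- 3 / 4))" by simp
    also have "\<dots> \<le> Q * (4 * (\<delta> + t - t0) powr (1 / 4))" by (intro mult_left_mono pw Q)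
    also have "\<dots> \<le> Q * (4 * (1 + a / 2) powr (1 / 4))"
      using \<delta> a by (intro mult_left_mono Q powr_mono2) (auto simp: t0_def)
    finally show ?thesis .
  qed
  have "\<bar>\<integral>\<omega>. (fdiff h ^^ Suc m) (heat \<delta> \<phi>) (Y t \<omega>) \<partial>M\<bar> \<le> K * sqrt (2 * C / sqrt (a / 2)) * B * \<rho> ^ Suc m + Q * (4 * (1 + a / 2) powr (1 / 4))"
    unfolding duh by (rule order_trans[OF abs_triangle_ineq add_mono[OF first second]])
  also have "\<dots> = (K * sqrt (2 * C / sqrt (a / 2)) + real DIM('a) * (2 ^ m * K * (K * \<beta>) * (C * sqrt 2)) * (4 * (1 + a / 2) powr (1 / 4))) * B * \<rho> ^ Suc m"
    unfolding Q_def by (simp add: algebra_simps)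
  finally show ?thesis unfolding \<rho>_def .
qed

text \<open>For continuous test functions the mollification is removed by dominated convergence, as
  the constant of \<open>mollified_law_step\<close> is independent of \<delta>. Bounded Borel test
  functions then follow from \<open>fdiff_continuous_approx\<close>.\<close>

lemma smooth_law_step:
  assumes "\<And>a. 0 < a \<Longrightarrow> \<exists>K. \<forall>j\<le>m. smooth_law j K a" and a: "0 < a"
  shows "\<exists>K. smooth_law (Suc m) K a"
proof -
  define C where "C = heat_const TYPE('a)"
  obtain K where K: "\<And>j. j \<le> m \<Longrightarrow> smooth_law j K (a / 2)" using assms(1)[of "a / 2"] a by auto
  have C: "0 \<le> C" unfolding C_def by (rule heat_const_nonneg)
  have K0: "0 \<le> K" using smooth_lawD(1)[OF K[of 0]] by simp
  define L where "L = K * sqrt (2 * C / sqrt (a / 2)) + real DIM('a) * (2 ^ m * K * (K * \<beta>) * (C * sqrt 2)) * (4 * (1 + a / 2) powr (1 / 4))"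
  have L: "0 \<le> L" unfolding L_def using K0 C \<beta>_nonneg a by (intro add_nonneg_nonneg mult_nonneg_nonneg) auto
  have "smooth_law (Suc m) L a"
    unfolding smooth_law_def
  proof (intro conjI allI impI L)
    fix t B and h :: 'a and \<phi> :: "'a \<Rightarrow> real" assume t: "a \<le> t" and \<phi>: "bounded_borel B \<phi>"
    show "\<bar>\<integral>\<omega>. (fdiff h ^^ Suc m) \<phi> (Y t \<omega>) \<partial>M\<bar> \<le> L * B * sqrt (norm h) ^ Suc m"
    proof (rule fdiff_continuous_approx[OF _ \<phi>])
      fix g :: "'a \<Rightarrow> real" assume c: "continuous_on UNIV g" and g: "bounded_borel B g"
      have bd: "bounded_borel (2 ^ Suc m * B) ((fdiff h ^^ Suc m) g)" by (rule bounded_borel_fdiff_funpow[OF g])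
      have lim: "(\<lambda>n. \<integral>\<omega>. heat (1 / real (Suc n)) ((fdiff h ^^ Suc m) g) (Y t \<omega>) \<partial>M) \<longlonglongrightarrow> (\<integral>\<omega>. (fdiff h ^^ Suc m) g (Y t \<omega>) \<partial>M)"
      proof (rule integral_dominated_convergence[where w="\<lambda>_. 2 ^ Suc m * B"])
        have hb: "bounded_borel (2 ^ Suc m * B) (heat (1 / real (Suc n)) ((fdiff h ^^ Suc m) g))" for n
          by (rule heat_bounded[OF _ bd]) simp
        show "(\<lambda>\<omega>. heat (1 / real (Suc n)) ((fdiff h ^^ Suc m) g) (Y t \<omega>)) \<in> borel_measurable M" for n
          by (rule borel_measurable_integrable[OF integrable_bounded_borel[OF hb]]) measurable
        show "(\<lambda>\<omega>. (fdiff h ^^ Suc m) g (Y t \<omega>)) \<in> borel_measurable M"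
          by (rule borel_measurable_integrable[OF integrable_bounded_borel[OF bd]]) measurable
        show "AE \<omega> in M. norm (heat (1 / real (Suc n)) ((fdiff h ^^ Suc m) g) (Y t \<omega>)) \<le> 2 ^ Suc m * B" for n
          using bounded_borelD(2)[OF hb] by (intro AE_I2) simp
        show "AE \<omega> in M. (\<lambda>n. heat (1 / real (Suc n)) ((fdiff h ^^ Suc m) g) (Y t \<omega>)) \<longlonglongrightarrow> (fdiff h ^^ Suc m) g (Y t \<omega>)"
          by (intro AE_I2 heat_tendsto_id[OF bd continuous_on_fdiff_funpow[OF c]] LIMSEQ_Suc[OF lim_1_over_n]) simp
      qed simp
      show "\<bar>\<integral>\<omega>. (fdiff h ^^ Suc m) g (Y t \<omega>) \<partial>M\<bar> \<le> L * B * sqrt (norm h) ^ Suc m"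
      proof (rule tendsto_upperbound[OF tendsto_rabs[OF lim]])
        show "\<forall>\<^sub>F n in sequentially. \<bar>\<integral>\<omega>. heat (1 / real (Suc n)) ((fdiff h ^^ Suc m) g) (Y t \<omega>) \<partial>M\<bar> \<le> L * B * sqrt (norm h) ^ Suc m"
        proof (rule always_eventually, rule allI)
          fix n
          have p: "0 < 1 / real (Suc n)" by simp
          show "\<bar>\<integral>\<omega>. heat (1 / real (Suc n)) ((fdiff h ^^ Suc m) g) (Y t \<omega>) \<partial>M\<bar> \<le> L * B * sqrt (norm h) ^ Suc m"
            unfolding heat_fdiff_funpow[OF p g] L_def C_def by (rule mollified_law_step[OF a K t g p]) simp_all
        qed
      qed simp
    qed simp
  qed
  then show ?thesis ..
qed

text \<open>Each step halves the starting time and the product bound uses all lower orders. Hence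
  the induction carries all \<open>a > 0\<close> and all orders up to \<open>n\<close> together,
  with a common constant obtained as a maximum.\<close>

theorem smooth_law_all:
  assumes "0 < a" shows "\<exists>K. smooth_law n K a"
proof -
  have "\<exists>K. \<forall>j\<le>n. smooth_law j K a" if "0 < a" for a
    using that
  proof (induction n arbitrary: a)
    case 0 then show ?case using smooth_law_0 by auto
  next
    case (Suc n)
    obtain K where K: "\<And>j. j \<le> n \<Longrightarrow> smooth_law j K a" using Suc by blast
    obtain K' where K': "smooth_law (Suc n) K' a" using smooth_law_step[OF Suc.IH Suc.prems] by blast
    have mono: "smooth_law j (max K K') a" if "smooth_law j L a" "L \<le> max K K'" for j L
      unfolding smooth_law_def
    proof (intro conjI allI impI)
      show "0 \<le> max K K'" using smooth_lawD(1)[OF that(1)] that(2) by simp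
      fix t B and h :: 'a and \<phi> :: "'a \<Rightarrow> real" assume t: "a \<le> t" and \<phi>: "bounded_borel B \<phi>"
      have "L * B * sqrt (norm h) ^ j \<le> max K K' * B * sqrt (norm h) ^ j"
        using that(2) bounded_borelD(3)[OF \<phi>] by (intro mult_right_mono) auto
      then show "\<bar>\<integral>\<omega>. (fdiff h ^^ j) \<phi> (Y t \<omega>) \<partial>M\<bar> \<le> max K K' * B * sqrt (norm h) ^ j"
        using smooth_lawD(2)[OF that(1) t \<phi>, of h] by linarith
    qed
    have "smooth_law j (max K K') a" if "j \<le> Suc n" for j
      using that mono[OF K] mono[OF K'] by (cases "j = Suc n") auto
    then show ?case by blast
  qed
  then show ?thesis using assms by blast
qed

end

section \<open>The McKean-Vlasov equation\<close>

locale mckean_vlasov =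
  fixes M :: "'w measure" and F :: "real \<Rightarrow> 'w measure" and W :: "real \<Rightarrow> 'w \<Rightarrow> 'a::euclidean_space"
    and b :: "real \<Rightarrow> 'a \<Rightarrow> 'a" and X :: "real \<Rightarrow> 'w \<Rightarrow> 'a"
  assumes b_measurable: "set_borel_measurable borel ({0..} \<times> UNIV) (\<lambda>(t, x). b t x)"
    and b_bounded: "\<exists>C. AE (t, x) in lborel. 0 \<le> t \<longrightarrow> norm (b t x) \<le> C"
    and solution: "mckean_vlasov_solution M F W b X"

sublocale mckean_vlasov \<subseteq> prob_space M
  using solution by (simp add: mckean_vlasov_solution_def filtered_prob_space_def)

context mckean_vlasov begin

lemma space_F: "0 \<le> t \<Longrightarrow> space (F t) = space M"
  and sets_F_subset: "0 \<le> t \<Longrightarrow> sets (F t) \<subseteq> sets M"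
  and sets_F_mono: "0 \<le> s \<Longrightarrow> s \<le> t \<Longrightarrow> sets (F s) \<subseteq> sets (F t)"
  using solution by (auto simp: mckean_vlasov_solution_def filtered_prob_space_def subalgebra_def)

lemma measurable_F_mono:
  assumes "f \<in> measurable (F s) N" "0 \<le> s" "s \<le> t"
  shows "f \<in> measurable (F t) N"
  using assms sets_F_mono[OF assms(2,3)] space_F[of s] space_F[of t] by (auto simp: measurable_def)

lemma measurable_F_M:
  assumes "f \<in> measurable (F s) N" "0 \<le> s"
  shows "f \<in> measurable M N"
  using assms sets_F_subset[OF assms(2)] space_F[of s] by (auto simp: measurable_def)

lemma adapted_XW: "adapted F X" "adapted F W"
  using solution by (simp_all add: mckean_vlasov_solution_def brownian_motion_def)

lemma X_adapted: "0 \<le> s \<Longrightarrow> s \<le> t \<Longrightarrow> X s \<in> borel_measurable (F t)"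
  by (rule measurable_F_mono[of _ s]) (use adapted_XW(1) in \<open>auto simp: adapted_def\<close>)

lemma X_measurable: "0 \<le> s \<Longrightarrow> X s \<in> borel_measurable M"
  and W_measurable: "0 \<le> s \<Longrightarrow> W s \<in> borel_measurable M"
  using adapted_XW measurable_F_M[of _ s] by (auto simp: adapted_def)

text \<open>\<open>K\<close> may take values in any measurable space, so that it can carry the
  position \<open>X s\<close> alone or together with a weight that depends on the path up to time
  \<open>s\<close>.\<close>

lemma W_increment:
  assumes st: "0 \<le> s" "s < t" and K: "K \<in> measurable (F s) N"
  shows "distr M (N \<Otimes>\<^sub>M borel) (\<lambda>\<omega>. (K \<omega>, W t \<omega> - W s \<omega>)) = distr M N K \<Otimes>\<^sub>M gauss (t - s)"
proof -
  have [measurable]: "W t \<in> borel_measurable M" "W s \<in> borel_measurable M" using W_measurable st by auto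
  have KM: "K \<in> measurable M N" using measurable_F_M[OF K] st by simp
  have bm: "distributed M lborel (\<lambda>\<omega>. W t \<omega> - W s \<omega>) (\<lambda>x. ennreal (\<Prod>e\<in>Basis. normal_density 0 (sqrt (t - s)) (x \<bullet> e)))"
    and ind: "indep_set (sets (F s)) (sets (vimage_algebra (space M) (\<lambda>\<omega>. W t \<omega> - W s \<omega>) borel))"
    using solution st by (auto simp: mckean_vlasov_solution_def brownian_motion_def)
  have "distr M lborel (\<lambda>\<omega>. W t \<omega> - W s \<omega>) = gauss (t - s)"
    using bm by (simp add: distributed_def gauss_def gauss_density_def)
  then have law: "distr M borel (\<lambda>\<omega>. W t \<omega> - W s \<omega>) = gauss (t - s)"
    by (metis distr_cong sets_lborel)
  interpret D: prob_space "distr M N K" by (rule prob_space_distr[OF KM])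
  interpret G: prob_space "gauss (t - s) :: 'a measure" using st by (intro prob_space_gauss) simp
  have "distr M N K \<Otimes>\<^sub>M gauss (t - s) = distr M (N \<Otimes>\<^sub>M borel) (\<lambda>\<omega>. (K \<omega>, W t \<omega> - W s \<omega>))"
  proof (rule pair_measure_eqI)
    show "sets (distr M N K \<Otimes>\<^sub>M gauss (t - s)) = sets (distr M (N \<Otimes>\<^sub>M borel) (\<lambda>\<omega>. (K \<omega>, W t \<omega> - W s \<omega>)))"
      by (simp cong: sets_pair_measure_cong)
    fix A and B :: "'a set" assume "A \<in> sets (distr M N K)" "B \<in> sets (gauss (t - s))"
    then have A: "A \<in> sets N" and [measurable]: "B \<in> sets borel" by simp_all
    have "K -` A \<inter> space M \<in> sets (F s)" using measurable_sets[OF K A] space_F[OF st(1)] by simp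
    moreover have "(\<lambda>\<omega>. W t \<omega> - W s \<omega>) -` B \<inter> space M \<in> sets (vimage_algebra (space M) (\<lambda>\<omega>. W t \<omega> - W s \<omega>) borel)"
      by (rule in_vimage_algebra) simp
    ultimately have "prob ((K -` A \<inter> space M) \<inter> ((\<lambda>\<omega>. W t \<omega> - W s \<omega>) -` B \<inter> space M))
        = prob (K -` A \<inter> space M) * prob ((\<lambda>\<omega>. W t \<omega> - W s \<omega>) -` B \<inter> space M)"
      using ind by (intro indep_setD)
    moreover have "(\<lambda>\<omega>. (K \<omega>, W t \<omega> - W s \<omega>)) -` (A \<times> B) \<inter> space M = (K -` A \<inter> space M) \<inter> ((\<lambda>\<omega>. W t \<omega> - W s \<omega>) -` B \<inter> space M)"
      by auto
    ultimately show "emeasure (distr M N K) A * emeasure (gauss (t - s)) B = emeasure (distr M (N \<Otimes>\<^sub>M borel) (\<lambda>\<omega>. (K \<omega>, W t \<omega> - W s \<omega>))) (A \<times> B)"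
      using A KM unfolding law[symmetric]
      by (simp add: emeasure_distr emeasure_eq_measure ennreal_mult)
  qed unfold_locales
  then show ?thesis ..
qed

text \<open>Approximates \<open>r\<close> from below on the grid of mesh
  \<open>1 / real (Suc n)\<close>. Countably many values make \<open>X (floor_time n r)\<close>
  jointly measurable, and approximation from below never looks beyond time \<open>r\<close>. The
  maximum with 0 takes care of negative times.\<close>

definition floor_time :: "nat \<Rightarrow> real \<Rightarrow> real" where
  "floor_time n r = max 0 (of_int \<lfloor>real (Suc n) * r\<rfloor> / real (Suc n))"

lemma floor_time: "0 \<le> floor_time n r" "0 \<le> r \<Longrightarrow> floor_time n r \<le> r" "0 \<le> r \<Longrightarrow> r - 1 / real (Suc n) \<le> floor_time n r"
proof -
  show "0 \<le> floor_time n r" by (simp add: floor_time_def)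
  show "floor_time n r \<le> r" if "0 \<le> r"
  proof -
    have "of_int \<lfloor>real (Suc n) * r\<rfloor> / real (Suc n) \<le> r"
      using of_int_floor_le[of "real (Suc n) * r"] by (simp add: divide_le_eq mult.commute)
    then show ?thesis using that unfolding floor_time_def by simp
  qed
  show "r - 1 / real (Suc n) \<le> floor_time n r" if "0 \<le> r"
  proof -
    have "(r - 1 / real (Suc n)) * real (Suc n) = real (Suc n) * r - 1" by (simp add: algebra_simps)
    also have "\<dots> \<le> of_int \<lfloor>real (Suc n) * r\<rfloor>" by linarith
    finally have "r - 1 / real (Suc n) \<le> of_int \<lfloor>real (Suc n) * r\<rfloor> / real (Suc n)" by (simp add: pos_le_divide_eq)
    then show ?thesis unfolding floor_time_def by simp
  qed
qed

lemma floor_time_tendsto: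
  assumes "0 \<le> r" shows "(\<lambda>n. floor_time n r) \<longlonglongrightarrow> r"
proof (rule tendsto_sandwich)
  show "(\<lambda>n. r - 1 / real (Suc n)) \<longlonglongrightarrow> r"
    using tendsto_diff[OF tendsto_const LIMSEQ_Suc[OF lim_1_over_n], of r] by simp
qed (use floor_time assms in auto)

text \<open>A jointly measurable modification of \<open>X\<close>, needed because only almost all paths of \<open>X\<close> are
  continuous and the filtration need not be complete.\<close>

definition Xmod :: "real \<Rightarrow> 'w \<Rightarrow> 'a" where
  "Xmod r \<omega> = lim (\<lambda>n. X (floor_time n r) \<omega>)"

text \<open>The same limit with the times cut off at \<open>s\<close>. It is jointly measurable for
  \<open>F s\<close> and agrees with \<open>Xmod\<close> up to time \<open>s\<close>; path
  functionals become adapted through it.\<close>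

definition clamped_path :: "real \<Rightarrow> real \<Rightarrow> 'w \<Rightarrow> 'a" where
  "clamped_path s r \<omega> = lim (\<lambda>n. X (min s (floor_time n r)) \<omega>)"

lemma clamped_path_eq: "0 \<le> r \<Longrightarrow> r \<le> s \<Longrightarrow> clamped_path s r = Xmod r"
proof -
  assume r: "0 \<le> r" "r \<le> s"
  have "min s (floor_time n r) = floor_time n r" for n using floor_time(2)[OF r(1), of n] r(2) by simp
  then show "clamped_path s r = Xmod r" by (simp add: clamped_path_def Xmod_def fun_eq_iff)
qed

lemma Xmod_joint: "(\<lambda>p. Xmod (fst p) (snd p)) \<in> borel_measurable (borel \<Otimes>\<^sub>M M)"
  unfolding Xmod_def
proof (rule borel_measurable_lim_metric)
  fix n
  have [measurable]: "X (max 0 c) \<in> borel_measurable M" for c by (rule X_measurable) simp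
  show "(\<lambda>p. X (floor_time n (fst p)) (snd p)) \<in> borel_measurable (borel \<Otimes>\<^sub>M M)"
    unfolding floor_time_def
    by (rule measurable_compose_countable[where f="\<lambda>k p. X (max 0 (of_int k / real (Suc n))) (snd p)" and g="\<lambda>p. \<lfloor>real (Suc n) * fst p\<rfloor>"]) measurable
qed

lemma clamped_path_joint:
  assumes s: "0 \<le> s"
  shows "(\<lambda>p. clamped_path s (fst p) (snd p)) \<in> borel_measurable (borel \<Otimes>\<^sub>M F s)"
  unfolding clamped_path_def
proof (rule borel_measurable_lim_metric)
  fix n
  have [measurable]: "X (min s (max 0 c)) \<in> borel_measurable (F s)" for c by (rule X_adapted) (use s in auto)
  show "(\<lambda>p. X (min s (floor_time n (fst p))) (snd p)) \<in> borel_measurable (borel \<Otimes>\<^sub>M F s)"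
    unfolding floor_time_def
    by (rule measurable_compose_countable[where f="\<lambda>k p. X (min s (max 0 (of_int k / real (Suc n)))) (snd p)" and g="\<lambda>p. \<lfloor>real (Suc n) * fst p\<rfloor>"]) measurable
qed

lemma Xmod_measurable: "Xmod r \<in> borel_measurable M"
  using measurable_compose[OF _ Xmod_joint, of "\<lambda>\<omega>. (r, \<omega>)" M] by simp

text \<open>Extension by zero to negative times turns measurability on the half space into
  measurability on the whole product.\<close>

definition b0 :: "real \<Rightarrow> 'a \<Rightarrow> 'a" where
  "b0 t x = (if 0 \<le> t then b t x else 0)"

lemma b0_joint: "(\<lambda>p. b0 (fst p) (snd p)) \<in> borel_measurable (borel \<Otimes>\<^sub>M borel)"
proof -
  have "(\<lambda>p. indicator ({0..} \<times> UNIV) p *\<^sub>R (case p of (t, x) \<Rightarrow> b t x)) = (\<lambda>p. b0 (fst p) (snd p))"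
    by (auto simp: b0_def indicator_def fun_eq_iff)
  then show ?thesis
    using b_measurable unfolding set_borel_measurable_def borel_prod by simp
qed

lemma b0_measurable: "b0 t \<in> borel_measurable borel"
  using measurable_compose[OF _ b0_joint, of "\<lambda>x. (t, x)" borel] by simp

text \<open>The drift as a function of position. No bound is available for it at this stage, since
  the law may still charge the null set on which \<open>b\<close> is large.\<close>

definition vel :: "real \<Rightarrow> 'a \<Rightarrow> 'a" where
  "vel t x = (\<integral>\<omega>. b0 t (x - Xmod t \<omega>) \<partial>M)"

lemma vel_joint: "(\<lambda>p. vel (fst p) (snd p)) \<in> borel_measurable (borel \<Otimes>\<^sub>M borel)"
proof -
  have 1: "(\<lambda>q. Xmod (fst (fst q)) (snd q)) \<in> borel_measurable ((borel \<Otimes>\<^sub>M (borel :: 'a measure)) \<Otimes>\<^sub>M M)"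
    using measurable_compose[OF _ Xmod_joint, of "\<lambda>q. (fst (fst q), snd q)" "(borel \<Otimes>\<^sub>M (borel :: 'a measure)) \<Otimes>\<^sub>M M"] by simp
  have "(\<lambda>q. b0 (fst (fst q)) (snd (fst q) - Xmod (fst (fst q)) (snd q))) \<in> borel_measurable ((borel \<Otimes>\<^sub>M borel) \<Otimes>\<^sub>M M)"
    using measurable_compose[OF _ b0_joint, of "\<lambda>q. (fst (fst q), snd (fst q) - Xmod (fst (fst q)) (snd q))" "(borel \<Otimes>\<^sub>M borel) \<Otimes>\<^sub>M M"] 1
    by simp
  then show ?thesis
    unfolding vel_def by (intro borel_measurable_lebesgue_integral) (simp add: case_prod_beta')
qed

definition good :: "'w \<Rightarrow> bool" where
  "good \<omega> \<longleftrightarrow> (\<forall>t\<ge>0. Xmod t \<omega> = X t \<omega> \<and> set_integrable lborel {0..t} (\<lambda>s. vel s (Xmod s \<omega>))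
     \<and> Xmod t \<omega> = Xmod 0 \<omega> + (LINT s:{0..t}|lborel. vel s (Xmod s \<omega>)) + W t \<omega>)"

text \<open>For almost every path the equation expresses \<open>X\<close> by an indefinite integral
  plus a continuous Brownian path, so \<open>X\<close> is continuous and the grid limits defining
  \<open>Xmod\<close> recover it at all times at once. The integrand may then be rewritten with
  \<open>vel\<close>, as \<open>X s\<close> and \<open>Xmod s\<close> have the same law.\<close>

lemma good_AE: "AE \<omega> in M. good \<omega>"
proof -
  have bm: "AE \<omega> in M. continuous_on {0..} (\<lambda>t. W t \<omega>)"
    and eq: "AE \<omega> in M. \<forall>t\<ge>0.
        set_integrable lborel {0..t} (\<lambda>s. pairing b s (X s \<omega>) (law M (X s))) \<and>
        X t \<omega> = X 0 \<omega> + (LINT s:{0..t}|lborel. pairing b s (X s \<omega>) (law M (X s))) + W t \<omega>"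
    using solution by (auto simp: mckean_vlasov_solution_def brownian_motion_def)
  have Xmod_eq: "Xmod t \<omega> = X t \<omega>"
    if w: "continuous_on {0..} (\<lambda>t. W t \<omega>)" and e: "\<And>t. 0 \<le> t \<Longrightarrow>
        set_integrable lborel {0..t} (\<lambda>s. pairing b s (X s \<omega>) (law M (X s))) \<and>
        X t \<omega> = X 0 \<omega> + (LINT s:{0..t}|lborel. pairing b s (X s \<omega>) (law M (X s))) + W t \<omega>" and t: "0 \<le> t" for t \<omega>
  proof -
    define u where "u = (\<lambda>s. pairing b s (X s \<omega>) (law M (X s)))"
    have ui: "set_integrable lborel {0..r} u" if "0 \<le> r" for r using e[OF that] by (simp add: u_def)
    have Xeq: "X r \<omega> = X 0 \<omega> + integral {0..r} u + W r \<omega>" if "0 \<le> r" for r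
      using e[OF that] set_borel_integral_eq_integral(2)[OF ui[OF that]] by (simp add: u_def)
    have "continuous_on {0..t} (\<lambda>r. X 0 \<omega> + integral {0..r} u + W r \<omega>)"
      by (intro continuous_intros indefinite_integral_continuous_1 set_borel_integral_eq_integral(1)[OF ui[OF t]] continuous_on_subset[OF w]) auto
    then have c: "continuous_on {0..t} (\<lambda>r. X r \<omega>)" by (rule continuous_on_eq) (rule Xeq[symmetric], simp)
    have "(\<lambda>n. X (floor_time n t) \<omega>) \<longlonglongrightarrow> X t \<omega>"
      by (rule continuous_on_tendsto_compose[OF c floor_time_tendsto[OF t]]) (use t floor_time in auto)
    then show "Xmod t \<omega> = X t \<omega>" unfolding Xmod_def by (rule limI)
  qed
  have pe: "AE \<omega> in M. \<forall>t\<ge>0. Xmod t \<omega> = X t \<omega>"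
    using bm eq by eventually_elim (use Xmod_eq in blast)
  have law: "pairing b s x (law M (X s)) = vel s x" if s: "0 \<le> s" for s x
  proof -
    have [measurable]: "b s \<in> borel_measurable borel"
      using b0_measurable[of s] s unfolding b0_def[abs_def] by simp
    have [measurable]: "X s \<in> borel_measurable M" "Xmod s \<in> borel_measurable M" using X_measurable[OF s] Xmod_measurable by auto
    have "pairing b s x (law M (X s)) = (\<integral>\<omega>. b s (x - X s \<omega>) \<partial>M)"
      unfolding pairing_def law_def by (rule integral_distr) measurable
    also have "\<dots> = (\<integral>\<omega>. b s (x - Xmod s \<omega>) \<partial>M)"
      by (rule integral_cong_AE) (use pe s in \<open>auto elim: eventually_mono\<close>)
    finally show ?thesis using s by (simp add: vel_def b0_def)
  qed
  show ?thesis
    using pe eq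
  proof eventually_elim
    case (elim \<omega>)
    show ?case unfolding good_def
    proof (intro allI impI conjI)
      fix t :: real assume t: "0 \<le> t"
      show p: "Xmod t \<omega> = X t \<omega>" using elim(1) t by blast
      have cong: "pairing b s (X s \<omega>) (law M (X s)) = vel s (Xmod s \<omega>)" if "s \<in> {0..t}" for s
        using law[of s] elim(1) that by simp
      have ind: "(\<lambda>s. indicator {0..t} s *\<^sub>R pairing b s (X s \<omega>) (law M (X s))) = (\<lambda>s. indicator {0..t} s *\<^sub>R vel s (Xmod s \<omega>))"
      proof
        fix s show "indicator {0..t} s *\<^sub>R pairing b s (X s \<omega>) (law M (X s)) = indicator {0..t} s *\<^sub>R vel s (Xmod s \<omega>)"
          using cong[of s] by (cases "s \<in> {0..t}") simp_all
      qed
      show "set_integrable lborel {0..t} (\<lambda>s. vel s (Xmod s \<omega>))"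
        using elim(2)[rule_format, OF t, THEN conjunct1] unfolding set_integrable_def ind .
      have i: "(LINT s:{0..t}|lborel. pairing b s (X s \<omega>) (law M (X s))) = (LINT s:{0..t}|lborel. vel s (Xmod s \<omega>))"
        unfolding set_lebesgue_integral_def ind ..
      have p0: "Xmod 0 \<omega> = X 0 \<omega>" using elim(1) by simp
      show "Xmod t \<omega> = Xmod 0 \<omega> + (LINT s:{0..t}|lborel. vel s (Xmod s \<omega>)) + W t \<omega>"
        unfolding p p0 using elim(2)[rule_format, OF t, THEN conjunct2] unfolding i .
    qed
  qed
qed

section \<open>An exponential weight that tames the unbounded drift\<close>

definition variation :: "real \<Rightarrow> 'w \<Rightarrow> ennreal" where
  "variation t \<omega> = (\<integral>\<^sup>+s. indicator {0..t} s * ennreal (norm (vel s (Xmod s \<omega>))) \<partial>lborel)"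

text \<open>The drift is only known to be integrable along almost every path, so its effect on an
  expectation cannot be bounded directly. Under this weight the displacement over an interval is
  dominated by the decrease of the weight itself, whose expectation is a monotone function with
  values in the unit interval. The weight never vanishes, so null sets of the weighted law are null
  for the law.\<close>

definition weight :: "real \<Rightarrow> 'w \<Rightarrow> real" where
  "weight t \<omega> = exp (- enn2real (variation t \<omega>))"

text \<open>The variation up to \<open>t\<close> is rewritten with \<open>clamped_path\<close>,
  which involves the path up to time \<open>t\<close> only.\<close>

lemma weight_measurable_F:
  assumes t: "0 \<le> t"
  shows "weight t \<in> borel_measurable (F t)"
proof -
  have [measurable]: "(\<lambda>p. vel (snd p) (clamped_path t (snd p) (fst p))) \<in> borel_measurable (F t \<Otimes>\<^sub>M lborel)"
    using measurable_compose[OF _ vel_joint, of "\<lambda>p. (snd p, clamped_path t (snd p) (fst p))" "F t \<Otimes>\<^sub>M lborel"]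
      measurable_compose[OF _ clamped_path_joint[OF t], of "\<lambda>p. (snd p, fst p)" "F t \<Otimes>\<^sub>M lborel"] by simp
  have "variation t = (\<lambda>\<omega>. \<integral>\<^sup>+s. indicator {0..t} s * ennreal (norm (vel s (clamped_path t s \<omega>))) \<partial>lborel)"
    unfolding variation_def using clamped_path_eq[of _ t]
    by (intro ext nn_integral_cong) (auto simp: indicator_def)
  also have "\<dots> \<in> borel_measurable (F t)"
    by (rule lborel.borel_measurable_nn_integral) (simp add: case_prod_beta')
  finally have [measurable]: "variation t \<in> borel_measurable (F t)" .
  show ?thesis unfolding weight_def[abs_def] by measurable
qed

lemma weight_bounds: "0 < weight t \<omega>" "weight t \<omega> \<le> 1"
  by (simp_all add: weight_def)

lemma weight_neg: "t \<le> 0 \<Longrightarrow> weight t \<omega> = 1"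
proof -
  assume t: "t \<le> 0"
  have "AE s in lborel. indicator {0..t} s * ennreal (norm (vel s (Xmod s \<omega>))) = 0"
    using AE_lborel_singleton[of "0::real"] by eventually_elim (use t in \<open>auto simp: indicator_def\<close>)
  then have "variation t \<omega> = 0" unfolding variation_def by (subst nn_integral_cong_AE) auto
  then show ?thesis by (simp add: weight_def)
qed

lemma variation_increment:
  assumes g: "good \<omega>" and st: "0 \<le> s" "s \<le> t"
  shows "norm (Xmod t \<omega> - Xmod s \<omega> - (W t \<omega> - W s \<omega>)) \<le> enn2real (variation t \<omega>) - enn2real (variation s \<omega>)"
proof -
  define v where "v = (\<lambda>s. vel s (Xmod s \<omega>))"
  have vi: "set_integrable lborel {0..r} v" if "0 \<le> r" for r using g that by (simp add: good_def v_def)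
  have var: "enn2real (variation r \<omega>) = (LINT s:{0..r}|lborel. norm (v s))" if "0 \<le> r" for r
  proof -
    have i: "integrable lborel (\<lambda>s. indicator {0..r} s *\<^sub>R norm (v s))"
      using set_integrable_norm[OF vi[OF that]] by (simp add: set_integrable_def)
    have "variation r \<omega> = (\<integral>\<^sup>+s. ennreal (indicator {0..r} s *\<^sub>R norm (v s)) \<partial>lborel)"
      unfolding variation_def v_def by (intro nn_integral_cong) (auto simp: indicator_def)
    also have "\<dots> = ennreal (LINT s:{0..r}|lborel. norm (v s))"
      unfolding set_lebesgue_integral_def by (rule nn_integral_eq_integral[OF i]) simp
    finally show ?thesis
      by (simp add: set_lebesgue_integral_def integral_nonneg_AE)
  qed
  have split: "{0..t} = {0..s} \<union> {s<..t}" "{0..s} \<inter> {s<..t} = {}" using st by auto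
  have vi2: "set_integrable lborel {s<..t} v"
    using st by (intro set_integrable_subset[OF vi[of t]]) auto
  have X: "Xmod r \<omega> = Xmod 0 \<omega> + (LINT s:{0..r}|lborel. v s) + W r \<omega>" if "0 \<le> r" for r
    using g that unfolding good_def v_def by blast
  have "Xmod t \<omega> - Xmod s \<omega> - (W t \<omega> - W s \<omega>) = (LINT s:{0..t}|lborel. v s) - (LINT s:{0..s}|lborel. v s)"
    using X[of t] X[OF st(1)] st by simp
  also have "\<dots> = (LINT r:{s<..t}|lborel. v r)"
    unfolding split(1) by (subst set_integral_Un[OF split(2)]) (use st vi vi2 in auto)
  also have "norm \<dots> \<le> (LINT r:{s<..t}|lborel. norm (v r))"
    by (rule set_integral_norm_bound[OF vi2])
  also have "\<dots> = enn2real (variation t \<omega>) - enn2real (variation s \<omega>)"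
    using st unfolding var[OF st(1)] var[OF order_trans[OF st]] split(1)
    by (subst set_integral_Un[OF split(2)]) (use st vi vi2 in \<open>auto intro!: set_integrable_norm\<close>)
  finally show ?thesis .
qed

end

text \<open>Both sides are compared with \<gamma> / (1 + \<gamma>).\<close>

lemma one_minus_exp_lower:
  fixes \<gamma> :: real
  assumes "0 \<le> \<gamma>"
  shows "min 1 \<gamma> \<le> 2 * (1 - exp (- \<gamma>))"
proof -
  have "exp (- \<gamma>) \<le> 1 / (1 + \<gamma>)"
    using exp_ge_add_one_self[of \<gamma>] assms by (simp add: exp_minus inverse_eq_divide frac_le)
  then have "\<gamma> / (1 + \<gamma>) \<le> 1 - exp (- \<gamma>)" using assms by (simp add: field_simps)
  then have "2 * (\<gamma> / (1 + \<gamma>)) \<le> 2 * (1 - exp (- \<gamma>))" by (rule mult_left_mono) simp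
  moreover have "min 1 \<gamma> \<le> 2 * (\<gamma> / (1 + \<gamma>))"
  proof (cases "\<gamma> \<le> 1")
    case True
    have "\<gamma> * (1 + \<gamma>) \<le> \<gamma> * 2" using True assms by (intro mult_left_mono) auto
    then show ?thesis using True assms by (simp add: field_simps)
  qed (simp add: field_simps)
  ultimately show ?thesis by (rule order_trans[rotated])
qed

text \<open>Here \<open>v'\<close> and \<open>v\<close> are the variations at the two ends. The
  difference of \<open>p\<close> and \<open>q\<close> is at most
  \<open>2 * L * min 1 (v - v')\<close>, which after multiplication by \<open>exp (- v')\<close> is
  absorbed in the drop of the exponential; changing the weight in front of \<open>p\<close> costs
  that same drop once more.\<close>

lemma weighted_difference_bound:
  fixes p q v v' L \<gamma> :: real
  assumes "\<bar>p\<bar> \<le> 1" "\<bar>q\<bar> \<le> 1" "\<bar>p - q\<bar> \<le> L * (v - v')" "v' \<le> v" "1 \<le> L"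
  shows "\<bar>exp (- v) * p - exp (- v') * q\<bar> \<le> (1 + 4 * L) * (exp (- v') - exp (- v))"
proof -
  have "\<bar>p - q\<bar> \<le> 2 * L * min 1 (v - v')"
  proof (cases "v - v' \<le> 1")
    case True
    have "L * (v - v') \<le> 2 * L * (v - v')" using assms by (intro mult_right_mono) auto
    then show ?thesis using assms(3) True by simp
  next
    case False
    have "\<bar>p - q\<bar> \<le> 2 * 1" using abs_triangle_ineq4[of p q] assms by linarith
    also have "\<dots> \<le> 2 * L * min 1 (v - v')" using False assms by simp
    finally show ?thesis .
  qed
  also have "\<dots> \<le> 2 * L * (2 * (1 - exp (- (v - v'))))"
    using assms by (intro mult_left_mono one_minus_exp_lower) auto
  also have "2 * L * (2 * (1 - exp (- (v - v')))) = 4 * L * (1 - exp (- (v - v')))" by simp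
  finally have "exp (- v') * \<bar>p - q\<bar> \<le> exp (- v') * (4 * L * (1 - exp (- (v - v'))))"
    by (rule mult_left_mono) simp
  also have "\<dots> = 4 * L * (exp (- v') - exp (- v))"
    by (simp add: algebra_simps mult_exp_exp)
  finally have 1: "exp (- v') * \<bar>p - q\<bar> \<le> 4 * L * (exp (- v') - exp (- v))" .
  have 2: "(exp (- v') - exp (- v)) * \<bar>p\<bar> \<le> exp (- v') - exp (- v)"
    using assms mult_left_mono[of "\<bar>p\<bar>" 1 "exp (- v') - exp (- v)"] by simp
  have "exp (- v) * p - exp (- v') * q = exp (- v') * (p - q) - (exp (- v') - exp (- v)) * p"
    by (simp add: algebra_simps)
  also have "\<bar>\<dots>\<bar> \<le> exp (- v') * \<bar>p - q\<bar> + (exp (- v') - exp (- v)) * \<bar>p\<bar>"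
    using assms by (intro order_trans[OF abs_triangle_ineq4]) (simp add: abs_mult)
  finally show ?thesis using 1 2 by (simp add: algebra_simps)
qed

context mckean_vlasov begin

declare Xmod_measurable[measurable]

lemma weight_measurable[measurable]: "weight t \<in> borel_measurable M"
proof (cases "0 \<le> t")
  case True then show ?thesis using measurable_F_M[OF weight_measurable_F] by simp
next
  case False
  then have "weight t = (\<lambda>_. 1)" by (intro ext weight_neg) simp
  then show ?thesis by simp
qed

lemma integrable_weight: "integrable M (weight t)"
  using weight_bounds[of t] by (intro integrable_const_bound[of _ 1]) (auto simp: less_imp_le)

definition mean_weight :: "real \<Rightarrow> real" where
  "mean_weight t = (\<integral>\<omega>. weight t \<omega> \<partial>M)"

lemma mean_weight_bounds: "0 \<le> mean_weight t" "mean_weight t \<le> 1"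
proof -
  show "0 \<le> mean_weight t" unfolding mean_weight_def
    using weight_bounds[of t] by (intro integral_nonneg_AE) (auto simp: less_imp_le)
  show "mean_weight t \<le> 1" unfolding mean_weight_def
    using weight_bounds[of t] integrable_weight by (intro integral_le_const) auto
qed

lemma weight_mono_good:
  assumes "good \<omega>" "s \<le> t"
  shows "weight t \<omega> \<le> weight s \<omega>"
proof (cases "0 \<le> s")
  case True
  have "0 \<le> enn2real (variation t \<omega>) - enn2real (variation s \<omega>)"
    using variation_increment[OF assms(1) True assms(2)] order_trans norm_ge_zero by blast
  then show ?thesis by (simp add: weight_def)
next
  case False
  then have "weight s \<omega> = 1" by (intro weight_neg) simp
  then show ?thesis using weight_bounds by simp
qed

lemma mean_weight_antimono: "s \<le> t \<Longrightarrow> mean_weight t \<le> mean_weight s"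
  unfolding mean_weight_def
  using good_AE weight_mono_good by (intro integral_mono_AE integrable_weight) (auto elim: eventually_mono)

text \<open>The pair of weight and position at time \<open>s\<close> is measurable for
  \<open>F s\<close>, hence independent of the Brownian increment, which can be integrated
  out.\<close>

lemma weighted_step_eq:
  assumes st: "0 \<le> s" "s < t" and \<phi>: "bounded_borel B \<phi>"
  shows "(\<integral>\<omega>. weight s \<omega> * \<phi> (X s \<omega> + (W t \<omega> - W s \<omega>)) \<partial>M) = (\<integral>\<omega>. weight s \<omega> * heat (t - s) \<phi> (X s \<omega>) \<partial>M)"
proof -
  define K where "K = (\<lambda>\<omega>. (weight s \<omega>, X s \<omega>))"
  have [measurable]: "X s \<in> borel_measurable (F s)" "weight s \<in> borel_measurable (F s)"
    using X_adapted weight_measurable_F st by auto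
  have KF: "K \<in> measurable (F s) (borel \<Otimes>\<^sub>M borel)" unfolding K_def by measurable
  have KM[measurable]: "K \<in> measurable M (borel \<Otimes>\<^sub>M borel)" using measurable_F_M[OF KF st(1)] .
  have [measurable]: "W t \<in> borel_measurable M" "W s \<in> borel_measurable M" "X s \<in> borel_measurable M"
    using W_measurable X_measurable st by auto
  note [measurable] = bounded_borelD(1)[OF \<phi>]
  interpret D: prob_space "distr M (borel \<Otimes>\<^sub>M borel) K" by (rule prob_space_distr[OF KM])
  interpret G: prob_space "gauss (t - s) :: 'a measure" using st by (intro prob_space_gauss) simp
  interpret DG: pair_prob_space "distr M (borel \<Otimes>\<^sub>M borel) K" "gauss (t - s) :: 'a measure" ..
  \<comment> \<open>The weight is clamped to the unit interval to make \<open>g\<close> bounded on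
    the whole space; on actual values of the weight this changes nothing.\<close>
  define g where "g = (\<lambda>p :: (real \<times> 'a) \<times> 'a. max 0 (min 1 (fst (fst p))) * \<phi> (snd (fst p) + snd p))"
  have [measurable]: "g \<in> borel_measurable ((borel \<Otimes>\<^sub>M borel) \<Otimes>\<^sub>M borel)" unfolding g_def by measurable
  have gb: "\<bar>g p\<bar> \<le> B" for p
  proof -
    have "\<bar>g p\<bar> \<le> 1 * B"
      unfolding g_def abs_mult using bounded_borelD(2,3)[OF \<phi>] by (intro mult_mono) auto
    then show ?thesis by simp
  qed
  have clamp: "max 0 (min 1 (weight s \<omega>)) = weight s \<omega>" for \<omega> using weight_bounds[of s \<omega>] by simp
  have "(\<integral>\<omega>. weight s \<omega> * \<phi> (X s \<omega> + (W t \<omega> - W s \<omega>)) \<partial>M)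
    = (\<integral>p. g p \<partial>distr M ((borel \<Otimes>\<^sub>M borel) \<Otimes>\<^sub>M borel) (\<lambda>\<omega>. (K \<omega>, W t \<omega> - W s \<omega>)))"
    by (subst integral_distr) (simp_all add: g_def K_def clamp)
  also have "\<dots> = (\<integral>p. g p \<partial>(distr M (borel \<Otimes>\<^sub>M borel) K \<Otimes>\<^sub>M gauss (t - s)))"
    unfolding W_increment[OF st KF] ..
  also have "\<dots> = (\<integral>k. \<integral>z. g (k, z) \<partial>gauss (t - s) \<partial>distr M (borel \<Otimes>\<^sub>M borel) K)"
    using gb by (intro DG.integral_fst'[symmetric] DG.integrable_const_bound[of _ B]) auto
  also have "\<dots> = (\<integral>\<omega>. \<integral>z. g (K \<omega>, z) \<partial>gauss (t - s) \<partial>M)"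
    by (rule integral_distr) measurable
  also have "\<dots> = (\<integral>\<omega>. weight s \<omega> * heat (t - s) \<phi> (X s \<omega>) \<partial>M)"
    unfolding heat_def g_def K_def by (simp add: clamp)
  finally show ?thesis .
qed

text \<open>Replacing \<open>Xmod t\<close> by \<open>X s\<close> plus noise moves the argument by
  at most the growth of the variation. By \<open>weighted_difference_bound\<close> the error is then
  at most a multiple of the drop of the weight, whose expectation is
  \<open>mean_weight s - mean_weight t\<close>.\<close>

lemma weighted_step:
  assumes st: "0 \<le> s" "s < t" and \<phi>: "bounded_borel 1 \<phi>" and L: "1 \<le> L"
    and lip: "\<And>x y. \<bar>\<phi> x - \<phi> y\<bar> \<le> L * norm (x - y)"
  shows "\<bar>\<integral>\<omega>. weight t \<omega> * \<phi> (Xmod t \<omega>) \<partial>M\<bar>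
    \<le> \<bar>\<integral>\<omega>. weight s \<omega> * heat (t - s) \<phi> (X s \<omega>) \<partial>M\<bar> + (1 + 4 * L) * (mean_weight s - mean_weight t)"
proof -
  have [measurable]: "W t \<in> borel_measurable M" "W s \<in> borel_measurable M" "X s \<in> borel_measurable M"
    using W_measurable X_measurable st by auto
  note [measurable] = bounded_borelD(1)[OF \<phi>]
  define \<xi> where "\<xi> = (\<lambda>\<omega>. X s \<omega> + (W t \<omega> - W s \<omega>))"
  have [measurable]: "\<xi> \<in> borel_measurable M" unfolding \<xi>_def by measurable
  have int: "integrable M (\<lambda>\<omega>. weight r \<omega> * \<phi> (x \<omega>))" if [measurable]: "x \<in> borel_measurable M" for r x
  proof (rule integrable_const_bound[of _ 1])
    have "\<bar>weight r \<omega> * \<phi> (x \<omega>)\<bar> \<le> 1 * 1" for \<omega>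
      unfolding abs_mult using weight_bounds[of r \<omega>] bounded_borelD(2)[OF \<phi>] by (intro mult_mono) auto
    then show "AE \<omega> in M. norm (weight r \<omega> * \<phi> (x \<omega>)) \<le> 1" by simp
  qed measurable
  have "\<bar>(\<integral>\<omega>. weight t \<omega> * \<phi> (Xmod t \<omega>) \<partial>M) - (\<integral>\<omega>. weight s \<omega> * \<phi> (\<xi> \<omega>) \<partial>M)\<bar>
     = \<bar>\<integral>\<omega>. weight t \<omega> * \<phi> (Xmod t \<omega>) - weight s \<omega> * \<phi> (\<xi> \<omega>) \<partial>M\<bar>"
    by (subst Bochner_Integration.integral_diff[OF int int]) auto
  also have "\<dots> \<le> (\<integral>\<omega>. \<bar>weight t \<omega> * \<phi> (Xmod t \<omega>) - weight s \<omega> * \<phi> (\<xi> \<omega>)\<bar> \<partial>M)"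
    by (rule integral_abs_bound)
  also have "\<dots> \<le> (\<integral>\<omega>. (1 + 4 * L) * (weight s \<omega> - weight t \<omega>) \<partial>M)"
  proof (rule integral_mono_AE)
    show "integrable M (\<lambda>\<omega>. \<bar>weight t \<omega> * \<phi> (Xmod t \<omega>) - weight s \<omega> * \<phi> (\<xi> \<omega>)\<bar>)"
      by (intro integrable_abs Bochner_Integration.integrable_diff int) measurable
    show "integrable M (\<lambda>\<omega>. (1 + 4 * L) * (weight s \<omega> - weight t \<omega>))"
      by (intro integrable_mult_right Bochner_Integration.integrable_diff integrable_weight)
    show "AE \<omega> in M. \<bar>weight t \<omega> * \<phi> (Xmod t \<omega>) - weight s \<omega> * \<phi> (\<xi> \<omega>)\<bar> \<le> (1 + 4 * L) * (weight s \<omega> - weight t \<omega>)"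
      using good_AE
    proof eventually_elim
      case (elim \<omega>)
      define v where "v = enn2real (variation t \<omega>)"
      define v' where "v' = enn2real (variation s \<omega>)"
      have n: "norm (Xmod t \<omega> - Xmod s \<omega> - (W t \<omega> - W s \<omega>)) \<le> v - v'"
        unfolding v_def v'_def using variation_increment[OF elim st(1)] st by simp
      have "Xmod s \<omega> = X s \<omega>" using elim st unfolding good_def by blast
      then have "norm (Xmod t \<omega> - \<xi> \<omega>) \<le> v - v'" using n by (simp add: \<xi>_def algebra_simps)
      then have "L * norm (Xmod t \<omega> - \<xi> \<omega>) \<le> L * (v - v')" using L by (intro mult_left_mono) auto
      then have "\<bar>\<phi> (Xmod t \<omega>) - \<phi> (\<xi> \<omega>)\<bar> \<le> L * (v - v')" using lip[of "Xmod t \<omega>" "\<xi> \<omega>"] by linarith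
      then show ?case
        unfolding weight_def v_def[symmetric] v'_def[symmetric]
        using bounded_borelD(2)[OF \<phi>] L order_trans[OF norm_ge_zero n] by (intro weighted_difference_bound) auto
    qed
  qed
  also have "\<dots> = (1 + 4 * L) * (mean_weight s - mean_weight t)"
    unfolding mean_weight_def using integrable_weight by simp
  finally have "\<bar>(\<integral>\<omega>. weight t \<omega> * \<phi> (Xmod t \<omega>) \<partial>M) - (\<integral>\<omega>. weight s \<omega> * \<phi> (\<xi> \<omega>) \<partial>M)\<bar> \<le> (1 + 4 * L) * (mean_weight s - mean_weight t)" .
  moreover have "(\<integral>\<omega>. weight s \<omega> * \<phi> (\<xi> \<omega>) \<partial>M) = (\<integral>\<omega>. weight s \<omega> * heat (t - s) \<phi> (X s \<omega>) \<partial>M)"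
    unfolding \<xi>_def by (rule weighted_step_eq[OF st \<phi>])
  ultimately show ?thesis by linarith
qed

lemma mean_weight_measurable[measurable]: "mean_weight \<in> borel_measurable borel"
proof -
  have "mono (\<lambda>t. - mean_weight t)" using mean_weight_antimono by (auto intro!: monoI)
  then have "(\<lambda>t. - mean_weight t) \<in> borel_measurable borel" by (rule borel_measurable_mono)
  then have "(\<lambda>t. - (- mean_weight t)) \<in> borel_measurable borel" by (rule borel_measurable_uminus)
  then show ?thesis by simp
qed

text \<open>After a translation the two integrals cancel except over an interval of length
  \<open>h\<close> next to zero, where \<open>mean_weight\<close> is at most 1.\<close>

lemma mean_weight_increment_integral:
  assumes h: "0 \<le> h" and T: "0 \<le> T"
  shows "(\<integral>\<^sup>+s. indicator {0..T} s * ennreal (mean_weight (s - h) - mean_weight s) \<partial>lborel) \<le> ennreal h"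
proof -
  have le1: "(\<integral>\<^sup>+s. indicator {0..T} s * ennreal (mean_weight s) \<partial>lborel) \<le> ennreal T"
  proof -
    have "(\<integral>\<^sup>+s. indicator {0..T} s * ennreal (mean_weight s) \<partial>lborel) \<le> (\<integral>\<^sup>+s. indicator {0..T} s \<partial>lborel)"
      using mean_weight_bounds by (intro nn_integral_mono) (auto simp: indicator_def)
    then show ?thesis using T by simp
  qed
  have "(\<integral>\<^sup>+s. indicator {0..T} s * ennreal (mean_weight (s - h) - mean_weight s) \<partial>lborel)
     = (\<integral>\<^sup>+s. indicator {0..T} s * ennreal (mean_weight (s - h)) - indicator {0..T} s * ennreal (mean_weight s) \<partial>lborel)"
    using mean_weight_bounds by (intro nn_integral_cong) (auto simp: indicator_def ennreal_minus)
  also have "\<dots> = (\<integral>\<^sup>+s. indicator {0..T} s * ennreal (mean_weight (s - h)) \<partial>lborel) - (\<integral>\<^sup>+s. indicator {0..T} s * ennreal (mean_weight s) \<partial>lborel)"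
  proof (rule nn_integral_diff)
    show "(\<integral>\<^sup>+s. indicator {0..T} s * ennreal (mean_weight s) \<partial>lborel) \<noteq> \<infinity>"
      using le1 by (metis ennreal_less_top infinity_ennreal_def leD)
    show "AE s in lborel. indicator {0..T} s * ennreal (mean_weight s) \<le> indicator {0..T} s * ennreal (mean_weight (s - h))"
      using mean_weight_antimono[of "s - h" s for s] h by (intro AE_I2 mult_left_mono ennreal_leI) auto
  qed measurable
  also have "(\<integral>\<^sup>+s. indicator {0..T} s * ennreal (mean_weight (s - h)) \<partial>lborel)
      = (\<integral>\<^sup>+s. indicator {0..T} (h + s) * ennreal (mean_weight s) \<partial>lborel)"
    using nn_integral_lborel_shift[of "\<lambda>s. indicator {0..T} s * ennreal (mean_weight (s - h))" h] by simp
  also have "\<dots> \<le> (\<integral>\<^sup>+s. indicator {-h..0} s + indicator {0..T} s * ennreal (mean_weight s) \<partial>lborel)"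
  proof (rule nn_integral_mono)
    fix s
    show "indicator {0..T} (h + s) * ennreal (mean_weight s) \<le> indicator {- h..0} s + indicator {0..T} s * ennreal (mean_weight s)"
    proof (cases "s \<le> 0")
      case True
      then show ?thesis using mean_weight_bounds(2)[of s] by (auto simp: indicator_def intro!: add_increasing2)
    next
      case False then show ?thesis using h by (auto simp: indicator_def)
    qed
  qed
  also have "\<dots> = ennreal h + (\<integral>\<^sup>+s. indicator {0..T} s * ennreal (mean_weight s) \<partial>lborel)"
    using h by (subst nn_integral_add) auto
  finally have "(\<integral>\<^sup>+s. indicator {0..T} s * ennreal (mean_weight (s - h) - mean_weight s) \<partial>lborel)
    \<le> ennreal h + (\<integral>\<^sup>+s. indicator {0..T} s * ennreal (mean_weight s) \<partial>lborel) - (\<integral>\<^sup>+s. indicator {0..T} s * ennreal (mean_weight s) \<partial>lborel)"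
    by (auto intro!: ennreal_minus_mono)
  moreover have "(\<integral>\<^sup>+s. indicator {0..T} s * ennreal (mean_weight s) \<partial>lborel) \<noteq> \<top>"
    using le1 by (metis ennreal_less_top infinity_ennreal_def leD)
  ultimately show ?thesis by simp
qed

text \<open>The integral of the \<open>j\<close>-th term over a bounded interval is at most
  \<open>(sqrt 8 / 4) ^ j\<close> by \<open>mean_weight_increment_integral\<close>. This is
  summable, so the series of nonnegative terms is finite at almost every \<open>s\<close>.\<close>

lemma mean_weight_increment_summable:
  "AE s in lborel. 0 \<le> s \<longrightarrow> summable (\<lambda>j. sqrt 8 ^ j * (mean_weight (s - (1 / 4) ^ j) - mean_weight s))"
proof -
  define f where "f = (\<lambda>j s. sqrt 8 ^ j * (mean_weight (s - (1 / 4) ^ j) - mean_weight s))"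
  have f0: "0 \<le> f j s" for j s
    unfolding f_def using mean_weight_antimono[of "s - (1/4)^j" s] by (intro mult_nonneg_nonneg) auto
  have [measurable]: "f j \<in> borel_measurable borel" for j unfolding f_def by measurable
  have "AE s in lborel. s \<in> {0..real n} \<longrightarrow> summable (\<lambda>j. f j s)" for n
  proof -
    have "(\<integral>\<^sup>+s. indicator {0..real n} s * (\<Sum>j. ennreal (f j s)) \<partial>lborel) = (\<integral>\<^sup>+s. (\<Sum>j. indicator {0..real n} s * ennreal (f j s)) \<partial>lborel)"
      by simp
    also have "\<dots> = (\<Sum>j. \<integral>\<^sup>+s. indicator {0..real n} s * ennreal (f j s) \<partial>lborel)"
      by (rule nn_integral_suminf) measurable
    also have "\<dots> \<le> (\<Sum>j. ennreal ((sqrt 8 / 4) ^ j))"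
    proof (rule suminf_le)
      fix j
      have "(\<integral>\<^sup>+s. indicator {0..real n} s * ennreal (f j s) \<partial>lborel)
        = (\<integral>\<^sup>+s. ennreal (sqrt 8 ^ j) * (indicator {0..real n} s * ennreal (mean_weight (s - (1/4)^j) - mean_weight s)) \<partial>lborel)"
        by (intro nn_integral_cong) (simp add: f_def ennreal_mult' mult_ac)
      also have "\<dots> = ennreal (sqrt 8 ^ j) * (\<integral>\<^sup>+s. indicator {0..real n} s * ennreal (mean_weight (s - (1/4)^j) - mean_weight s) \<partial>lborel)"
        by (rule nn_integral_cmult) measurable
      also have "\<dots> \<le> ennreal (sqrt 8 ^ j) * ennreal ((1/4)^j)"
        by (intro mult_left_mono mean_weight_increment_integral) auto
      also have "\<dots> = ennreal ((sqrt 8 / 4) ^ j)"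
        by (simp add: ennreal_mult[symmetric] power_divide)
      finally show "(\<integral>\<^sup>+s. indicator {0..real n} s * ennreal (f j s) \<partial>lborel) \<le> ennreal ((sqrt 8 / 4) ^ j)" .
    qed auto
    also have "\<dots> < \<infinity>"
    proof -
      have "sqrt 8 / 4 < 1" using real_sqrt_less_mono[of 8 16] by simp
      then have "summable (\<lambda>j. (sqrt 8 / 4) ^ j)" by (intro summable_geometric) simp
      then show ?thesis by (simp add: suminf_ennreal2)
    qed
    finally have "AE s in lborel. indicator {0..real n} s * (\<Sum>j. ennreal (f j s)) \<noteq> \<infinity>"
      by (intro nn_integral_PInf_AE) auto
    then show ?thesis
    proof eventually_elim
      case (elim s)
      show ?case
      proof
        assume "s \<in> {0..real n}"
        then show "summable (\<lambda>j. f j s)" using elim f0 by (intro summable_suminf_not_top) auto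
      qed
    qed
  qed
  then have "AE s in lborel. \<forall>n. s \<in> {0..real n} \<longrightarrow> summable (\<lambda>j. f j s)" by (subst AE_all_countable) blast
  then show ?thesis
  proof eventually_elim
    case (elim s)
    obtain n :: nat where "s \<le> real n" using real_arch_simple by blast
    then show ?case using elim[rule_format, of n] unfolding f_def by auto
  qed
qed

end

context mckean_vlasov begin

section \<open>Absolute continuity of the law at almost every time\<close>

text \<open>Let \<phi> be half the difference of two consecutive mollifications of \<open>f\<close>
  and go back in time by \<open>h\<close>. The heat flow over time \<open>h\<close> makes \<phi>
  small because the mollification scales are much smaller than \<open>h\<close>, and the drift
  contributes the Lipschitz constant of \<phi> times the drop of the mean weight. Neither bound
  depends on \<open>f\<close>.\<close>

lemma weighted_mollifier_increment:
  assumes s: "(1 / 4) ^ i \<le> s" and f: "bounded_borel 1 f"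
  defines "C \<equiv> heat_const TYPE('a)"
  shows "\<bar>(\<integral>\<omega>. weight s \<omega> * heat ((1 / 8) ^ i) f (Xmod s \<omega>) \<partial>M) - (\<integral>\<omega>. weight s \<omega> * heat ((1 / 8) ^ Suc i) f (Xmod s \<omega>) \<partial>M)\<bar>
    \<le> 2 * (C * sqrt (1 / 2) ^ i + (5 + 4 * C * sqrt 8) * (sqrt 8 ^ i * (mean_weight (s - (1 / 4) ^ i) - mean_weight s)))"
proof -
  \<comment> \<open>The scales must satisfy two demands: \<open>sqrt (\<epsilon> / h)\<close>, the
    size after the heat flow, and \<open>h / sqrt \<epsilon>\<close>, which governs the drift term
    for almost every \<open>s\<close>, both have to be summable. With powers of 1/8 and 1/4 both
    equal \<open>sqrt (1 / 2) ^ i\<close>.\<close>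
  define \<epsilon> \<epsilon>' h where "\<epsilon> = (1 / 8 :: real) ^ i" and "\<epsilon>' = (1 / 8 :: real) ^ Suc i" and "h = (1 / 4 :: real) ^ i"
  have pos: "0 < \<epsilon>" "0 < \<epsilon>'" "0 < h" "\<epsilon>' < \<epsilon>" by (simp_all add: \<epsilon>_def \<epsilon>'_def h_def)
  have C: "0 \<le> C" unfolding C_def by (rule heat_const_nonneg)
  have hb: "bounded_borel 1 (heat \<epsilon> f)" "bounded_borel 1 (heat \<epsilon>' f)" using heat_bounded[OF _ f] pos by auto
  define \<phi> where "\<phi> = (\<lambda>x. (heat \<epsilon> f x - heat \<epsilon>' f x) / 2)"
  have \<phi>: "bounded_borel 1 \<phi>"
    using bounded_borel_diff[OF hb] unfolding \<phi>_def bounded_borel_def by auto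
  define L where "L = 1 + C / sqrt \<epsilon>'"
  have L: "1 \<le> L" unfolding L_def using C pos by simp
  have lip: "\<bar>\<phi> x - \<phi> y\<bar> \<le> L * norm (x - y)" for x y
  proof -
    have l: "\<bar>heat t f x - heat t f y\<bar> \<le> C * norm (x - y) / sqrt \<epsilon>'" if "\<epsilon>' \<le> t" for t
    proof -
      have t: "0 < t" using that pos by simp
      have "\<bar>heat t f x - heat t f y\<bar> \<le> C * norm (x - y) / sqrt t"
        using heat_const_estimates(2)[OF t f, of y "x - y"] by (simp add: C_def)
      also have "\<dots> \<le> C * norm (x - y) / sqrt \<epsilon>'" using that pos C by (intro frac_le) auto
      finally show ?thesis .
    qed
    have "\<bar>\<phi> x - \<phi> y\<bar> \<le> C * norm (x - y) / sqrt \<epsilon>'"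
    proof -
      have "\<bar>\<phi> x - \<phi> y\<bar> = \<bar>(heat \<epsilon> f x - heat \<epsilon> f y) - (heat \<epsilon>' f x - heat \<epsilon>' f y)\<bar> / 2"
      proof -
        have "\<phi> x - \<phi> y = ((heat \<epsilon> f x - heat \<epsilon> f y) - (heat \<epsilon>' f x - heat \<epsilon>' f y)) / 2"
          by (simp add: \<phi>_def field_simps)
        then show ?thesis by (simp only: abs_divide abs_numeral)
      qed
      moreover have "a \<le> k" if "a = b / 2" "b \<le> c + d" "c \<le> k" "d \<le> k" for a b c d k :: real
        using that by simp
      ultimately show ?thesis
        using abs_triangle_ineq4 l[OF less_imp_le[OF pos(4)]] l[OF order_refl] by blast
    qed
    also have "\<dots> \<le> L * norm (x - y)" unfolding L_def by (simp add: algebra_simps)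
    finally show ?thesis .
  qed
  have sh: "0 \<le> s - h" "s - h < s" "s - (s - h) = h" using s pos by (auto simp: h_def)
  have sq: "sqrt \<epsilon> / sqrt h = sqrt (1 / 2) ^ i"
  proof -
    have "\<epsilon> / h = (1 / 2) ^ i" unfolding \<epsilon>_def h_def power_divide[symmetric] by (simp add: power_divide[symmetric])
    then show ?thesis by (simp add: real_sqrt_divide[symmetric] real_sqrt_power)
  qed
  have hh: "\<bar>heat h \<phi> x\<bar> \<le> C * sqrt (1 / 2) ^ i" for x
  proof -
    have e: "heat h \<phi> x = (heat (h + \<epsilon>) f x - heat (h + \<epsilon>') f x) / 2"
    proof -
      have "heat h \<phi> x = heat h (\<lambda>x. heat \<epsilon> f x - heat \<epsilon>' f x) x / 2" unfolding heat_def[of h] \<phi>_def by simp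
      also have "\<dots> = (heat h (heat \<epsilon> f) x - heat h (heat \<epsilon>' f) x) / 2" by (subst heat_diff[OF pos(3) hb]) simp
      finally show ?thesis by (simp add: heat_heat[OF pos(3) _ f] pos)
    qed
    have "\<bar>heat ((h + \<epsilon>') + (\<epsilon> - \<epsilon>')) f x - heat (h + \<epsilon>') f x\<bar> \<le> C * 1 * sqrt (\<epsilon> - \<epsilon>') / sqrt (h + \<epsilon>')"
      unfolding C_def using pos by (intro heat_const_estimates(5)[OF _ f]) auto
    also have "\<dots> \<le> C * 1 * sqrt \<epsilon> / sqrt h" using pos C by (intro frac_le mult_left_mono) auto
    also have "\<dots> = C * (sqrt \<epsilon> / sqrt h)" by simp
    also have "\<dots> = C * sqrt (1 / 2) ^ i" unfolding sq ..
    finally have d: "\<bar>heat (h + \<epsilon>) f x - heat (h + \<epsilon>') f x\<bar> \<le> C * sqrt (1 / 2) ^ i" by simp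
    have "\<bar>heat h \<phi> x\<bar> = \<bar>heat (h + \<epsilon>) f x - heat (h + \<epsilon>') f x\<bar> / 2" unfolding e by simp
    moreover have "a \<le> k" if "a = b / 2" "b \<le> k" "0 \<le> b" for a b k :: real
      using that by simp
    ultimately show ?thesis using d abs_ge_zero by blast
  qed
  have meas: "X (s - h) \<in> borel_measurable M" by (rule X_measurable[OF sh(1)])
  have "\<bar>\<integral>\<omega>. weight s \<omega> * \<phi> (Xmod s \<omega>) \<partial>M\<bar>
    \<le> \<bar>\<integral>\<omega>. weight (s - h) \<omega> * heat (s - (s - h)) \<phi> (X (s - h) \<omega>) \<partial>M\<bar> + (1 + 4 * L) * (mean_weight (s - h) - mean_weight s)"
    by (rule weighted_step[OF sh(1,2) \<phi> L lip])
  also have "\<bar>\<integral>\<omega>. weight (s - h) \<omega> * heat (s - (s - h)) \<phi> (X (s - h) \<omega>) \<partial>M\<bar> \<le> C * sqrt (1 / 2) ^ i"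
    unfolding sh(3)
  proof (rule expectation_abs_le)
    show "(\<lambda>\<omega>. weight (s - h) \<omega> * heat h \<phi> (X (s - h) \<omega>)) \<in> borel_measurable M"
      using bounded_borelD(1)[OF heat_bounded[OF pos(3) \<phi>]] meas by measurable
    fix \<omega>
    have "\<bar>weight (s - h) \<omega> * heat h \<phi> (X (s - h) \<omega>)\<bar> \<le> 1 * (C * sqrt (1 / 2) ^ i)"
      unfolding abs_mult using weight_bounds[of "s - h" \<omega>] by (intro mult_mono hh) auto
    then show "\<bar>weight (s - h) \<omega> * heat h \<phi> (X (s - h) \<omega>)\<bar> \<le> C * sqrt (1 / 2) ^ i" by simp
  qed
  also have "(1 + 4 * L) * (mean_weight (s - h) - mean_weight s) \<le> ((5 + 4 * C * sqrt 8) * sqrt 8 ^ i) * (mean_weight (s - h) - mean_weight s)"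
  proof (rule mult_right_mono)
    have "sqrt \<epsilon>' = 1 / sqrt 8 ^ Suc i" by (simp add: \<epsilon>'_def real_sqrt_power real_sqrt_divide power_divide real_sqrt_mult)
    then have "1 + 4 * L = 5 + 4 * C * sqrt 8 * sqrt 8 ^ i" by (simp add: L_def)
    also have "\<dots> \<le> 5 * sqrt 8 ^ i + 4 * C * sqrt 8 * sqrt 8 ^ i"
      using one_le_power[of "sqrt 8" i] by simp
    finally show "1 + 4 * L \<le> (5 + 4 * C * sqrt 8) * sqrt 8 ^ i" by (simp add: algebra_simps)
    show "0 \<le> mean_weight (s - h) - mean_weight s" using mean_weight_antimono[of "s - h" s] pos by simp
  qed
  finally have 1: "\<bar>\<integral>\<omega>. weight s \<omega> * \<phi> (Xmod s \<omega>) \<partial>M\<bar> \<le> C * sqrt (1 / 2) ^ i + (5 + 4 * C * sqrt 8) * (sqrt 8 ^ i * (mean_weight (s - h) - mean_weight s))"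
    by (simp add: mult.assoc)
  have int: "integrable M (\<lambda>\<omega>. weight s \<omega> * g (Xmod s \<omega>))" if g: "bounded_borel 1 g" for g
  proof (rule integrable_const_bound[of _ 1])
    note [measurable] = bounded_borelD(1)[OF g]
    have "\<bar>weight s \<omega> * g (Xmod s \<omega>)\<bar> \<le> 1 * 1" for \<omega>
      unfolding abs_mult using weight_bounds[of s \<omega>] bounded_borelD(2)[OF g] by (intro mult_mono) auto
    then show "AE \<omega> in M. norm (weight s \<omega> * g (Xmod s \<omega>)) \<le> 1" by simp
    show "(\<lambda>\<omega>. weight s \<omega> * g (Xmod s \<omega>)) \<in> borel_measurable M" by measurable
  qed
  have "(\<integral>\<omega>. weight s \<omega> * heat \<epsilon> f (Xmod s \<omega>) \<partial>M) - (\<integral>\<omega>. weight s \<omega> * heat \<epsilon>' f (Xmod s \<omega>) \<partial>M)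
    = (\<integral>\<omega>. weight s \<omega> * heat \<epsilon> f (Xmod s \<omega>) - weight s \<omega> * heat \<epsilon>' f (Xmod s \<omega>) \<partial>M)"
    by (rule Bochner_Integration.integral_diff[OF int[OF hb(1)] int[OF hb(2)], symmetric])
  also have "\<dots> = (\<integral>\<omega>. 2 * (weight s \<omega> * \<phi> (Xmod s \<omega>)) \<partial>M)"
    by (rule Bochner_Integration.integral_cong) (simp_all add: \<phi>_def algebra_simps)
  also have "\<dots> = 2 * (\<integral>\<omega>. weight s \<omega> * \<phi> (Xmod s \<omega>) \<partial>M)" by simp
  finally have "\<bar>(\<integral>\<omega>. weight s \<omega> * heat \<epsilon> f (Xmod s \<omega>) \<partial>M) - (\<integral>\<omega>. weight s \<omega> * heat \<epsilon>' f (Xmod s \<omega>) \<partial>M)\<bar>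
     = 2 * \<bar>\<integral>\<omega>. weight s \<omega> * \<phi> (Xmod s \<omega>) \<partial>M\<bar>" by (simp add: abs_mult)
  also have "\<dots> \<le> 2 * (C * sqrt (1 / 2) ^ i + (5 + 4 * C * sqrt 8) * (sqrt 8 ^ i * (mean_weight (s - h) - mean_weight s)))"
    by (rule mult_left_mono[OF 1]) simp
  finally show ?thesis unfolding \<epsilon>_def \<epsilon>'_def h_def .
qed

text \<open>By \<open>weighted_mollifier_increment\<close> the weighted expectation of a continuous
  function exceeds that of its mollification at scale \<open>(1 / 8) ^ j\<close> by at most the tail
  \<open>R j\<close> of a convergent series. Tents carry this over to the indicator of
  \<open>K\<close>, whose mollification vanishes identically. So the weighted mass of
  \<open>K\<close> is at most every \<open>R j\<close>, hence zero, and the weight is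
  positive.\<close>

lemma null_compact:
  assumes s: "0 < s" and sum: "summable (\<lambda>j. sqrt 8 ^ j * (mean_weight (s - (1 / 4) ^ j) - mean_weight s))"
    and K: "compact K" "K \<in> null_sets lborel"
  shows "prob (Xmod s -` K \<inter> space M) = 0"
proof -
  define C where "C = heat_const TYPE('a)"
  define d where "d = (\<lambda>i. 2 * (C * sqrt (1 / 2) ^ i + (5 + 4 * C * sqrt 8) * (sqrt 8 ^ i * (mean_weight (s - (1 / 4) ^ i) - mean_weight s))))"
  have C: "0 \<le> C" unfolding C_def by (rule heat_const_nonneg)
  have sd: "summable d"
    unfolding d_def using real_sqrt_less_mono[of "1/2" 1]
    by (intro summable_mult summable_add sum summable_geometric) simp
  have d0: "0 \<le> d i" for i
    unfolding d_def using mean_weight_antimono[of "s - (1 / 4) ^ i" s] C by (intro mult_nonneg_nonneg add_nonneg_nonneg) auto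
  define \<nu> where "\<nu> = (\<lambda>g :: 'a \<Rightarrow> real. \<integral>\<omega>. weight s \<omega> * g (Xmod s \<omega>) \<partial>M)"
  define R where "R = (\<lambda>j. suminf d - (\<Sum>i<j. d i))"
  have R: "R \<longlonglongrightarrow> 0"
    unfolding R_def using tendsto_diff[OF tendsto_const summable_LIMSEQ[OF sd], of "suminf d"] by simp
  have int: "integrable M (\<lambda>\<omega>. weight s \<omega> * g (Xmod s \<omega>))" if g: "bounded_borel 1 g" for g
  proof (rule integrable_const_bound[of _ 1])
    note [measurable] = bounded_borelD(1)[OF g]
    have "\<bar>weight s \<omega> * g (Xmod s \<omega>)\<bar> \<le> 1 * 1" for \<omega>
      unfolding abs_mult using weight_bounds[of s \<omega>] bounded_borelD(2)[OF g] by (intro mult_mono) auto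
    then show "AE \<omega> in M. norm (weight s \<omega> * g (Xmod s \<omega>)) \<le> 1" by simp
    show "(\<lambda>\<omega>. weight s \<omega> * g (Xmod s \<omega>)) \<in> borel_measurable M" by measurable
  qed
  have lim\<nu>: "(\<lambda>n. \<nu> (g n)) \<longlonglongrightarrow> \<nu> g'" if g: "\<And>n. bounded_borel 1 (g n)" "bounded_borel 1 g'" "\<And>x. (\<lambda>n. g n x) \<longlonglongrightarrow> g' x" for g g'
    unfolding \<nu>_def
  proof (rule integral_dominated_convergence[where w="\<lambda>_. 1"])
    show "(\<lambda>\<omega>. weight s \<omega> * g' (Xmod s \<omega>)) \<in> borel_measurable M" using int[OF g(2)] by auto
    show "(\<lambda>\<omega>. weight s \<omega> * g n (Xmod s \<omega>)) \<in> borel_measurable M" for n using int[OF g(1)] by auto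
    show "AE \<omega> in M. (\<lambda>n. weight s \<omega> * g n (Xmod s \<omega>)) \<longlonglongrightarrow> weight s \<omega> * g' (Xmod s \<omega>)"
      by (intro AE_I2 tendsto_intros g(3))
    have "\<bar>weight s \<omega> * g n (Xmod s \<omega>)\<bar> \<le> 1 * 1" for \<omega> n
      unfolding abs_mult using weight_bounds[of s \<omega>] bounded_borelD(2)[OF g(1)] by (intro mult_mono) auto
    then show "AE \<omega> in M. norm (weight s \<omega> * g n (Xmod s \<omega>)) \<le> 1" for n by simp
  qed simp
  obtain N0 where N0: "\<And>i. N0 \<le> i \<Longrightarrow> (1 / 4) ^ i \<le> s"
  proof -
    have "(\<lambda>i. (1 / 4 :: real) ^ i) \<longlonglongrightarrow> 0" by (rule LIMSEQ_power_zero) simp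
    from order_tendstoD(2)[OF this s] show ?thesis using that unfolding eventually_sequentially by (meson less_imp_le)
  qed
  \<comment> \<open>Increments are summed from scale \<open>j\<close> to scale \<open>n\<close>, and
    then \<open>n\<close> tends to infinity; continuity of \<open>f\<close> makes the mollifications
    converge to \<open>f\<close>. From \<open>N0\<close> on, the step \<open>(1 / 4) ^ i\<close>
    back in time stays within nonnegative times.\<close>
  have cont_bound: "\<nu> f \<le> \<nu> (heat ((1 / 8) ^ j) f) + R j" if j: "N0 \<le> j" and f: "bounded_borel 1 f" "continuous_on UNIV f" for f j
  proof -
    have step: "\<nu> (heat ((1 / 8) ^ n) f) \<le> \<nu> (heat ((1 / 8) ^ j) f) + (\<Sum>i\<in>{j..<n}. d i)" if "j \<le> n" for n
      using that
    proof (induction n rule: dec_induct)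
      case (step n)
      have "\<bar>\<nu> (heat ((1 / 8) ^ n) f) - \<nu> (heat ((1 / 8) ^ Suc n) f)\<bar> \<le> d n"
        unfolding \<nu>_def d_def C_def using j step by (intro weighted_mollifier_increment[OF N0 f(1)]) simp
      then show ?case using step by simp
    qed simp
    have "\<nu> (heat ((1 / 8) ^ n) f) \<le> \<nu> (heat ((1 / 8) ^ j) f) + R j" if n: "j \<le> n" for n
    proof -
      have "(\<Sum>i<n. d i) = (\<Sum>i<j. d i) + (\<Sum>i\<in>{j..<n}. d i)"
        using sum.atLeastLessThan_concat[of 0 j n d] n by (simp add: atLeast0LessThan)
      moreover have "(\<Sum>i<n. d i) \<le> suminf d" by (rule sum_le_suminf[OF sd]) (use d0 in auto)
      ultimately show ?thesis using step[OF n] unfolding R_def by linarith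
    qed
    moreover have "(\<lambda>n. \<nu> (heat ((1 / 8) ^ n) f)) \<longlonglongrightarrow> \<nu> f"
    proof (rule lim\<nu>)
      show "bounded_borel 1 (heat ((1 / 8) ^ n) f)" for n by (rule heat_bounded[OF _ f(1)]) simp
      show "(\<lambda>n. heat ((1 / 8) ^ n) f x) \<longlonglongrightarrow> f x" for x
        by (rule heat_tendsto_id[OF f]) (auto intro: LIMSEQ_power_zero)
    qed (rule f)
    ultimately show ?thesis
      by (intro tendsto_upperbound[of "\<lambda>n. \<nu> (heat ((1 / 8) ^ n) f)" "\<nu> f" sequentially]) (auto simp: eventually_sequentially)
  qed
  obtain f :: "nat \<Rightarrow> 'a \<Rightarrow> real" where f: "\<And>n. continuous_on UNIV (f n)" "\<And>n x. 0 \<le> f n x" "\<And>n x. f n x \<le> 1"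
      "\<And>x. (\<lambda>n. f n x) \<longlonglongrightarrow> indicator K x"
    using closed_indicator_approx[OF compact_imp_closed[OF K(1)]] by metis
  have fb: "bounded_borel 1 (f n)" for n
    using f(2,3)[of n] borel_measurable_continuous_onI[OF f(1)] unfolding bounded_borel_def
    by (auto simp: abs_le_iff intro: order_trans[of _ 0])
  have [measurable]: "K \<in> sets borel" using K(2) by auto
  have Kb: "bounded_borel 1 (indicator K)" unfolding bounded_borel_def by (auto simp: indicator_def)
  have bound: "\<nu> (indicator K) \<le> R j" if j: "N0 \<le> j" for j
  proof -
    have p: "(0::real) < (1 / 8) ^ j" by simp
    \<comment> \<open>This is where \<open>K\<close> being Lebesgue null enters: Gaussian measures
      have a density.\<close>
    have h0: "heat ((1 / 8) ^ j) (indicator K) x = 0" for x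
    proof -
      have "(\<lambda>z. x + z) -` K \<in> null_sets lborel"
      proof -
        have "emeasure lborel ((\<lambda>z. x + z) -` K \<inter> space lborel) = emeasure (distr lborel borel (\<lambda>z. x + z)) K"
          by (rule emeasure_distr[symmetric]) auto
        also have "\<dots> = 0" using K(2) by (simp add: lborel_distr_plus null_setsD1)
        finally show ?thesis by (auto simp: null_sets_def intro!: measurable_sets_borel[of "\<lambda>z. x + z" borel])
      qed
      then have "AE z in lborel. z \<notin> (\<lambda>z. x + z) -` K" by (rule AE_not_in)
      then have "AE z in gauss ((1 / 8) ^ j). indicator K (x + z) = (0::real)"
        unfolding gauss_def by (subst AE_density) (auto elim: eventually_mono)
      then show ?thesis unfolding heat_def by (subst integral_cong_AE[where g="\<lambda>_. 0"]) auto
    qed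
    have hl: "(\<lambda>n. heat ((1 / 8) ^ j) (f n) x) \<longlonglongrightarrow> heat ((1 / 8) ^ j) (indicator K) x" for x
      unfolding heat_def
    proof (rule integral_dominated_convergence[where w="\<lambda>_. 1"])
      show "integrable (gauss ((1 / 8) ^ j)) (\<lambda>z::'a. 1::real)" using p by (intro integrable_gauss_bounded[of _ _ 1]) auto
      show "(\<lambda>z. f n (x + z)) \<in> borel_measurable (gauss ((1 / 8) ^ j))" for n
        using bounded_borelD(1)[OF fb] by measurable
      show "AE z in gauss ((1 / 8) ^ j). norm (f n (x + z)) \<le> 1" for n using bounded_borelD(2)[OF fb] by auto
    qed (use f(4) in auto)
    have "\<nu> (indicator K) \<le> \<nu> (heat ((1 / 8) ^ j) (indicator K)) + R j"
    proof (rule LIMSEQ_le)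
      show "(\<lambda>n. \<nu> (f n)) \<longlonglongrightarrow> \<nu> (indicator K)" by (rule lim\<nu>[OF fb Kb f(4)])
      show "(\<lambda>n. \<nu> (heat ((1 / 8) ^ j) (f n)) + R j) \<longlonglongrightarrow> \<nu> (heat ((1 / 8) ^ j) (indicator K)) + R j"
        by (intro tendsto_add tendsto_const lim\<nu> heat_bounded[OF p] fb Kb hl)
      show "\<exists>N. \<forall>n\<ge>N. \<nu> (f n) \<le> \<nu> (heat ((1 / 8) ^ j) (f n)) + R j"
        using cont_bound[OF j fb f(1)] by blast
    qed
    also have "\<nu> (heat ((1 / 8) ^ j) (indicator K)) = 0" unfolding \<nu>_def h0 by simp
    finally show ?thesis by simp
  qed
  have "\<nu> (indicator K) \<le> 0"
    by (rule tendsto_lowerbound[OF R]) (use bound in \<open>auto simp: eventually_sequentially\<close>)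
  moreover have nn: "0 \<le> weight s \<omega> * indicator K (Xmod s \<omega>)" for \<omega>
    using weight_bounds(1)[of s \<omega>] by (auto simp: indicator_def)
  moreover have "0 \<le> \<nu> (indicator K)" unfolding \<nu>_def using nn by simp
  ultimately have "(\<integral>\<omega>. weight s \<omega> * indicator K (Xmod s \<omega>) \<partial>M) = 0" unfolding \<nu>_def by linarith
  then have "AE \<omega> in M. weight s \<omega> * indicator K (Xmod s \<omega>) = 0"
    using integral_nonneg_eq_0_iff_AE[OF int[OF Kb]] nn by simp
  then have "AE \<omega> in M. \<not> (\<omega> \<in> Xmod s -` K \<inter> space M)"
    by eventually_elim (use weight_bounds(1)[of s] in \<open>auto simp: indicator_def less_le split: if_splits\<close>)
  then show ?thesis by (subst prob_eq_0) auto
qed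

text \<open>Inner regularity of the law reduces any null set to its compact subsets, to which
  \<open>null_compact\<close> applies. The exceptional times are those at which the series of mean
  weight increments diverges.\<close>

lemma Xmod_law_null:
  "AE s in lborel. 0 < s \<longrightarrow> (\<forall>N\<in>null_sets lborel. AE \<omega> in M. Xmod s \<omega> \<notin> N)"
  using mean_weight_increment_summable
proof eventually_elim
  case (elim s)
  show ?case
  proof (intro impI ballI)
    assume s: "0 < s"
    fix N :: "'a set" assume N: "N \<in> null_sets lborel"
    then have Nb[measurable]: "N \<in> sets borel" by auto
    define D where "D = distr M borel (Xmod s)"
    interpret D: prob_space D unfolding D_def by (rule prob_space_distr) measurable
    have "emeasure D N = (SUP K \<in> {K. K \<subseteq> N \<and> compact K}. emeasure D K)"
      by (rule inner_regular) (use D.emeasure_space_1 in \<open>auto simp: D_def\<close>)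
    also have "\<dots> = 0"
    proof -
      have "emeasure D K = 0" if "K \<subseteq> N" "compact K" for K
      proof -
        have Kb: "K \<in> sets borel" using that by (auto simp: compact_imp_closed)
        have "K \<in> null_sets lborel" by (rule null_sets_subset[OF N]) (use that Kb in auto)
        then have "prob (Xmod s -` K \<inter> space M) = 0" using null_compact[OF s _ that(2)] elim s by auto
        then show ?thesis using Kb by (simp add: D_def emeasure_distr emeasure_eq_measure)
      qed
      then show ?thesis by (auto simp: SUP_eq_const intro!: SUP_eqI)
    qed
    finally have "emeasure M (Xmod s -` N \<inter> space M) = 0" by (simp add: D_def emeasure_distr)
    then show "AE \<omega> in M. Xmod s \<omega> \<notin> N"
      by (intro AE_I[of _ _ "Xmod s -` N \<inter> space M"]) auto
  qed
qed

section \<open>Passage to a coefficient bounded everywhere\<close>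

text \<open>For almost every \<open>s\<close> the points where \<open>b0 s\<close> exceeds \<beta>
  form a null set, and so do their reflections \<open>x - y\<close> for each fixed \<open>x\<close>.
  The law of \<open>Xmod s\<close> does not charge them, so altering the coefficient there leaves
  the integral unchanged for every \<open>x\<close>, not merely for almost every one.\<close>

lemma drift_eq_vel:
  fixes c :: "real \<Rightarrow> 'a \<Rightarrow> 'a"
  assumes c: "\<And>s x. norm (b0 s x) \<le> \<beta> \<Longrightarrow> c s x = b0 s x" and c_m: "\<And>s. c s \<in> borel_measurable borel"
    and bd: "AE (s, x) in lborel. norm (b0 s x) \<le> \<beta>"
  shows "AE s in lborel. 0 < s \<longrightarrow> (\<forall>x. (\<integral>\<omega>. c s (x - Xmod s \<omega>) \<partial>M) = vel s x)"
proof -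
  have "AE s in lborel. AE x in lborel. norm (b0 s x) \<le> \<beta>"
    using lborel_pair.AE_pair[of "\<lambda>(s, x). norm (b0 s x) \<le> \<beta>"] bd unfolding lborel_prod by simp
  then show ?thesis
    using Xmod_law_null
  proof eventually_elim
    case (elim s)
    show ?case
    proof (intro impI allI)
      fix x :: 'a assume s: "0 < s"
      have [measurable]: "b0 s \<in> borel_measurable borel" "c s \<in> borel_measurable borel"
        by (rule b0_measurable, rule c_m)
      have "distr lborel borel (\<lambda>y. x - y) = lborel"
        by (subst (2) lborel_affine[of "-1" x]) (auto simp: density_1)
      then have "AE y in distr lborel borel (\<lambda>y. x - y). norm (b0 s y) \<le> \<beta>" using elim(1) by (simp only:)
      then have "AE y in lborel. norm (b0 s (x - y)) \<le> \<beta>" by (subst (asm) AE_distr_iff) auto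
      then have "{y. \<not> norm (b0 s (x - y)) \<le> \<beta>} \<in> null_sets lborel"
        by (subst AE_iff_null_sets) simp_all
      then have "AE \<omega> in M. Xmod s \<omega> \<notin> {y. \<not> norm (b0 s (x - y)) \<le> \<beta>}" using elim(2) s by blast
      then show "(\<integral>\<omega>. c s (x - Xmod s \<omega>) \<partial>M) = vel s x"
        unfolding vel_def by (intro integral_cong_AE) (auto simp: c elim: eventually_mono)
    qed
  qed
qed

text \<open>With the truncated coefficient \<open>c\<close>, the drift equals \<open>vel\<close> for
  almost every time, so the integrated drift is the one in the equation. Consequently
  \<open>Xmod t - Xmod s\<close> minus its drift part is almost surely the Brownian increment, and
  \<open>W_increment\<close> provides the required joint law.\<close>

lemma mean_field_instance: "\<exists>c \<beta>. mean_field M Xmod c \<beta>"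
proof -
  obtain C where C: "AE (t, x) in lborel. 0 \<le> t \<longrightarrow> norm (b t x) \<le> C" using b_bounded by blast
  define \<beta> where "\<beta> = max C 0"
  \<comment> \<open>Set to zero where the essential bound fails. The bound \<beta> is taken as a
    maximum with 0 since the essential bound comes with no sign.\<close>
  define c where "c = (\<lambda>s x. if norm (b0 s x) \<le> \<beta> then b0 s x else 0)"
  note [measurable] = b0_joint b0_measurable vel_joint
  have \<beta>: "0 \<le> \<beta>" by (simp add: \<beta>_def)
  have cb: "norm (c s x) \<le> \<beta>" for s x using \<beta> by (simp add: c_def)
  have cm: "c s \<in> borel_measurable borel" for s unfolding c_def by measurable
  have bd: "AE (s, x) in lborel. norm (b0 s x) \<le> \<beta>"
    using C by eventually_elim (auto simp: b0_def \<beta>_def)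
  interpret P: mean_field_paths M Xmod c \<beta>
  proof
    show "(\<lambda>p. Xmod (fst p) (snd p)) \<in> borel_measurable (borel \<Otimes>\<^sub>M M)" by (rule Xmod_joint)
    show "(\<lambda>p. c (fst p) (snd p)) \<in> borel_measurable (borel \<Otimes>\<^sub>M borel)" unfolding c_def by measurable
  qed (rule cb)
  have dv: "AE s in lborel. 0 < s \<longrightarrow> (\<forall>x. P.drift s x = vel s x)"
    unfolding P.drift_def by (rule drift_eq_vel[OF _ cm bd]) (simp add: c_def)
  have acc: "P.acc t \<omega> = (LINT s:{0..t}|lborel. vel s (Xmod s \<omega>))" if \<omega>: "\<omega> \<in> space M" for t \<omega>
  proof -
    have [measurable]: "(\<lambda>s. Xmod s \<omega>) \<in> borel_measurable borel"
      using measurable_compose[OF _ Xmod_joint, of "\<lambda>s. (s, \<omega>)" borel] \<omega> by simp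
    have [measurable]: "(\<lambda>s. vel s (Xmod s \<omega>)) \<in> borel_measurable borel"
      using measurable_compose[OF _ vel_joint, of "\<lambda>s. (s, Xmod s \<omega>)" borel] by simp
    note [measurable] = P.drift_path_measurable[OF \<omega>]
    show ?thesis
      unfolding P.acc_def set_lebesgue_integral_def
    proof (rule integral_cong_AE)
      show "AE s in lborel. indicator {0..t} s *\<^sub>R P.drift s (Xmod s \<omega>) = indicator {0..t} s *\<^sub>R vel s (Xmod s \<omega>)"
        using dv AE_lborel_singleton[of "0::real"] by eventually_elim (auto simp: indicator_def)
    qed measurable
  qed
  have "mean_field M Xmod c \<beta>"
  proof
    fix s t :: real assume st: "0 \<le> s" "s < t"
    have [measurable]: "X s \<in> borel_measurable M" "W t \<in> borel_measurable M" "W s \<in> borel_measurable M"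
      using X_measurable W_measurable st by auto
    have X: "Xmod r \<omega> = Xmod 0 \<omega> + P.acc r \<omega> + W r \<omega>" if "good \<omega>" "\<omega> \<in> space M" "0 \<le> r" for r \<omega>
      using that unfolding good_def acc[OF that(2)] by blast
    have ae: "AE \<omega> in M. (Xmod s \<omega>, Xmod t \<omega> - Xmod s \<omega> - (P.acc t \<omega> - P.acc s \<omega>)) = (X s \<omega>, W t \<omega> - W s \<omega>)"
      using good_AE AE_space
    proof eventually_elim
      case (elim \<omega>)
      have "Xmod s \<omega> = X s \<omega>" using elim(1) st(1) unfolding good_def by blast
      moreover have "Xmod t \<omega> - Xmod s \<omega> - (P.acc t \<omega> - P.acc s \<omega>) = W t \<omega> - W s \<omega>"
        using X[OF elim, of t] X[OF elim, of s] st by simp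
      ultimately show ?case by simp
    qed
    have ae2: "AE \<omega> in M. X s \<omega> = Xmod s \<omega>" using ae by eventually_elim simp
    have "distr M (borel \<Otimes>\<^sub>M borel) (\<lambda>\<omega>. (Xmod s \<omega>, Xmod t \<omega> - Xmod s \<omega> - (P.acc t \<omega> - P.acc s \<omega>)))
      = distr M (borel \<Otimes>\<^sub>M borel) (\<lambda>\<omega>. (X s \<omega>, W t \<omega> - W s \<omega>))"
      by (rule distr_cong_AE[OF refl refl ae]) measurable
    also have "\<dots> = distr M borel (X s) \<Otimes>\<^sub>M gauss (t - s)"
      using X_adapted[of s s] st by (intro W_increment) auto
    also have "distr M borel (X s) = distr M borel (Xmod s)"
      by (rule distr_cong_AE[OF refl refl ae2]) measurable
    finally show "distr M (borel \<Otimes>\<^sub>M borel) (\<lambda>\<omega>. (Xmod s \<omega>, Xmod t \<omega> - Xmod s \<omega> - (P.acc t \<omega> - P.acc s \<omega>)))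
      = distr M borel (Xmod s) \<Otimes>\<^sub>M gauss (t - s)" .
  qed
  then show ?thesis by blast
qed

theorem law_differences:
  assumes t: "0 < t"
  shows "\<exists>K\<ge>0. \<forall>h B \<phi>. bounded_borel B \<phi> \<longrightarrow> \<bar>\<integral>\<omega>. (fdiff h ^^ n) \<phi> (X t \<omega>) \<partial>M\<bar> \<le> K * B * sqrt (norm h) ^ n"
proof -
  obtain c \<beta> where "mean_field M Xmod c \<beta>" using mean_field_instance by blast
  then interpret P: mean_field M Xmod c \<beta> .
  obtain K where K: "P.smooth_law n K t" using P.smooth_law_all[OF t] by blast
  have ae: "AE \<omega> in M. Xmod t \<omega> = X t \<omega>"
    using good_AE by eventually_elim (use t in \<open>auto simp: good_def\<close>)
  have [measurable]: "X t \<in> borel_measurable M" using X_measurable t by simp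
  show ?thesis
  proof (intro exI[of _ K] conjI allI impI P.smooth_lawD(1)[OF K])
    fix h B and \<phi> :: "'a \<Rightarrow> real" assume \<phi>: "bounded_borel B \<phi>"
    note [measurable] = bounded_borelD(1)[OF bounded_borel_fdiff_funpow[OF \<phi>]]
    have "(\<integral>\<omega>. (fdiff h ^^ n) \<phi> (X t \<omega>) \<partial>M) = (\<integral>\<omega>. (fdiff h ^^ n) \<phi> (Xmod t \<omega>) \<partial>M)"
      by (rule integral_cong_AE) (use ae in \<open>auto elim: eventually_mono\<close>)
    then show "\<bar>\<integral>\<omega>. (fdiff h ^^ n) \<phi> (X t \<omega>) \<partial>M\<bar> \<le> K * B * sqrt (norm h) ^ n"
      using P.smooth_lawD(2)[OF K order_refl \<phi>] by simp
  qed
qed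

end

section \<open>Fourier transforms of rapidly decreasing functions\<close>

lemma iter_deriv_closed:
  assumes f: "f \<in> Q"
    and D: "\<And>f. f \<in> Q \<Longrightarrow> \<exists>f'. (\<forall>x. (f has_derivative f' x) (at x)) \<and> (\<forall>v\<in>Basis. (\<lambda>x. f' x v) \<in> Q)"
    and vs: "set vs \<subseteq> Basis"
  shows "iter_deriv vs f \<in> Q"
  using vs
proof (induction vs)
  case (Cons v vs)
  then obtain f' where f': "\<And>x. (iter_deriv vs f has_derivative f' x) (at x)" "\<forall>v\<in>Basis. (\<lambda>x. f' x v) \<in> Q"
    using D[of "iter_deriv vs f"] by auto
  then have "frechet_derivative (iter_deriv vs f) (at x) = f' x" for x
    using frechet_derivative_at[OF f'(1)] by simp
  then show ?case using f'(2) Cons.prems by simp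
qed (use f in simp)

text \<open>An invariance principle: to prove smoothness it suffices to place \<open>f\<close> in
  some set of differentiable functions that is closed under partial derivatives. The sets used below
  are chosen for that purpose.\<close>

lemma smooth_closed:
  fixes f :: "'a::euclidean_space \<Rightarrow> 'b::real_normed_vector"
  assumes f: "f \<in> Q"
    and D: "\<And>f. f \<in> Q \<Longrightarrow> \<exists>f'. (\<forall>x. (f has_derivative f' x) (at x)) \<and> (\<forall>v\<in>Basis. (\<lambda>x. f' x v) \<in> Q)"
  shows "smooth f"
  unfolding smooth_def differentiable_upto_def
proof (intro allI impI)
  fix k and vs :: "'a list" and x :: 'a assume "set vs \<subseteq> Basis \<and> length vs < (k::nat)"
  then have "iter_deriv vs f \<in> Q" using iter_deriv_closed[OF f D, of vs] by blast
  then show "iter_deriv vs f differentiable at x" using D[of "iter_deriv vs f"] unfolding differentiable_def by blast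
qed

lemma iter_deriv_append:
  "iter_deriv (vs @ [e]) f = iter_deriv vs (\<lambda>x. frechet_derivative f (at x) e)"
  by (induction vs) simp_all

lemma smooth_differentiable: "smooth f \<Longrightarrow> f differentiable at x"
  unfolding smooth_def differentiable_upto_def by (metis iter_deriv.simps(1) empty_subsetI length_0_conv lessI list.set(1))

lemma smooth_has_derivative:
  assumes "smooth f" shows "(f has_derivative frechet_derivative f (at x)) (at x)"
  using smooth_differentiable[OF assms] frechet_derivative_works by blast

lemma smooth_continuous: "smooth f \<Longrightarrow> continuous_on UNIV f"
  using smooth_differentiable differentiable_imp_continuous_within continuous_at_imp_continuous_on by blast

lemma smooth_partial:
  fixes f :: "'a::euclidean_space \<Rightarrow> 'b::real_normed_vector"
  assumes "smooth f" "e \<in> Basis"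
  shows "smooth (\<lambda>x. frechet_derivative f (at x) e)"
  unfolding smooth_def differentiable_upto_def
proof (intro allI impI)
  fix k and vs :: "'a list" and x :: 'a assume "set vs \<subseteq> Basis \<and> length vs < (k::nat)"
  then have "iter_deriv (vs @ [e]) f differentiable at x"
    using assms unfolding smooth_def differentiable_upto_def by (metis Un_subset_iff empty_subsetI insert_subset length_append_singleton lessI list.set(1) list.simps(15) set_append)
  then show "iter_deriv vs (\<lambda>x. frechet_derivative f (at x) e) differentiable at x"
    unfolding iter_deriv_append .
qed

text \<open>Sums and products of smooth functions, made into a set that the Leibniz rule does not
  leave.\<close>

inductive_set smooth_algebra :: "('a::euclidean_space \<Rightarrow> complex) set" where
  base: "smooth f \<Longrightarrow> f \<in> smooth_algebra"
| add: "f \<in> smooth_algebra \<Longrightarrow> g \<in> smooth_algebra \<Longrightarrow> (\<lambda>x. f x + g x) \<in> smooth_algebra"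
| mult: "f \<in> smooth_algebra \<Longrightarrow> g \<in> smooth_algebra \<Longrightarrow> (\<lambda>x. f x * g x) \<in> smooth_algebra"

lemma smooth_algebra_smooth: "f \<in> smooth_algebra \<Longrightarrow> smooth f"
proof (rule smooth_closed[of f smooth_algebra])
  fix f :: "'a \<Rightarrow> complex" assume "f \<in> smooth_algebra"
  then show "\<exists>f'. (\<forall>x. (f has_derivative f' x) (at x)) \<and> (\<forall>v\<in>Basis. (\<lambda>x. f' x v) \<in> smooth_algebra)"
  proof induction
    case (base f)
    then show ?case
      using smooth_has_derivative smooth_partial smooth_algebra.base by (intro exI[of _ "\<lambda>x. frechet_derivative f (at x)"]) blast
  next
    case (add f g)
    then obtain f' g' where "\<forall>x. (f has_derivative f' x) (at x)" "\<forall>v\<in>Basis. (\<lambda>x. f' x v) \<in> smooth_algebra"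
      "\<forall>x. (g has_derivative g' x) (at x)" "\<forall>v\<in>Basis. (\<lambda>x. g' x v) \<in> smooth_algebra" by blast
    then show ?case
      by (intro exI[of _ "\<lambda>x v. f' x v + g' x v"]) (auto intro!: has_derivative_add smooth_algebra.add)
  next
    case (mult f g)
    then obtain f' g' where *: "\<forall>x. (f has_derivative f' x) (at x)" "\<forall>v\<in>Basis. (\<lambda>x. f' x v) \<in> smooth_algebra"
      "\<forall>x. (g has_derivative g' x) (at x)" "\<forall>v\<in>Basis. (\<lambda>x. g' x v) \<in> smooth_algebra" by blast
    show ?case
    proof (intro exI[of _ "\<lambda>x v. f x * g' x v + f' x v * g x"] conjI allI ballI)
      show "((\<lambda>x. f x * g x) has_derivative (\<lambda>v. f x * g' x v + f' x v * g x)) (at x)" for x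
        using * by (intro has_derivative_mult) auto
      show "(\<lambda>x. f x * g' x v + f' x v * g x) \<in> smooth_algebra" if "v \<in> Basis" for v
        using * mult that by (intro smooth_algebra.add smooth_algebra.mult) auto
    qed
  qed
qed

lemma smooth_add: "smooth f \<Longrightarrow> smooth g \<Longrightarrow> smooth (\<lambda>x. f x + g x :: complex)"
  and smooth_mult: "smooth f \<Longrightarrow> smooth g \<Longrightarrow> smooth (\<lambda>x. f x * g x :: complex)"
  by (rule smooth_algebra_smooth[OF smooth_algebra.add[OF smooth_algebra.base smooth_algebra.base]]; assumption)
     (rule smooth_algebra_smooth[OF smooth_algebra.mult[OF smooth_algebra.base smooth_algebra.base]]; assumption)

lemma smooth_const: "smooth (\<lambda>_::'a::euclidean_space. c :: complex)"
proof (rule smooth_closed[of _ "range (\<lambda>c _. c)"])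
  fix f :: "'a \<Rightarrow> complex" assume "f \<in> range (\<lambda>c _. c)"
  then show "\<exists>f'. (\<forall>x. (f has_derivative f' x) (at x)) \<and> (\<forall>v\<in>Basis. (\<lambda>x. f' x v) \<in> range (\<lambda>c _. c))"
    by (intro exI[of _ "\<lambda>_ _. 0"]) auto
qed auto

lemma smooth_cmult: "smooth f \<Longrightarrow> smooth (\<lambda>x. c * f x :: complex)"
  by (rule smooth_mult[OF smooth_const])

lemma smooth_diff: "smooth f \<Longrightarrow> smooth g \<Longrightarrow> smooth (\<lambda>x. f x - g x :: complex)"
  using smooth_add[OF _ smooth_cmult[of g "-1"]] by simp

lemma smooth_power: "smooth f \<Longrightarrow> smooth (\<lambda>x. f x ^ n :: complex)"
  by (induction n) (simp_all add: smooth_const smooth_mult)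

lemma smooth_sum: "(\<And>i. i \<in> I \<Longrightarrow> smooth (f i)) \<Longrightarrow> smooth (\<lambda>x. \<Sum>i\<in>I. f i x :: complex)"
  by (induction I rule: infinite_finite_induct) (simp_all add: smooth_const smooth_add)

text \<open>Multiples of cosines with a phase are closed under differentiation, because the
  derivative shifts the phase by a quarter turn.\<close>

lemma smooth_cos: "smooth (\<lambda>x::'a::euclidean_space. complex_of_real (cos (x \<bullet> e)))"
proof (rule smooth_closed[of _ "{f. \<exists>c \<theta>. f = (\<lambda>x. complex_of_real (c * cos (x \<bullet> e + \<theta>)))}"])
  show "(\<lambda>x. complex_of_real (cos (x \<bullet> e))) \<in> {f. \<exists>c \<theta>. f = (\<lambda>x. complex_of_real (c * cos (x \<bullet> e + \<theta>)))}"
    by (simp, rule exI[of _ 1], rule exI[of _ 0]) simp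
  fix f :: "'a \<Rightarrow> complex" assume "f \<in> {f. \<exists>c \<theta>. f = (\<lambda>x. complex_of_real (c * cos (x \<bullet> e + \<theta>)))}"
  then obtain c \<theta> where f: "f = (\<lambda>x. complex_of_real (c * cos (x \<bullet> e + \<theta>)))" by blast
  show "\<exists>f'. (\<forall>x. (f has_derivative f' x) (at x)) \<and> (\<forall>v\<in>Basis. (\<lambda>x. f' x v) \<in> {f. \<exists>c \<theta>. f = (\<lambda>x. complex_of_real (c * cos (x \<bullet> e + \<theta>)))})"
  proof (intro exI[of _ "\<lambda>x v. complex_of_real (c * (- sin (x \<bullet> e + \<theta>) * (v \<bullet> e)))"] conjI allI ballI)
    show "(f has_derivative (\<lambda>v. complex_of_real (c * (- sin (x \<bullet> e + \<theta>) * (v \<bullet> e))))) (at x)" for x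
      unfolding f by (auto intro!: derivative_eq_intros simp: algebra_simps)
    show "(\<lambda>x. complex_of_real (c * (- sin (x \<bullet> e + \<theta>) * (v \<bullet> e)))) \<in> {f. \<exists>c \<theta>. f = (\<lambda>x. complex_of_real (c * cos (x \<bullet> e + \<theta>)))}" for v
      by (simp, rule exI[of _ "c * (v \<bullet> e)"], rule exI[of _ "\<theta> + pi / 2"])
         (simp add: fun_eq_iff add.assoc[symmetric] cos_add)
  qed
qed

lemma supp_partial: "supp (\<lambda>x. frechet_derivative f (at x) e) \<subseteq> supp f"
  unfolding supp_def
proof (rule closure_mono[of _ "closure {x. f x \<noteq> 0}", simplified])
  show "{x. frechet_derivative f (at x) e \<noteq> 0} \<subseteq> closure {x. f x \<noteq> 0}"
  proof (rule ccontr)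
    assume "\<not> ?thesis"
    then obtain x where x: "frechet_derivative f (at x) e \<noteq> 0" "x \<notin> closure {x. f x \<noteq> 0}" by blast
    have "(f has_derivative (\<lambda>_. 0)) (at x)"
    proof (rule has_derivative_transform_within_open[of "\<lambda>_. 0" _ _ UNIV "- closure {x. f x \<noteq> 0}"])
      show "0 = f y" if "y \<in> - closure {x. f x \<noteq> 0}" for y using that closure_subset[of "{x. f x \<noteq> 0}"] by auto
    qed (use x in auto)
    from frechet_derivative_at[OF this] have "frechet_derivative f (at x) e = 0" by metis
    with x(1) show False by simp
  qed
qed

lemma not_supp_zero: "x \<notin> supp f \<Longrightarrow> f x = 0"
  unfolding supp_def using closure_subset[of "{x. f x \<noteq> 0}"] by auto

lemma supp_subset_closed: "closed S \<Longrightarrow> (\<And>x. f x \<noteq> 0 \<Longrightarrow> x \<in> S) \<Longrightarrow> supp f \<subseteq> S"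
  unfolding supp_def by (rule closure_minimal) auto

lemma closed_supp: "closed (supp f)"
  by (simp add: supp_def)

lemma test_functionsI:
  assumes "smooth f" "compact K" "\<And>x. f x \<noteq> 0 \<Longrightarrow> x \<in> K"
  shows "f \<in> test_functions"
proof -
  have "supp f \<subseteq> K" using assms compact_imp_closed by (intro supp_subset_closed) auto
  then have "compact (supp f)"
    using closed_Int_compact[OF closed_supp assms(2), of f] by (simp add: Int_absorb2)
  then show ?thesis using assms by (simp add: test_functions_def)
qed

lemma test_functions_partial:
  assumes "f \<in> test_functions" "e \<in> Basis"
  shows "(\<lambda>x. frechet_derivative f (at x) e) \<in> test_functions"
  using assms supp_partial[of f e] not_supp_zero[of _ "\<lambda>x. frechet_derivative f (at x) e"] unfolding test_functions_def
  by (intro test_functionsI[of _ "supp f", unfolded test_functions_def] smooth_partial) auto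

lemma test_functions_diff:
  fixes f g :: "'a::euclidean_space \<Rightarrow> complex"
  assumes "f \<in> test_functions" "g \<in> test_functions"
  shows "(\<lambda>x. f x - g x) \<in> test_functions"
proof (rule test_functionsI[of _ "supp f \<union> supp g"])
  show "smooth (\<lambda>x. f x - g x)" using assms by (intro smooth_diff) (auto simp: test_functions_def)
  show "compact (supp f \<union> supp g)" using assms by (intro compact_Un) (auto simp: test_functions_def)
  show "x \<in> supp f \<union> supp g" if "f x - g x \<noteq> 0" for x
  proof (rule ccontr)
    assume "x \<notin> supp f \<union> supp g"
    then have "f x = 0" "g x = 0" by (auto intro: not_supp_zero)
    with that show False by simp
  qed
qed

text \<open>The invariant set consists of the quotients by powers of \<open>a\<close> whose
  numerator is supported where \<open>a\<close> does not vanish. By the quotient rule the new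
  numerator is supported in the old support.\<close>

lemma test_functions_divide:
  fixes \<eta> a :: "'a::euclidean_space \<Rightarrow> complex"
  assumes \<eta>: "\<eta> \<in> test_functions" and a: "smooth a" and nz: "\<And>x. x \<in> supp \<eta> \<Longrightarrow> a x \<noteq> 0"
  shows "(\<lambda>x. \<eta> x / a x) \<in> test_functions"
proof (rule test_functionsI[of _ "supp \<eta>"])
  define Q where "Q = {f. \<exists>\<eta> k. smooth \<eta> \<and> (\<forall>x\<in>supp \<eta>. a x \<noteq> 0) \<and> f = (\<lambda>x. \<eta> x / a x ^ k)}"
  show "smooth (\<lambda>x. \<eta> x / a x)"
  proof (rule smooth_closed[of _ Q])
    show "(\<lambda>x. \<eta> x / a x) \<in> Q"
      unfolding Q_def using \<eta> nz by (auto intro!: exI[of _ \<eta>] exI[of _ 1] simp: test_functions_def)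
    fix f assume "f \<in> Q"
    then obtain \<eta> k where \<eta>: "smooth \<eta>" "\<forall>x\<in>supp \<eta>. a x \<noteq> 0" and f: "f = (\<lambda>x. \<eta> x / a x ^ k)" unfolding Q_def by blast
    define \<eta>' where "\<eta>' = (\<lambda>x. frechet_derivative \<eta> (at x))"
    define a' where "a' = (\<lambda>x. frechet_derivative a (at x))"
    define f' where "f' = (\<lambda>x v. (a x * \<eta>' x v - of_nat k * \<eta> x * a' x v) / a x ^ Suc k)"
    have d\<eta>: "(\<eta> has_derivative \<eta>' x) (at x)" and da: "(a has_derivative a' x) (at x)" for x
      unfolding \<eta>'_def a'_def by (rule smooth_has_derivative[OF \<eta>(1)], rule smooth_has_derivative[OF a])
    have "(f has_derivative f' x) (at x)" for x
    \<comment> \<open>At a zero of \<open>a\<close> the numerator vanishes in a whole neighbourhood,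
      and the quotient is 0 there, also at zeros of \<open>a\<close> by the convention for division
      by zero.\<close>
    proof (cases "a x = 0")
      case True
      then have x: "x \<in> - supp \<eta>" using \<eta>(2) by blast
      have z: "\<eta> y = 0" if "y \<in> - supp \<eta>" for y using that not_supp_zero by auto
      have "(f has_derivative (\<lambda>_. 0)) (at x)"
      proof (rule has_derivative_transform_within_open[of "\<lambda>_. 0" _ _ UNIV "- supp \<eta>"])
        show "0 = f y" if "y \<in> - supp \<eta>" for y using z[OF that] by (simp add: f)
      qed (use x closed_supp in auto)
      moreover have "f' x = (\<lambda>_. 0)" using True by (simp add: f'_def)
      ultimately show ?thesis by simp
    next
      case False
      have "((\<lambda>x. \<eta> x / a x ^ k) has_derivative
        (\<lambda>h. - \<eta> x * (inverse (a x ^ k) * (of_nat k * a' x h * a x ^ (k - 1)) * inverse (a x ^ k)) + \<eta>' x h / a x ^ k)) (at x)"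
        by (rule has_derivative_divide[OF d\<eta> has_derivative_power[OF da]]) (use False in auto)
      moreover have "- \<eta> x * (inverse (a x ^ k) * (of_nat k * a' x h * a x ^ (k - 1)) * inverse (a x ^ k)) + \<eta>' x h / a x ^ k = f' x h" for h
        using False by (cases k) (simp_all add: f'_def field_simps)
      ultimately show ?thesis unfolding f by simp
    qed
    moreover have "(\<lambda>x. f' x v) \<in> Q" if v: "v \<in> Basis" for v
    proof -
      have "smooth (\<lambda>x. a x * \<eta>' x v - of_nat k * \<eta> x * a' x v)"
        unfolding \<eta>'_def a'_def using a \<eta>(1) v by (intro smooth_diff smooth_mult smooth_const smooth_partial)
      moreover have "supp (\<lambda>x. a x * \<eta>' x v - of_nat k * \<eta> x * a' x v) \<subseteq> supp \<eta>"
      proof (rule supp_subset_closed[OF closed_supp])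
        fix x assume "a x * \<eta>' x v - of_nat k * \<eta> x * a' x v \<noteq> 0"
        then have "\<eta>' x v \<noteq> 0 \<or> \<eta> x \<noteq> 0" by auto
        then show "x \<in> supp \<eta>"
          using not_supp_zero[of x \<eta>] not_supp_zero[of x "\<lambda>x. \<eta>' x v"] supp_partial[of \<eta> v] unfolding \<eta>'_def by blast
      qed
      ultimately show ?thesis using \<eta>(2) unfolding Q_def f'_def by blast
    qed
    ultimately show "\<exists>f'. (\<forall>x. (f has_derivative f' x) (at x)) \<and> (\<forall>v\<in>Basis. (\<lambda>x. f' x v) \<in> Q)" by blast
  qed
  show "compact (supp \<eta>)" using \<eta> by (simp add: test_functions_def)
  show "x \<in> supp \<eta>" if "\<eta> x / a x \<noteq> 0" for x using that not_supp_zero[of x \<eta>] by auto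
qed

lemma has_derivative_quadratic:
  fixes f :: "'a::real_normed_vector \<Rightarrow> 'b::real_normed_vector"
  assumes L: "bounded_linear L" and bd: "\<And>v. norm (f (x + v) - f x - L v) \<le> C * (norm v)\<^sup>2"
  shows "(f has_derivative L) (at x)"
  unfolding has_derivative_at
proof (rule conjI[OF L], rule Lim_null_comparison[where g="\<lambda>v. C * norm v"])
  show "\<forall>\<^sub>F h in at 0. norm (norm (f (x + h) - f x - L h) / norm h) \<le> C * norm h"
    unfolding eventually_at_filter
  proof (intro always_eventually allI impI)
    fix h :: 'a assume "h \<noteq> 0"
    then show "norm (norm (f (x + h) - f x - L h) / norm h) \<le> C * norm h"
      using bd[of h] by (simp add: power2_eq_square pos_divide_le_eq mult.assoc)
  qed
  show "((\<lambda>v. C * norm v) \<longlongrightarrow> 0) (at 0)"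
    by (auto intro!: tendsto_eq_intros)
qed

section \<open>Fourier transforms of functions with all moments\<close>

text \<open>Integrated moments in place of pointwise decay: this is what differentiating the Fourier
  transform arbitrarily often consumes, and multiplication by a coordinate preserves it.\<close>

definition rapid :: "('a::euclidean_space \<Rightarrow> complex) \<Rightarrow> bool" where
  "rapid a \<longleftrightarrow> a \<in> borel_measurable borel \<and> (\<forall>N. integrable lborel (\<lambda>\<xi>. (1 + norm \<xi>) ^ N * norm (a \<xi>)))"

lemma rapidD:
  assumes "rapid a"
  shows "a \<in> borel_measurable borel" "integrable lborel (\<lambda>\<xi>. (1 + norm \<xi>) ^ N * norm (a \<xi>))" "integrable lborel a"
proof -
  show "a \<in> borel_measurable borel" "integrable lborel (\<lambda>\<xi>. (1 + norm \<xi>) ^ N * norm (a \<xi>))" for N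
    using assms by (auto simp: rapid_def)
  from this(1) this(2)[of 0] show "integrable lborel a" using integrable_norm_cancel[of lborel a] by simp
qed

lemma rapid_coord:
  assumes "rapid a" shows "rapid (\<lambda>\<xi>. - \<i> * complex_of_real (\<xi> \<bullet> v) * a \<xi>)"
  unfolding rapid_def
proof (intro conjI allI)
  note [measurable] = rapidD(1)[OF assms]
  show "(\<lambda>\<xi>. - \<i> * complex_of_real (\<xi> \<bullet> v) * a \<xi>) \<in> borel_measurable borel" by measurable
  fix N
  show "integrable lborel (\<lambda>\<xi>. (1 + norm \<xi>) ^ N * norm (- \<i> * complex_of_real (\<xi> \<bullet> v) * a \<xi>))"
  proof (rule Bochner_Integration.integrable_bound[OF integrable_mult_right[OF rapidD(2)[OF assms, of "Suc N"], of "norm v"]])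
    show "AE \<xi> in lborel. norm ((1 + norm \<xi>) ^ N * norm (- \<i> * complex_of_real (\<xi> \<bullet> v) * a \<xi>))
      \<le> norm (norm v * ((1 + norm \<xi>) ^ Suc N * norm (a \<xi>)))"
    proof (rule AE_I2)
      fix \<xi> :: 'a
      have "\<bar>\<xi> \<bullet> v\<bar> \<le> (1 + norm \<xi>) * norm v"
        by (rule order_trans[OF Cauchy_Schwarz_ineq2]) (simp add: mult_right_mono)
      then have "(1 + norm \<xi>) ^ N * (\<bar>\<xi> \<bullet> v\<bar> * norm (a \<xi>)) \<le> (1 + norm \<xi>) ^ N * (((1 + norm \<xi>) * norm v) * norm (a \<xi>))"
        by (intro mult_left_mono mult_right_mono) auto
      then show "norm ((1 + norm \<xi>) ^ N * norm (- \<i> * complex_of_real (\<xi> \<bullet> v) * a \<xi>))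
          \<le> norm (norm v * ((1 + norm \<xi>) ^ Suc N * norm (a \<xi>)))"
        by (simp add: norm_mult abs_mult mult_ac)
    qed
  qed measurable
qed

lemma cis_bounds:
  "norm (cis \<theta> - 1) \<le> \<bar>\<theta>\<bar>" "norm (cis \<theta> - 1 - \<i> * complex_of_real \<theta>) \<le> \<theta>\<^sup>2"
proof -
  show "norm (cis \<theta> - 1) \<le> \<bar>\<theta>\<bar>" using iexp_approx1[of \<theta> 0] by (simp add: cis_conv_exp)
  have "norm (cis \<theta> - 1 - \<i> * complex_of_real \<theta>) \<le> \<bar>\<theta>\<bar>\<^sup>2 / 2"
    using iexp_approx1[of \<theta> 1] by (simp add: cis_conv_exp algebra_simps power2_eq_square)
  then show "norm (cis \<theta> - 1 - \<i> * complex_of_real \<theta>) \<le> \<theta>\<^sup>2" using zero_le_power2[of \<theta>] by (simp only: power2_abs)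
qed

lemma integrable_cis_mult:
  fixes a :: "'a::euclidean_space \<Rightarrow> complex"
  assumes "integrable lborel a" "(\<lambda>\<xi>. c \<xi> :: real) \<in> borel_measurable borel"
  shows "integrable lborel (\<lambda>\<xi>. cis (c \<xi>) * a \<xi>)"
proof -
  have [measurable]: "a \<in> borel_measurable borel" using assms(1) by auto
  have [measurable]: "(\<lambda>\<xi>. cis (c \<xi>)) \<in> borel_measurable borel"
    using assms(2) unfolding cis_conv_exp by measurable
  show ?thesis by (rule Bochner_Integration.integrable_bound[OF assms(1)]) (auto simp: norm_mult)
qed

lemma fourier_norm_le:
  fixes a :: "'a::euclidean_space \<Rightarrow> complex"
  shows "norm (fourier a x) \<le> (\<integral>\<xi>. norm (a \<xi>) \<partial>lborel)"
  unfolding fourier_def by (rule order_trans[OF integral_norm_bound]) (simp add: norm_mult)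

text \<open>The second order estimate for \<open>cis\<close> bounds the remainder by the second
  moment of \<open>a\<close> times the square of \<open>norm v\<close>, so
  \<open>has_derivative_quadratic\<close> applies.\<close>

lemma fourier_has_derivative:
  assumes a: "rapid a"
  shows "(fourier a has_derivative (\<lambda>v. fourier (\<lambda>\<xi>. - \<i> * complex_of_real (\<xi> \<bullet> v) * a \<xi>) x)) (at x)"
proof (rule has_derivative_quadratic)
  note [measurable] = rapidD(1)[OF a]
  have int: "integrable lborel (\<lambda>\<xi>. cis (- (\<xi> \<bullet> x)) * (- \<i> * complex_of_real (\<xi> \<bullet> v) * a \<xi>))" for v
    by (rule integrable_cis_mult[OF rapidD(3)[OF rapid_coord[OF a]]]) measurable
  have int0: "integrable lborel (\<lambda>\<xi>. cis (- (\<xi> \<bullet> y)) * a \<xi>)" for y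
    by (rule integrable_cis_mult[OF rapidD(3)[OF a]]) measurable
  show "bounded_linear (\<lambda>v. fourier (\<lambda>\<xi>. - \<i> * complex_of_real (\<xi> \<bullet> v) * a \<xi>) x)"
    unfolding linear_conv_bounded_linear[symmetric]
  proof (rule linearI)
    show "fourier (\<lambda>\<xi>. - \<i> * complex_of_real (\<xi> \<bullet> (v + w)) * a \<xi>) x
      = fourier (\<lambda>\<xi>. - \<i> * complex_of_real (\<xi> \<bullet> v) * a \<xi>) x + fourier (\<lambda>\<xi>. - \<i> * complex_of_real (\<xi> \<bullet> w) * a \<xi>) x" for v w
      unfolding fourier_def using Bochner_Integration.integral_add[OF int[of v] int[of w]]
      by (simp add: inner_add_right algebra_simps)
    show "fourier (\<lambda>\<xi>. - \<i> * complex_of_real (\<xi> \<bullet> (r *\<^sub>R v)) * a \<xi>) x = r *\<^sub>R fourier (\<lambda>\<xi>. - \<i> * complex_of_real (\<xi> \<bullet> v) * a \<xi>) x" for r v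
      unfolding fourier_def scaleR_conv_of_real by (subst integral_mult_right_zero[symmetric]) (simp add: mult_ac)
  qed
  fix v
  have cis_add: "cis (- (\<xi> \<bullet> (x + v))) = cis (- (\<xi> \<bullet> x)) * cis (- (\<xi> \<bullet> v))" for \<xi>
    by (simp add: cis_mult inner_add_right)
  have pt: "cis (- (\<xi> \<bullet> (x + v))) * a \<xi> - cis (- (\<xi> \<bullet> x)) * a \<xi> - cis (- (\<xi> \<bullet> x)) * (- \<i> * complex_of_real (\<xi> \<bullet> v) * a \<xi>)
     = cis (- (\<xi> \<bullet> x)) * (cis (- (\<xi> \<bullet> v)) - 1 - \<i> * complex_of_real (- (\<xi> \<bullet> v))) * a \<xi>" for \<xi>
    unfolding cis_add by (simp add: algebra_simps)
  define I where "I = (\<integral>\<xi>. (1 + norm \<xi>) ^ 2 * norm (a \<xi>) \<partial>lborel)"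
  have "fourier a (x + v) - fourier a x - fourier (\<lambda>\<xi>. - \<i> * complex_of_real (\<xi> \<bullet> v) * a \<xi>) x
     = (\<integral>\<xi>. cis (- (\<xi> \<bullet> (x + v))) * a \<xi> - cis (- (\<xi> \<bullet> x)) * a \<xi> - cis (- (\<xi> \<bullet> x)) * (- \<i> * complex_of_real (\<xi> \<bullet> v) * a \<xi>) \<partial>lborel)"
    unfolding fourier_def
    by (simp only: Bochner_Integration.integral_diff[OF Bochner_Integration.integrable_diff[OF int0 int0] int] Bochner_Integration.integral_diff[OF int0 int0])
  also have "\<dots> = (\<integral>\<xi>. cis (- (\<xi> \<bullet> x)) * (cis (- (\<xi> \<bullet> v)) - 1 - \<i> * complex_of_real (- (\<xi> \<bullet> v))) * a \<xi> \<partial>lborel)"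
    unfolding pt ..
  also have "norm \<dots> \<le> (\<integral>\<xi>. norm (cis (- (\<xi> \<bullet> x)) * (cis (- (\<xi> \<bullet> v)) - 1 - \<i> * complex_of_real (- (\<xi> \<bullet> v))) * a \<xi>) \<partial>lborel)"
    by (rule integral_norm_bound)
  also have "\<dots> \<le> (\<integral>\<xi>. norm v ^ 2 * ((1 + norm \<xi>) ^ 2 * norm (a \<xi>)) \<partial>lborel)"
  proof (rule integral_mono)
    show "integrable lborel (\<lambda>\<xi>. norm v ^ 2 * ((1 + norm \<xi>) ^ 2 * norm (a \<xi>)))"
      by (intro integrable_mult_right rapidD(2)[OF a])
    have "integrable lborel (\<lambda>\<xi>. cis (- (\<xi> \<bullet> (x + v))) * a \<xi> - cis (- (\<xi> \<bullet> x)) * a \<xi> - cis (- (\<xi> \<bullet> x)) * (- \<i> * complex_of_real (\<xi> \<bullet> v) * a \<xi>))"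
      by (intro Bochner_Integration.integrable_diff int int0)
    then show "integrable lborel (\<lambda>\<xi>. norm (cis (- (\<xi> \<bullet> x)) * (cis (- (\<xi> \<bullet> v)) - 1 - \<i> * complex_of_real (- (\<xi> \<bullet> v))) * a \<xi>))"
      unfolding pt by (rule integrable_norm)
    fix \<xi> :: 'a
    have "norm (cis (- (\<xi> \<bullet> v)) - 1 - \<i> * complex_of_real (- (\<xi> \<bullet> v))) \<le> (- (\<xi> \<bullet> v))\<^sup>2" by (rule cis_bounds)
    also have "\<dots> = \<bar>\<xi> \<bullet> v\<bar>\<^sup>2" by simp
    also have "\<dots> \<le> ((1 + norm \<xi>) * norm v)\<^sup>2"
      by (intro power_mono order_trans[OF Cauchy_Schwarz_ineq2]) (auto intro: mult_right_mono)
    finally have "norm (cis (- (\<xi> \<bullet> v)) - 1 - \<i> * complex_of_real (- (\<xi> \<bullet> v))) \<le> ((1 + norm \<xi>) * norm v)\<^sup>2" .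
    then have "norm (cis (- (\<xi> \<bullet> v)) - 1 - \<i> * complex_of_real (- (\<xi> \<bullet> v))) * norm (a \<xi>) \<le> ((1 + norm \<xi>) * norm v)\<^sup>2 * norm (a \<xi>)"
      by (rule mult_right_mono) simp
    then show "norm (cis (- (\<xi> \<bullet> x)) * (cis (- (\<xi> \<bullet> v)) - 1 - \<i> * complex_of_real (- (\<xi> \<bullet> v))) * a \<xi>) \<le> norm v ^ 2 * ((1 + norm \<xi>) ^ 2 * norm (a \<xi>))"
      by (simp add: norm_mult power_mult_distrib mult_ac)
  qed
  also have "\<dots> = I * (norm v)\<^sup>2" by (simp add: I_def mult.commute)
  finally show "norm (fourier a (x + v) - fourier a x - fourier (\<lambda>\<xi>. - \<i> * complex_of_real (\<xi> \<bullet> v) * a \<xi>) x) \<le> I * (norm v)\<^sup>2" .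
qed

lemma fourier_closed:
  assumes "f \<in> {fourier a | a. rapid a}"
  shows "\<exists>f'. (\<forall>x. (f has_derivative f' x) (at x)) \<and> (\<forall>v\<in>Basis. (\<lambda>x. f' x v) \<in> {fourier a | a. rapid a})"
proof -
  obtain a where a: "rapid a" "f = fourier a" using assms by blast
  show ?thesis
    unfolding a(2) using fourier_has_derivative[OF a(1)] rapid_coord[OF a(1)]
    by (intro exI[of _ "\<lambda>x v. fourier (\<lambda>\<xi>. - \<i> * complex_of_real (\<xi> \<bullet> v) * a \<xi>) x"]) blast
qed

lemma smooth_fourier: "rapid a \<Longrightarrow> smooth (fourier a)"
  by (rule smooth_closed[OF _ fourier_closed]) auto

text \<open>Generated by the products to be shown Schwartz. Differentiating the Gaussian factor
  brings down a coordinate and differentiating the Fourier transform gives another rapid function,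
  so the set is closed under derivatives, while each member decays faster than any power.\<close>

inductive_set gauss_algebra :: "real \<Rightarrow> ('a::euclidean_space \<Rightarrow> complex) set" for \<epsilon> where
  base: "rapid a \<Longrightarrow> (\<lambda>x. complex_of_real (exp (- \<epsilon> * (x \<bullet> x))) * fourier a x) \<in> gauss_algebra \<epsilon>"
| coord: "f \<in> gauss_algebra \<epsilon> \<Longrightarrow> (\<lambda>x. complex_of_real (x \<bullet> w) * f x) \<in> gauss_algebra \<epsilon>"
| add: "f \<in> gauss_algebra \<epsilon> \<Longrightarrow> g \<in> gauss_algebra \<epsilon> \<Longrightarrow> (\<lambda>x. f x + g x) \<in> gauss_algebra \<epsilon>"
| cmult: "f \<in> gauss_algebra \<epsilon> \<Longrightarrow> (\<lambda>x. c * f x) \<in> gauss_algebra \<epsilon>"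

lemma gauss_algebra_closed:
  assumes "f \<in> gauss_algebra \<epsilon>"
  shows "\<exists>f'. (\<forall>x. (f has_derivative f' x) (at x)) \<and> (\<forall>v\<in>Basis. (\<lambda>x. f' x v) \<in> gauss_algebra \<epsilon>)"
  using assms
proof induction
  case (base a)
  define f' where "f' = (\<lambda>x v. fourier (\<lambda>\<xi>. - \<i> * complex_of_real (\<xi> \<bullet> v) * a \<xi>) x)"
  define E where "E = (\<lambda>x::'a. complex_of_real (exp (- \<epsilon> * (x \<bullet> x))))"
  show ?case
  proof (intro exI[of _ "\<lambda>x v. E x * f' x v + (- 2 * complex_of_real \<epsilon>) * (complex_of_real (x \<bullet> v) * (E x * fourier a x))"] conjI allI ballI)
    show "((\<lambda>x. complex_of_real (exp (- \<epsilon> * (x \<bullet> x))) * fourier a x) has_derivative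
        (\<lambda>v. E x * f' x v + (- 2 * complex_of_real \<epsilon>) * (complex_of_real (x \<bullet> v) * (E x * fourier a x)))) (at x)" for x
    proof -
      have "((\<lambda>x. exp (- \<epsilon> * (x \<bullet> x))) has_derivative (\<lambda>v. exp (- \<epsilon> * (x \<bullet> x)) * (- \<epsilon> * (x \<bullet> v + v \<bullet> x)))) (at x)"
        by (auto intro!: derivative_eq_intros)
      from has_derivative_of_real[OF this]
      have "(E has_derivative (\<lambda>v. complex_of_real (exp (- \<epsilon> * (x \<bullet> x)) * (- \<epsilon> * (x \<bullet> v + v \<bullet> x))))) (at x)"
        unfolding E_def .
      from has_derivative_mult[OF this fourier_has_derivative[OF base]]
      show ?thesis
        unfolding f'_def E_def by (rule has_derivative_eq_rhs) (simp add: fun_eq_iff inner_commute algebra_simps)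
    qed
    show "(\<lambda>x. E x * f' x v + (- 2 * complex_of_real \<epsilon>) * (complex_of_real (x \<bullet> v) * (E x * fourier a x))) \<in> gauss_algebra \<epsilon>" for v
      unfolding f'_def E_def by (rule gauss_algebra.add[OF gauss_algebra.base[OF rapid_coord[OF base]] gauss_algebra.cmult[OF gauss_algebra.coord[OF gauss_algebra.base[OF base]]]])
  qed
next
  case (coord f w)
  then obtain f' where f': "\<And>x. (f has_derivative f' x) (at x)" "\<And>v. v \<in> Basis \<Longrightarrow> (\<lambda>x. f' x v) \<in> gauss_algebra \<epsilon>" by blast
  show ?case
  proof (intro exI[of _ "\<lambda>x v. complex_of_real (x \<bullet> w) * f' x v + complex_of_real (v \<bullet> w) * f x"] conjI allI ballI)
    show "((\<lambda>x. complex_of_real (x \<bullet> w) * f x) has_derivative (\<lambda>v. complex_of_real (x \<bullet> w) * f' x v + complex_of_real (v \<bullet> w) * f x)) (at x)" for x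
      by (rule has_derivative_mult[OF _ f'(1)]) (auto intro!: derivative_eq_intros)
    show "(\<lambda>x. complex_of_real (x \<bullet> w) * f' x v + complex_of_real (v \<bullet> w) * f x) \<in> gauss_algebra \<epsilon>" if "v \<in> Basis" for v
      by (rule gauss_algebra.add[OF gauss_algebra.coord[OF f'(2)[OF that]] gauss_algebra.cmult[OF coord(1)]])
  qed
next
  case (add f g)
  then obtain f' g' where *: "\<And>x. (f has_derivative f' x) (at x)" "\<And>v. v \<in> Basis \<Longrightarrow> (\<lambda>x. f' x v) \<in> gauss_algebra \<epsilon>"
    "\<And>x. (g has_derivative g' x) (at x)" "\<And>v. v \<in> Basis \<Longrightarrow> (\<lambda>x. g' x v) \<in> gauss_algebra \<epsilon>" by metis
  show ?case
    by (intro exI[of _ "\<lambda>x v. f' x v + g' x v"] conjI allI ballI has_derivative_add gauss_algebra.add *)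
next
  case (cmult f c)
  then obtain f' where f': "\<And>x. (f has_derivative f' x) (at x)" "\<And>v. v \<in> Basis \<Longrightarrow> (\<lambda>x. f' x v) \<in> gauss_algebra \<epsilon>" by blast
  show ?case
    by (intro exI[of _ "\<lambda>x v. c * f' x v"] conjI allI ballI has_derivative_mult_right gauss_algebra.cmult f')
qed

lemma power_exp_bounded:
  fixes \<epsilon> :: real
  assumes "0 < \<epsilon>"
  shows "\<exists>C. \<forall>r\<ge>0. (1 + r) ^ n * exp (- \<epsilon> * (r * r)) \<le> C"
proof -
  \<comment> \<open>Beyond this value of \<open>r\<close> the Gaussian exponent outweighs
    \<open>real n * r\<close>; below it, \<open>r\<close> is replaced by \<open>k\<close>.\<close>
  define k where "k = real n / \<epsilon> + 1"
  have "(1 + r) ^ n * exp (- \<epsilon> * (r * r)) \<le> exp (real n * k)" if r: "0 \<le> r" for r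
  proof -
    have "(1 + r) ^ n \<le> exp r ^ n" by (rule power_mono) (use r exp_ge_add_one_self[of r] in auto)
    also have "\<dots> = exp (real n * r)" by (simp add: exp_of_nat_mult)
    finally have "(1 + r) ^ n * exp (- \<epsilon> * (r * r)) \<le> exp (real n * r) * exp (- \<epsilon> * (r * r))"
      by (rule mult_right_mono) simp
    also have "\<dots> = exp (real n * r - \<epsilon> * (r * r))" by (simp add: mult_exp_exp)
    also have "\<dots> \<le> exp (real n * k)"
    proof (cases "r \<le> k")
      case True
      then have "real n * r \<le> real n * k" by (intro mult_left_mono) auto
      moreover have "0 \<le> \<epsilon> * (r * r)" using assms by simp
      ultimately show ?thesis by simp
    next
      case False
      then have "real n \<le> \<epsilon> * r" using assms by (simp add: k_def field_simps)
      then have "real n * r \<le> \<epsilon> * r * r" using r by (intro mult_right_mono) auto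
      moreover have "0 \<le> real n * k" using assms by (simp add: k_def)
      ultimately show ?thesis by (simp add: mult.assoc)
    qed
    finally show ?thesis .
  qed
  then show ?thesis by blast
qed

lemma gauss_algebra_decay:
  assumes "0 < \<epsilon>" "f \<in> gauss_algebra \<epsilon>"
  shows "\<exists>C. \<forall>x. (1 + norm x) ^ n * norm (f x) \<le> C"
  using assms(2)
proof (induction arbitrary: n)
  case (base a)
  obtain C where C: "\<And>r. 0 \<le> r \<Longrightarrow> (1 + r) ^ n * exp (- \<epsilon> * (r * r)) \<le> C" using power_exp_bounded[OF assms(1)] by blast
  define I where "I = (\<integral>\<xi>. norm (a \<xi>) \<partial>lborel)"
  have "(1 + norm x) ^ n * norm (complex_of_real (exp (- \<epsilon> * (x \<bullet> x))) * fourier a x) \<le> C * I" for x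
  proof -
    have "((1 + norm x) ^ n * exp (- \<epsilon> * (norm x * norm x))) * norm (fourier a x) \<le> C * I"
      unfolding I_def using C[of "norm x"] C[of 0] by (intro mult_mono fourier_norm_le) auto
    then show ?thesis by (simp add: norm_mult dot_square_norm power2_eq_square mult_ac)
  qed
  then show ?case by blast
next
  case (coord f w)
  obtain C where C: "\<And>x. (1 + norm x) ^ Suc n * norm (f x) \<le> C" using coord.IH by blast
  have "(1 + norm x) ^ n * norm (complex_of_real (x \<bullet> w) * f x) \<le> norm w * C" for x
  proof -
    have "\<bar>x \<bullet> w\<bar> \<le> (1 + norm x) * norm w"
      by (rule order_trans[OF Cauchy_Schwarz_ineq2]) (simp add: mult_right_mono)
    then have "(1 + norm x) ^ n * (\<bar>x \<bullet> w\<bar> * norm (f x)) \<le> (1 + norm x) ^ n * (((1 + norm x) * norm w) * norm (f x))"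
      by (intro mult_left_mono mult_right_mono) auto
    also have "\<dots> = norm w * ((1 + norm x) ^ Suc n * norm (f x))" by simp
    also have "\<dots> \<le> norm w * C" by (intro mult_left_mono C) auto
    finally show ?thesis by (simp add: norm_mult)
  qed
  then show ?case by blast
next
  case (add f g)
  obtain C D where C: "\<And>x. (1 + norm x) ^ n * norm (f x) \<le> C" and D: "\<And>x. (1 + norm x) ^ n * norm (g x) \<le> D" using add.IH by metis
  have "(1 + norm x) ^ n * norm (f x + g x) \<le> C + D" for x
  proof -
    have "(1 + norm x) ^ n * norm (f x + g x) \<le> (1 + norm x) ^ n * (norm (f x) + norm (g x))"
      by (intro mult_left_mono norm_triangle_ineq) auto
    then show ?thesis using C[of x] D[of x] by (simp add: distrib_left)
  qed
  then show ?case by blast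
next
  case (cmult f c)
  obtain C where C: "\<And>x. (1 + norm x) ^ n * norm (f x) \<le> C" using cmult.IH by blast
  have "(1 + norm x) ^ n * norm (c * f x) \<le> norm c * C" for x
    using mult_left_mono[OF C[of x], of "norm c"] by (simp add: norm_mult mult_ac)
  then show ?case by blast
qed

text \<open>Supplies the Schwartz approximants for the Besov norm: smoothness comes from the Fourier
  transform, and all decay comes from the Gaussian.\<close>

lemma gauss_fourier_schwartz:
  assumes "0 < \<epsilon>" "rapid a"
  shows "(\<lambda>x. complex_of_real (exp (- \<epsilon> * (x \<bullet> x))) * fourier a x) \<in> schwartz"
proof -
  note f = gauss_algebra.base[OF assms(2), of \<epsilon>]
  show ?thesis
    unfolding schwartz_def
  proof (intro CollectI conjI allI impI)
    show "smooth (\<lambda>x. complex_of_real (exp (- \<epsilon> * (x \<bullet> x))) * fourier a x)" by (rule smooth_closed[OF f gauss_algebra_closed])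
    fix n and vs :: "'a list" assume vs: "set vs \<subseteq> Basis"
    have "iter_deriv vs (\<lambda>x. complex_of_real (exp (- \<epsilon> * (x \<bullet> x))) * fourier a x) \<in> gauss_algebra \<epsilon>"
      by (rule iter_deriv_closed[OF f _ vs]) (rule gauss_algebra_closed)
    from gauss_algebra_decay[OF assms(1) this, of n]
    show "bounded (range (\<lambda>x. (1 + norm x) ^ n *\<^sub>R iter_deriv vs (\<lambda>x. complex_of_real (exp (- \<epsilon> * (x \<bullet> x))) * fourier a x) x))"
      unfolding bounded_iff by auto
  qed
qed

section \<open>Integrable majorants and Fourier transforms of test functions\<close>

lemma integrable_cauchy_density: "integrable lborel (\<lambda>x::real. 1 / (1 + x\<^sup>2))"
proof -
  have pos: "(\<integral>\<^sup>+x. ennreal (1 / (1 + x\<^sup>2)) * indicator {0..} x \<partial>lborel) = ennreal (pi / 2 - arctan 0)"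
  proof (rule nn_integral_FTC_atLeast)
    show "DERIV arctan x :> 1 / (1 + x\<^sup>2)" for x :: real
      using DERIV_arctan[of x] by (simp add: inverse_eq_divide)
    show "(arctan \<longlongrightarrow> pi / 2) at_top" by (rule tendsto_arctan_at_top)
  qed auto
  have "(\<integral>\<^sup>+x. ennreal (1 / (1 + x\<^sup>2)) * indicator {..0} x \<partial>lborel) = (\<integral>\<^sup>+x. ennreal (1 / (1 + x\<^sup>2)) * indicator {0..} x \<partial>lborel)"
    by (subst nn_integral_real_affine[where c="-1" and t=0]) (auto intro!: nn_integral_cong simp: indicator_def)
  with pos have neg: "(\<integral>\<^sup>+x. ennreal (1 / (1 + x\<^sup>2)) * indicator {..0} x \<partial>lborel) < \<infinity>" by simp
  have "(\<integral>\<^sup>+x. ennreal (1 / (1 + x\<^sup>2)) \<partial>lborel) \<le> (\<integral>\<^sup>+x. ennreal (1 / (1 + x\<^sup>2)) * indicator {..0} x + ennreal (1 / (1 + x\<^sup>2)) * indicator {0..} x \<partial>lborel)"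
    by (intro nn_integral_mono) (auto simp: indicator_def)
  also have "\<dots> = (\<integral>\<^sup>+x. ennreal (1 / (1 + x\<^sup>2)) * indicator {..0} x \<partial>lborel) + (\<integral>\<^sup>+x. ennreal (1 / (1 + x\<^sup>2)) * indicator {0..} x \<partial>lborel)"
    by (rule nn_integral_add) auto
  also have "\<dots> < \<infinity>" using neg pos by simp
  finally show ?thesis by (intro integrableI_bounded) (auto simp: add_nonneg_nonneg)
qed

lemma integrable_prod_cauchy:
  "integrable lborel (\<lambda>x::'a::euclidean_space. \<Prod>e\<in>Basis. 1 / (1 + (x \<bullet> e)\<^sup>2))"
proof (rule integrableI_bounded)
  have "(\<integral>\<^sup>+(x::real). ennreal (1 / (1 + x\<^sup>2)) \<partial>lborel) = ennreal (\<integral>(x::real). 1 / (1 + x\<^sup>2) \<partial>lborel)"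
    by (rule nn_integral_eq_integral[OF integrable_cauchy_density]) (simp add: add_nonneg_nonneg)
  then have "(\<Prod>e\<in>(Basis::'a set). (\<integral>\<^sup>+(x::real). ennreal (1 / (1 + x\<^sup>2)) \<partial>lborel)) < \<infinity>"
    by (simp add: ennreal_power)
  moreover have "(\<integral>\<^sup>+(x::'a). (\<Prod>e\<in>Basis. ennreal (1 / (1 + (x \<bullet> e)\<^sup>2))) \<partial>lborel) = (\<Prod>e\<in>(Basis::'a set). (\<integral>\<^sup>+(x::real). ennreal (1 / (1 + x\<^sup>2)) \<partial>lborel))"
    by (rule nn_integral_lborel_prod[of "\<lambda>_ x. ennreal (1 / (1 + x\<^sup>2))"]) auto
  moreover have "ennreal (norm (\<Prod>e\<in>Basis. 1 / (1 + (x \<bullet> e)\<^sup>2))) = (\<Prod>e\<in>Basis. ennreal (1 / (1 + (x \<bullet> e)\<^sup>2)))" for x :: 'a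
    by (subst prod_ennreal) (auto simp: abs_prod intro!: arg_cong[where f=ennreal] prod.cong)
  ultimately show "(\<integral>\<^sup>+(x::'a). ennreal (norm (\<Prod>e\<in>Basis. 1 / (1 + (x \<bullet> e)\<^sup>2))) \<partial>lborel) < \<infinity>" by simp
qed measurable

lemma prod_cauchy_ge:
  fixes x :: "'a::euclidean_space"
  shows "1 / (1 + norm x) ^ (2 * DIM('a)) \<le> (\<Prod>e\<in>Basis. 1 / (1 + (x \<bullet> e)\<^sup>2))"
proof -
  have "1 / (1 + norm x) ^ (2 * DIM('a)) = (\<Prod>e\<in>(Basis::'a set). 1 / (1 + norm x)\<^sup>2)"
    by (simp add: power_mult power_divide)
  also have "\<dots> \<le> (\<Prod>e\<in>Basis. 1 / (1 + (x \<bullet> e)\<^sup>2))"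
  proof (rule prod_mono)
    fix e :: 'a assume e: "e \<in> Basis"
    have "(x \<bullet> e)\<^sup>2 \<le> (norm x)\<^sup>2" using Basis_le_norm[OF e, of x] by (metis abs_ge_zero power2_abs power_mono)
    then have "1 + (x \<bullet> e)\<^sup>2 \<le> (1 + norm x)\<^sup>2" by (simp add: power2_sum add_increasing2)
    then show "0 \<le> 1 / (1 + norm x)\<^sup>2 \<and> 1 / (1 + norm x)\<^sup>2 \<le> 1 / (1 + (x \<bullet> e)\<^sup>2)"
      by (intro conjI frac_le) (auto simp: add_pos_nonneg)
  qed
  finally show ?thesis .
qed

text \<open>The majorant is a product of one-dimensional Cauchy densities, up to constants. It
  dominates the power \<open>2 * DIM('a)\<close> of the inverse of \<open>1 + norm x\<close> and is
  integrable by Fubini.\<close>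

lemma integrable_decay:
  fixes f :: "'a::euclidean_space \<Rightarrow> 'b::{banach, second_countable_topology}"
  assumes [measurable]: "f \<in> borel_measurable borel" and bd: "\<And>x. (1 + norm x) ^ (2 * DIM('a)) * norm (f x) \<le> C"
  shows "integrable lborel f"
proof (rule Bochner_Integration.integrable_bound[OF integrable_mult_right[OF integrable_prod_cauchy, of C]])
  have C: "0 \<le> C" using bd[of 0] norm_ge_zero[of "f 0"] by (simp add: order_trans[OF norm_ge_zero])
  have "norm (f x) \<le> C * (\<Prod>e\<in>Basis. 1 / (1 + (x \<bullet> e)\<^sup>2))" for x
  proof -
    have p: "0 < (1 + norm x) ^ (2 * DIM('a))" by (simp add: add_pos_nonneg)
    have "norm (f x) \<le> C * (1 / (1 + norm x) ^ (2 * DIM('a)))"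
      using bd[of x] p by (simp add: field_simps)
    also have "\<dots> \<le> C * (\<Prod>e\<in>Basis. 1 / (1 + (x \<bullet> e)\<^sup>2))" by (intro mult_left_mono prod_cauchy_ge C)
    finally show ?thesis .
  qed
  then show "AE x in lborel. norm (f x) \<le> norm (C * (\<Prod>e\<in>Basis. 1 / (1 + (x \<bullet> e)\<^sup>2)))"
    by (intro AE_I2) (auto intro: order_trans[OF _ abs_ge_self])
qed simp

lemma schwartzD:
  assumes "f \<in> schwartz"
  shows "smooth f" "f \<in> borel_measurable borel" "\<exists>C. \<forall>x. (1 + norm x) ^ n * norm (f x) \<le> C" "integrable lborel f"
    "\<exists>C. \<forall>x. norm (f x) \<le> C"
proof -
  show s: "smooth f" using assms by (simp add: schwartz_def)
  show m: "f \<in> borel_measurable borel" by (rule borel_measurable_continuous_onI[OF smooth_continuous[OF s]])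
  have d: "\<exists>C. \<forall>x. (1 + norm x) ^ n * norm (f x) \<le> C" for n
  proof -
    have "\<forall>n vs. set vs \<subseteq> Basis \<longrightarrow> bounded (range (\<lambda>x. (1 + norm x) ^ n *\<^sub>R iter_deriv vs f x))"
      using assms unfolding schwartz_def by blast
    from this[rule_format, of "[]" n] have "bounded (range (\<lambda>x. (1 + norm x) ^ n *\<^sub>R f x))" by simp
    then show ?thesis unfolding bounded_iff by auto
  qed
  then show "\<exists>C. \<forall>x. (1 + norm x) ^ n * norm (f x) \<le> C" for n .
  obtain C where "\<And>x. (1 + norm x) ^ (2 * DIM('a)) * norm (f x) \<le> C" using d by blast
  then show "integrable lborel f" by (rule integrable_decay[OF m])
  show "\<exists>C. \<forall>x. norm (f x) \<le> C" using d[of 0] by simp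
qed

lemma test_functions_continuous: "f \<in> test_functions \<Longrightarrow> continuous_on UNIV f"
  by (simp add: test_functions_def smooth_continuous)

lemma test_functions_measurable: "f \<in> test_functions \<Longrightarrow> f \<in> borel_measurable borel"
  by (rule borel_measurable_continuous_onI[OF test_functions_continuous])

lemma test_functions_bounded:
  fixes f :: "'a::euclidean_space \<Rightarrow> complex"
  assumes "f \<in> test_functions"
  shows "\<exists>B\<ge>0. \<forall>x. norm (f x) \<le> B"
proof -
  have "compact (supp f)" using assms by (simp add: test_functions_def)
  then have "compact (f ` supp f)"
    using test_functions_continuous[OF assms] continuous_on_subset by (intro compact_continuous_image) blast+
  then obtain B where B: "\<And>x. x \<in> supp f \<Longrightarrow> norm (f x) \<le> B"
    using compact_imp_bounded bounded_iff by (metis imageI)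
  have "norm (f x) \<le> max 0 B" for x
    using B[of x] not_supp_zero[of x f] by (cases "x \<in> supp f") auto
  then show ?thesis by (intro exI[of _ "max 0 B"]) auto
qed

lemma test_functions_support_ball:
  assumes "f \<in> test_functions"
  obtains R where "0 < R" "\<And>x. f x \<noteq> 0 \<Longrightarrow> norm x \<le> R"
proof -
  have "bounded (supp f)" using assms by (simp add: test_functions_def compact_imp_bounded)
  then obtain R where "0 < R" "\<And>x. x \<in> supp f \<Longrightarrow> norm x \<le> R" using bounded_pos by blast
  then show ?thesis using that not_supp_zero by blast
qed

lemma integrable_bounded_support:
  fixes f :: "'a::euclidean_space \<Rightarrow> complex"
  assumes "f \<in> borel_measurable borel" "\<And>x. norm (f x) \<le> B" "\<And>x. f x \<noteq> 0 \<Longrightarrow> norm x \<le> R"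
  shows "integrable lborel f"
proof (rule integrableI_bounded_set[where A="cball 0 R" and B=B])
  show "emeasure lborel (cball 0 R :: 'a set) < \<infinity>" using emeasure_lborel_cball_finite[of "0::'a" R] by (simp add: less_top)
qed (use assms in auto)

lemma test_functions_integrable:
  fixes f :: "'a::euclidean_space \<Rightarrow> complex"
  assumes "f \<in> test_functions" shows "integrable lborel f"
proof -
  obtain B where "\<And>x. norm (f x) \<le> B" using test_functions_bounded[OF assms] by blast
  moreover obtain R where "\<And>x. f x \<noteq> 0 \<Longrightarrow> norm x \<le> R" using test_functions_support_ball[OF assms] by blast
  ultimately show ?thesis by (rule integrable_bounded_support[OF test_functions_measurable[OF assms]])
qed

lemma test_functions_lipschitz:
  fixes f :: "'a::euclidean_space \<Rightarrow> complex"
  assumes f: "f \<in> test_functions"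
  shows "\<exists>L\<ge>0. \<forall>x y. norm (f x - f y) \<le> L * norm (x - y)"
proof -
  have "\<forall>e\<in>Basis. \<exists>B\<ge>0. \<forall>x. norm (frechet_derivative f (at x) e) \<le> B"
    using test_functions_bounded[OF test_functions_partial[OF f]] by blast
  then obtain B where B: "\<And>e x. e \<in> Basis \<Longrightarrow> norm (frechet_derivative f (at x) e) \<le> B e" "\<And>e. e \<in> Basis \<Longrightarrow> 0 \<le> B e"
    by metis
  define L where "L = (\<Sum>e\<in>Basis. B e)"
  have d: "(f has_derivative frechet_derivative f (at x)) (at x)" for x
    using f by (intro smooth_has_derivative) (simp add: test_functions_def)
  have on: "onorm (frechet_derivative f (at x)) \<le> L" for x
  proof (rule onorm_le)
    fix v :: 'a
    interpret bounded_linear "frechet_derivative f (at x)" using d has_derivative_bounded_linear by blast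
    have "frechet_derivative f (at x) v = (\<Sum>e\<in>Basis. (v \<bullet> e) *\<^sub>R frechet_derivative f (at x) e)"
      by (subst (1) euclidean_representation[of v, symmetric]) (simp only: sum scaleR)
    also have "norm \<dots> \<le> (\<Sum>e\<in>Basis. norm v * B e)"
      by (rule order_trans[OF norm_sum]) (auto intro!: sum_mono mult_mono B Basis_le_norm)
    also have "\<dots> = L * norm v" by (simp add: L_def sum_distrib_left mult.commute)
    finally show "norm (frechet_derivative f (at x) v) \<le> L * norm v" .
  qed
  have "norm (f x - f y) \<le> L * norm (x - y)" for x y
    by (rule differentiable_bound[of UNIV f "\<lambda>x. frechet_derivative f (at x)"]) (use d on in auto)
  moreover have "0 \<le> L" unfolding L_def by (intro sum_nonneg B)
  ultimately show ?thesis by blast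
qed

text \<open>Integration by parts through difference quotients: translating the integrand turns the
  quotient into a factor acting on the transform. Dominated convergence applies since the quotients
  are bounded by a Lipschitz constant on a fixed ball.\<close>

lemma inv_fourier_partial:
  fixes m :: "'a::euclidean_space \<Rightarrow> complex"
  assumes m: "m \<in> test_functions" and e: "e \<in> Basis"
  shows "inv_fourier (\<lambda>\<xi>. frechet_derivative m (at \<xi>) e) x = - \<i> * complex_of_real (x \<bullet> e) * inv_fourier m x"
proof -
  note [measurable] = test_functions_measurable[OF m] test_functions_measurable[OF test_functions_partial[OF m e]]
  have [measurable]: "(\<lambda>\<xi>. cis (x \<bullet> \<xi>)) \<in> borel_measurable borel" unfolding cis_conv_exp by measurable
  have mi: "integrable lborel m" by (rule test_functions_integrable[OF m])
  define I where "I = (\<integral>\<xi>. cis (x \<bullet> \<xi>) * m \<xi> \<partial>lborel)"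
  define h where "h = (\<lambda>n. 1 / real (Suc n))"
  have h: "0 < h n" "h n \<le> 1" for n by (auto simp: h_def)
  have hlim: "h \<longlonglongrightarrow> 0" unfolding h_def by (rule LIMSEQ_Suc[OF lim_1_over_n])
  define q where "q = (\<lambda>n \<xi>. (m (h n *\<^sub>R e + \<xi>) - m \<xi>) / complex_of_real (h n))"
  have int: "(\<integral>\<xi>. cis (x \<bullet> \<xi>) * q n \<xi> \<partial>lborel) = ((cis (- (h n * (x \<bullet> e))) - 1) / complex_of_real (h n)) * I" for n
  proof -
    have i1: "integrable lborel (\<lambda>\<xi>. cis (x \<bullet> \<xi>) * m \<xi>)" by (rule integrable_cis_mult[OF mi]) simp
    have i2: "integrable lborel (\<lambda>\<xi>. cis (x \<bullet> \<xi>) * m (h n *\<^sub>R e + \<xi>))"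
      by (rule integrable_cis_mult[OF lborel_integrable_shift[OF mi]]) simp
    have "(\<integral>\<xi>. cis (x \<bullet> \<xi>) * m (h n *\<^sub>R e + \<xi>) \<partial>lborel) = (\<integral>\<xi>. cis (- (h n * (x \<bullet> e))) * (cis (x \<bullet> (h n *\<^sub>R e + \<xi>)) * m (h n *\<^sub>R e + \<xi>)) \<partial>lborel)"
      by (rule Bochner_Integration.integral_cong) (simp_all add: mult.assoc[symmetric] cis_mult inner_add_right)
    also have "\<dots> = (\<integral>\<xi>. cis (- (h n * (x \<bullet> e))) * (cis (x \<bullet> \<xi>) * m \<xi>) \<partial>lborel)"
      by (rule lborel_integral_shift)
    also have "\<dots> = cis (- (h n * (x \<bullet> e))) * I" by (simp add: I_def)
    finally have s: "(\<integral>\<xi>. cis (x \<bullet> \<xi>) * m (h n *\<^sub>R e + \<xi>) \<partial>lborel) = cis (- (h n * (x \<bullet> e))) * I" .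
    have "(\<integral>\<xi>. cis (x \<bullet> \<xi>) * q n \<xi> \<partial>lborel) = (\<integral>\<xi>. (cis (x \<bullet> \<xi>) * m (h n *\<^sub>R e + \<xi>) - cis (x \<bullet> \<xi>) * m \<xi>) / complex_of_real (h n) \<partial>lborel)"
      by (rule Bochner_Integration.integral_cong) (simp_all add: q_def right_diff_distrib)
    also have "\<dots> = (cis (- (h n * (x \<bullet> e))) * I - I) / complex_of_real (h n)"
      by (simp add: Bochner_Integration.integral_diff[OF i2 i1] s I_def[symmetric])
    finally show ?thesis by (simp add: algebra_simps)
  qed
  obtain L where L: "0 \<le> L" "\<And>x y. norm (m x - m y) \<le> L * norm (x - y)" using test_functions_lipschitz[OF m] by blast
  obtain R where R: "0 < R" "\<And>x. m x \<noteq> 0 \<Longrightarrow> norm x \<le> R" using test_functions_support_ball[OF m] by blast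
  have qb: "norm (q n \<xi>) \<le> L * indicator (cball 0 (R + 1)) \<xi>" for n \<xi>
  proof (cases "norm \<xi> \<le> R + 1")
    case True
    have "norm (q n \<xi>) = norm (m (h n *\<^sub>R e + \<xi>) - m \<xi>) / h n" using h[of n] by (simp add: q_def norm_divide)
    also have "\<dots> \<le> L" using L(2)[of "h n *\<^sub>R e + \<xi>" \<xi>] h[of n] e by (simp add: pos_divide_le_eq)
    finally show ?thesis using True by simp
  next
    case False
    have "norm \<xi> \<le> norm (h n *\<^sub>R e + \<xi>) + norm (h n *\<^sub>R e)" using norm_triangle_ineq4[of "h n *\<^sub>R e + \<xi>" "h n *\<^sub>R e"] by simp
    then have "R < norm (h n *\<^sub>R e + \<xi>)" using False h[of n] e by simp
    then have "m (h n *\<^sub>R e + \<xi>) = 0" "m \<xi> = 0" using R(2)[of "h n *\<^sub>R e + \<xi>"] R(2)[of \<xi>] False by fastforce+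
    then show ?thesis using L(1) by (simp add: q_def)
  qed
  have lim: "(\<lambda>n. \<integral>\<xi>. cis (x \<bullet> \<xi>) * q n \<xi> \<partial>lborel) \<longlonglongrightarrow> (\<integral>\<xi>. cis (x \<bullet> \<xi>) * frechet_derivative m (at \<xi>) e \<partial>lborel)"
  proof (rule integral_dominated_convergence[where w="\<lambda>\<xi>. L * indicator (cball 0 (R + 1)) \<xi>"])
    show "(\<lambda>\<xi>. cis (x \<bullet> \<xi>) * frechet_derivative m (at \<xi>) e) \<in> borel_measurable lborel" by measurable
    show "(\<lambda>\<xi>. cis (x \<bullet> \<xi>) * q n \<xi>) \<in> borel_measurable lborel" for n unfolding q_def by measurable
    show "integrable lborel (\<lambda>\<xi>::'a. L * indicator (cball 0 (R + 1)) \<xi>)"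
      using emeasure_lborel_cball_finite[of "0::'a" "R + 1"] by (intro integrable_mult_right integrable_real_indicator) (auto simp: less_top)
    show "AE \<xi> in lborel. norm (cis (x \<bullet> \<xi>) * q n \<xi>) \<le> L * indicator (cball 0 (R + 1)) \<xi>" for n
      using qb by (simp add: norm_mult)
    show "AE \<xi> in lborel. (\<lambda>n. cis (x \<bullet> \<xi>) * q n \<xi>) \<longlonglongrightarrow> cis (x \<bullet> \<xi>) * frechet_derivative m (at \<xi>) e"
    proof (intro AE_I2 tendsto_mult tendsto_const)
      fix \<xi> :: 'a
      have "(m has_derivative frechet_derivative m (at \<xi>)) (at \<xi>)"
        using m by (intro smooth_has_derivative) (simp add: test_functions_def)
      then interpret D: bounded_linear "frechet_derivative m (at \<xi>)" by (rule has_derivative_bounded_linear)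
      have "((\<lambda>v. norm (m (\<xi> + v) - m \<xi> - frechet_derivative m (at \<xi>) v) / norm v) \<longlongrightarrow> 0) (at 0)"
        using \<open>(m has_derivative _) _\<close> unfolding has_derivative_at by blast
      moreover have "filterlim (\<lambda>n. h n *\<^sub>R e) (at 0) sequentially"
        unfolding filterlim_at
      proof
        show "\<forall>\<^sub>F n in sequentially. h n *\<^sub>R e \<in> UNIV \<and> h n *\<^sub>R e \<noteq> 0"
          using h(1) e by (intro always_eventually) (auto simp: less_le)
        show "(\<lambda>n. h n *\<^sub>R e) \<longlonglongrightarrow> 0" using tendsto_scaleR[OF hlim tendsto_const, of e] by simp
      qed
      ultimately have "(\<lambda>n. norm (m (\<xi> + h n *\<^sub>R e) - m \<xi> - frechet_derivative m (at \<xi>) (h n *\<^sub>R e)) / norm (h n *\<^sub>R e)) \<longlonglongrightarrow> 0"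
        by (rule filterlim_compose)
      moreover have "norm (m (\<xi> + h n *\<^sub>R e) - m \<xi> - frechet_derivative m (at \<xi>) (h n *\<^sub>R e)) / norm (h n *\<^sub>R e) = norm (q n \<xi> - frechet_derivative m (at \<xi>) e)" for n
      proof -
        have "q n \<xi> - frechet_derivative m (at \<xi>) e = (m (\<xi> + h n *\<^sub>R e) - m \<xi> - frechet_derivative m (at \<xi>) (h n *\<^sub>R e)) / complex_of_real (h n)"
          using h(1)[of n] by (simp add: q_def D.scaleR scaleR_conv_of_real field_simps add.commute)
        then show ?thesis using h(1)[of n] e by (simp add: norm_divide)
      qed
      ultimately have "(\<lambda>n. norm (q n \<xi> - frechet_derivative m (at \<xi>) e)) \<longlonglongrightarrow> 0" by simp
      then show "(\<lambda>n. q n \<xi>) \<longlonglongrightarrow> frechet_derivative m (at \<xi>) e"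
        by (rule LIM_zero_cancel[OF tendsto_norm_zero_cancel])
    qed
  qed
  have lim2: "(\<lambda>n. ((cis (- (h n * (x \<bullet> e))) - 1) / complex_of_real (h n)) * I) \<longlonglongrightarrow> (- \<i> * complex_of_real (x \<bullet> e)) * I"
  proof (intro tendsto_mult tendsto_const)
    have b: "norm ((cis (- (h n * (x \<bullet> e))) - 1) / complex_of_real (h n) - (- \<i> * complex_of_real (x \<bullet> e))) \<le> h n * (x \<bullet> e)\<^sup>2" for n
    proof -
      have "(cis (- (h n * (x \<bullet> e))) - 1) / complex_of_real (h n) - (- \<i> * complex_of_real (x \<bullet> e))
        = (cis (- (h n * (x \<bullet> e))) - 1 - \<i> * complex_of_real (- (h n * (x \<bullet> e)))) / complex_of_real (h n)"
        using h[of n] by (simp add: field_simps)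
      also have "norm \<dots> \<le> (- (h n * (x \<bullet> e)))\<^sup>2 / h n"
        using h[of n] cis_bounds(2)[of "- (h n * (x \<bullet> e))"] by (simp add: norm_divide divide_right_mono)
      finally show ?thesis using h[of n] by (simp add: power2_eq_square mult_ac)
    qed
    have l: "(\<lambda>n. h n * (x \<bullet> e)\<^sup>2) \<longlonglongrightarrow> 0" using tendsto_mult_right[OF hlim, of "(x \<bullet> e)\<^sup>2"] by (simp add: mult.commute)
    have "(\<lambda>n. (cis (- (h n * (x \<bullet> e))) - 1) / complex_of_real (h n) - (- \<i> * complex_of_real (x \<bullet> e))) \<longlonglongrightarrow> 0"
      by (rule Lim_null_comparison[OF always_eventually[OF allI[OF b]] l])
    then show "(\<lambda>n. (cis (- (h n * (x \<bullet> e))) - 1) / complex_of_real (h n)) \<longlonglongrightarrow> - \<i> * complex_of_real (x \<bullet> e)"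
      by (rule LIM_zero_cancel)
  qed
  have "(\<integral>\<xi>. cis (x \<bullet> \<xi>) * frechet_derivative m (at \<xi>) e \<partial>lborel) = (- \<i> * complex_of_real (x \<bullet> e)) * I"
    using LIMSEQ_unique[OF lim[unfolded int] lim2] .
  then show ?thesis unfolding inv_fourier_def I_def by simp
qed

lemma inv_fourier_diff:
  fixes f g :: "'a::euclidean_space \<Rightarrow> complex"
  assumes "integrable lborel f" "integrable lborel g"
  shows "inv_fourier (\<lambda>\<xi>. f \<xi> - g \<xi>) x = inv_fourier f x - inv_fourier g x"
  unfolding inv_fourier_def
  using Bochner_Integration.integral_diff[OF integrable_cis_mult[OF assms(1)] integrable_cis_mult[OF assms(2)], of "\<lambda>\<xi>. x \<bullet> \<xi>" "\<lambda>\<xi>. x \<bullet> \<xi>"]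
  by (simp add: right_diff_distrib diff_divide_distrib)

lemma inv_fourier_norm_le:
  fixes f :: "'a::euclidean_space \<Rightarrow> complex"
  shows "norm (inv_fourier f x) \<le> (\<integral>\<xi>. norm (f \<xi>) \<partial>lborel) / (2 * pi) ^ DIM('a)"
proof -
  have "norm (\<integral>\<xi>. cis (x \<bullet> \<xi>) * f \<xi> \<partial>lborel) \<le> (\<integral>\<xi>. norm (f \<xi>) \<partial>lborel)"
    by (rule order_trans[OF integral_norm_bound]) (simp add: norm_mult)
  then show ?thesis unfolding inv_fourier_def by (simp add: norm_divide norm_power norm_mult divide_right_mono)
qed

lemma inv_fourier_measurable:
  fixes f :: "'a::euclidean_space \<Rightarrow> complex"
  assumes [measurable]: "f \<in> borel_measurable borel"
  shows "inv_fourier f \<in> borel_measurable borel"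
proof -
  have [measurable]: "(\<lambda>p. cis (fst p \<bullet> snd p)) \<in> borel_measurable ((borel :: 'a measure) \<Otimes>\<^sub>M (lborel :: 'a measure))"
    unfolding cis_conv_exp by measurable
  have "(\<lambda>x. \<integral>\<xi>. cis (x \<bullet> \<xi>) * f \<xi> \<partial>lborel) \<in> borel_measurable borel"
    by (rule lborel.borel_measurable_lebesgue_integral) (simp add: case_prod_beta')
  then show ?thesis unfolding inv_fourier_def[abs_def] by measurable
qed

text \<open>Subtracting the second partial derivative along \<open>e\<close> multiplies the
  transform by \<open>1 + (x \<bullet> e)\<^sup>2\<close>; one does this coordinate by
  coordinate.\<close>

lemma inv_fourier_prod:
  fixes m :: "'a::euclidean_space \<Rightarrow> complex"
  assumes m: "m \<in> test_functions" and S: "finite S" "S \<subseteq> Basis"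
  shows "\<exists>m'\<in>test_functions. \<forall>x. inv_fourier m' x = complex_of_real (\<Prod>e\<in>S. 1 + (x \<bullet> e)\<^sup>2) * inv_fourier m x"
  using S
proof (induction S)
  case empty then show ?case using m by auto
next
  case (insert e S)
  then obtain m' where m': "m' \<in> test_functions" "\<And>x. inv_fourier m' x = complex_of_real (\<Prod>e\<in>S. 1 + (x \<bullet> e)\<^sup>2) * inv_fourier m x"
    by auto
  have e: "e \<in> Basis" using insert by simp
  define d1 where "d1 = (\<lambda>x. frechet_derivative m' (at x) e)"
  define d2 where "d2 = (\<lambda>x. frechet_derivative d1 (at x) e)"
  have d1: "d1 \<in> test_functions" unfolding d1_def by (rule test_functions_partial[OF m'(1) e])
  have d2: "d2 \<in> test_functions" unfolding d2_def by (rule test_functions_partial[OF d1 e])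
  have "inv_fourier (\<lambda>x. m' x - d2 x) x = complex_of_real (1 + (x \<bullet> e)\<^sup>2) * inv_fourier m' x" for x
    unfolding inv_fourier_diff[OF test_functions_integrable[OF m'(1)] test_functions_integrable[OF d2]]
    using inv_fourier_partial[OF d1 e, of x] inv_fourier_partial[OF m'(1) e, of x]
    by (simp add: d1_def[symmetric] d2_def[symmetric] power2_eq_square algebra_simps)
  then have "inv_fourier (\<lambda>x. m' x - d2 x) x = complex_of_real (\<Prod>e\<in>insert e S. 1 + (x \<bullet> e)\<^sup>2) * inv_fourier m x" for x
    using insert(1,2) by (simp add: m'(2))
  then show ?case using test_functions_diff[OF m'(1) d2] by blast
qed

text \<open>With the product over all coordinates, the transform is a bounded function divided by
  that product, hence bounded by a multiple of the Cauchy majorant. This makes the kernels of the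
  Littlewood-Paley blocks integrable.\<close>

lemma inv_fourier_test_integrable:
  fixes m :: "'a::euclidean_space \<Rightarrow> complex"
  assumes m: "m \<in> test_functions"
  shows "integrable lborel (inv_fourier m)"
proof -
  obtain m' where m': "m' \<in> test_functions" "\<And>x. inv_fourier m' x = complex_of_real (\<Prod>e\<in>Basis. 1 + (x \<bullet> e)\<^sup>2) * inv_fourier m x"
    using inv_fourier_prod[OF m finite_Basis order_refl] by blast
  define B where "B = (\<integral>\<xi>. norm (m' \<xi>) \<partial>lborel) / (2 * pi) ^ DIM('a)"
  show ?thesis
  proof (rule Bochner_Integration.integrable_bound[OF integrable_mult_right[OF integrable_prod_cauchy, of B]])
    show "inv_fourier m \<in> borel_measurable lborel"
      using inv_fourier_measurable[OF test_functions_measurable[OF m]] by simp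
    have "norm (inv_fourier m x) \<le> B * (\<Prod>e\<in>Basis. 1 / (1 + (x \<bullet> e)\<^sup>2))" for x
    proof -
      have p: "0 < (\<Prod>e\<in>Basis. 1 + (x \<bullet> e)\<^sup>2)" by (intro prod_pos) (simp add: add_pos_nonneg)
      have "(\<Prod>e\<in>Basis. 1 + (x \<bullet> e)\<^sup>2) * norm (inv_fourier m x) = norm (inv_fourier m' x)"
        unfolding m'(2) using p by (simp add: norm_mult norm_of_real del: of_real_prod)
      also have "\<dots> \<le> B" unfolding B_def by (rule inv_fourier_norm_le)
      finally show ?thesis using p by (simp add: prod_dividef field_simps)
    qed
    then show "AE x in lborel. norm (inv_fourier m x) \<le> norm (B * (\<Prod>e\<in>Basis. 1 / (1 + (x \<bullet> e)\<^sup>2)))"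
      by (intro AE_I2) (auto intro: order_trans[OF _ abs_ge_self])
  qed
qed

section \<open>Fourier inversion of the law\<close>

lemma lborel_integral_prod:
  fixes f :: "'a::euclidean_space \<Rightarrow> real \<Rightarrow> complex"
  assumes f: "\<And>e. e \<in> Basis \<Longrightarrow> integrable lborel (f e)"
  shows "(\<integral>x. (\<Prod>e\<in>Basis. f e (x \<bullet> e)) \<partial>lborel) = (\<Prod>e\<in>Basis. \<integral>x. f e x \<partial>lborel)"
proof -
  interpret finite_product_sigma_finite "\<lambda>_::'a. lborel :: real measure" Basis by standard simp
  have [measurable]: "f e \<in> borel_measurable borel" if "e \<in> Basis" for e using f[OF that] by auto
  have "(\<integral>x. (\<Prod>e\<in>Basis. f e (x \<bullet> e)) \<partial>lborel) = (\<integral>x. (\<Prod>e\<in>Basis. f e ((\<Sum>b\<in>Basis. x b *\<^sub>R b) \<bullet> e)) \<partial>(\<Pi>\<^sub>M b\<in>Basis. lborel))"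
    by (subst (1) lborel_eq, rule integral_distr) measurable
  also have "\<dots> = (\<integral>x. (\<Prod>e\<in>Basis. f e (x e)) \<partial>(\<Pi>\<^sub>M b\<in>(Basis::'a set). lborel))"
    by (intro Bochner_Integration.integral_cong prod.cong refl) (simp add: inner_sum_left_Basis)
  also have "\<dots> = (\<Prod>e\<in>Basis. \<integral>x. f e x \<partial>lborel)"
    by (rule product_integral_prod[OF finite_Basis f])
  finally show ?thesis .
qed

lemma cis_sum: "finite I \<Longrightarrow> cis (\<Sum>i\<in>I. f i) = (\<Prod>i\<in>I. cis (f i))"
  by (induction I rule: finite_induct) (simp_all add: cis_mult[symmetric])

lemma fourier_gauss_1:
  "(\<integral>(z::'a::euclidean_space). cis (x \<bullet> z) * complex_of_real (gauss_density 1 z) \<partial>lborel) = complex_of_real (exp (- (norm x)\<^sup>2 / 2))"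
proof -
  have 1: "(\<integral>r. cis (t * r) * complex_of_real (normal_density 0 1 r) \<partial>lborel) = complex_of_real (exp (- t\<^sup>2 / 2))" for t
  proof -
    have "complex_of_real (exp (- t\<^sup>2 / 2)) = (\<integral>r. iexp (t * r) \<partial>density lborel (\<lambda>x. ennreal (normal_density 0 1 x)))"
      using fun_cong[OF char_std_normal_distribution, of t] by (simp add: char_def)
    also have "\<dots> = (\<integral>r. normal_density 0 1 r *\<^sub>R iexp (t * r) \<partial>lborel)"
      by (subst integral_density) auto
    finally show ?thesis by (simp add: cis_conv_exp scaleR_conv_of_real mult.commute)
  qed
  have "(\<integral>(z::'a). cis (x \<bullet> z) * complex_of_real (gauss_density 1 z) \<partial>lborel)
    = (\<integral>(z::'a). (\<Prod>e\<in>Basis. cis ((x \<bullet> e) * (z \<bullet> e)) * complex_of_real (normal_density 0 1 (z \<bullet> e))) \<partial>lborel)"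
    by (intro Bochner_Integration.integral_cong refl, subst euclidean_inner)
       (simp add: cis_sum prod.distrib gauss_density_def)
  also have "\<dots> = (\<Prod>e\<in>Basis. \<integral>r. cis ((x \<bullet> e) * r) * complex_of_real (normal_density 0 1 r) \<partial>lborel)"
  proof (rule lborel_integral_prod[where f="\<lambda>e r. cis ((x \<bullet> e) * r) * complex_of_real (normal_density 0 1 r)"])
    show "integrable lborel (\<lambda>r. cis ((x \<bullet> e) * r) * complex_of_real (normal_density 0 1 r))" for e
      by (rule integrable_cis_mult) auto
  qed
  also have "\<dots> = complex_of_real (exp (\<Sum>e\<in>Basis. - (x \<bullet> e)\<^sup>2 / 2))"
    unfolding 1 by (simp add: exp_sum)
  also have "(\<Sum>e\<in>Basis. - (x \<bullet> e)\<^sup>2 / 2) = - (norm x)\<^sup>2 / 2"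
    unfolding power2_norm_eq_inner
    by (subst euclidean_inner) (simp add: sum_negf sum_divide_distrib[symmetric] power2_eq_square)
  finally show ?thesis .
qed

lemma fourier_gauss:
  assumes t: "0 < t"
  shows "(\<integral>(z::'a::euclidean_space). cis (x \<bullet> z) * complex_of_real (gauss_density t z) \<partial>lborel) = complex_of_real (exp (- t * (norm x)\<^sup>2 / 2))"
proof -
  have [measurable]: "(\<lambda>z::'a. cis (x \<bullet> z)) \<in> borel_measurable borel" unfolding cis_conv_exp by measurable
  have "(\<integral>(z::'a). cis (x \<bullet> z) * complex_of_real (gauss_density t z) \<partial>lborel)
    = (\<bar>sqrt t\<bar> ^ DIM('a)) *\<^sub>R (\<integral>(z::'a). cis (x \<bullet> (sqrt t *\<^sub>R z)) * complex_of_real (gauss_density t (sqrt t *\<^sub>R z)) \<partial>lborel)"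
    using t by (intro lborel_integral_scale) auto
  also have "\<dots> = (\<integral>(z::'a). cis ((sqrt t *\<^sub>R x) \<bullet> z) * complex_of_real (gauss_density 1 z) \<partial>lborel)"
    unfolding scaleR_conv_of_real
    by (subst integral_mult_right_zero[symmetric], rule Bochner_Integration.integral_cong)
       (use t in \<open>simp_all add: gauss_density_scale[OF t, symmetric] mult_ac\<close>)
  also have "\<dots> = complex_of_real (exp (- t * (norm x)\<^sup>2 / 2))"
    unfolding fourier_gauss_1 using t by (simp add: power_mult_distrib)
  finally show ?thesis .
qed

text \<open>The Gaussian in the frequency is a multiple of \<open>gauss_density (1 / t)\<close>, so
  \<open>fourier_gauss\<close> can be read backwards.\<close>

lemma gauss_density_fourier:
  fixes x :: "'a::euclidean_space"
  assumes t: "0 < t"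
  shows "(\<integral>\<xi>. cis (x \<bullet> \<xi>) * complex_of_real (exp (- t * (norm \<xi>)\<^sup>2 / 2)) \<partial>lborel) = complex_of_real ((2 * pi) ^ DIM('a) * gauss_density t x)"
proof -
  define c where "c = sqrt (2 * pi / t) ^ DIM('a)"
  have s: "sqrt (2 * pi / t) * (1 / sqrt (2 * pi * (1 / t))) = 1" using t by (simp add: real_sqrt_mult real_sqrt_divide)
  have e: "exp (- t * (norm \<xi>)\<^sup>2 / 2) = c * gauss_density (1 / t) \<xi>" for \<xi> :: 'a
  proof -
    have "c * gauss_density (1 / t) \<xi> = (sqrt (2 * pi / t) * (1 / sqrt (2 * pi * (1 / t)))) ^ DIM('a) * exp (- (norm \<xi>)\<^sup>2 / (2 * (1 / t)))"
      unfolding c_def power_mult_distrib using t by (subst gauss_density_eq) auto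
    also have "\<dots> = exp (- t * (norm \<xi>)\<^sup>2 / 2)" unfolding s using t by (simp add: mult.commute)
    finally show ?thesis ..
  qed
  have "(\<integral>\<xi>. cis (x \<bullet> \<xi>) * complex_of_real (exp (- t * (norm \<xi>)\<^sup>2 / 2)) \<partial>lborel) = complex_of_real c * (\<integral>\<xi>. cis (x \<bullet> \<xi>) * complex_of_real (gauss_density (1 / t) \<xi>) \<partial>lborel)"
    unfolding e by (subst integral_mult_right_zero[symmetric]) (simp add: mult_ac)
  also have "\<dots> = complex_of_real (c * exp (- (1 / t) * (norm x)\<^sup>2 / 2))"
    using t by (subst fourier_gauss) auto
  also have "c * exp (- (1 / t) * (norm x)\<^sup>2 / 2) = (2 * pi) ^ DIM('a) * gauss_density t x"
  proof -
    have "a * (1 / sqrt (a * t)) = sqrt (a / t)" if "0 < a" for a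
    proof -
      have "a * (1 / sqrt (a * t)) = (a / sqrt a) / sqrt t" by (simp add: real_sqrt_mult)
      also have "a / sqrt a = sqrt a" using that by (intro real_div_sqrt) simp
      finally show ?thesis by (simp only: real_sqrt_divide)
    qed
    from this[of "2 * pi"] have "2 * pi * (1 / sqrt (2 * pi * t)) = sqrt (2 * pi / t)" by simp
    then show ?thesis
      unfolding gauss_density_eq[OF t] c_def mult.assoc[symmetric] power_mult_distrib[symmetric] using t by simp
  qed
  finally show ?thesis .
qed

section \<open>A smooth density for a variable whose law has difference bounds of all orders\<close>

text \<open>Isolates what the probabilistic part delivers at one fixed time. From here on only the
  law of \<open>X\<close> matters.\<close>

locale smooth_variable = prob_space M for M :: "'w measure" +
  fixes X :: "'w \<Rightarrow> 'a::euclidean_space"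
  assumes X_measurable[measurable]: "X \<in> borel_measurable M"
    and differences: "\<And>n. \<exists>K\<ge>0. \<forall>h B \<phi>. bounded_borel B \<phi> \<longrightarrow>
      \<bar>\<integral>\<omega>. (fdiff h ^^ n) \<phi> (X \<omega>) \<partial>M\<bar> \<le> K * B * sqrt (norm h) ^ n"
begin

definition chf :: "'a \<Rightarrow> complex" where
  "chf \<xi> = (\<integral>\<omega>. cis (X \<omega> \<bullet> \<xi>) \<partial>M)"

lemma chf_measurable[measurable]: "chf \<in> borel_measurable borel"
  unfolding chf_def[abs_def] cis_conv_exp by measurable

lemma integrable_cis: "integrable M (\<lambda>\<omega>. cis (X \<omega> \<bullet> \<xi>))"
proof (rule integrable_const_bound[of _ 1])
  show "(\<lambda>\<omega>. cis (X \<omega> \<bullet> \<xi>)) \<in> borel_measurable M" unfolding cis_conv_exp by measurable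
qed auto

lemma chf_le_1: "norm (chf \<xi>) \<le> 1"
  unfolding chf_def by (rule order_trans[OF integral_norm_bound]) (simp add: prob_space)

text \<open>A step with \<open>h \<bullet> \<xi> = pi\<close> reverses the sign of the wave, so each
  difference multiplies it by -2.\<close>

lemma fdiff_wave:
  assumes h: "h \<bullet> \<xi> = pi"
  shows "(fdiff h ^^ m) (\<lambda>x. cos (x \<bullet> \<xi>)) x = (-2) ^ m * cos (x \<bullet> \<xi>)"
    "(fdiff h ^^ m) (\<lambda>x. sin (x \<bullet> \<xi>)) x = (-2) ^ m * sin (x \<bullet> \<xi>)"
  by (induction m arbitrary: x) (simp_all add: fdiff_def inner_add_left h)

text \<open>Waves of frequency \<xi> are bounded test functions, and the step along \<xi> that
  reverses their sign has length \<open>pi / norm \<xi>\<close>. Differences of order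
  \<open>2 * n\<close> therefore give decay of order \<open>n\<close>.\<close>

lemma chf_decay: "\<exists>C. \<forall>\<xi>. (1 + norm \<xi>) ^ n * norm (chf \<xi>) \<le> C"
proof -
  obtain K where K: "0 \<le> K" "\<And>h B \<phi>. bounded_borel B \<phi> \<Longrightarrow> \<bar>\<integral>\<omega>. (fdiff h ^^ (2 * n)) \<phi> (X \<omega>) \<partial>M\<bar> \<le> K * B * sqrt (norm h) ^ (2 * n)"
    using differences[of "2 * n"] by blast
  have "(1 + norm \<xi>) ^ n * norm (chf \<xi>) \<le> 2 * K * (2 * pi) ^ n + 2 ^ n" for \<xi>
  proof (cases "norm \<xi> \<le> 1")
    case True
    have "(1 + norm \<xi>) ^ n * norm (chf \<xi>) \<le> 2 ^ n * 1"
      using True chf_le_1 by (intro mult_mono power_mono) auto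
    then show ?thesis using K(1) by (simp add: add_increasing)
  next
    case False
    define h where "h = (pi / (norm \<xi>)\<^sup>2) *\<^sub>R \<xi>"
    have h: "h \<bullet> \<xi> = pi" using False by (auto simp: h_def dot_square_norm)
    have nh: "sqrt (norm h) ^ (2 * n) = (pi / norm \<xi>) ^ n"
      using False by (simp add: h_def power_mult power2_eq_square)
    have b: "bounded_borel 1 (\<lambda>x. cos (x \<bullet> \<xi>))" "bounded_borel 1 (\<lambda>x. sin (x \<bullet> \<xi>))" unfolding bounded_borel_def by auto
    have p: "(2::real) ^ (2 * n) \<ge> 1" by simp
    have c: "\<bar>\<integral>\<omega>. cos (X \<omega> \<bullet> \<xi>) \<partial>M\<bar> \<le> K * (pi / norm \<xi>) ^ n"
    proof -
      have "2 ^ (2 * n) * \<bar>\<integral>\<omega>. cos (X \<omega> \<bullet> \<xi>) \<partial>M\<bar> \<le> K * (pi / norm \<xi>) ^ n"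
        using K(2)[OF b(1), of h] unfolding fdiff_wave[OF h] nh by (simp add: abs_mult)
      moreover have "1 * \<bar>\<integral>\<omega>. cos (X \<omega> \<bullet> \<xi>) \<partial>M\<bar> \<le> 2 ^ (2 * n) * \<bar>\<integral>\<omega>. cos (X \<omega> \<bullet> \<xi>) \<partial>M\<bar>"
        using p by (rule mult_right_mono) simp
      ultimately show ?thesis by linarith
    qed
    have s: "\<bar>\<integral>\<omega>. sin (X \<omega> \<bullet> \<xi>) \<partial>M\<bar> \<le> K * (pi / norm \<xi>) ^ n"
    proof -
      have "2 ^ (2 * n) * \<bar>\<integral>\<omega>. sin (X \<omega> \<bullet> \<xi>) \<partial>M\<bar> \<le> K * (pi / norm \<xi>) ^ n"
        using K(2)[OF b(2), of h] unfolding fdiff_wave[OF h] nh by (simp add: abs_mult)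
      moreover have "1 * \<bar>\<integral>\<omega>. sin (X \<omega> \<bullet> \<xi>) \<partial>M\<bar> \<le> 2 ^ (2 * n) * \<bar>\<integral>\<omega>. sin (X \<omega> \<bullet> \<xi>) \<partial>M\<bar>"
        using p by (rule mult_right_mono) simp
      ultimately show ?thesis by linarith
    qed
    have "Re (chf \<xi>) = (\<integral>\<omega>. cos (X \<omega> \<bullet> \<xi>) \<partial>M)" "Im (chf \<xi>) = (\<integral>\<omega>. sin (X \<omega> \<bullet> \<xi>) \<partial>M)"
      unfolding chf_def using integrable_cis[of \<xi>] by (simp_all add: integral_Re[symmetric] integral_Im[symmetric])
    then have "norm (chf \<xi>) \<le> 2 * K * (pi / norm \<xi>) ^ n"
      using cmod_le[of "chf \<xi>"] c s by simp
    then have "(1 + norm \<xi>) ^ n * norm (chf \<xi>) \<le> (1 + norm \<xi>) ^ n * (2 * K * (pi / norm \<xi>) ^ n)"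
      by (intro mult_left_mono) auto
    also have "\<dots> \<le> (2 * norm \<xi>) ^ n * (2 * K * (pi / norm \<xi>) ^ n)"
      using False K(1) by (intro mult_right_mono power_mono) auto
    also have "\<dots> = 2 * K * ((2 * norm \<xi>) * (pi / norm \<xi>)) ^ n"
      unfolding power_mult_distrib[of "2 * norm \<xi>" "pi / norm \<xi>"] by (simp only: mult_ac)
    also have "(2 * norm \<xi>) * (pi / norm \<xi>) = 2 * pi" using False by auto
    finally show ?thesis by (simp add: add_increasing2)
  qed
  then show ?thesis by blast
qed

lemma rapid_chf: "rapid chf"
  unfolding rapid_def
proof (intro conjI allI chf_measurable)
  fix N
  obtain C where C: "\<And>\<xi>. (1 + norm \<xi>) ^ (2 * DIM('a) + N) * norm (chf \<xi>) \<le> C" using chf_decay by blast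
  show "integrable lborel (\<lambda>\<xi>. (1 + norm \<xi>) ^ N * norm (chf \<xi>))"
    by (rule integrable_decay[of _ C]) (use C in \<open>simp_all add: power_add mult.assoc abs_mult\<close>)
qed

text \<open>The density, obtained by Fourier inversion.\<close>

definition dens :: "'a \<Rightarrow> real" where
  "dens x = Re (fourier (\<lambda>\<xi>. chf \<xi> / of_real ((2 * pi) ^ DIM('a))) x)"

lemma rapid_dens: "rapid (\<lambda>\<xi>. chf \<xi> / of_real ((2 * pi) ^ DIM('a)))"
proof -
  have "(\<lambda>\<xi>. (1 + norm \<xi>) ^ N * norm (chf \<xi> / of_real ((2 * pi) ^ DIM('a)))) = (\<lambda>\<xi>. ((1 + norm \<xi>) ^ N * norm (chf \<xi>)) / (2 * pi) ^ DIM('a))" for N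
    by (simp add: norm_divide norm_power norm_mult fun_eq_iff)
  then show ?thesis using rapidD(2)[OF rapid_chf] unfolding rapid_def by simp
qed

text \<open>The convolution of the law with a centred Gaussian of variance \<delta>. It is a density
  before one for \<open>X\<close> is known.\<close>

definition mollified :: "real \<Rightarrow> 'a \<Rightarrow> real" where
  "mollified \<delta> x = (\<integral>\<omega>. gauss_density \<delta> (x - X \<omega>) \<partial>M)"

lemma mollified_fourier:
  assumes \<delta>: "0 < \<delta>"
  shows "complex_of_real (mollified \<delta> x) = (\<integral>\<xi>. cis (- (\<xi> \<bullet> x)) * (chf \<xi> / of_real ((2 * pi) ^ DIM('a)) * complex_of_real (exp (- \<delta> * (norm \<xi>)\<^sup>2 / 2))) \<partial>lborel)"
proof -
  interpret P: pair_sigma_finite M "lborel :: 'a measure" ..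
  define E where "E = (\<lambda>\<xi>::'a. complex_of_real (exp (- \<delta> * (norm \<xi>)\<^sup>2 / 2)))"
  have [measurable]: "E \<in> borel_measurable borel" unfolding E_def by measurable
  have cis_m[measurable]: "(\<lambda>p. cis ((X (fst p) - x) \<bullet> snd p)) \<in> borel_measurable (M \<Otimes>\<^sub>M (lborel :: 'a measure))"
    unfolding cis_conv_exp by measurable
  have Ei: "integrable lborel E"
  proof -
    have "integrable lborel (\<lambda>\<xi>::'a. gauss_density (1 / \<delta>) \<xi>)" using \<delta> by (intro integrable_gauss_density) simp
    from integrable_mult_right[OF this, of "inverse ((1 / sqrt (2 * pi * (1 / \<delta>))) ^ DIM('a))"]
    have "integrable lborel (\<lambda>\<xi>::'a. exp (- (norm \<xi>)\<^sup>2 / (2 * (1 / \<delta>))))"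
      using \<delta> by (simp add: gauss_density_eq)
    then show ?thesis unfolding E_def using \<delta> by (intro integrable_of_real) (simp add: mult.commute)
  qed
  have int: "integrable (M \<Otimes>\<^sub>M lborel) (\<lambda>(\<omega>, \<xi>). cis ((X \<omega> - x) \<bullet> \<xi>) * E \<xi>)"
  proof (rule P.Fubini_integrable)
    show "(\<lambda>(\<omega>, \<xi>). cis ((X \<omega> - x) \<bullet> \<xi>) * E \<xi>) \<in> borel_measurable (M \<Otimes>\<^sub>M lborel)" by (simp add: case_prod_beta')
    show "integrable M (\<lambda>\<omega>. \<integral>\<xi>. norm (case (\<omega>, \<xi>) of (\<omega>, \<xi>) \<Rightarrow> cis ((X \<omega> - x) \<bullet> \<xi>) * E \<xi>) \<partial>lborel)"
      by (simp add: norm_mult)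
    show "AE \<omega> in M. integrable lborel (\<lambda>\<xi>. case (\<omega>, \<xi>) of (\<omega>, \<xi>) \<Rightarrow> cis ((X \<omega> - x) \<bullet> \<xi>) * E \<xi>)"
      using integrable_cis_mult[OF Ei] by simp
  qed
  have g: "(\<integral>\<xi>. cis ((X \<omega> - x) \<bullet> \<xi>) * E \<xi> \<partial>lborel) = complex_of_real ((2 * pi) ^ DIM('a) * gauss_density \<delta> (x - X \<omega>))" for \<omega>
    unfolding E_def gauss_density_fourier[OF \<delta>] using gauss_density_minus[of \<delta> "X \<omega> - x"] by simp
  have "(\<integral>\<xi>. cis (- (\<xi> \<bullet> x)) * (chf \<xi> * E \<xi>) \<partial>lborel) = (\<integral>\<xi>. \<integral>\<omega>. cis ((X \<omega> - x) \<bullet> \<xi>) * E \<xi> \<partial>M \<partial>lborel)"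
  proof (rule Bochner_Integration.integral_cong[OF refl])
    fix \<xi>
    have eq: "cis ((X \<omega> - x) \<bullet> \<xi>) * E \<xi> = (cis (- (\<xi> \<bullet> x)) * E \<xi>) * cis (X \<omega> \<bullet> \<xi>)" for \<omega>
      by (simp add: inner_diff_left inner_commute[of x] cis_mult mult_ac)
    show "cis (- (\<xi> \<bullet> x)) * (chf \<xi> * E \<xi>) = (\<integral>\<omega>. cis ((X \<omega> - x) \<bullet> \<xi>) * E \<xi> \<partial>M)"
      unfolding eq chf_def integral_mult_right_zero by (simp only: mult_ac)
  qed
  also have "\<dots> = (\<integral>\<omega>. \<integral>\<xi>. cis ((X \<omega> - x) \<bullet> \<xi>) * E \<xi> \<partial>lborel \<partial>M)"
    by (rule P.Fubini_integral[OF int])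
  also have "\<dots> = complex_of_real ((2 * pi) ^ DIM('a) * mollified \<delta> x)"
    unfolding g mollified_def by (simp del: of_real_mult of_real_power)
  finally have "(\<integral>\<xi>. cis (- (\<xi> \<bullet> x)) * (chf \<xi> * E \<xi>) \<partial>lborel) = complex_of_real ((2 * pi) ^ DIM('a)) * complex_of_real (mollified \<delta> x)" by simp
  moreover have "(\<integral>\<xi>. cis (- (\<xi> \<bullet> x)) * (chf \<xi> / of_real ((2 * pi) ^ DIM('a)) * E \<xi>) \<partial>lborel)
     = (\<integral>\<xi>. cis (- (\<xi> \<bullet> x)) * (chf \<xi> * E \<xi>) \<partial>lborel) / of_real ((2 * pi) ^ DIM('a))"
    by (subst integral_divide_zero[symmetric]) (simp add: mult.assoc)
  ultimately show ?thesis unfolding E_def by simp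
qed

text \<open>In Fourier variables the mollification is the factor
  \<open>exp (- \<delta> * (norm \<xi>)\<^sup>2 / 2)\<close>, which differs from 1 by at most
  \<open>\<delta> * (norm \<xi>)\<^sup>2\<close>. The second moment of the characteristic function
  then gives a rate uniform in \<open>x\<close>.\<close>

lemma mollified_tendsto:
  "\<exists>J\<ge>0. \<forall>\<delta>>0. \<forall>x. norm (complex_of_real (mollified \<delta> x) - fourier (\<lambda>\<xi>. chf \<xi> / of_real ((2 * pi) ^ DIM('a))) x) \<le> J * \<delta>"
proof -
  define a where "a = (\<lambda>\<xi>. chf \<xi> / of_real ((2 * pi) ^ DIM('a)))"
  have a: "rapid a" unfolding a_def by (rule rapid_dens)
  note [measurable] = rapidD(1)[OF a]
  define J where "J = (\<integral>\<xi>. (1 + norm \<xi>) ^ 2 * norm (a \<xi>) \<partial>lborel)"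
  have "norm (complex_of_real (mollified \<delta> x) - fourier a x) \<le> J * \<delta>" if \<delta>: "0 < \<delta>" for \<delta> x
  proof -
    define E where "E = (\<lambda>\<xi>::'a. exp (- \<delta> * (norm \<xi>)\<^sup>2 / 2))"
    have E: "0 \<le> 1 - E \<xi>" "1 - E \<xi> \<le> \<delta> * (norm \<xi>)\<^sup>2" "E \<xi> \<le> 1" for \<xi>
    proof -
      show 1: "E \<xi> \<le> 1" unfolding E_def using \<delta> by simp
      then show "0 \<le> 1 - E \<xi>" by simp
      have "1 - E \<xi> \<le> \<delta> * (norm \<xi>)\<^sup>2 / 2" unfolding E_def using exp_ge_add_one_self[of "- \<delta> * (norm \<xi>)\<^sup>2 / 2"] by simp
      also have "\<dots> \<le> \<delta> * (norm \<xi>)\<^sup>2" using \<delta> by simp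
      finally show "1 - E \<xi> \<le> \<delta> * (norm \<xi>)\<^sup>2" .
    qed
    have [measurable]: "E \<in> borel_measurable borel" unfolding E_def by measurable
    have aE: "integrable lborel (\<lambda>\<xi>. a \<xi> * complex_of_real (E \<xi>))"
      by (rule Bochner_Integration.integrable_bound[OF rapidD(3)[OF a]])
         (use E in \<open>auto simp: norm_mult E_def intro!: mult_right_le_one_le\<close>)
    have i1: "integrable lborel (\<lambda>\<xi>. cis (- (\<xi> \<bullet> x)) * (a \<xi> * complex_of_real (E \<xi>)))" by (rule integrable_cis_mult[OF aE]) simp
    have i2: "integrable lborel (\<lambda>\<xi>. cis (- (\<xi> \<bullet> x)) * a \<xi>)" by (rule integrable_cis_mult[OF rapidD(3)[OF a]]) simp
    have "complex_of_real (mollified \<delta> x) - fourier a x = (\<integral>\<xi>. cis (- (\<xi> \<bullet> x)) * (a \<xi> * complex_of_real (E \<xi>)) - cis (- (\<xi> \<bullet> x)) * a \<xi> \<partial>lborel)"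
      unfolding Bochner_Integration.integral_diff[OF i1 i2] unfolding mollified_fourier[OF \<delta>] fourier_def a_def E_def ..
    also have "norm \<dots> \<le> (\<integral>\<xi>. norm (cis (- (\<xi> \<bullet> x)) * (a \<xi> * complex_of_real (E \<xi>)) - cis (- (\<xi> \<bullet> x)) * a \<xi>) \<partial>lborel)"
      by (rule integral_norm_bound)
    also have "\<dots> \<le> (\<integral>\<xi>. \<delta> * ((1 + norm \<xi>) ^ 2 * norm (a \<xi>)) \<partial>lborel)"
    proof (rule integral_mono)
      show "integrable lborel (\<lambda>\<xi>. norm (cis (- (\<xi> \<bullet> x)) * (a \<xi> * complex_of_real (E \<xi>)) - cis (- (\<xi> \<bullet> x)) * a \<xi>))"
        by (intro integrable_norm Bochner_Integration.integrable_diff i1 i2)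
      show "integrable lborel (\<lambda>\<xi>. \<delta> * ((1 + norm \<xi>) ^ 2 * norm (a \<xi>)))" by (intro integrable_mult_right rapidD(2)[OF a])
      fix \<xi> :: 'a
      have "cis (- (\<xi> \<bullet> x)) * (a \<xi> * complex_of_real (E \<xi>)) - cis (- (\<xi> \<bullet> x)) * a \<xi> = - (cis (- (\<xi> \<bullet> x)) * a \<xi> * complex_of_real (1 - E \<xi>))"
        by (simp add: algebra_simps)
      then have "norm (cis (- (\<xi> \<bullet> x)) * (a \<xi> * complex_of_real (E \<xi>)) - cis (- (\<xi> \<bullet> x)) * a \<xi>) = norm (a \<xi>) * (1 - E \<xi>)"
        using E(1)[of \<xi>] by (simp add: norm_mult del: of_real_diff)
      also have "\<dots> \<le> norm (a \<xi>) * (\<delta> * (1 + norm \<xi>) ^ 2)"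
        using E(2)[of \<xi>] \<delta> by (intro mult_left_mono order_trans[OF E(2)] power_mono) auto
      finally show "norm (cis (- (\<xi> \<bullet> x)) * (a \<xi> * complex_of_real (E \<xi>)) - cis (- (\<xi> \<bullet> x)) * a \<xi>) \<le> \<delta> * ((1 + norm \<xi>) ^ 2 * norm (a \<xi>))"
        by (simp add: mult_ac)
    qed
    also have "\<dots> = J * \<delta>" by (simp add: J_def)
    finally show ?thesis .
  qed
  moreover have "0 \<le> J" unfolding J_def by simp
  ultimately show ?thesis unfolding a_def by blast
qed

lemma mollified_nonneg: "0 \<le> mollified \<delta> x"
  unfolding mollified_def by simp

text \<open>Being real and being nonnegative are inherited from the mollified densities in the
  limit; Fourier inversion by itself shows neither.\<close>

lemma dens_eq: "complex_of_real (dens x) = fourier (\<lambda>\<xi>. chf \<xi> / of_real ((2 * pi) ^ DIM('a))) x"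
  and dens_nonneg: "0 \<le> dens x"
  and mollified_dens: "\<exists>J\<ge>0. \<forall>\<delta>>0. \<forall>x. \<bar>mollified \<delta> x - dens x\<bar> \<le> J * \<delta>"
proof -
  obtain J where J: "0 \<le> J" "\<And>\<delta> x. 0 < \<delta> \<Longrightarrow> norm (complex_of_real (mollified \<delta> x) - fourier (\<lambda>\<xi>. chf \<xi> / of_real ((2 * pi) ^ DIM('a))) x) \<le> J * \<delta>"
    using mollified_tendsto by blast
  have lim: "(\<lambda>n. complex_of_real (mollified (1 / real (Suc n)) x)) \<longlonglongrightarrow> fourier (\<lambda>\<xi>. chf \<xi> / of_real ((2 * pi) ^ DIM('a))) x" for x
  proof -
    have b: "norm (complex_of_real (mollified (1 / real (Suc n)) x) - fourier (\<lambda>\<xi>. chf \<xi> / of_real ((2 * pi) ^ DIM('a))) x) \<le> J * (1 / real (Suc n))" for n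
      by (rule J(2)) simp
    have l: "(\<lambda>n. J * (1 / real (Suc n))) \<longlonglongrightarrow> 0"
      using tendsto_mult_right[OF LIMSEQ_Suc[OF lim_1_over_n[where 'a=real]], of J] by simp
    show ?thesis by (rule LIM_zero_cancel[OF Lim_null_comparison[OF always_eventually[OF allI[OF b]] l]])
  qed
  have limr: "(\<lambda>n. mollified (1 / real (Suc n)) x) \<longlonglongrightarrow> dens x" for x
    using tendsto_Re[OF lim[of x]] by (simp add: dens_def)
  show eq: "complex_of_real (dens x) = fourier (\<lambda>\<xi>. chf \<xi> / of_real ((2 * pi) ^ DIM('a))) x" for x
    by (rule LIMSEQ_unique[OF tendsto_of_real[OF limr[of x]] lim[of x]])
  show "0 \<le> dens x" for x
    by (rule tendsto_lowerbound[OF limr[of x]]) (auto intro!: always_eventually mollified_nonneg)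
  have "\<bar>mollified \<delta> x - dens x\<bar> \<le> J * \<delta>" if "0 < \<delta>" for \<delta> x
    using J(2)[OF that, of x] unfolding eq[symmetric] of_real_diff[symmetric] norm_of_real .
  then show "\<exists>J\<ge>0. \<forall>\<delta>>0. \<forall>x. \<bar>mollified \<delta> x - dens x\<bar> \<le> J * \<delta>" using J(1) by blast
qed

lemma dens_continuous: "continuous_on UNIV dens"
  unfolding dens_def by (intro continuous_intros smooth_continuous smooth_fourier rapid_dens)

lemma dens_measurable[measurable]: "dens \<in> borel_measurable borel"
  by (rule borel_measurable_continuous_onI[OF dens_continuous])

end

context smooth_variable begin

text \<open>Fubini moves the Gaussian from the test function to the law.\<close>

lemma expectation_heat:
  assumes \<delta>: "0 < \<delta>" and f: "bounded_borel B f" and fi: "integrable lborel f"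
  shows "(\<integral>\<omega>. heat \<delta> f (X \<omega>) \<partial>M) = (\<integral>y. f y * mollified \<delta> y \<partial>lborel)"
proof -
  interpret P: pair_sigma_finite M "lborel :: 'a measure" ..
  note [measurable] = bounded_borelD(1)[OF f]
  have h: "heat \<delta> f (X \<omega>) = (\<integral>y. f y * gauss_density \<delta> (y - X \<omega>) \<partial>lborel)" for \<omega>
  proof -
    have "heat \<delta> f (X \<omega>) = (\<integral>z. gauss_density \<delta> z * f (X \<omega> + z) \<partial>lborel)"
      unfolding heat_def by (rule integral_gauss) measurable
    also have "\<dots> = (\<integral>z. f (X \<omega> + z) * gauss_density \<delta> ((X \<omega> + z) - X \<omega>) \<partial>lborel)" by (simp add: mult.commute)
    finally show ?thesis using lborel_integral_shift[of "\<lambda>y. f y * gauss_density \<delta> (y - X \<omega>)" "X \<omega>"] by simp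
  qed
  have gb: "gauss_density \<delta> z \<le> (1 / sqrt (2 * pi * \<delta>)) ^ DIM('a)" for z :: 'a
    unfolding gauss_density_eq[OF \<delta>] using \<delta> by (intro mult_left_le) auto
  define c where "c = (1 / sqrt (2 * pi * \<delta>)) ^ DIM('a)"
  have c: "0 \<le> c" unfolding c_def using \<delta> by simp
  have abs_le: "\<bar>f y * gauss_density \<delta> (y - x)\<bar> \<le> \<bar>f y\<bar> * c" for x y
    unfolding abs_mult c_def using gb[of "y - x"] by (intro mult_left_mono) auto
  have ig: "integrable lborel (\<lambda>y. f y * gauss_density \<delta> (y - x))" for x
    by (rule Bochner_Integration.integrable_bound[OF integrable_mult_left[OF integrable_norm[OF fi], of c]])
       (use abs_le c in \<open>auto intro!: AE_I2\<close>)
  have int: "integrable (M \<Otimes>\<^sub>M lborel) (\<lambda>(\<omega>, y). f y * gauss_density \<delta> (y - X \<omega>))"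
  proof (rule P.Fubini_integrable)
    show "(\<lambda>(\<omega>, y). f y * gauss_density \<delta> (y - X \<omega>)) \<in> borel_measurable (M \<Otimes>\<^sub>M lborel)"
      by (simp add: case_prod_beta')
    show "AE \<omega> in M. integrable lborel (\<lambda>y. case (\<omega>, y) of (\<omega>, y) \<Rightarrow> f y * gauss_density \<delta> (y - X \<omega>))"
      using ig by simp
    show "integrable M (\<lambda>\<omega>. \<integral>y. norm (case (\<omega>, y) of (\<omega>, y) \<Rightarrow> f y * gauss_density \<delta> (y - X \<omega>)) \<partial>lborel)"
    proof (rule integrable_const_bound)
      show "AE \<omega> in M. norm (\<integral>y. norm (case (\<omega>, y) of (\<omega>, y) \<Rightarrow> f y * gauss_density \<delta> (y - X \<omega>)) \<partial>lborel) \<le> (\<integral>y. \<bar>f y\<bar> * c \<partial>lborel)"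
      proof (rule AE_I2)
        fix \<omega>
        have "(\<integral>y. \<bar>f y * gauss_density \<delta> (y - X \<omega>)\<bar> \<partial>lborel) \<le> (\<integral>y. \<bar>f y\<bar> * c \<partial>lborel)"
          by (intro integral_mono integrable_abs ig integrable_mult_left fi abs_le)
        then show "norm (\<integral>y. norm (case (\<omega>, y) of (\<omega>, y) \<Rightarrow> f y * gauss_density \<delta> (y - X \<omega>)) \<partial>lborel) \<le> (\<integral>y. \<bar>f y\<bar> * c \<partial>lborel)"
          by simp
      qed
      show "(\<lambda>\<omega>. \<integral>y. norm (case (\<omega>, y) of (\<omega>, y) \<Rightarrow> f y * gauss_density \<delta> (y - X \<omega>)) \<partial>lborel) \<in> borel_measurable M"
        by (rule lborel.borel_measurable_lebesgue_integral) (simp add: case_prod_beta')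
    qed
  qed
  have "(\<integral>\<omega>. heat \<delta> f (X \<omega>) \<partial>M) = (\<integral>y. \<integral>\<omega>. f y * gauss_density \<delta> (y - X \<omega>) \<partial>M \<partial>lborel)"
    unfolding h by (rule P.Fubini_integral[OF int, symmetric])
  then show ?thesis by (simp add: mollified_def)
qed

text \<open>Let \<delta> tend to zero on both sides of \<open>expectation_heat\<close>;
  integrability of \<open>f\<close> dominates the right-hand side, since the mollified densities are
  uniformly bounded.\<close>

lemma expectation_compact_support:
  assumes f: "bounded_borel B f" "continuous_on UNIV f" and fi: "integrable lborel f"
  shows "(\<integral>\<omega>. f (X \<omega>) \<partial>M) = (\<integral>y. f y * dens y \<partial>lborel)" "integrable lborel (\<lambda>y. f y * dens y)"
proof -
  note [measurable] = bounded_borelD(1)[OF f(1)]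
  define D where "D = (\<integral>\<xi>. norm (chf \<xi> / of_real ((2 * pi) ^ DIM('a))) \<partial>lborel)"
  have db: "\<bar>dens x\<bar> \<le> D" for x
    unfolding D_def using fourier_norm_le[of "\<lambda>\<xi>. chf \<xi> / of_real ((2 * pi) ^ DIM('a))" x] unfolding dens_eq[symmetric] norm_of_real .
  show int: "integrable lborel (\<lambda>y. f y * dens y)"
  proof (rule Bochner_Integration.integrable_bound[OF integrable_mult_left[OF integrable_norm[OF fi], of D]])
    show "AE x in lborel. norm (f x * dens x) \<le> norm (norm (f x) * D)"
    proof (rule AE_I2)
      fix x
      have "\<bar>f x\<bar> * \<bar>dens x\<bar> \<le> \<bar>f x\<bar> * \<bar>D\<bar>" using db[of x] by (intro mult_left_mono) auto
      then show "norm (f x * dens x) \<le> norm (norm (f x) * D)" by (simp add: abs_mult)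
    qed
  qed measurable
  obtain J where J: "0 \<le> J" "\<And>\<delta> x. 0 < \<delta> \<Longrightarrow> \<bar>mollified \<delta> x - dens x\<bar> \<le> J * \<delta>" using mollified_dens by blast
  define \<delta> where "\<delta> = (\<lambda>n. 1 / real (Suc n))"
  have \<delta>: "0 < \<delta> n" for n by (simp add: \<delta>_def)
  have \<delta>l: "\<delta> \<longlonglongrightarrow> 0" unfolding \<delta>_def by (rule LIMSEQ_Suc[OF lim_1_over_n])
  have l1: "(\<lambda>n. \<integral>\<omega>. heat (\<delta> n) f (X \<omega>) \<partial>M) \<longlonglongrightarrow> (\<integral>\<omega>. f (X \<omega>) \<partial>M)"
  proof (rule integral_dominated_convergence[where w="\<lambda>_. B"])
    have hb: "bounded_borel B (heat (\<delta> n) f)" for n by (rule heat_bounded[OF \<delta> f(1)])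
    show "(\<lambda>\<omega>. heat (\<delta> n) f (X \<omega>)) \<in> borel_measurable M" for n
      using bounded_borelD(1)[OF hb] by measurable
    show "AE \<omega> in M. norm (heat (\<delta> n) f (X \<omega>)) \<le> B" for n using bounded_borelD(2)[OF hb] by simp
    show "AE \<omega> in M. (\<lambda>n. heat (\<delta> n) f (X \<omega>)) \<longlonglongrightarrow> f (X \<omega>)"
      by (intro AE_I2 heat_tendsto_id[OF f \<delta> \<delta>l])
  qed auto
  have l2: "(\<lambda>n. \<integral>y. f y * mollified (\<delta> n) y \<partial>lborel) \<longlonglongrightarrow> (\<integral>y. f y * dens y \<partial>lborel)"
  proof (rule integral_dominated_convergence[where w="\<lambda>y. norm (f y) * (D + J)"])
    have [measurable]: "mollified d \<in> borel_measurable borel" for d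
      unfolding mollified_def[abs_def] by measurable
    show "(\<lambda>y. f y * mollified (\<delta> n) y) \<in> borel_measurable lborel" for n by measurable
    show "integrable lborel (\<lambda>y. norm (f y) * (D + J))" by (intro integrable_mult_left integrable_norm fi)
    show "AE y in lborel. norm (f y * mollified (\<delta> n) y) \<le> norm (f y) * (D + J)" for n
    proof (rule AE_I2)
      fix y
      have "J * \<delta> n \<le> J * 1" using J(1) by (intro mult_left_mono) (simp_all add: \<delta>_def)
      then have "\<bar>mollified (\<delta> n) y\<bar> \<le> D + J" using J(2)[OF \<delta>, of n y] db[of y] by linarith
      then show "norm (f y * mollified (\<delta> n) y) \<le> norm (f y) * (D + J)" by (simp add: abs_mult mult_left_mono)
    qed
    show "AE y in lborel. (\<lambda>n. f y * mollified (\<delta> n) y) \<longlonglongrightarrow> f y * dens y"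
    proof (intro AE_I2 tendsto_mult tendsto_const)
      fix y
      have b: "norm (mollified (\<delta> n) y - dens y) \<le> J * \<delta> n" for n using J(2)[OF \<delta>] by simp
      have l: "(\<lambda>n. J * \<delta> n) \<longlonglongrightarrow> 0" using tendsto_mult[OF tendsto_const \<delta>l, of J] by simp
      show "(\<lambda>n. mollified (\<delta> n) y) \<longlonglongrightarrow> dens y"
        by (rule LIM_zero_cancel[OF Lim_null_comparison[OF always_eventually[OF allI[OF b]] l]])
    qed
  qed auto
  show "(\<integral>\<omega>. f (X \<omega>) \<partial>M) = (\<integral>y. f y * dens y \<partial>lborel)"
    using LIMSEQ_unique[OF l1] l2 unfolding expectation_heat[OF \<delta> f(1) fi] by blast
qed

text \<open>Tents decreasing to the indicator of \<open>K\<close> have supports in one common ball,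
  so \<open>expectation_compact_support\<close> applies to them and passes to the limit.\<close>

lemma prob_compact:
  assumes K: "compact K"
  shows "emeasure (distr M borel X) K = emeasure (density lborel (\<lambda>x. ennreal (dens x))) K"
proof (cases "K = {}")
  case False
  have Kc: "closed K" by (rule compact_imp_closed[OF K])
  have [measurable]: "K \<in> sets borel" using Kc by auto
  obtain f :: "nat \<Rightarrow> 'a \<Rightarrow> real" where f: "\<And>n. continuous_on UNIV (f n)" "\<And>n x. 0 \<le> f n x" "\<And>n x. f n x \<le> 1"
      "\<And>x. (\<lambda>n. f n x) \<longlonglongrightarrow> indicator K x" "\<And>n x. f n x \<noteq> 0 \<Longrightarrow> infdist x K \<le> 1"
    using closed_indicator_approx[OF Kc] False by metis
  obtain R where R: "\<And>x. x \<in> K \<Longrightarrow> norm x \<le> R" using compact_imp_bounded[OF K] bounded_iff by blast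
  have supp: "norm x \<le> R + 2" if x: "f n x \<noteq> 0" for n x
  proof -
    have "infdist x K < 2" using f(5)[OF x] by simp
    then obtain k where k: "k \<in> K" "dist x k < 2"
      unfolding infdist_notempty[OF False] using cINF_less_iff[OF False] by (metis bdd_below_image_dist)
    then show ?thesis using R[OF k(1)] norm_triangle_sub[of x k] by (simp add: dist_norm)
  qed
  have fb: "bounded_borel 1 (f n)" for n
    using f(2,3)[of n] borel_measurable_continuous_onI[OF f(1)] unfolding bounded_borel_def
    by (auto simp: abs_le_iff intro: order_trans[of _ 0])
  have ball_i: "integrable lborel (indicator (cball 0 (R + 2)) :: 'a \<Rightarrow> real)"
    using emeasure_lborel_cball_finite[of "0::'a" "R + 2"] by (intro integrable_real_indicator) (auto simp: less_top)
  have fle: "\<bar>f n x\<bar> \<le> indicator (cball 0 (R + 2)) x" for n x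
    using supp[of n x] f(2,3)[of n x] by (cases "f n x = 0") (auto simp: indicator_def)
  have fi: "integrable lborel (f n)" for n
    by (rule Bochner_Integration.integrable_bound[OF ball_i]) (use fle bounded_borelD(1)[OF fb] in \<open>auto intro!: AE_I2 order_trans[OF fle]\<close>)
  note e = expectation_compact_support[OF fb f(1) fi]
  note [measurable] = bounded_borelD(1)[OF fb]
  have l1: "(\<lambda>n. \<integral>\<omega>. f n (X \<omega>) \<partial>M) \<longlonglongrightarrow> (\<integral>\<omega>. indicator K (X \<omega>) \<partial>M)"
    by (rule integral_dominated_convergence[where w="\<lambda>_. 1"]) (use f bounded_borelD(2)[OF fb] in auto)
  have bi: "integrable lborel (\<lambda>y. indicator (cball 0 (R + 2)) y * dens y)"
  proof -
    have "bounded (dens ` cball 0 (R + 2))"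
      by (intro compact_imp_bounded compact_continuous_image continuous_on_subset[OF dens_continuous]) auto
    then obtain D where D: "\<And>x. x \<in> cball 0 (R + 2) \<Longrightarrow> \<bar>dens x\<bar> \<le> D" unfolding bounded_iff by (metis imageI real_norm_def)
    show ?thesis
      by (rule Bochner_Integration.integrable_bound[OF integrable_mult_right[OF ball_i, of "\<bar>D\<bar>"]])
         (use D abs_ge_self[of D] in \<open>auto simp: indicator_def intro!: AE_I2 intro: order_trans[OF D abs_ge_self]\<close>)
  qed
  have l2: "(\<lambda>n. \<integral>y. f n y * dens y \<partial>lborel) \<longlonglongrightarrow> (\<integral>y. indicator K y * dens y \<partial>lborel)"
  proof (rule integral_dominated_convergence[OF _ _ bi])
    show "AE y in lborel. (\<lambda>n. f n y * dens y) \<longlonglongrightarrow> indicator K y * dens y" by (intro AE_I2 tendsto_mult f tendsto_const)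
    show "AE y in lborel. norm (f n y * dens y) \<le> indicator (cball 0 (R + 2)) y * dens y" for n
      using fle dens_nonneg by (intro AE_I2) (simp add: abs_mult mult_right_mono)
  qed auto
  have eq: "(\<integral>\<omega>. indicator K (X \<omega>) \<partial>M) = (\<integral>y. indicator K y * dens y \<partial>lborel)"
    using LIMSEQ_unique[OF l1] l2 unfolding e(1) by blast
  have Ki: "integrable lborel (\<lambda>y. indicator K y * dens y)"
    by (rule Bochner_Integration.integrable_bound[OF bi])
       (use R dens_nonneg in \<open>force intro!: AE_I2 simp: indicator_def abs_mult\<close>)+
  have "emeasure (distr M borel X) K = ennreal (\<integral>\<omega>. indicator K (X \<omega>) \<partial>M)"
  proof -
    have "(\<integral>\<omega>. indicat_real K (X \<omega>) \<partial>M) = (\<integral>\<omega>. indicat_real (X -` K \<inter> space M) \<omega> \<partial>M)"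
      by (rule Bochner_Integration.integral_cong) (auto simp: indicator_def)
    then show ?thesis by (simp add: emeasure_distr emeasure_eq_measure)
  qed
  also have "\<dots> = (\<integral>\<^sup>+y. ennreal (indicator K y * dens y) \<partial>lborel)"
    unfolding eq using dens_nonneg by (intro nn_integral_eq_integral[symmetric] Ki) auto
  also have "\<dots> = (\<integral>\<^sup>+y. ennreal (dens y) * indicator K y \<partial>lborel)"
    by (rule nn_integral_cong) (auto simp: indicator_def)
  finally show ?thesis by (simp add: emeasure_density)
qed simp

text \<open>Agreement on compact sets bounds the mass of the candidate on every ball by 1, so it is
  a finite measure; inner regularity then extends the agreement to all Borel sets.\<close>

lemma law_dens: "distr M borel X = density lborel (\<lambda>x. ennreal (dens x))"
proof -
  define D D' where "D = distr M borel X" and "D' = density lborel (\<lambda>x. ennreal (dens x))"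
  interpret D: prob_space D unfolding D_def by (rule prob_space_distr) simp
  have s: "sets D = sets borel" "sets D' = sets borel" by (auto simp: D_def D'_def)
  have cK: "emeasure D K = emeasure D' K" if "compact K" for K unfolding D_def D'_def by (rule prob_compact[OF that])
  have "emeasure D' (\<Union>n. cball 0 (real n)) = (SUP n. emeasure D' (cball 0 (real n)))"
    by (rule SUP_emeasure_incseq[symmetric]) (auto simp: s incseq_def)
  also have "\<dots> \<le> 1" by (rule SUP_least) (simp add: cK[symmetric] D.emeasure_le_1)
  also have "(\<Union>n. cball 0 (real n)) = (UNIV :: 'a set)" using real_arch_simple by auto
  finally have fin: "emeasure D' (space D') \<noteq> \<infinity>" by (auto simp: D'_def top_unique)
  show ?thesis
    unfolding D_def[symmetric] D'_def[symmetric]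
  proof (rule measure_eqI)
    fix A assume "A \<in> sets D"
    then have A: "A \<in> sets borel" by (simp add: s)
    have "emeasure D A = (SUP K \<in> {K. K \<subseteq> A \<and> compact K}. emeasure D K)"
      by (rule inner_regular[OF s(1) _ A]) (simp add: D.emeasure_space_1)
    also have "\<dots> = (SUP K \<in> {K. K \<subseteq> A \<and> compact K}. emeasure D' K)" by (rule SUP_cong) (auto simp: cK)
    also have "\<dots> = emeasure D' A" by (rule inner_regular[OF s(2) fin A, symmetric])
    finally show "emeasure D A = emeasure D' A" .
  qed (simp add: s)
qed

lemma distributed_dens: "distributed M lborel X (\<lambda>x. ennreal (dens x))"
  unfolding distributed_def using law_dens by (simp cong: distr_cong)

lemma integrable_dens: "integrable lborel dens"
proof -
  interpret D: prob_space "density lborel (\<lambda>x. ennreal (dens x))" unfolding law_dens[symmetric] by (rule prob_space_distr) simp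
  have "(\<integral>\<^sup>+x. ennreal (dens x) \<partial>lborel) = 1"
    using D.emeasure_space_1 by (simp add: emeasure_density)
  then show ?thesis using dens_nonneg by (intro integrableI_bounded) auto
qed

lemma expectation_dens:
  assumes "bounded_borel B f"
  shows "(\<integral>\<omega>. f (X \<omega>) \<partial>M) = (\<integral>y. dens y * f y \<partial>lborel)"
proof -
  note [measurable] = bounded_borelD(1)[OF assms]
  have "(\<integral>\<omega>. f (X \<omega>) \<partial>M) = (\<integral>y. f y \<partial>distr M borel X)" by (rule integral_distr[symmetric]) measurable
  also have "\<dots> = (\<integral>y. dens y * f y \<partial>lborel)"
    unfolding law_dens using dens_nonneg by (subst integral_density) auto
  finally show ?thesis .
qed

end

section \<open>Integral bounds for differences and Hoelder continuity of the density\<close>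

lemma integrable_fdiff_funpow:
  fixes f :: "'a::euclidean_space \<Rightarrow> 'b::{banach, second_countable_topology}"
  assumes "integrable lborel f"
  shows "integrable lborel ((fdiff h ^^ n) f)"
proof (induction n)
  case (Suc n)
  have "integrable lborel (\<lambda>x. (fdiff h ^^ n) f (x + h) - (fdiff h ^^ n) f x)"
    using lborel_integrable_shift[OF Suc, of h] Suc by (intro Bochner_Integration.integrable_diff) (simp_all add: add.commute)
  then show ?case unfolding fdiff_funpow_Suc(1) fdiff_def[of h "(fdiff h ^^ n) f"] .
qed (use assms in simp)

lemma integrable_bounded_mult:
  fixes f g :: "'a::euclidean_space \<Rightarrow> real"
  assumes "bounded_borel B f" "integrable lborel g"
  shows "integrable lborel (\<lambda>x. f x * g x)"
proof (rule Bochner_Integration.integrable_bound[OF integrable_mult_right[OF assms(2), of B]])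
  note [measurable] = bounded_borelD(1)[OF assms(1)]
  have [measurable]: "g \<in> borel_measurable borel" using assms(2) by auto
  show "(\<lambda>x. f x * g x) \<in> borel_measurable lborel" by measurable
  show "AE x in lborel. norm (f x * g x) \<le> norm (B * g x)"
    using bounded_borelD(2,3)[OF assms(1)] by (intro AE_I2) (auto simp: abs_mult intro!: mult_right_mono)
qed

text \<open>Summation by parts, from translation invariance of Lebesgue measure.\<close>

lemma fdiff_adjoint:
  fixes f g :: "'a::euclidean_space \<Rightarrow> real"
  assumes "bounded_borel B f" "integrable lborel g"
  shows "(\<integral>x. f x * (fdiff h ^^ n) g x \<partial>lborel) = (\<integral>x. (fdiff (- h) ^^ n) f x * g x \<partial>lborel)"
  using assms
proof (induction n arbitrary: f g B)
  case (Suc n)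
  define k where "k = (fdiff h ^^ n) g"
  have k: "integrable lborel k" unfolding k_def by (rule integrable_fdiff_funpow[OF Suc.prems(2)])
  have i: "integrable lborel (\<lambda>x. f x * k x)" by (rule integrable_bounded_mult[OF Suc.prems(1) k])
  have i1: "integrable lborel (\<lambda>x. f x * k (x + h))"
    using integrable_bounded_mult[OF Suc.prems(1) lborel_integrable_shift[OF k, of h]] by (simp add: add.commute)
  have i2: "integrable lborel (\<lambda>x. f (x + (- h)) * k x)"
    by (rule integrable_bounded_mult[OF bounded_borel_shift[OF Suc.prems(1)] k])
  have "(\<integral>x. f x * (fdiff h ^^ Suc n) g x \<partial>lborel) = (\<integral>x. f x * k (x + h) - f x * k x \<partial>lborel)"
    by (simp add: k_def fdiff_def right_diff_distrib)
  also have "\<dots> = (\<integral>x. f x * k (x + h) \<partial>lborel) - (\<integral>x. f x * k x \<partial>lborel)" by (rule Bochner_Integration.integral_diff[OF i1 i])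
  also have "(\<integral>x. f x * k (x + h) \<partial>lborel) = (\<integral>x. f (x + (- h)) * k x \<partial>lborel)"
    using lborel_integral_shift[of "\<lambda>x. f (x + (- h)) * k x" h] by (simp add: add.commute)
  also have "(\<integral>x. f (x + (- h)) * k x \<partial>lborel) - (\<integral>x. f x * k x \<partial>lborel) = (\<integral>x. fdiff (- h) f x * k x \<partial>lborel)"
    by (subst Bochner_Integration.integral_diff[OF i2 i, symmetric]) (simp add: fdiff_def left_diff_distrib)
  also have "\<dots> = (\<integral>x. (fdiff (- h) ^^ n) (fdiff (- h) f) x * g x \<partial>lborel)"
    unfolding k_def by (rule Suc.IH[OF bounded_borel_fdiff[OF Suc.prems(1)] Suc.prems(2)])
  finally show ?case unfolding fdiff_funpow_Suc(2)[symmetric] .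
qed simp

text \<open>The L^1 norm is the pairing with the sign of the difference. That sign is a test
  function bounded by 1, and moving the differences onto it leads back to the assumed bound on
  expectations.\<close>

lemma (in smooth_variable) dens_L1_differences:
  "\<exists>K\<ge>0. \<forall>h. (\<integral>x. \<bar>(fdiff h ^^ n) dens x\<bar> \<partial>lborel) \<le> K * sqrt (norm h) ^ n"
proof -
  obtain K where K: "0 \<le> K" "\<And>h B \<phi>. bounded_borel B \<phi> \<Longrightarrow> \<bar>\<integral>\<omega>. (fdiff h ^^ n) \<phi> (X \<omega>) \<partial>M\<bar> \<le> K * B * sqrt (norm h) ^ n"
    using differences[of n] by blast
  have "(\<integral>x. \<bar>(fdiff h ^^ n) dens x\<bar> \<partial>lborel) \<le> K * sqrt (norm h) ^ n" for h
  proof -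
    define \<phi> where "\<phi> = (\<lambda>x. sgn ((fdiff h ^^ n) dens x))"
    have [measurable]: "(fdiff h ^^ n) dens \<in> borel_measurable borel"
      using integrable_fdiff_funpow[OF integrable_dens, of n h] by auto
    have \<phi>: "bounded_borel 1 \<phi>"
    proof -
      have "\<phi> \<in> borel_measurable borel" unfolding \<phi>_def by measurable
      then show ?thesis unfolding bounded_borel_def by (auto simp: \<phi>_def sgn_real_def)
    qed
    have "(\<integral>x. \<bar>(fdiff h ^^ n) dens x\<bar> \<partial>lborel) = (\<integral>x. \<phi> x * (fdiff h ^^ n) dens x \<partial>lborel)"
      unfolding \<phi>_def by (intro Bochner_Integration.integral_cong refl) (simp add: sgn_mult_self_eq abs_sgn mult.commute)
    also have "\<dots> = (\<integral>x. (fdiff (- h) ^^ n) \<phi> x * dens x \<partial>lborel)"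
      by (rule fdiff_adjoint[OF \<phi> integrable_dens])
    also have "\<dots> = (\<integral>\<omega>. (fdiff (- h) ^^ n) \<phi> (X \<omega>) \<partial>M)"
      unfolding expectation_dens[OF bounded_borel_fdiff_funpow[OF \<phi>]] by (simp add: mult.commute)
    also have "\<dots> \<le> K * sqrt (norm h) ^ n" using K(2)[OF \<phi>, of "- h"] by simp
    finally show ?thesis .
  qed
  then show ?thesis using K(1) by blast
qed

lemma frechet_derivative_Re:
  assumes "(f has_derivative f') (at x)"
  shows "frechet_derivative (\<lambda>x. Re (f x)) (at x) = (\<lambda>v. Re (f' v))"
  using frechet_derivative_at[OF has_derivative_Re[OF assms]] by simp

text \<open>The Lipschitz bound serves at distances up to 1, the uniform bound beyond.\<close>

lemma bounded_lipschitz_holder: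
  fixes f :: "'a::real_normed_vector \<Rightarrow> real"
  assumes b: "\<And>x. \<bar>f x\<bar> \<le> B" and L: "\<And>x y. \<bar>f x - f y\<bar> \<le> L * norm (x - y)" and \<gamma>: "0 < \<gamma>" "\<gamma> < 1"
  shows "\<bar>f x - f y\<bar> \<le> (2 * B + \<bar>L\<bar>) * norm (x - y) powr \<gamma>"
proof (cases "x = y")
  case False
  then have n: "0 < norm (x - y)" by simp
  have B: "0 \<le> B" using order_trans[OF abs_ge_zero b] .
  show ?thesis
  proof (cases "norm (x - y) \<le> 1")
    case True
    have "norm (x - y) powr 1 \<le> norm (x - y) powr \<gamma>" using True \<gamma> n by (intro powr_mono') auto
    then have "\<bar>L\<bar> * norm (x - y) \<le> \<bar>L\<bar> * norm (x - y) powr \<gamma>" using n by (intro mult_left_mono) auto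
    moreover have "L * norm (x - y) \<le> \<bar>L\<bar> * norm (x - y)" by (intro mult_right_mono) auto
    moreover have "\<bar>L\<bar> * norm (x - y) powr \<gamma> \<le> (2 * B + \<bar>L\<bar>) * norm (x - y) powr \<gamma>" using B by (intro mult_right_mono) auto
    ultimately show ?thesis using L[of x y] by linarith
  next
    case False
    have "\<bar>f x - f y\<bar> \<le> 2 * B * 1" using abs_triangle_ineq4[of "f x" "f y"] b[of x] b[of y] by linarith
    also have "\<dots> \<le> (2 * B + \<bar>L\<bar>) * norm (x - y) powr \<gamma>"
      using False \<gamma> B by (intro mult_mono ge_one_powr_ge_zero) auto
    finally show ?thesis .
  qed
qed simp

lemma fourier_lipschitz:
  fixes x y :: "'a::euclidean_space"
  assumes "rapid a"
  shows "norm (fourier a x - fourier a y) \<le> (\<integral>\<xi>. (1 + norm \<xi>) ^ 1 * norm (a \<xi>) \<partial>lborel) * norm (x - y)"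
proof -
  note [measurable] = rapidD(1)[OF assms]
  have i: "integrable lborel (\<lambda>\<xi>. cis (- (\<xi> \<bullet> z)) * a \<xi>)" for z by (rule integrable_cis_mult[OF rapidD(3)[OF assms]]) simp
  have "fourier a x - fourier a y = (\<integral>\<xi>. cis (- (\<xi> \<bullet> x)) * a \<xi> - cis (- (\<xi> \<bullet> y)) * a \<xi> \<partial>lborel)"
    unfolding fourier_def by (rule Bochner_Integration.integral_diff[OF i i, symmetric])
  also have "norm \<dots> \<le> (\<integral>\<xi>. norm (cis (- (\<xi> \<bullet> x)) * a \<xi> - cis (- (\<xi> \<bullet> y)) * a \<xi>) \<partial>lborel)" by (rule integral_norm_bound)
  also have "\<dots> \<le> (\<integral>\<xi>. ((1 + norm \<xi>) ^ 1 * norm (a \<xi>)) * norm (x - y) \<partial>lborel)"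
  proof (rule integral_mono)
    show "integrable lborel (\<lambda>\<xi>. norm (cis (- (\<xi> \<bullet> x)) * a \<xi> - cis (- (\<xi> \<bullet> y)) * a \<xi>))"
      by (intro integrable_norm Bochner_Integration.integrable_diff i)
    show "integrable lborel (\<lambda>\<xi>. ((1 + norm \<xi>) ^ 1 * norm (a \<xi>)) * norm (x - y))" by (intro integrable_mult_left rapidD(2)[OF assms])
    fix \<xi> :: 'a
    have "cis (- (\<xi> \<bullet> x)) = cis (- (\<xi> \<bullet> y)) * cis (- (\<xi> \<bullet> (x - y)))" by (simp add: cis_mult inner_diff_right)
    then have "cis (- (\<xi> \<bullet> x)) * a \<xi> - cis (- (\<xi> \<bullet> y)) * a \<xi> = cis (- (\<xi> \<bullet> y)) * (cis (- (\<xi> \<bullet> (x - y))) - 1) * a \<xi>" by (simp add: algebra_simps)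
    then have "norm (cis (- (\<xi> \<bullet> x)) * a \<xi> - cis (- (\<xi> \<bullet> y)) * a \<xi>) = norm (cis (- (\<xi> \<bullet> (x - y))) - 1) * norm (a \<xi>)" by (simp add: norm_mult)
    also have "\<dots> \<le> ((1 + norm \<xi>) * norm (x - y)) * norm (a \<xi>)"
    proof (rule mult_right_mono)
      have "norm (cis (- (\<xi> \<bullet> (x - y))) - 1) \<le> \<bar>\<xi> \<bullet> (x - y)\<bar>" using cis_bounds(1)[of "- (\<xi> \<bullet> (x - y))"] by simp
      also have "\<dots> \<le> (1 + norm \<xi>) * norm (x - y)" by (rule order_trans[OF Cauchy_Schwarz_ineq2]) (simp add: mult_right_mono)
      finally show "norm (cis (- (\<xi> \<bullet> (x - y))) - 1) \<le> (1 + norm \<xi>) * norm (x - y)" .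
    qed simp
    finally show "norm (cis (- (\<xi> \<bullet> x)) * a \<xi> - cis (- (\<xi> \<bullet> y)) * a \<xi>) \<le> ((1 + norm \<xi>) ^ 1 * norm (a \<xi>)) * norm (x - y)"
      by (simp add: mult_ac)
  qed
  finally show ?thesis by simp
qed

text \<open>As \<open>\<lfloor>1 + \<gamma>\<rfloor>\<close> is 1, only first partial derivatives
  occur. They are again Fourier transforms of rapid functions, hence bounded and Lipschitz.\<close>

lemma Re_fourier_holder_space:
  fixes a :: "'a::euclidean_space \<Rightarrow> complex"
  assumes a: "rapid a" and \<gamma>: "0 < \<gamma>" "\<gamma> < 1"
  shows "(\<lambda>x. Re (fourier a x)) \<in> holder_space (1 + \<gamma>)"
proof -
  define p where "p = (\<lambda>x. Re (fourier a x))"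
  define a' where "a' = (\<lambda>v \<xi>. - \<i> * complex_of_real (\<xi> \<bullet> v) * a \<xi>)"
  have a': "rapid (a' v)" for v unfolding a'_def by (rule rapid_coord[OF a])
  have fl: "\<lfloor>1 + \<gamma>\<rfloor> = 1" using \<gamma> by linarith
  have d: "(p has_derivative (\<lambda>v. Re (fourier (a' v) x))) (at x)" for x
    unfolding p_def a'_def by (rule has_derivative_Re[OF fourier_has_derivative[OF a]])
  have dv: "frechet_derivative p (at x) v = Re (fourier (a' v) x)" for x v
    using frechet_derivative_at[OF d] by metis
  have re: "\<bar>Re (fourier c x)\<bar> \<le> (\<integral>\<xi>. norm (c \<xi>) \<partial>lborel)" for c and x :: 'a
    by (rule order_trans[OF abs_Re_le_cmod fourier_norm_le])
  have reL: "\<bar>Re (fourier c x) - Re (fourier c y)\<bar> \<le> (\<integral>\<xi>. (1 + norm \<xi>) ^ 1 * norm (c \<xi>) \<partial>lborel) * norm (x - y)" if "rapid c" for c and x y :: 'a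
    using order_trans[OF abs_Re_le_cmod fourier_lipschitz[OF that]] by simp
  have "p \<in> holder_space (1 + \<gamma>)"
    unfolding holder_space_def fl
  proof (intro CollectI conjI allI impI)
    show "differentiable_upto (nat 1) p"
      unfolding differentiable_upto_def using d by (auto simp: differentiable_def)
  next
    fix vs :: "'a list" assume vs: "set vs \<subseteq> Basis \<and> length vs \<le> nat 1"
    show "bounded (range (iter_deriv vs p))"
    proof (cases vs)
      case Nil
      then show ?thesis unfolding bounded_iff using re[of a] by (auto simp: p_def)
    next
      case (Cons v vs')
      then have "iter_deriv vs p = (\<lambda>x. Re (fourier (a' v) x))" using vs dv by auto
      then show ?thesis unfolding bounded_iff using re[of "a' v"] by auto
    qed
  next
    fix vs :: "'a list" assume vs: "set vs \<subseteq> Basis \<and> length vs = nat 1"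
    then obtain v where v: "vs = [v]" by (auto simp: length_Suc_conv)
    have eq: "iter_deriv vs p = (\<lambda>x. Re (fourier (a' v) x))" unfolding v using dv by auto
    show "\<exists>C. \<forall>x y. norm (iter_deriv vs p x - iter_deriv vs p y) \<le> C * norm (x - y) powr (1 + \<gamma> - of_int 1)"
      unfolding eq using bounded_lipschitz_holder[OF re reL[OF a'] \<gamma>, of v] by auto
  qed
  then show ?thesis unfolding p_def .
qed

section \<open>Besov regularity\<close>

lemma fdiff_mult:
  fixes u f :: "'a::real_vector \<Rightarrow> complex"
  shows "fdiff h (\<lambda>x. u x * f x) = (\<lambda>x. fdiff h u x * f (x + h) + u x * fdiff h f x)"
  by (simp add: fdiff_def fun_eq_iff algebra_simps)

lemma fdiff_funpow_add: "(fdiff h ^^ m) (\<lambda>x. f x + g x) x = (fdiff h ^^ m) f x + (fdiff h ^^ m) g x"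
  by (induction m arbitrary: x) (simp_all add: fdiff_def)

text \<open>Iterated Leibniz rule: each difference falls either on \<open>u\<close> or on
  \<open>f\<close> and supplies a factor \<open>r\<close> in both cases, and there are
  \<open>2 ^ n\<close> ways to distribute them.\<close>

lemma fdiff_mult_L1:
  fixes u f :: "'a::euclidean_space \<Rightarrow> complex"
  assumes [measurable]: "u \<in> borel_measurable borel" and f: "integrable lborel f"
    and u: "\<And>j x. j \<le> n \<Longrightarrow> norm ((fdiff h ^^ j) u x) \<le> U * r ^ j"
    and fr: "\<And>j. j \<le> n \<Longrightarrow> (\<integral>x. norm ((fdiff h ^^ j) f x) \<partial>lborel) \<le> V * r ^ j"
  shows "(\<integral>x. norm ((fdiff h ^^ n) (\<lambda>x. u x * f x) x) \<partial>lborel) \<le> 2 ^ n * (U * V) * r ^ n"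
  using assms
proof (induction n arbitrary: u f U V)
  case 0
  have u: "norm (u x) \<le> U" for x using "0.prems"(3)[of 0] by simp
  have U: "0 \<le> U" using u[of 0] norm_ge_zero order_trans by blast
  have "(\<integral>x. norm (u x * f x) \<partial>lborel) \<le> (\<integral>x. U * norm (f x) \<partial>lborel)"
    using u U "0.prems"(2)
    by (intro Bochner_Integration.integral_mono' integrable_mult_right integrable_norm)
       (auto simp: norm_mult intro!: mult_right_mono)
  also have "\<dots> \<le> U * V" using "0.prems"(4)[of 0] U by (simp add: mult_left_mono)
  finally show ?case by simp
next
  case (Suc n)
  note [measurable] = Suc.prems(1)
  have um: "fdiff h u \<in> borel_measurable borel" unfolding fdiff_def by measurable
  have fs: "integrable lborel (\<lambda>x. f (x + h))"
    using lborel_integrable_shift[OF Suc.prems(2), of h] by (simp add: add.commute)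
  have fd: "integrable lborel (fdiff h f)"
    using integrable_fdiff_funpow[OF Suc.prems(2), where h=h and n=1] by simp
  have u0: "norm (u x) \<le> U" for x using Suc.prems(3)[of 0] by simp
  have u1: "norm (fdiff h u x) \<le> U * r" for x using Suc.prems(3)[of 1] by simp
  have i1: "integrable lborel (\<lambda>x. fdiff h u x * f (x + h))"
    by (rule Bochner_Integration.integrable_bound[OF integrable_mult_right[OF integrable_norm[OF fs], of "\<bar>U * r\<bar>"]])
       (use um fs u1 in \<open>auto intro!: AE_I2 mult_right_mono order_trans[OF u1 abs_ge_self] simp: norm_mult abs_mult simp del: abs_mult\<close>)
  have i2: "integrable lborel (\<lambda>x. u x * fdiff h f x)"
    by (rule Bochner_Integration.integrable_bound[OF integrable_mult_right[OF integrable_norm[OF fd], of "\<bar>U\<bar>"]])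
       (use fd u0 in \<open>auto intro!: AE_I2 mult_right_mono order_trans[OF u0 abs_ge_self] simp: norm_mult\<close>)
  have 1: "(\<integral>x. norm ((fdiff h ^^ n) (\<lambda>x. fdiff h u x * f (x + h)) x) \<partial>lborel) \<le> 2 ^ n * ((U * r) * V) * r ^ n"
  proof (rule Suc.IH[OF um fs])
    fix j x assume "j \<le> n"
    then show "norm ((fdiff h ^^ j) (fdiff h u) x) \<le> U * r * r ^ j"
      using Suc.prems(3)[of "Suc j" x] by (simp add: fdiff_funpow_Suc(2) mult.assoc del: funpow.simps)
  next
    fix j assume j: "j \<le> n"
    have "(\<integral>x. norm ((fdiff h ^^ j) (\<lambda>x. f (x + h)) x) \<partial>lborel) = (\<integral>x. norm ((fdiff h ^^ j) f (h + x)) \<partial>lborel)"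
      by (simp add: fdiff_funpow_shift add.commute)
    also have "\<dots> = (\<integral>x. norm ((fdiff h ^^ j) f x) \<partial>lborel)"
      by (rule lborel_integral_shift)
    finally show "(\<integral>x. norm ((fdiff h ^^ j) (\<lambda>x. f (x + h)) x) \<partial>lborel) \<le> V * r ^ j"
      using Suc.prems(4)[of j] j by simp
  qed
  have 2: "(\<integral>x. norm ((fdiff h ^^ n) (\<lambda>x. u x * fdiff h f x) x) \<partial>lborel) \<le> 2 ^ n * (U * (V * r)) * r ^ n"
  proof (rule Suc.IH[OF Suc.prems(1) fd])
    fix j x assume "j \<le> n"
    then show "norm ((fdiff h ^^ j) u x) \<le> U * r ^ j" using Suc.prems(3)[of j x] by simp
  next
    fix j assume "j \<le> n"
    then show "(\<integral>x. norm ((fdiff h ^^ j) (fdiff h f) x) \<partial>lborel) \<le> V * r * r ^ j"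
      using Suc.prems(4)[of "Suc j"] by (simp add: fdiff_funpow_Suc(2) mult.assoc del: funpow.simps)
  qed
  have "(\<integral>x. norm ((fdiff h ^^ Suc n) (\<lambda>x. u x * f x) x) \<partial>lborel)
     \<le> (\<integral>x. norm ((fdiff h ^^ n) (\<lambda>x. fdiff h u x * f (x + h)) x) + norm ((fdiff h ^^ n) (\<lambda>x. u x * fdiff h f x) x) \<partial>lborel)"
    unfolding fdiff_funpow_Suc(2) fdiff_mult fdiff_funpow_add
    by (intro Bochner_Integration.integral_mono' Bochner_Integration.integrable_add integrable_norm
        integrable_fdiff_funpow i1 i2 norm_triangle_ineq) simp
  also have "\<dots> = (\<integral>x. norm ((fdiff h ^^ n) (\<lambda>x. fdiff h u x * f (x + h)) x) \<partial>lborel) + (\<integral>x. norm ((fdiff h ^^ n) (\<lambda>x. u x * fdiff h f x) x) \<partial>lborel)"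
    by (intro Bochner_Integration.integral_add integrable_norm integrable_fdiff_funpow i1 i2)
  also have "\<dots> \<le> 2 ^ Suc n * (U * V) * r ^ Suc n" using 1 2 by (simp add: algebra_simps)
  finally show ?case .
qed

lemma fdiff_funpow_cis:
  "(fdiff h ^^ j) (\<lambda>x. cis (x \<bullet> z)) = (\<lambda>x. (cis (h \<bullet> z) - 1) ^ j * cis (x \<bullet> z))"
  by (induction j) (simp_all add: fdiff_def fun_eq_iff inner_add_left cis_mult[symmetric] algebra_simps)

text \<open>The Gaussian is an average of waves with frequency \<open>sqrt t *\<^sub>R z\<close>
  over standard Gaussian \<open>z\<close>. Each difference multiplies such a wave by at most
  \<open>norm h * norm z\<close> when \<open>t \<le> 1\<close>, so the constant is a Gaussian moment
  and is uniform in \<open>t\<close>.\<close>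

lemma fdiff_gaussian_bound:
  "\<exists>C\<ge>0. \<forall>t h. \<forall>x::'a::euclidean_space. 0 < t \<longrightarrow> t \<le> 1 \<longrightarrow>
     norm ((fdiff h ^^ j) (\<lambda>x. complex_of_real (exp (- t * (norm x)\<^sup>2 / 2))) x) \<le> C * norm h ^ j"
proof (intro exI[of _ "\<integral>(z::'a). norm z ^ j \<partial>gauss 1"] conjI allI impI)
  fix t :: real and h x :: 'a
  assume t: "0 < t" "t \<le> 1"
  define G where "G = (\<lambda>z::'a. complex_of_real (gauss_density 1 z))"
  have Gi: "integrable lborel G" unfolding G_def by (intro integrable_of_real integrable_gauss_density) simp
  have [measurable]: "G \<in> borel_measurable borel" unfolding G_def by measurable
  have i: "integrable lborel (\<lambda>z. (cis (h \<bullet> (sqrt t *\<^sub>R z)) - 1) ^ j * cis (x \<bullet> (sqrt t *\<^sub>R z)) * G z)" for j x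
    by (rule Bochner_Integration.integrable_bound[OF integrable_mult_right[OF integrable_norm[OF Gi], of "2 ^ j"]])
       (auto simp: norm_mult norm_power cis_conv_exp intro!: AE_I2 mult_right_mono power_mono
          order_trans[OF norm_triangle_ineq4])
  have e: "(\<lambda>x. complex_of_real (exp (- t * (norm x)\<^sup>2 / 2))) = (\<lambda>x. \<integral>z. cis (x \<bullet> (sqrt t *\<^sub>R z)) * G z \<partial>lborel)"
  proof
    fix x :: 'a
    show "complex_of_real (exp (- t * (norm x)\<^sup>2 / 2)) = (\<integral>z. cis (x \<bullet> (sqrt t *\<^sub>R z)) * G z \<partial>lborel)"
      using fourier_gauss_1[of "sqrt t *\<^sub>R x"] t unfolding G_def by (simp add: power_mult_distrib)
  qed
  have "(fdiff h ^^ j) (\<lambda>x. \<integral>z. cis (x \<bullet> (sqrt t *\<^sub>R z)) * G z \<partial>lborel) x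
      = (\<integral>z. (cis (h \<bullet> (sqrt t *\<^sub>R z)) - 1) ^ j * cis (x \<bullet> (sqrt t *\<^sub>R z)) * G z \<partial>lborel)" for j
  proof (induction j arbitrary: x)
    case (Suc j)
    have "(fdiff h ^^ Suc j) (\<lambda>x. \<integral>z. cis (x \<bullet> (sqrt t *\<^sub>R z)) * G z \<partial>lborel) x
       = (\<integral>z. (cis (h \<bullet> (sqrt t *\<^sub>R z)) - 1) ^ j * cis ((x + h) \<bullet> (sqrt t *\<^sub>R z)) * G z -
           (cis (h \<bullet> (sqrt t *\<^sub>R z)) - 1) ^ j * cis (x \<bullet> (sqrt t *\<^sub>R z)) * G z \<partial>lborel)"
      unfolding fdiff_funpow_Suc fdiff_def[of h] Suc by (rule Bochner_Integration.integral_diff[OF i i, symmetric])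
    also have "\<dots> = (\<integral>z. (cis (h \<bullet> (sqrt t *\<^sub>R z)) - 1) ^ Suc j * cis (x \<bullet> (sqrt t *\<^sub>R z)) * G z \<partial>lborel)"
      by (intro Bochner_Integration.integral_cong refl)
         (simp only: inner_add_left cis_mult[symmetric] power_Suc algebra_simps mult_1_left mult_1_right)
    finally show ?case .
  qed simp
  then have "norm ((fdiff h ^^ j) (\<lambda>x. complex_of_real (exp (- t * (norm x)\<^sup>2 / 2))) x)
     = norm (\<integral>z. (cis (h \<bullet> (sqrt t *\<^sub>R z)) - 1) ^ j * cis (x \<bullet> (sqrt t *\<^sub>R z)) * G z \<partial>lborel)"
    unfolding e by simp
  also have "\<dots> \<le> (\<integral>(z::'a). gauss_density 1 z * (norm h ^ j * norm z ^ j) \<partial>lborel)"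
  proof (rule order_trans[OF integral_norm_bound], rule Bochner_Integration.integral_mono')
    show "integrable lborel (\<lambda>z::'a. gauss_density 1 z * (norm h ^ j * norm z ^ j))"
      using integrable_norm_gauss_1[where 'a='a, of j]
      by (subst integrable_gauss_iff[symmetric]) auto
    fix z :: 'a
    have "norm (cis (h \<bullet> (sqrt t *\<^sub>R z)) - 1) \<le> \<bar>h \<bullet> (sqrt t *\<^sub>R z)\<bar>" by (rule cis_bounds)
    also have "\<dots> \<le> norm h * norm (sqrt t *\<^sub>R z)" by (rule Cauchy_Schwarz_ineq2)
    also have "\<dots> \<le> norm h * norm z" using t by (auto intro!: mult_left_mono mult_left_le_one_le)
    finally have "norm (cis (h \<bullet> (sqrt t *\<^sub>R z)) - 1) ^ j \<le> (norm h * norm z) ^ j" by (intro power_mono) auto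
    then have "gauss_density 1 z * norm (cis (h \<bullet> (sqrt t *\<^sub>R z)) - 1) ^ j \<le> gauss_density 1 z * (norm h * norm z) ^ j"
      by (intro mult_left_mono) auto
    then show "norm ((cis (h \<bullet> (sqrt t *\<^sub>R z)) - 1) ^ j * cis (x \<bullet> (sqrt t *\<^sub>R z)) * G z) \<le> gauss_density 1 z * (norm h ^ j * norm z ^ j)"
      unfolding G_def by (simp add: norm_mult norm_power power_mult_distrib mult_ac)
  qed simp
  also have "\<dots> = (\<integral>(z::'a). norm h ^ j * norm z ^ j \<partial>gauss 1)"
    by (rule integral_gauss[symmetric]) simp
  also have "\<dots> = (\<integral>(z::'a). norm z ^ j \<partial>gauss 1) * norm h ^ j" by simp
  finally show "norm ((fdiff h ^^ j) (\<lambda>x. complex_of_real (exp (- t * (norm x)\<^sup>2 / 2))) x) \<le> (\<integral>(z::'a). norm z ^ j \<partial>gauss 1) * norm h ^ j" .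
qed simp

section \<open>Convolutions and Fourier multipliers\<close>

definition conv :: "('a::euclidean_space \<Rightarrow> complex) \<Rightarrow> ('a \<Rightarrow> complex) \<Rightarrow> 'a \<Rightarrow> complex" where
  "conv f k y = (\<integral>x. f x * k (y - x) \<partial>lborel)"

lemma integrable_mult_bounded:
  fixes f k :: "'a::euclidean_space \<Rightarrow> complex"
  assumes "integrable lborel f" "k \<in> borel_measurable borel" "\<And>x. norm (k x) \<le> B"
  shows "integrable lborel (\<lambda>x. f x * k x)"
proof (rule Bochner_Integration.integrable_bound[OF integrable_mult_right[OF integrable_norm[OF assms(1)], of "\<bar>B\<bar>"]])
  show "(\<lambda>x. f x * k x) \<in> borel_measurable lborel" using assms(1,2) by auto
  show "AE x in lborel. norm (f x * k x) \<le> norm (\<bar>B\<bar> * norm (f x))"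
    using order_trans[OF assms(3) abs_ge_self] by (intro AE_I2) (simp add: norm_mult mult.commute[of "\<bar>B\<bar>"] mult_left_mono)
qed

lemma conv_integrable:
  fixes f k :: "'a::euclidean_space \<Rightarrow> complex"
  assumes "integrable lborel f" "k \<in> borel_measurable borel" "\<And>x. norm (k x) \<le> B"
  shows "integrable lborel (\<lambda>x. f x * k (y - x))"
  using assms by (intro integrable_mult_bounded[where B=B]) auto

lemma conv_measurable:
  assumes [measurable]: "f \<in> borel_measurable borel" "k \<in> borel_measurable borel"
  shows "conv f k \<in> borel_measurable borel"
proof -
  have "(\<lambda>y. \<integral>x. f x * k (y - x) \<partial>lborel) \<in> borel_measurable borel"
    by (rule lborel.borel_measurable_lebesgue_integral) (simp add: case_prod_beta')
  then show ?thesis unfolding conv_def[abs_def] .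
qed

lemma conv_bounded:
  fixes f k :: "'a::euclidean_space \<Rightarrow> complex"
  assumes f: "integrable lborel f" and k: "k \<in> borel_measurable borel" "\<And>x. norm (k x) \<le> B"
  shows "norm (conv f k y) \<le> B * (\<integral>x. norm (f x) \<partial>lborel)"
proof -
  have "norm (conv f k y) \<le> (\<integral>x. norm (f x * k (y - x)) \<partial>lborel)"
    unfolding conv_def by (rule integral_norm_bound)
  also have "\<dots> \<le> (\<integral>x. B * norm (f x) \<partial>lborel)"
    using f k(2) order_trans[OF norm_ge_zero k(2)]
    by (intro Bochner_Integration.integral_mono') (auto simp: norm_mult mult.commute[of B] intro: mult_left_mono)
  finally show ?thesis by simp
qed

lemma conv_L1:
  fixes f k :: "'a::euclidean_space \<Rightarrow> complex"
  assumes f: "integrable lborel f" and k: "integrable lborel k"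
  shows "(\<integral>\<^sup>+y. ennreal (norm (conv f k y)) \<partial>lborel) \<le> ennreal ((\<integral>x. norm (f x) \<partial>lborel) * (\<integral>x. norm (k x) \<partial>lborel))"
proof -
  have [measurable]: "f \<in> borel_measurable borel" "k \<in> borel_measurable borel" using f k by auto
  have "(\<integral>\<^sup>+y. ennreal (norm (conv f k y)) \<partial>lborel) \<le> (\<integral>\<^sup>+y. \<integral>\<^sup>+x. ennreal (norm (f x)) * ennreal (norm (k (y - x))) \<partial>lborel \<partial>lborel)"
  proof (rule nn_integral_mono)
    fix y
    have "ennreal (norm (conv f k y)) \<le> (\<integral>\<^sup>+x. ennreal (norm (f x * k (y - x))) \<partial>lborel)"
      unfolding conv_def by (cases "integrable lborel (\<lambda>x. f x * k (y - x))") (simp_all add: integral_norm_bound_ennreal not_integrable_integral_eq)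
    then show "ennreal (norm (conv f k y)) \<le> (\<integral>\<^sup>+x. ennreal (norm (f x)) * ennreal (norm (k (y - x))) \<partial>lborel)"
      by (simp add: norm_mult ennreal_mult)
  qed
  also have "\<dots> = (\<integral>\<^sup>+x. \<integral>\<^sup>+y. ennreal (norm (f x)) * ennreal (norm (k (y - x))) \<partial>lborel \<partial>lborel)"
    by (rule lborel_pair.Fubini') simp
  also have "\<dots> = (\<integral>\<^sup>+x. ennreal (norm (f x)) * (\<integral>\<^sup>+y. ennreal (norm (k (- x + y))) \<partial>lborel) \<partial>lborel)"
    by (intro nn_integral_cong) (simp add: nn_integral_cmult)
  also have "\<dots> = (\<integral>\<^sup>+x. ennreal (norm (f x)) * (\<integral>\<^sup>+y. ennreal (norm (k y)) \<partial>lborel) \<partial>lborel)"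
    by (intro nn_integral_cong) (subst nn_integral_lborel_shift[of "\<lambda>y. ennreal (norm (k y))"], simp_all)
  also have "\<dots> = (\<integral>\<^sup>+x. ennreal (norm (f x)) \<partial>lborel) * (\<integral>\<^sup>+y. ennreal (norm (k y)) \<partial>lborel)"
    by (rule nn_integral_multc) simp
  also have "\<dots> = ennreal ((\<integral>x. norm (f x) \<partial>lborel) * (\<integral>x. norm (k x) \<partial>lborel))"
    using f k by (simp add: nn_integral_eq_integral ennreal_mult)
  finally show ?thesis .
qed

text \<open>Translating the kernel and translating the function have the same effect on a
  convolution.\<close>

lemma conv_fdiff:
  fixes f k :: "'a::euclidean_space \<Rightarrow> complex"
  assumes f: "integrable lborel f" and k: "k \<in> borel_measurable borel" "\<And>x. norm (k x) \<le> B"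
  shows "conv f ((fdiff h ^^ n) k) y = conv ((fdiff h ^^ n) f) k y"
  using f
proof (induction n arbitrary: f y)
  case (Suc n)
  have fi: "integrable lborel ((fdiff h ^^ n) f)" by (rule integrable_fdiff_funpow[OF Suc.prems])
  define g where "g = (fdiff h ^^ n) f"
  have km: "(fdiff h ^^ n) k \<in> borel_measurable borel"
    using k(1) by (induction n) (auto simp: fdiff_def)
  have kb: "norm ((fdiff h ^^ n) k x) \<le> 2 ^ n * B" for x
  proof (induction n arbitrary: x)
    case (Suc n)
    have "norm ((fdiff h ^^ n) k (x + h) - (fdiff h ^^ n) k x) \<le> 2 ^ n * B + 2 ^ n * B"
      by (rule order_trans[OF norm_triangle_ineq4 add_mono[OF Suc Suc]])
    then show ?case unfolding fdiff_funpow_Suc(1) fdiff_def[of h "(fdiff h ^^ n) k"] by (simp add: mult_ac)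
  qed (use k in simp)
  have "conv f ((fdiff h ^^ Suc n) k) y = (\<integral>x. f x * (fdiff h ^^ n) k ((y + h) - x) - f x * (fdiff h ^^ n) k (y - x) \<partial>lborel)"
    unfolding conv_def fdiff_funpow_Suc(1) fdiff_def[of h "(fdiff h ^^ n) k"] by (simp add: algebra_simps)
  also have "\<dots> = conv f ((fdiff h ^^ n) k) (y + h) - conv f ((fdiff h ^^ n) k) y"
    unfolding conv_def by (intro Bochner_Integration.integral_diff conv_integrable[OF Suc.prems km kb])
  also have "\<dots> = conv g k (y + h) - conv g k y"
    unfolding g_def using Suc.IH[OF Suc.prems] by simp
  also have "conv g k (y + h) = (\<integral>x. g (h + x) * k (y + h - (h + x)) \<partial>lborel)"
    unfolding conv_def by (rule lborel_integral_shift[symmetric])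
  also have "\<dots> = (\<integral>x. g (x + h) * k (y - x) \<partial>lborel)"
    by (simp add: algebra_simps)
  also have "\<dots> - conv g k y = (\<integral>x. g (x + h) * k (y - x) - g x * k (y - x) \<partial>lborel)"
    unfolding conv_def using lborel_integrable_shift[OF fi, of h] fi
    by (intro Bochner_Integration.integral_diff[symmetric] conv_integrable[OF _ k]) (simp_all add: g_def add.commute)
  also have "\<dots> = conv ((fdiff h ^^ Suc n) f) k y"
    unfolding conv_def fdiff_funpow_Suc(1) fdiff_def[of h "(fdiff h ^^ n) f"] g_def by (simp add: algebra_simps)
  finally show ?case .
qed simp

lemma fourier_eq_inv_fourier:
  fixes f :: "'a::euclidean_space \<Rightarrow> complex"
  shows "fourier f x = of_real ((2 * pi) ^ DIM('a)) * inv_fourier f (- x)"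
  unfolding fourier_def inv_fourier_def by (simp add: inner_commute)

lemma fourier_measurable:
  fixes f :: "'a::euclidean_space \<Rightarrow> complex"
  assumes "f \<in> borel_measurable borel"
  shows "fourier f \<in> borel_measurable borel"
  unfolding fourier_eq_inv_fourier[abs_def] using inv_fourier_measurable[OF assms] by measurable

text \<open>The adjoint form of the multiplier: a distribution meets its test function after an
  inverse transform, a multiplication and a transform, and Fubini turns these into one integral
  against the kernel \<open>inv_fourier m\<close>.\<close>

lemma fourier_multiplier:
  fixes m g :: "'a::euclidean_space \<Rightarrow> complex"
  assumes m: "integrable lborel m" and g: "integrable lborel g"
  shows "fourier (\<lambda>\<xi>. m \<xi> * inv_fourier g \<xi>) x = (\<integral>y. g y * inv_fourier m (y - x) \<partial>lborel)"
proof -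
  let ?c = "complex_of_real ((2 * pi) ^ DIM('a))"
  have [measurable]: "m \<in> borel_measurable borel" "g \<in> borel_measurable borel" using m g by auto
  have cm[measurable]: "(\<lambda>p::'a \<times> 'a. cis (fst p \<bullet> (snd p - x))) \<in> borel_measurable (borel \<Otimes>\<^sub>M borel)"
    unfolding cis_conv_exp by measurable
  have int: "integrable (lborel \<Otimes>\<^sub>M lborel) (\<lambda>(\<xi>, y). cis (\<xi> \<bullet> (y - x)) * (m \<xi> * g y))"
  proof (rule lborel_pair.Fubini_integrable)
    show "(\<lambda>(\<xi>, y). cis (\<xi> \<bullet> (y - x)) * (m \<xi> * g y)) \<in> borel_measurable (lborel \<Otimes>\<^sub>M lborel)"
      by (simp add: case_prod_beta')
    show "integrable lborel (\<lambda>\<xi>. \<integral>y. norm (case (\<xi>, y) of (\<xi>, y) \<Rightarrow> cis (\<xi> \<bullet> (y - x)) * (m \<xi> * g y)) \<partial>lborel)"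
      using m by (simp add: norm_mult)
    show "AE \<xi> in lborel. integrable lborel (\<lambda>y. case (\<xi>, y) of (\<xi>, y) \<Rightarrow> cis (\<xi> \<bullet> (y - x)) * (m \<xi> * g y))"
      using g by (intro AE_I2) (simp add: integrable_cis_mult)
  qed
  have "fourier (\<lambda>\<xi>. m \<xi> * inv_fourier g \<xi>) x
     = (\<integral>\<xi>. \<integral>y. cis (\<xi> \<bullet> (y - x)) * (m \<xi> * g y) \<partial>lborel \<partial>lborel) / ?c"
  proof -
    have "cis (- (\<xi> \<bullet> x)) * (m \<xi> * inv_fourier g \<xi>) = (\<integral>y. cis (\<xi> \<bullet> (y - x)) * (m \<xi> * g y) \<partial>lborel) / ?c" for \<xi>
    proof -
      have eq: "cis (\<xi> \<bullet> (y - x)) * (m \<xi> * g y) = (cis (- (\<xi> \<bullet> x)) * m \<xi>) * (cis (\<xi> \<bullet> y) * g y)" for y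
      proof -
        have "cis (\<xi> \<bullet> (y - x)) = cis (- (\<xi> \<bullet> x)) * cis (\<xi> \<bullet> y)" by (simp add: cis_mult inner_diff_right)
        then show ?thesis by (simp only: mult_ac)
      qed
      show ?thesis unfolding eq integral_mult_right_zero inv_fourier_def by simp
    qed
    then show ?thesis unfolding fourier_def by simp
  qed
  also have "(\<integral>\<xi>. \<integral>y. cis (\<xi> \<bullet> (y - x)) * (m \<xi> * g y) \<partial>lborel \<partial>lborel)
    = (\<integral>y. \<integral>\<xi>. cis (\<xi> \<bullet> (y - x)) * (m \<xi> * g y) \<partial>lborel \<partial>lborel)"
    by (rule lborel_pair.Fubini_integral[OF int, symmetric])
  also have "\<dots> / ?c = (\<integral>y. g y * inv_fourier m (y - x) \<partial>lborel)"
  proof -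
    have "(\<integral>\<xi>. cis (\<xi> \<bullet> (y - x)) * (m \<xi> * g y) \<partial>lborel) / ?c = g y * inv_fourier m (y - x)" for y
    proof -
      have eq: "cis (\<xi> \<bullet> (y - x)) * (m \<xi> * g y) = g y * (cis ((y - x) \<bullet> \<xi>) * m \<xi>)" for \<xi>
        by (simp add: inner_commute mult_ac)
      show ?thesis unfolding eq integral_mult_right_zero inv_fourier_def by simp
    qed
    then show ?thesis by (simp flip: integral_divide_zero)
  qed
  finally show ?thesis .
qed

text \<open>Identifies a block of an integrable function, defined by duality, with an honest
  convolution whose L^1 norm can be estimated.\<close>

lemma represents_multiplier:
  fixes m f :: "'a::euclidean_space \<Rightarrow> complex"
  assumes m: "integrable lborel m" and f: "integrable lborel f"
  shows "represents (conv f (inv_fourier m)) (dist_inv_fourier (dist_mult m (dist_fourier (dist_of f))))"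
  unfolding represents_def
proof (intro conjI ballI)
  let ?K = "inv_fourier m"
  have fm[measurable]: "f \<in> borel_measurable borel" "m \<in> borel_measurable borel" using m f by auto
  have Km[measurable]: "?K \<in> borel_measurable borel" by (rule inv_fourier_measurable) simp
  obtain B where B: "\<And>x. norm (?K x) \<le> B" using inv_fourier_norm_le[of m] by blast
  have cm: "conv f ?K \<in> borel_measurable borel" by (rule conv_measurable) simp_all
  then show "conv f ?K \<in> borel_measurable lborel" by simp
  fix g :: "'a \<Rightarrow> complex"
  assume "g \<in> schwartz"
  then have gi: "integrable lborel g" by (rule schwartzD)
  then have [measurable]: "g \<in> borel_measurable borel" by auto
  show "integrable lborel (\<lambda>x. conv f ?K x * g x)"
    using integrable_mult_bounded[OF gi cm conv_bounded[OF f Km B]] by (simp add: mult.commute)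
  have int: "integrable (lborel \<Otimes>\<^sub>M lborel) (\<lambda>(x, y). f x * (g y * ?K (y - x)))"
  proof (rule lborel_pair.Fubini_integrable)
    show mm: "(\<lambda>(x, y). f x * (g y * ?K (y - x))) \<in> borel_measurable (lborel \<Otimes>\<^sub>M lborel)"
      by (simp add: case_prod_beta')
    have gK: "integrable lborel (\<lambda>y. g y * ?K (y - x))" for x
      by (rule integrable_mult_bounded[OF gi _ B]) measurable
    show "AE x in lborel. integrable lborel (\<lambda>y. case (x, y) of (x, y) \<Rightarrow> f x * (g y * ?K (y - x)))"
      using gK by (intro AE_I2) simp
    show "integrable lborel (\<lambda>x. \<integral>y. norm (case (x, y) of (x, y) \<Rightarrow> f x * (g y * ?K (y - x))) \<partial>lborel)"
    proof (rule Bochner_Integration.integrable_bound[OF integrable_mult_right[OF integrable_norm[OF f], of "B * (\<integral>y. norm (g y) \<partial>lborel)"]])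
      show "(\<lambda>x. \<integral>y. norm (case (x, y) of (x, y) \<Rightarrow> f x * (g y * ?K (y - x))) \<partial>lborel) \<in> borel_measurable lborel"
        using mm by (intro lborel.borel_measurable_lebesgue_integral) (simp add: case_prod_beta')
      have "(\<integral>y. norm (f x * (g y * ?K (y - x))) \<partial>lborel) \<le> B * (\<integral>y. norm (g y) \<partial>lborel) * norm (f x)" for x
      proof -
        have "(\<integral>y. norm (f x * (g y * ?K (y - x))) \<partial>lborel) \<le> (\<integral>y. (norm (f x) * B) * norm (g y) \<partial>lborel)"
          using gi B order_trans[OF norm_ge_zero B]
          by (intro Bochner_Integration.integral_mono') (auto simp: norm_mult mult.assoc mult.commute[of B] intro!: mult_left_mono)
        then show ?thesis by (simp add: mult_ac)
      qed
      then show "AE x in lborel. norm (\<integral>y. norm (case (x, y) of (x, y) \<Rightarrow> f x * (g y * ?K (y - x))) \<partial>lborel)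
         \<le> norm (B * (\<integral>y. norm (g y) \<partial>lborel) * norm (f x))"
        by (intro AE_I2) (simp add: order_trans[OF _ abs_ge_self])
    qed
  qed
  have "dist_inv_fourier (dist_mult m (dist_fourier (dist_of f))) g = (\<integral>x. f x * fourier (\<lambda>\<xi>. m \<xi> * inv_fourier g \<xi>) x \<partial>lborel)"
    by (simp add: dist_inv_fourier_def dist_mult_def dist_fourier_def dist_of_def)
  also have "\<dots> = (\<integral>x. \<integral>y. f x * (g y * ?K (y - x)) \<partial>lborel \<partial>lborel)"
    unfolding fourier_multiplier[OF m gi] by simp
  also have "\<dots> = (\<integral>y. \<integral>x. f x * (g y * ?K (y - x)) \<partial>lborel \<partial>lborel)"
    by (rule lborel_pair.Fubini_integral[OF int, symmetric])
  also have "\<dots> = (\<integral>y. conv f ?K y * g y \<partial>lborel)"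
  proof -
    have "(\<integral>x. f x * (g y * ?K (y - x)) \<partial>lborel) = conv f ?K y * g y" for y
    proof -
      have eq: "f x * (g y * ?K (y - x)) = (f x * ?K (y - x)) * g y" for x by (simp only: mult_ac)
      show ?thesis unfolding eq integral_mult_left_zero conv_def ..
    qed
    then show ?thesis by simp
  qed
  finally show "dist_inv_fourier (dist_mult m (dist_fourier (dist_of f))) g = dist_of (conv f ?K) g"
    unfolding dist_of_def .
qed

lemma inv_fourier_scale:
  fixes f :: "'a::euclidean_space \<Rightarrow> complex"
  assumes f: "f \<in> borel_measurable borel" and c: "0 < c"
  shows "inv_fourier (\<lambda>\<xi>. f (\<xi> /\<^sub>R c)) x = c ^ DIM('a) *\<^sub>R inv_fourier f (c *\<^sub>R x)"
proof -
  have m: "(\<lambda>\<xi>. cis (x \<bullet> \<xi>) * f (\<xi> /\<^sub>R c)) \<in> borel_measurable borel"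
    using f unfolding cis_conv_exp by measurable
  have "(\<integral>\<xi>. cis (x \<bullet> \<xi>) * f (\<xi> /\<^sub>R c) \<partial>lborel) = c ^ DIM('a) *\<^sub>R (\<integral>\<xi>. cis ((c *\<^sub>R x) \<bullet> \<xi>) * f \<xi> \<partial>lborel)"
    using lborel_integral_scale[OF m, of c] c by simp
  then show ?thesis unfolding inv_fourier_def by (simp add: scaleR_conv_of_real)
qed

lemma inv_fourier_modulate:
  fixes f :: "'a::euclidean_space \<Rightarrow> complex"
  shows "inv_fourier (\<lambda>\<xi>. cis (h \<bullet> \<xi>) * f \<xi>) x = inv_fourier f (x + h)"
  unfolding inv_fourier_def by (simp add: inner_add_left cis_mult[symmetric] mult.assoc)

lemma integrable_wave_mult:
  fixes f :: "'a::euclidean_space \<Rightarrow> complex"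
  assumes "integrable lborel f"
  shows "integrable lborel (\<lambda>\<xi>. (cis (h \<bullet> \<xi>) - 1) ^ n * f \<xi>)"
proof (induction n)
  case (Suc n)
  have "integrable lborel (\<lambda>\<xi>. cis (h \<bullet> \<xi>) * ((cis (h \<bullet> \<xi>) - 1) ^ n * f \<xi>) - (cis (h \<bullet> \<xi>) - 1) ^ n * f \<xi>)"
    using Suc by (intro Bochner_Integration.integrable_diff integrable_cis_mult) simp_all
  then show ?case by (simp add: algebra_simps)
qed (use assms in simp)

lemma inv_fourier_fdiff:
  fixes f :: "'a::euclidean_space \<Rightarrow> complex"
  assumes "integrable lborel f"
  shows "inv_fourier (\<lambda>\<xi>. (cis (h \<bullet> \<xi>) - 1) ^ n * f \<xi>) = (fdiff h ^^ n) (inv_fourier f)"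
proof (induction n)
  case (Suc n)
  note i = integrable_wave_mult[OF assms, of h n]
  have "inv_fourier (\<lambda>\<xi>. (cis (h \<bullet> \<xi>) - 1) ^ Suc n * f \<xi>)
      = inv_fourier (\<lambda>\<xi>. cis (h \<bullet> \<xi>) * ((cis (h \<bullet> \<xi>) - 1) ^ n * f \<xi>) - (cis (h \<bullet> \<xi>) - 1) ^ n * f \<xi>)"
    by (simp add: algebra_simps)
  also have "\<dots> = (\<lambda>x. inv_fourier (\<lambda>\<xi>. (cis (h \<bullet> \<xi>) - 1) ^ n * f \<xi>) (x + h) - inv_fourier (\<lambda>\<xi>. (cis (h \<bullet> \<xi>) - 1) ^ n * f \<xi>) x)"
  proof
    fix x
    show "inv_fourier (\<lambda>\<xi>. cis (h \<bullet> \<xi>) * ((cis (h \<bullet> \<xi>) - 1) ^ n * f \<xi>) - (cis (h \<bullet> \<xi>) - 1) ^ n * f \<xi>) x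
      = inv_fourier (\<lambda>\<xi>. (cis (h \<bullet> \<xi>) - 1) ^ n * f \<xi>) (x + h) - inv_fourier (\<lambda>\<xi>. (cis (h \<bullet> \<xi>) - 1) ^ n * f \<xi>) x"
      using i by (subst inv_fourier_diff) (simp_all add: integrable_cis_mult inv_fourier_modulate)
  qed
  finally show ?case unfolding Suc fdiff_funpow_Suc(1) fdiff_def[of h "(fdiff h ^^ n) (inv_fourier f)"] .
qed simp

lemma inv_fourier_sum:
  fixes f :: "'i \<Rightarrow> 'a::euclidean_space \<Rightarrow> complex"
  assumes "\<And>i. i \<in> I \<Longrightarrow> integrable lborel (f i)"
  shows "inv_fourier (\<lambda>\<xi>. \<Sum>i\<in>I. f i \<xi>) x = (\<Sum>i\<in>I. inv_fourier (f i) x)"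
proof -
  have "(\<integral>\<xi>. cis (x \<bullet> \<xi>) * (\<Sum>i\<in>I. f i \<xi>) \<partial>lborel) = (\<Sum>i\<in>I. \<integral>\<xi>. cis (x \<bullet> \<xi>) * f i \<xi> \<partial>lborel)"
    unfolding sum_distrib_left using assms
    by (intro Bochner_Integration.integral_sum integrable_cis_mult) simp_all
  then show ?thesis unfolding inv_fourier_def by (simp add: sum_divide_distrib)
qed

section \<open>Littlewood-Paley blocks dominated by sixth differences\<close>

text \<open>A sixth difference acts on a wave as the sixth power of \<open>cis \<theta> - 1\<close>.
  Recentring by three steps makes the symbol real and nonnegative, so that symbols of different
  coordinates can be added without cancellation.\<close>

lemma cis_minus_1_power_6: "- cis (- 3 * \<theta>) * (cis \<theta> - 1) ^ 6 = (2 - 2 * complex_of_real (cos \<theta>)) ^ 3"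
proof -
  have "2 * complex_of_real (cos \<theta>) = cis \<theta> + cis (- \<theta>)" by (simp add: complex_eq_iff)
  moreover have "cis (- \<theta>) * cis \<theta> = 1" by (simp add: cis_mult)
  moreover have "cis (- 3 * \<theta>) = cis (- \<theta>) ^ 3" unfolding Complex.DeMoivre by simp
  ultimately show ?thesis by algebra
qed

text \<open>Some coordinate of \<open>x\<close> is nonzero and smaller than 4 in absolute value,
  hence less than a full period, so its summand is positive while the others are
  nonnegative.\<close>

lemma lp_multiplier_nonzero:
  fixes x :: "'a::euclidean_space"
  assumes "x \<in> ball 0 4 - ball 0 1"
  shows "(\<Sum>e\<in>Basis. (2 - 2 * complex_of_real (cos (x \<bullet> e))) ^ 3) \<noteq> 0"
proof -
  have "x \<noteq> 0" using assms by auto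
  then obtain e where e: "e \<in> Basis" "x \<bullet> e \<noteq> 0" using euclidean_all_zero_iff by blast
  have "\<bar>x \<bullet> e\<bar> < 4" using assms Basis_le_norm[OF e(1), of x] by simp
  then have "cos \<bar>x \<bullet> e\<bar> < 1"
  proof -
    assume *: "\<bar>x \<bullet> e\<bar> < 4"
    have "cos \<bar>x \<bullet> e\<bar> \<noteq> 1"
    proof
      assume "cos \<bar>x \<bullet> e\<bar> = 1"
      then obtain n :: int where n: "\<bar>x \<bullet> e\<bar> = n * (2 * pi)" unfolding cos_one_2pi_int by (auto simp only: mult.assoc)
      have "0 < real_of_int n * (2 * pi)" unfolding n[symmetric] using e by simp
      then have "1 \<le> n" using pi_gt_zero by (simp add: zero_less_mult_iff)
      then have "2 * pi \<le> real_of_int n * (2 * pi)" using pi_gt_zero by simp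
      then show False using n * pi_gt3 by linarith
    qed
    then show ?thesis using cos_le_one[of "\<bar>x \<bullet> e\<bar>"] by linarith
  qed
  then have "cos (x \<bullet> e) < 1" by simp
  then have "0 < (\<Sum>e\<in>Basis. (2 - 2 * cos (x \<bullet> e)) ^ 3)"
    by (intro sum_pos2[OF finite_Basis e(1)]) auto
  then have "complex_of_real (\<Sum>e\<in>Basis. (2 - 2 * cos (x \<bullet> e)) ^ 3) \<noteq> 0" by (simp only: of_real_eq_0_iff)
  then show ?thesis by simp
qed

lemma integral_shift_norm:
  fixes g :: "'a::euclidean_space \<Rightarrow> complex"
  assumes [measurable]: "g \<in> borel_measurable borel"
  shows "(\<integral>\<^sup>+y. ennreal (norm (g (y - c))) \<partial>lborel) = (\<integral>\<^sup>+y. ennreal (norm (g y)) \<partial>lborel)"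
  using nn_integral_lborel_shift[of "\<lambda>y. ennreal (norm (g y))" "- c"] by simp

lemma Lp_norm_1: "Lp_norm 1 h = (\<integral>\<^sup>+x. ennreal (norm (h x)) \<partial>lborel)"
proof -
  have p: "ennreal_powr x 1 = x" for x
    by (cases x) (auto simp: ennreal_powr_def)
  have "ennreal_powr (ennreal (norm z)) 1 = ennreal (norm z)" for z :: complex by (rule p)
  then show ?thesis unfolding Lp_norm_def by (simp add: p)
qed

lemma lp_cutoff_integrable:
  fixes \<psi> \<phi> :: "'a::euclidean_space \<Rightarrow> complex"
  assumes "lp_partition \<psi> \<phi>"
  shows "integrable lborel (lp_cutoff \<psi> \<phi> n)"
proof (cases "n = 0")
  case True
  then show ?thesis using assms unfolding lp_partition_def lp_cutoff_def[abs_def] by (simp add: test_functions_integrable)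
next
  case False
  have "integrable lborel \<phi>" using assms unfolding lp_partition_def by (simp add: test_functions_integrable)
  from lborel_integrable_scale[OF this, of "inverse (2 ^ n)"] False
  show ?thesis unfolding lp_cutoff_def[abs_def] by simp
qed

lemma dist_Lp_norm_block:
  fixes f :: "'a::euclidean_space \<Rightarrow> complex"
  assumes "lp_partition \<psi> \<phi>" "integrable lborel f"
  shows "dist_Lp_norm 1 (lp_block \<psi> \<phi> n (dist_of f)) \<le> (\<integral>\<^sup>+y. ennreal (norm (conv f (inv_fourier (lp_cutoff \<psi> \<phi> n)) y)) \<partial>lborel)"
  unfolding dist_Lp_norm_def lp_block_def Lp_norm_1[symmetric]
  by (rule INF_lower) (use represents_multiplier[OF lp_cutoff_integrable[OF assms(1)] assms(2)] in simp)

lemma integrable_inv_fourier_scale: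
  fixes \<eta> :: "'a::euclidean_space \<Rightarrow> complex"
  assumes \<eta>: "\<eta> \<in> test_functions" and c: "0 < c"
  shows "integrable lborel (inv_fourier (\<lambda>\<xi>. \<eta> (\<xi> /\<^sub>R c)))"
    and "(\<integral>x. norm (inv_fourier (\<lambda>\<xi>. \<eta> (\<xi> /\<^sub>R c)) x) \<partial>lborel) = (\<integral>x. norm (inv_fourier \<eta> x) \<partial>lborel)"
proof -
  have eq: "inv_fourier (\<lambda>\<xi>. \<eta> (\<xi> /\<^sub>R c)) = (\<lambda>x. c ^ DIM('a) *\<^sub>R inv_fourier \<eta> (c *\<^sub>R x))"
    using inv_fourier_scale[OF test_functions_measurable[OF \<eta>] c] by blast
  note i = inv_fourier_test_integrable[OF \<eta>]
  show "integrable lborel (inv_fourier (\<lambda>\<xi>. \<eta> (\<xi> /\<^sub>R c)))"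
    unfolding eq using lborel_integrable_scale[OF i, of c] c by simp
  have "(\<integral>x. norm (inv_fourier \<eta> x) \<partial>lborel) = \<bar>c\<bar> ^ DIM('a) *\<^sub>R (\<integral>x. norm (inv_fourier \<eta> (c *\<^sub>R x)) \<partial>lborel)"
    by (rule lborel_integral_scale) (use i c in auto)
  then show "(\<integral>x. norm (inv_fourier (\<lambda>\<xi>. \<eta> (\<xi> /\<^sub>R c)) x) \<partial>lborel) = (\<integral>x. norm (inv_fourier \<eta> x) \<partial>lborel)"
    unfolding eq using c by simp
qed

text \<open>The kernels of all blocks with positive index are dilations of one integrable function
  and share its L^1 norm, so the blocks are bounded on L^1 uniformly in \<open>n\<close>.\<close>

lemma lp_block_L1:
  fixes \<psi> \<phi> :: "'a::euclidean_space \<Rightarrow> complex"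
  assumes part: "lp_partition \<psi> \<phi>"
  shows "\<exists>C\<ge>0. \<forall>n f. integrable lborel f \<longrightarrow>
    dist_Lp_norm 1 (lp_block \<psi> \<phi> n (dist_of f)) \<le> ennreal (C * (\<integral>x. norm (f x) \<partial>lborel))"
proof -
  have t: "\<psi> \<in> test_functions" "\<phi> \<in> test_functions" using part unfolding lp_partition_def by auto
  define A where "A = (\<integral>x. norm (inv_fourier \<psi> x) \<partial>lborel)"
  define B where "B = (\<integral>x. norm (inv_fourier \<phi> x) \<partial>lborel)"
  have AB: "0 \<le> A" "0 \<le> B" unfolding A_def B_def by simp_all
  have k: "integrable lborel (inv_fourier (lp_cutoff \<psi> \<phi> n)) \<and> (\<integral>x. norm (inv_fourier (lp_cutoff \<psi> \<phi> n) x) \<partial>lborel) \<le> A + B" for n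
  proof (cases "n = 0")
    case True
    then show ?thesis using inv_fourier_test_integrable[OF t(1)] AB unfolding lp_cutoff_def[abs_def] A_def by simp
  next
    case False
    then show ?thesis using integrable_inv_fourier_scale[OF t(2), of "2 ^ n"] AB unfolding lp_cutoff_def[abs_def] B_def by simp
  qed
  have "dist_Lp_norm 1 (lp_block \<psi> \<phi> n (dist_of f)) \<le> ennreal ((A + B) * (\<integral>x. norm (f x) \<partial>lborel))" if f: "integrable lborel f" for n f
  proof -
    have "dist_Lp_norm 1 (lp_block \<psi> \<phi> n (dist_of f)) \<le> ennreal ((\<integral>x. norm (f x) \<partial>lborel) * (\<integral>x. norm (inv_fourier (lp_cutoff \<psi> \<phi> n) x) \<partial>lborel))"
      using k[of n] by (intro order_trans[OF dist_Lp_norm_block[OF part f] conv_L1[OF f]]) simp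
    also have "\<dots> \<le> ennreal ((A + B) * (\<integral>x. norm (f x) \<partial>lborel))"
      unfolding mult.commute[of "A + B"] using k[of n] by (intro ennreal_leI mult_left_mono) auto
    finally show ?thesis .
  qed
  then show ?thesis using AB by (intro exI[of _ "A + B"]) simp
qed

text \<open>On the support of \<phi> the symbol \<open>a\<close>, a sum of recentred sixth
  differences, does not vanish, so \<phi> is \<open>a\<close> times a test function \<eta>. After
  dilation, the block is a sum over the coordinates of shifted sixth differences with step
  \<open>e /\<^sub>R 2 ^ n\<close>, convolved with a kernel whose L^1 norm does not depend on
  \<open>n\<close>. The differences are then moved from the kernel to \<open>f\<close>.\<close>

lemma lp_block_differences:
  fixes \<psi> \<phi> :: "'a::euclidean_space \<Rightarrow> complex"
  assumes part: "lp_partition \<psi> \<phi>"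
  shows "\<exists>C\<ge>0. \<forall>n>0. \<forall>f. integrable lborel f \<longrightarrow>
    dist_Lp_norm 1 (lp_block \<psi> \<phi> n (dist_of f)) \<le>
      ennreal (C * (\<Sum>e\<in>Basis. \<integral>x. norm ((fdiff (e /\<^sub>R 2 ^ n) ^^ 6) f x) \<partial>lborel))"
proof -
  have t: "\<phi> \<in> test_functions" and s: "supp \<phi> \<subseteq> ball 0 4 - ball 0 1" using part unfolding lp_partition_def by auto
  define a where "a = (\<lambda>x::'a. \<Sum>e\<in>Basis. (2 - 2 * complex_of_real (cos (x \<bullet> e))) ^ 3)"
  define \<eta> where "\<eta> = (\<lambda>x. \<phi> x / a x)"
  have nz: "a x \<noteq> 0" if "x \<in> supp \<phi>" for x using lp_multiplier_nonzero[of x] s that unfolding a_def by auto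
  have \<eta>: "\<eta> \<in> test_functions" unfolding \<eta>_def
    by (rule test_functions_divide[OF t _ nz]) (unfold a_def, intro smooth_sum smooth_power smooth_diff smooth_cmult smooth_const smooth_cos, assumption)
  have \<phi>: "\<phi> x = a x * \<eta> x" for x
    using nz[of x] not_supp_zero[of x \<phi>] unfolding \<eta>_def by (cases "x \<in> supp \<phi>") auto
  define C where "C = (\<integral>x. norm (inv_fourier \<eta> x) \<partial>lborel)"
  have "dist_Lp_norm 1 (lp_block \<psi> \<phi> n (dist_of f)) \<le>
      ennreal (C * (\<Sum>e\<in>Basis. \<integral>x. norm ((fdiff (e /\<^sub>R 2 ^ n) ^^ 6) f x) \<partial>lborel))" if n: "0 < n" and f: "integrable lborel f" for n f
  proof -
    define m where "m = (\<lambda>\<xi>. \<eta> (\<xi> /\<^sub>R 2 ^ n))"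
    define h where "h = (\<lambda>e::'a. e /\<^sub>R 2 ^ n)"
    define L where "L = inv_fourier m"
    have mi: "integrable lborel m" unfolding m_def
      using lborel_integrable_scale[OF test_functions_integrable[OF \<eta>], of "inverse (2 ^ n)"] by simp
    have Li: "integrable lborel L" and LC: "(\<integral>x. norm (L x) \<partial>lborel) = C"
      unfolding L_def m_def C_def using integrable_inv_fourier_scale[OF \<eta>, of "2 ^ n"] by simp_all
    have Lm: "L \<in> borel_measurable borel" using Li by auto
    obtain B where B: "\<And>x. norm (L x) \<le> B" unfolding L_def using inv_fourier_norm_le[of m] by blast
    have cut: "lp_cutoff \<psi> \<phi> n = (\<lambda>\<xi>. \<Sum>e\<in>Basis. - (cis ((- 3 *\<^sub>R h e) \<bullet> \<xi>) * ((cis (h e \<bullet> \<xi>) - 1) ^ 6 * m \<xi>)))"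
    proof
      fix \<xi>
      have "lp_cutoff \<psi> \<phi> n \<xi> = (\<Sum>e\<in>Basis. (2 - 2 * complex_of_real (cos ((\<xi> /\<^sub>R 2 ^ n) \<bullet> e))) ^ 3 * m \<xi>)"
        using n \<phi>[of "\<xi> /\<^sub>R 2 ^ n"] unfolding lp_cutoff_def a_def m_def by (simp add: sum_distrib_right)
      also have "\<dots> = (\<Sum>e\<in>Basis. - (cis ((- 3 *\<^sub>R h e) \<bullet> \<xi>) * ((cis (h e \<bullet> \<xi>) - 1) ^ 6 * m \<xi>)))"
      proof (rule sum.cong[OF refl])
        fix e :: 'a
        have "(\<xi> /\<^sub>R 2 ^ n) \<bullet> e = h e \<bullet> \<xi>" unfolding h_def by (simp add: inner_commute)
        then show "(2 - 2 * complex_of_real (cos ((\<xi> /\<^sub>R 2 ^ n) \<bullet> e))) ^ 3 * m \<xi> = - (cis ((- 3 *\<^sub>R h e) \<bullet> \<xi>) * ((cis (h e \<bullet> \<xi>) - 1) ^ 6 * m \<xi>))"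
          unfolding cis_minus_1_power_6[symmetric] by (simp add: mult_ac)
      qed
      finally show "lp_cutoff \<psi> \<phi> n \<xi> = (\<Sum>e\<in>Basis. - (cis ((- 3 *\<^sub>R h e) \<bullet> \<xi>) * ((cis (h e \<bullet> \<xi>) - 1) ^ 6 * m \<xi>)))" .
    qed
    have wi: "integrable lborel (\<lambda>\<xi>. cis ((- 3 *\<^sub>R h e) \<bullet> \<xi>) * ((cis (h e \<bullet> \<xi>) - 1) ^ 6 * m \<xi>))" for e
      by (intro integrable_cis_mult integrable_wave_mult mi) simp
    have uminus: "inv_fourier (\<lambda>\<xi>. - g \<xi>) y = - inv_fourier g y" for g :: "'a \<Rightarrow> complex" and y
      unfolding inv_fourier_def by simp
    have K: "inv_fourier (lp_cutoff \<psi> \<phi> n) y = (\<Sum>e\<in>Basis. - ((fdiff (h e) ^^ 6) L (y + (- 3 *\<^sub>R h e))))" for y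
      unfolding cut using wi by (subst inv_fourier_sum) (simp_all only: integrable_minus uminus inv_fourier_modulate inv_fourier_fdiff[OF mi] L_def)
    have km: "(fdiff (h e) ^^ j) L \<in> borel_measurable borel" for e j
      using integrable_fdiff_funpow[OF Li, where h="h e" and n=j] by auto
    have kb: "norm ((fdiff h' ^^ j) L x) \<le> 2 ^ j * B" for x h' j
    proof (induction j arbitrary: x)
      case (Suc j)
      have "norm ((fdiff h' ^^ j) L (x + h') - (fdiff h' ^^ j) L x) \<le> 2 ^ j * B + 2 ^ j * B"
        by (rule order_trans[OF norm_triangle_ineq4 add_mono[OF Suc Suc]])
      then show ?case unfolding fdiff_funpow_Suc(1) fdiff_def[of h' "(fdiff h' ^^ j) L"] by (simp add: mult_ac)
    qed (use B in simp)
    have conv: "conv f (inv_fourier (lp_cutoff \<psi> \<phi> n)) y = (\<Sum>e\<in>Basis. - conv ((fdiff (h e) ^^ 6) f) L (y - 3 *\<^sub>R h e))" for y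
    proof -
      have "conv f (inv_fourier (lp_cutoff \<psi> \<phi> n)) y = (\<integral>x. (\<Sum>e\<in>Basis. - (f x * (fdiff (h e) ^^ 6) L ((y - 3 *\<^sub>R h e) - x))) \<partial>lborel)"
        unfolding conv_def K sum_distrib_left by (simp add: algebra_simps)
      also have "\<dots> = (\<Sum>e\<in>Basis. \<integral>x. - (f x * (fdiff (h e) ^^ 6) L ((y - 3 *\<^sub>R h e) - x)) \<partial>lborel)"
        by (intro Bochner_Integration.integral_sum Bochner_Integration.integrable_minus conv_integrable[OF f km kb])
      also have "\<dots> = (\<Sum>e\<in>Basis. - conv f ((fdiff (h e) ^^ 6) L) (y - 3 *\<^sub>R h e))"
        unfolding conv_def by simp
      finally show ?thesis unfolding conv_fdiff[OF f Lm B] .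
    qed
    have ci: "integrable lborel ((fdiff (h e) ^^ 6) f)" for e by (rule integrable_fdiff_funpow[OF f])
    have cm: "conv ((fdiff (h e) ^^ 6) f) L \<in> borel_measurable borel" for e
      using ci Lm by (intro conv_measurable) auto
    have "dist_Lp_norm 1 (lp_block \<psi> \<phi> n (dist_of f)) \<le> (\<integral>\<^sup>+y. ennreal (norm (conv f (inv_fourier (lp_cutoff \<psi> \<phi> n)) y)) \<partial>lborel)"
      by (rule dist_Lp_norm_block[OF part f])
    also have "\<dots> \<le> (\<integral>\<^sup>+y. (\<Sum>e\<in>Basis. ennreal (norm (conv ((fdiff (h e) ^^ 6) f) L (y - 3 *\<^sub>R h e)))) \<partial>lborel)"
    proof (rule nn_integral_mono)
      fix y
      have "norm (conv f (inv_fourier (lp_cutoff \<psi> \<phi> n)) y) \<le> (\<Sum>e\<in>Basis. norm (conv ((fdiff (h e) ^^ 6) f) L (y - 3 *\<^sub>R h e)))"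
        unfolding conv using norm_sum[of "\<lambda>e. - conv ((fdiff (h e) ^^ 6) f) L (y - 3 *\<^sub>R h e)" Basis] by (simp only: norm_minus_cancel)
      then show "ennreal (norm (conv f (inv_fourier (lp_cutoff \<psi> \<phi> n)) y)) \<le> (\<Sum>e\<in>Basis. ennreal (norm (conv ((fdiff (h e) ^^ 6) f) L (y - 3 *\<^sub>R h e))))"
        by (simp add: sum_ennreal ennreal_leI)
    qed
    also have "\<dots> = (\<Sum>e\<in>Basis. \<integral>\<^sup>+y. ennreal (norm (conv ((fdiff (h e) ^^ 6) f) L (y - 3 *\<^sub>R h e))) \<partial>lborel)"
      by (rule nn_integral_sum) (use cm in measurable)
    also have "\<dots> \<le> (\<Sum>e\<in>Basis. ennreal (C * (\<integral>x. norm ((fdiff (h e) ^^ 6) f x) \<partial>lborel)))"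
    proof (rule sum_mono)
      fix e :: 'a
      show "(\<integral>\<^sup>+y. ennreal (norm (conv ((fdiff (h e) ^^ 6) f) L (y - 3 *\<^sub>R h e))) \<partial>lborel) \<le> ennreal (C * (\<integral>x. norm ((fdiff (h e) ^^ 6) f x) \<partial>lborel))"
        unfolding integral_shift_norm[OF cm] using conv_L1[OF ci Li, of e] by (simp add: LC mult.commute)
    qed
    also have "\<dots> = ennreal (C * (\<Sum>e\<in>Basis. \<integral>x. norm ((fdiff (h e) ^^ 6) f x) \<partial>lborel))"
      by (subst sum_ennreal) (simp_all add: C_def sum_distrib_left)
    finally show ?thesis unfolding h_def .
  qed
  then show ?thesis by (intro exI[of _ C]) (simp add: C_def)
qed

section \<open>Schwartz approximation of the density in the Besov norm\<close>

text \<open>Holds for arbitrary \<open>f\<close>: if \<open>f\<close> is not integrable then neither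
  is any modulation of it, and the transform is 0 by the convention for integrals.\<close>

lemma fourier_regular:
  fixes f :: "'a::euclidean_space \<Rightarrow> complex"
  shows "fourier f \<in> borel_measurable borel" "norm (fourier f x) \<le> (\<integral>\<xi>. norm (f \<xi>) \<partial>lborel)"
proof -
  show "fourier f \<in> borel_measurable borel"
  proof (cases "integrable lborel f")
    case True
    then show ?thesis by (intro fourier_measurable) auto
  next
    case False
    have "\<not> integrable lborel (\<lambda>x. cis (- (x \<bullet> \<xi>)) * f x)" for \<xi>
    proof
      assume "integrable lborel (\<lambda>x. cis (- (x \<bullet> \<xi>)) * f x)"
      from integrable_cis_mult[OF this, of "\<lambda>x. x \<bullet> \<xi>"] have "integrable lborel f"
        by (simp add: mult.assoc[symmetric] cis_mult)
      then show False using False by simp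
    qed
    then have "fourier f = (\<lambda>_. 0)" unfolding fourier_def[abs_def] by (simp add: not_integrable_integral_eq)
    then show ?thesis by simp
  qed
qed (rule fourier_norm_le)

text \<open>The functions on which the distributions are evaluated here need not be known to be
  Schwartz; they are Fourier transforms, and boundedness and measurability suffice for pairing with
  integrable functions.\<close>

lemma lp_block_diff:
  fixes f g :: "'a::euclidean_space \<Rightarrow> complex"
  assumes "integrable lborel f" "integrable lborel g"
  shows "lp_block \<psi> \<phi> n (\<lambda>h. dist_of f h - dist_of g h) = lp_block \<psi> \<phi> n (dist_of (\<lambda>x. f x - g x))"
proof
  fix k :: "'a \<Rightarrow> complex"
  define h where "h = fourier (\<lambda>x. lp_cutoff \<psi> \<phi> n x * inv_fourier k x)"
  note h = fourier_regular[of "\<lambda>x. lp_cutoff \<psi> \<phi> n x * inv_fourier k x", folded h_def]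
  have "dist_of f h - dist_of g h = dist_of (\<lambda>x. f x - g x) h"
    unfolding dist_of_def left_diff_distrib
    by (intro Bochner_Integration.integral_diff[symmetric] integrable_mult_bounded[OF _ h] assms)
  then show "lp_block \<psi> \<phi> n (\<lambda>h. dist_of f h - dist_of g h) k = lp_block \<psi> \<phi> n (dist_of (\<lambda>x. f x - g x)) k"
    by (simp add: lp_block_def dist_inv_fourier_def dist_mult_def dist_fourier_def h_def)
qed

lemma schwartz_seminorm_0:
  fixes f :: "'a::euclidean_space \<Rightarrow> complex"
  assumes "f \<in> schwartz"
  shows "norm (f x) \<le> schwartz_seminorm 0 f"
proof -
  have "{vs :: 'a list. set vs \<subseteq> Basis \<and> length vs \<le> 0} = {[]}" by auto
  then have "schwartz_seminorm 0 f = (SUP x. norm (f x))" unfolding schwartz_seminorm_def by simp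
  moreover obtain C where "\<And>x. norm (f x) \<le> C" using schwartzD(5)[OF assms] by blast
  then have "bdd_above (range (\<lambda>x. norm (f x)))" by (rule bdd_aboveI2)
  ultimately show ?thesis by (metis cSUP_upper UNIV_I)
qed

lemma tempered_dist_of:
  fixes f :: "'a::euclidean_space \<Rightarrow> complex"
  assumes f: "integrable lborel f"
  shows "tempered (dist_of f)"
  unfolding tempered_def
proof (intro conjI ballI allI exI)
  have i: "integrable lborel (\<lambda>x. f x * g x)" if "g \<in> schwartz" for g
    by (rule integrable_mult_bounded[OF f schwartzD(2)[OF that] schwartz_seminorm_0[OF that]])
  fix g :: "'a \<Rightarrow> complex"
  assume g: "g \<in> schwartz"
  show "dist_of f (\<lambda>x. g x + h x) = dist_of f g + dist_of f h" if "h \<in> schwartz" for h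
    unfolding dist_of_def distrib_left by (rule Bochner_Integration.integral_add[OF i[OF g] i[OF that]])
  show "dist_of f (\<lambda>x. c * g x) = c * dist_of f g" for c
    unfolding dist_of_def by (simp flip: integral_mult_right_zero add: mult_ac)
  have "norm (dist_of f g) \<le> (\<integral>x. norm (f x * g x) \<partial>lborel)"
    unfolding dist_of_def by (rule integral_norm_bound)
  also have "\<dots> \<le> (\<integral>x. norm (f x) * schwartz_seminorm 0 g \<partial>lborel)"
    using f schwartz_seminorm_0[OF g] order_trans[OF norm_ge_zero schwartz_seminorm_0[OF g]]
    by (intro Bochner_Integration.integral_mono') (auto simp: norm_mult intro: mult_left_mono)
  finally show "norm (dist_of f g) \<le> (\<integral>x. norm (f x) \<partial>lborel) * schwartz_seminorm 0 g" by simp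
qed

text \<open>The Leibniz bound with the Gaussian as one factor. For \<open>norm h \<le> 1\<close> its
  bound \<open>norm h ^ j\<close> is at most \<open>sqrt (norm h) ^ j\<close>, the rate of
  \<open>p\<close>; everything is uniform in the width of the cutoff.\<close>

lemma gaussian_cutoff_differences:
  fixes p :: "'a::euclidean_space \<Rightarrow> complex"
  assumes p: "integrable lborel p"
    and diff: "\<And>n. \<exists>K\<ge>0. \<forall>h. (\<integral>x. norm ((fdiff h ^^ n) p x) \<partial>lborel) \<le> K * sqrt (norm h) ^ n"
  shows "\<exists>D\<ge>0. \<forall>t h. 0 < t \<longrightarrow> t \<le> 1 \<longrightarrow> norm h \<le> 1 \<longrightarrow>
    (\<integral>x. norm ((fdiff h ^^ n) (\<lambda>x. p x - complex_of_real (exp (- t * (norm x)\<^sup>2 / 2)) * p x) x) \<partial>lborel) \<le> D * sqrt (norm h) ^ n"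
proof -
  obtain K where K: "\<And>j. 0 \<le> K j" "\<And>j h. (\<integral>x. norm ((fdiff h ^^ j) p x) \<partial>lborel) \<le> K j * sqrt (norm h) ^ j"
    using diff by metis
  obtain C where C: "\<And>j. 0 \<le> C j" "\<And>j t h (x::'a). 0 < t \<Longrightarrow> t \<le> 1 \<Longrightarrow>
     norm ((fdiff h ^^ j) (\<lambda>x. complex_of_real (exp (- t * (norm x)\<^sup>2 / 2))) x) \<le> C j * norm h ^ j"
    using fdiff_gaussian_bound[where 'a='a] by metis
  define U V where "U = sum C {..n}" and "V = sum K {..n}"
  have CU: "C j \<le> U" "K j \<le> V" if "j \<le> n" for j
    unfolding U_def V_def using that C(1) K(1) by (auto intro!: member_le_sum)
  have "(\<integral>x. norm ((fdiff h ^^ n) (\<lambda>x. p x - complex_of_real (exp (- t * (norm x)\<^sup>2 / 2)) * p x) x) \<partial>lborel)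
     \<le> (V + 2 ^ n * (U * V)) * sqrt (norm h) ^ n" if t: "0 < t" "t \<le> 1" and h: "norm h \<le> 1" for t and h :: 'a
  proof -
    define u where "u = (\<lambda>x::'a. complex_of_real (exp (- t * (norm x)\<^sup>2 / 2)))"
    have [measurable]: "u \<in> borel_measurable borel" unfolding u_def by measurable
    have up: "integrable lborel (\<lambda>x. u x * p x)"
      using integrable_mult_bounded[OF p, of u 1] t unfolding u_def by (simp add: mult.commute)
    have r: "norm h \<le> sqrt (norm h)"
      using h by (intro real_le_rsqrt) (simp add: power2_eq_square mult_left_le)
    have 1: "(\<integral>x. norm ((fdiff h ^^ j) p x) \<partial>lborel) \<le> V * sqrt (norm h) ^ j" if "j \<le> n" for j
      by (rule order_trans[OF K(2) mult_right_mono[OF CU(2)[OF that]]]) simp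
    have 2: "norm ((fdiff h ^^ j) u x) \<le> U * sqrt (norm h) ^ j" if "j \<le> n" for j x
      unfolding u_def by (rule order_trans[OF C(2)[OF t]])
         (intro mult_mono power_mono CU that r norm_ge_zero zero_le_power order_trans[OF C(1) CU(1)[OF that]])
    have "(\<integral>x. norm ((fdiff h ^^ n) (\<lambda>x. p x - u x * p x) x) \<partial>lborel)
       \<le> (\<integral>x. norm ((fdiff h ^^ n) p x) + norm ((fdiff h ^^ n) (\<lambda>x. u x * p x) x) \<partial>lborel)"
      unfolding fdiff_funpow_diff
      by (intro Bochner_Integration.integral_mono' Bochner_Integration.integrable_add integrable_norm
        integrable_fdiff_funpow p up norm_triangle_ineq4) simp
    also have "\<dots> = (\<integral>x. norm ((fdiff h ^^ n) p x) \<partial>lborel) + (\<integral>x. norm ((fdiff h ^^ n) (\<lambda>x. u x * p x) x) \<partial>lborel)"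
      by (intro Bochner_Integration.integral_add integrable_norm integrable_fdiff_funpow p up)
    also have "\<dots> \<le> V * sqrt (norm h) ^ n + 2 ^ n * (U * V) * sqrt (norm h) ^ n"
      by (intro add_mono 1 fdiff_mult_L1 p 2) simp_all
    finally show ?thesis unfolding u_def by (simp add: algebra_simps)
  qed
  moreover have "0 \<le> V + 2 ^ n * (U * V)" using C(1) K(1) unfolding U_def V_def by (simp add: sum_nonneg)
  ultimately show ?thesis by blast
qed

lemma gaussian_cutoff_L1:
  fixes p :: "'a::euclidean_space \<Rightarrow> complex"
  assumes p: "integrable lborel p" and e: "0 < e"
  shows "\<exists>t. 0 < t \<and> t \<le> 1 \<and> (\<integral>x. norm (p x - complex_of_real (exp (- t * (norm x)\<^sup>2 / 2)) * p x) \<partial>lborel) < e"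
proof -
  define t where "t = (\<lambda>n. 1 / real (Suc n))"
  have [measurable]: "p \<in> borel_measurable borel" using p by auto
  have t0: "t \<longlonglongrightarrow> 0" unfolding t_def by (rule LIMSEQ_Suc[OF lim_1_over_n])
  have t: "0 < t n" "t n \<le> 1" for n unfolding t_def by (simp_all add: divide_simps)
  have "(\<lambda>n. \<integral>x. norm (p x - complex_of_real (exp (- t n * (norm x)\<^sup>2 / 2)) * p x) \<partial>lborel) \<longlonglongrightarrow> (\<integral>(x::'a). 0 \<partial>lborel)"
  proof (rule integral_dominated_convergence[where w="\<lambda>x. norm (p x)"])
    have "(\<lambda>n. norm (p x - complex_of_real (exp (- t n * (norm x)\<^sup>2 / 2)) * p x)) \<longlonglongrightarrow> norm (p x - complex_of_real (exp (- 0 * (norm x)\<^sup>2 / 2)) * p x)" for x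
      by (intro tendsto_intros t0) simp
    then show "AE x in lborel. (\<lambda>n. norm (p x - complex_of_real (exp (- t n * (norm x)\<^sup>2 / 2)) * p x)) \<longlonglongrightarrow> 0" by simp
    fix n
    have "norm (norm (p x - complex_of_real (exp (- t n * (norm x)\<^sup>2 / 2)) * p x)) \<le> norm (p x)" for x
    proof -
      have "p x - complex_of_real (exp (- t n * (norm x)\<^sup>2 / 2)) * p x = complex_of_real (1 - exp (- t n * (norm x)\<^sup>2 / 2)) * p x"
        by (simp add: algebra_simps)
      moreover have "\<bar>1 - exp (- t n * (norm x)\<^sup>2 / 2)\<bar> \<le> 1" using t[of n] by simp
      moreover have "norm (complex_of_real c * p x) \<le> norm (p x)" if "\<bar>c\<bar> \<le> 1" for c
        unfolding norm_mult norm_of_real using that by (intro mult_left_le_one_le) auto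
      ultimately show ?thesis by (simp only: real_norm_def abs_norm_cancel)
    qed
    then show "AE x in lborel. norm (norm (p x - complex_of_real (exp (- t n * (norm x)\<^sup>2 / 2)) * p x)) \<le> norm (p x)" by simp
  qed (use p in auto)
  then have "\<forall>\<^sub>F n in sequentially. (\<integral>x. norm (p x - complex_of_real (exp (- t n * (norm x)\<^sup>2 / 2)) * p x) \<partial>lborel) < e"
    using e by (auto dest: order_tendstoD(2))
  then obtain n where "(\<integral>x. norm (p x - complex_of_real (exp (- t n * (norm x)\<^sup>2 / 2)) * p x) \<partial>lborel) < e"
    by (auto simp: eventually_sequentially)
  then show ?thesis using t[of n] by blast
qed

text \<open>The approximant is \<open>p\<close> times a wide Gaussian. In high blocks the remainder
  is small uniformly in the width, by its sixth differences; in the finitely many low blocks it is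
  small in L^1 once the Gaussian is wide enough. The number of low blocks is fixed before the
  width.\<close>

theorem besov_space_fourier:
  fixes p :: "'a::euclidean_space \<Rightarrow> complex"
  assumes part: "lp_partition \<psi> \<phi>" and p: "integrable lborel p" and a: "rapid a" "p = fourier a"
    and diff: "\<And>n. \<exists>K\<ge>0. \<forall>h. (\<integral>x. norm ((fdiff h ^^ n) p x) \<partial>lborel) \<le> K * sqrt (norm h) ^ n"
    and \<gamma>: "\<gamma> < 1"
  shows "dist_of p \<in> besov_space \<psi> \<phi> (2 + \<gamma>) 1 \<infinity>"
  unfolding besov_space_def
proof (intro CollectI conjI tempered_dist_of[OF p] allI impI)
  fix \<epsilon> :: ennreal
  assume "0 < \<epsilon>"
  then obtain e where e: "0 < e" "ennreal e < \<epsilon>"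
  proof (cases \<epsilon>)
    case (real r)
    then show ?thesis using that[of "r / 2"] \<open>0 < \<epsilon>\<close> by (simp add: ennreal_less_iff)
  next
    case top
    then show ?thesis using that[of 1] by simp
  qed
  obtain D where D: "0 \<le> D" "\<And>t h. 0 < t \<Longrightarrow> t \<le> 1 \<Longrightarrow> norm h \<le> 1 \<Longrightarrow>
    (\<integral>x. norm ((fdiff h ^^ 6) (\<lambda>x. p x - complex_of_real (exp (- t * (norm x)\<^sup>2 / 2)) * p x) x) \<partial>lborel) \<le> D * sqrt (norm h) ^ 6"
    using gaussian_cutoff_differences[OF p diff, of 6] by blast
  obtain A where A: "0 \<le> A" "\<And>n f. integrable lborel f \<Longrightarrow>
    dist_Lp_norm 1 (lp_block \<psi> \<phi> n (dist_of f)) \<le> ennreal (A * (\<integral>x. norm (f x) \<partial>lborel))"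
    using lp_block_L1[OF part] by blast
  obtain C where C: "0 \<le> C" "\<And>n f. 0 < n \<Longrightarrow> integrable lborel f \<Longrightarrow>
    dist_Lp_norm 1 (lp_block \<psi> \<phi> n (dist_of f)) \<le>
      ennreal (C * (\<Sum>e\<in>Basis. \<integral>x. norm ((fdiff (e /\<^sub>R 2 ^ n) ^^ 6) f x) \<partial>lborel))"
    using lp_block_differences[OF part] by blast
  \<comment> \<open>Sixth differences with step \<open>2 ^ - n\<close> contribute the factor
    2^(-3n), so the weight 2^(n (2 + \<gamma>)) leaves \<open>q ^ n\<close>, which tends to zero
    because \<gamma> is less than 1.\<close>
  define q where "q = 2 powr (\<gamma> - 1)"
  have q: "0 < q" "q < 1" unfolding q_def using \<gamma> powr_less_mono[of "\<gamma> - 1" 0 2] by simp_all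
  have "(\<lambda>n. C * (real DIM('a) * D) * q ^ n) \<longlonglongrightarrow> C * (real DIM('a) * D) * 0"
    using q by (intro tendsto_mult tendsto_const LIMSEQ_power_zero) simp
  then have "\<forall>\<^sub>F n in sequentially. C * (real DIM('a) * D) * q ^ n < e"
    using e by (auto dest: order_tendstoD(2))
  then obtain N where N: "\<And>n. N \<le> n \<Longrightarrow> C * (real DIM('a) * D) * q ^ n < e"
    by (auto simp: eventually_sequentially)
  \<comment> \<open>Dominates weight times the L^1 constant for all low blocks at once; it depends
    on \<open>N\<close> but not on the cutoff width, which is chosen next.\<close>
  define Q where "Q = (\<Sum>n\<le>N. 2 powr (real n * (2 + \<gamma>)) * A)"
  have Q: "2 powr (real n * (2 + \<gamma>)) * A \<le> Q" if "n \<le> N" for n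
    unfolding Q_def using that A by (intro member_le_sum) auto
  have Q0: "0 \<le> Q" unfolding Q_def using A by (simp add: sum_nonneg)
  obtain t where t: "0 < t" "t \<le> 1" and small: "(\<integral>x. norm (p x - complex_of_real (exp (- t * (norm x)\<^sup>2 / 2)) * p x) \<partial>lborel) < e / (Q + 1)"
    using gaussian_cutoff_L1[OF p, of "e / (Q + 1)"] e Q0 by auto
  define g where "g = (\<lambda>x. complex_of_real (exp (- t * (norm x)\<^sup>2 / 2)) * p x)"
  define f where "f = (\<lambda>x. p x - g x)"
  have gs: "g \<in> schwartz"
    using gauss_fourier_schwartz[OF _ a(1), of "t / 2"] t unfolding g_def a(2) by (simp add: power2_norm_eq_inner)
  have fi: "integrable lborel f" unfolding f_def by (intro Bochner_Integration.integrable_diff p schwartzD(4) gs)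
  have small_e: "Q * (\<integral>x. norm (f x) \<partial>lborel) \<le> e"
  proof -
    have "Q * (\<integral>x. norm (f x) \<partial>lborel) \<le> (Q + 1) * (e / (Q + 1))"
      using small Q0 unfolding f_def g_def by (intro mult_mono) auto
    then show ?thesis using Q0 by simp
  qed
  have "ennreal (2 powr (real n * (2 + \<gamma>))) * dist_Lp_norm 1 (lp_block \<psi> \<phi> n (dist_of f)) \<le> ennreal e" for n
  proof (cases "n \<le> N \<or> n = 0")
    case True
    then have n: "n \<le> N" by auto
    have "ennreal (2 powr (real n * (2 + \<gamma>))) * dist_Lp_norm 1 (lp_block \<psi> \<phi> n (dist_of f))
       \<le> ennreal (2 powr (real n * (2 + \<gamma>))) * ennreal (A * (\<integral>x. norm (f x) \<partial>lborel))"
      by (intro mult_left_mono A fi) simp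
    also have "\<dots> = ennreal ((2 powr (real n * (2 + \<gamma>)) * A) * (\<integral>x. norm (f x) \<partial>lborel))"
      using A by (simp add: ennreal_mult'[symmetric] mult.assoc)
    also have "\<dots> \<le> ennreal e"
      by (intro ennreal_leI order_trans[OF mult_right_mono[OF Q[OF n]] small_e]) simp
    finally show ?thesis .
  next
    case False
    then have n: "N \<le> n" "0 < n" by auto
    have b: "(\<integral>x. norm ((fdiff (e /\<^sub>R 2 ^ n) ^^ 6) f x) \<partial>lborel) \<le> D * (1 / 2 ^ n) ^ 3" if "e \<in> Basis" for e
    proof -
      have ne: "norm (e /\<^sub>R 2 ^ n) = 1 / 2 ^ n" using that by (simp add: divide_inverse)
      have "sqrt (1 / 2 ^ n) ^ 6 = ((sqrt (1 / 2 ^ n))\<^sup>2) ^ 3" by (simp only: power_mult[symmetric]) simp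
      then have "sqrt (1 / 2 ^ n) ^ 6 = (1 / 2 ^ n) ^ 3" by simp
      moreover have "(1 :: real) / 2 ^ n \<le> 1" by simp
      ultimately show ?thesis using D(2)[OF t, of "e /\<^sub>R 2 ^ n"] unfolding ne f_def g_def by simp
    qed
    have "2 powr (real n * (2 + \<gamma>)) * (1 / 2 ^ n) ^ 3 = q ^ n"
    proof -
      have "2 powr (- real (n * 3)) = 1 / (2 :: real) ^ (n * 3)"
        unfolding powr_minus_divide by (simp only: powr_realpow zero_less_numeral)
      then have "(1 / 2 ^ n) ^ 3 = (2 :: real) powr (- real (n * 3))"
        by (simp only: power_mult power_one_over)
      moreover have "q ^ n = 2 powr (real n * (\<gamma> - 1))" unfolding q_def by (rule powr_power) simp
      moreover have "real n * (2 + \<gamma>) + - real (n * 3) = real n * (\<gamma> - 1)" by (simp add: algebra_simps)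
      ultimately show ?thesis by (simp only: powr_add[symmetric])
    qed
    have "ennreal (2 powr (real n * (2 + \<gamma>))) * dist_Lp_norm 1 (lp_block \<psi> \<phi> n (dist_of f))
       \<le> ennreal (2 powr (real n * (2 + \<gamma>))) * ennreal (C * (\<Sum>e\<in>Basis. \<integral>x. norm ((fdiff (e /\<^sub>R 2 ^ n) ^^ 6) f x) \<partial>lborel))"
      by (intro mult_left_mono C n fi) simp
    also have "\<dots> = ennreal (2 powr (real n * (2 + \<gamma>)) * (C * (\<Sum>e\<in>Basis. \<integral>x. norm ((fdiff (e /\<^sub>R 2 ^ n) ^^ 6) f x) \<partial>lborel)))"
      by (rule ennreal_mult'[symmetric]) simp
    also have "\<dots> \<le> ennreal (2 powr (real n * (2 + \<gamma>)) * (C * (\<Sum>e\<in>(Basis :: 'a set). D * (1 / 2 ^ n) ^ 3)))"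
      by (intro ennreal_leI mult_left_mono sum_mono b C) simp_all
    also have "2 powr (real n * (2 + \<gamma>)) * (C * (\<Sum>e\<in>(Basis :: 'a set). D * (1 / 2 ^ n) ^ 3))
       = C * (real DIM('a) * D) * (2 powr (real n * (2 + \<gamma>)) * (1 / 2 ^ n) ^ 3)"
      by (simp add: mult_ac)
    also have "\<dots> = C * (real DIM('a) * D) * q ^ n" by (simp only: \<open>2 powr (real n * (2 + \<gamma>)) * (1 / 2 ^ n) ^ 3 = q ^ n\<close>)
    also have "ennreal \<dots> \<le> ennreal e" using N[OF n(1)] by (intro ennreal_leI) simp
    finally show ?thesis .
  qed
  then have "besov_norm \<psi> \<phi> (2 + \<gamma>) 1 \<infinity> (\<lambda>h. dist_of p h - dist_of g h) \<le> ennreal e"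
    unfolding besov_norm_def ell_norm_def lp_block_diff[OF p schwartzD(4)[OF gs]] f_def by (auto intro: SUP_least)
  also have "\<dots> < \<epsilon>" by (rule e)
  finally show "\<exists>g\<in>schwartz. besov_norm \<psi> \<phi> (2 + \<gamma>) 1 \<infinity> (\<lambda>h. dist_of p h - dist_of g h) < \<epsilon>" using gs by blast
qed

lemma (in smooth_variable) dens_besov_space:
  assumes "lp_partition \<psi> \<phi>" "\<gamma> < 1"
  shows "dist_of (\<lambda>x. complex_of_real (dens x)) \<in> besov_space \<psi> \<phi> (2 + \<gamma>) 1 \<infinity>"
proof (rule besov_space_fourier[OF assms(1) _ rapid_dens _ _ assms(2)])
  show "integrable lborel (\<lambda>x. complex_of_real (dens x))" using integrable_dens by simp
  show "(\<lambda>x. complex_of_real (dens x)) = fourier (\<lambda>\<xi>. chf \<xi> / of_real ((2 * pi) ^ DIM('a)))"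
    using dens_eq by blast
  fix n
  have "(fdiff h ^^ n) (\<lambda>x. complex_of_real (dens x)) = (\<lambda>x. complex_of_real ((fdiff h ^^ n) dens x))" for h
    by (induction n) (simp_all add: fdiff_def fun_eq_iff)
  then show "\<exists>K\<ge>0. \<forall>h. (\<integral>x. norm ((fdiff h ^^ n) (\<lambda>x. complex_of_real (dens x)) x) \<partial>lborel) \<le> K * sqrt (norm h) ^ n"
    using dens_L1_differences[of n] by simp
qed

lemma (in smooth_variable) dens_holder_space:
  assumes "0 < \<gamma>" "\<gamma> < 1"
  shows "dens \<in> holder_space (1 + \<gamma>)"
  using Re_fourier_holder_space[OF rapid_dens assms] unfolding dens_def[abs_def] .

text \<open>The witness is the one function \<open>X.dens\<close>, obtained by Fourier inversion of
  the law of \<open>X t\<close>; since it does not depend on \<gamma>, the same density serves for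
  every exponent.\<close>

theorem theorem1p1:
  fixes b :: "real \<Rightarrow> real ^ 'd \<Rightarrow> real ^ 'd"
    and \<mu>0 :: "(real ^ 'd) measure"
    and M :: "'w measure" and F :: "real \<Rightarrow> 'w measure"
    and W X :: "real \<Rightarrow> 'w \<Rightarrow> real ^ 'd"
    and \<psi> \<phi> :: "real ^ 'd \<Rightarrow> complex"
  assumes partition: "lp_partition \<psi> \<phi>"
    and b_measurable: "set_borel_measurable borel ({0..} \<times> UNIV) (\<lambda>(t, x). b t x)"
    and b_bounded: "\<exists>C. AE (t, x) in lborel. 0 \<le> t \<longrightarrow> norm (b t x) \<le> C"
    and \<mu>0: "prob_space \<mu>0" "sets \<mu>0 = sets borel"
    and solution: "mckean_vlasov_solution M F W b X"
    and initial: "law M (X 0) = \<mu>0"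
  shows "\<forall>t>0. \<exists>p :: real ^ 'd \<Rightarrow> real.
           (\<forall>x. 0 \<le> p x) \<and> distributed M lborel (X t) (\<lambda>x. ennreal (p x)) \<and>
           (\<forall>\<gamma>\<in>{0<..<1}.
              dist_of (\<lambda>x. complex_of_real (p x)) \<in> besov_space \<psi> \<phi> (2 + \<gamma>) 1 \<infinity> \<and>
              p \<in> holder_space (1 + \<gamma>))"
proof (intro allI impI)
  fix t :: real
  assume t: "0 < t"
  interpret mckean_vlasov M F W b X
    by (rule mckean_vlasov.intro[OF b_measurable b_bounded solution])
  interpret X: smooth_variable M "X t"
    by unfold_locales (use X_measurable[of t] law_differences[OF t] t in simp_all)
  show "\<exists>p :: real ^ 'd \<Rightarrow> real.
           (\<forall>x. 0 \<le> p x) \<and> distributed M lborel (X t) (\<lambda>x. ennreal (p x)) \<and>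
           (\<forall>\<gamma>\<in>{0<..<1}.
              dist_of (\<lambda>x. complex_of_real (p x)) \<in> besov_space \<psi> \<phi> (2 + \<gamma>) 1 \<infinity> \<and>
              p \<in> holder_space (1 + \<gamma>))"
    using X.dens_nonneg X.distributed_dens X.dens_besov_space[OF partition] X.dens_holder_space
    by (intro exI[of _ X.dens]) auto
qed

end
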